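(* Let $\mathfrak{F}$ be a structure category with a faithful fibre functor $F$, so that $\mathfrak{F}$ is topologically enriched by the compact-open topology. Let $(\mathfrak{F},F)$ be an NKC structure category and $X$ an $(\mathfrak{F},F)$-stratified fibre bundle. Then the associated diagram $X^\circ$ is a principal stratified bundle diagram with fibre functor $\widehat{\hom}$. Conversely, if $P$ is a principal $(\mathfrak{F},\widehat{\hom})$-stratified bundle diagram and $F$ a fibre functor, then the coend $P\otimes_{\mathfrak{F}} F$ is a stratified fibre bundle in $\mathbf{Top}$ with structure category $\mathfrak{F}$ and fibre functor $F$. Moreover $$X^\circ \otimes_{\mathfrak{F}} F = X.$$
   Context: Structure category: a small category $\mathfrak{F}$ with a functor $F\colon\mathfrak{F}\to\mathbf{Top}$ (fibre functor) such that $F(V)$ is locally compact, second-countable and Hausdorff for each object $V$; one often writes $V$ for $F(V)$. $(\mathfrak{F},F)$-family: a space $X$ with a map $p_X\colon X\to\bar X$ (projection to the base space) and, for every $b\in\bar X$, an object $X_b$ of $\mathfrak{F}$ and a chosen homeomorphism (chart) $\Phi_b\colon p_X^{-1}(b)\approx F(X_b)$. An $\mathfrak{F}$-map $X\to Y$ is a pair of continuous maps $f\colon X\to Y$, $\bar f\colon\bar X\to\bar Y$ with $p_Yf=\bar fp_X$ such that for every $b\in\bar X$ the composite $\Phi_{\bar f b}\circ f|_{p_X^{-1}(b)}\circ\Phi_b^{-1}\colon F(X_b)\to F(Y_{\bar fb})$ equals $F(\phi)$ for some morphism $\phi\colon X_b\to Y_{\bar f b}$ of $\mathfrak{F}$.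 These form the category $\mathfrak{F}$-$\mathbf{Top}$. An object $V$ is also regarded as the family $F(V)\to *$. Pull-back: for a family $Y$ and a map $\bar f\colon\bar X\to\bar Y$, $\bar f^*Y=\bar X\times_{\bar Y}Y\to\bar X$ with $(\bar f^*Y)_b=Y_{\bar f b}$ and induced charts. The restriction $Y|U$ for $U\subset\bar Y$ is the pull-back along the inclusion. Bundle: a family $X$ such that each $b\in\bar X$ has a neighbourhood $U$ with $X|U$ isomorphic in $\mathfrak{F}$-$\mathbf{Top}$ to a product family $U\times F(V)\to U$ (charts given by projection), for some object $V$. Push-outs: a closed inclusion is an $\mathfrak{F}$-map $i\colon A\to Y$ such that $\bar i$ is the inclusion of a closed subspace and $A=\bar i^*Y$. Push-outs in $\mathfrak{F}$-$\mathbf{Top}$ of $X\leftarrow A\xrightarrow{i}Y$ with $i$ a closed inclusion are formed by the push-outs in $\mathbf{Top}$ of total spaces and of base spaces. $\lim$ of an increasing sequence denotes the colimit. Stratified space: a CW-pair is a pair homeomorphic to (CW-complex, subcomplex); a CW-space is a space homeomorphic to a CW-complex. A stratified space is a space $X$ with a filtration $X_0\subset X_1\subset\dots\subset\lim_{n}X_n=X$, where $X_0$ is a CW-space, and for every $i\ge1$ a given CW-pair $(M_i,A_i)$ and map $h_i\colon A_i\to X_{i-1}$ such that $X_i=X_{i-1}\cup_{h_i}M_i$ is the push-out. The $X_i\smallsetminus X_{i-1}$ are the strata. It is finite if the number of non-empty strata is finite. It is a stratified CW-complex if all attaching maps $h_i$ are cellular; a stratified space that is not finite is always assumed to be a stratified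 CW-complex. $(\mathfrak{F},F)$-stratified fibre bundle: a stratified space $\bar X$ (with CW-pairs $(\bar M_i,\bar A_i)$, space $\bar X_0$ and attaching maps $\bar h_i$) together with an $(\mathfrak{F},F)$-family $X\to\bar X$ such that, with $X_i=X|\bar X_i$: $X_0\to\bar X_0$ is a bundle; for $i\ge1$ there are a bundle $M_i\to\bar M_i$ with $A_i=M_i|\bar A_i$ and an $\mathfrak{F}$-map $h_i\colon A_i\to X_{i-1}$ over $\bar h_i$ such that $X_i=X_{i-1}\cup_{h_i}M_i$ is the push-out of $\mathfrak{F}$-maps; and $X=\lim_{i}X_i$. Function spaces ($F$ faithful): for an object $V$ and a family $Y$, $Y^V$ is the space of all $\mathfrak{F}$-maps $V\to Y$ with the compact-open topology, with projection $Y^V\to\bar Y$, $a\mapsto p_Ya(v_0)$, $v_0\in F(V)$ arbitrary. In particular $W^V=\hom_{\mathfrak{F}}(V,W)$ has the compact-open topology, and this makes $\mathfrak{F}$ topologically enriched. A morphism $\varphi\colon V\to V'$ induces $X^\varphi\colon X^{V'}\to X^V$ by precomposition. The associated diagram is the functor $X^\circ\colon\mathfrak{F}^{\mathrm{op}}\to\mathbf{Top}_{\bar X}$, $X^\circ(V)=X^V$, where $\mathbf{Top}_{\bar X}$ is the category of spaces over $\bar X$. NKC: for $K\subset V$ and $U\subset Y$ put $N_{K,U}=\{f\in Y^V: f(K)\subset U\}$. A family $\mathcal{K}$ of compact subsets of $V$ is generating if for every $\mathfrak{F}$-family $Y$ the sets $N_{K,U}$ with $K\in\mathcal{K}$ and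 $U$ open in $Y$ form a sub-basis of the topology of $Y^V$. A structure category $\mathfrak{F}$ with faithful fibre functor $F$ is NKC if for every object $V$ there is a generating family $\mathcal{K}$ of compact subsets of $V$ such that for all $K\in\mathcal{K}$, all objects $W$ and all compact $C\subset W$ the subspace $N_{K,C}\subset\hom_{\mathfrak{F}}(V,W)$ is compact. Bundle diagrams: for a topologically enriched category $\mathfrak{F}$ let $\mathfrak{F}^{\mathrm{op}}$-$\mathbf{Diag}$ be the category of functors $\mathfrak{F}^{\mathrm{op}}\to\mathbf{Top}$ and natural transformations, and let $\widehat{\hom}\colon\mathfrak{F}\to\mathfrak{F}^{\mathrm{op}}$-$\mathbf{Diag}$ be the functor $W\mapsto W^\circ=\hom_{\mathfrak{F}}(-,W)$. An $(\mathfrak{F},\widehat{\hom})$-stratified bundle diagram over a stratified space $\bar X$ is defined by repeating the definition of a stratified fibre bundle with $\mathbf{Top}$ replaced by diagrams in $\mathbf{Top}$ and $F$ replaced by $\widehat{\hom}$. That is: families are functors $D\colon\mathfrak{F}^{\mathrm{op}}\to\mathbf{Top}_{B}$ over a base space $B$ with, for each $b\in B$, a chosen isomorphism of the fibre diagram over $b$ with $\hom_{\mathfrak{F}}(-,D_b)$ for an object $D_b$ of $\mathfrak{F}$; maps of families are natural transformations covering a map of base spaces which on each fibre are, through the charts, induced by a morphism of $\mathfrak{F}$; product families are $U\times\hom_{\mathfrak{F}}(-,W)$; bundles are locally isomorphic to product families; push-outs and colimits are formed objectwise. Such a stratified bundle diagram $P\colon\mathfrak{F}^{\mathrm{op}}\to\mathbf{Top}_{\bar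 X}$ is called a principal stratified bundle diagram. Coend: for $P\colon\mathfrak{F}^{\mathrm{op}}\to\mathbf{Top}_{\bar X}$ and $F\colon\mathfrak{F}\to\mathbf{Top}$, $P\otimes_{\mathfrak{F}}F=\int^{V}P(V)\times F(V)$ is the quotient space of $\coprod_{V}P(V)\times F(V)$ by the identifications $(P(\alpha)(x),y)\sim(x,F(\alpha)(y))$ for every $\alpha\in\hom_{\mathfrak{F}}(V,W)$, $x\in P(W)$, $y\in F(V)$, with its induced map to $\bar X$. The equality $X^\circ\otimes_{\mathfrak{F}}F=X$ is the canonical identification over $\bar X$ (induced by evaluation $X^V\times F(V)\to X$). *)

theory Defs
  imports "HOL-Analysis.Analysis"
begin

text \<open>
  Conventions.  Spaces are values of type \<open>'a topology\<close>; a map between spaces is a function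
  constrained on the topspace only.  The points of all base spaces (of families, of the attached
  pieces of a stratified space, and of the test families in the NKC condition) are taken from one
  type \<open>'b\<close>, which plays the role of a universe: set-many given spaces can be transported to
  one such type.  Up to isomorphism a family with base points in \<open>'b\<close> and fibre points in
  \<open>'v\<close> has total space of type \<open>'b \<times> 'v\<close>, through \<open>x \<mapsto> (p x, \<Phi>\<^sub>b x)\<close>; hence quantifiers over
  families ranging over that type lose no generality.  The same applies to diagram families and
  \<open>'b \<times> 'h\<close>, where \<open>'h\<close> is the type of morphisms.
\<close>


subsection \<open>CW-complexes\<close>

definition disc :: "nat \<Rightarrow> (nat \<Rightarrow> real) topology" where
  "disc n = subtopology (Euclidean_space n) {x. (\<Sum>i<n. x i ^ 2) \<le> 1}"

definition disc_interior :: "nat \<Rightarrow> (nat \<Rightarrow> real) set" where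
  "disc_interior n = {x \<in> topspace (Euclidean_space n). (\<Sum>i<n. x i ^ 2) < 1}"

definition disc_boundary :: "nat \<Rightarrow> (nat \<Rightarrow> real) set" where
  "disc_boundary n = {x \<in> topspace (Euclidean_space n). (\<Sum>i<n. x i ^ 2) = 1}"

text \<open>A cell is given by its dimension and its characteristic map.\<close>

type_synonym 'b cell = "nat \<times> ((nat \<Rightarrow> real) \<Rightarrow> 'b)"

definition open_cell :: "'b cell \<Rightarrow> 'b set" where
  "open_cell e = snd e ` disc_interior (fst e)"

definition closed_cell :: "'b cell \<Rightarrow> 'b set" where
  "closed_cell e = snd e ` topspace (disc (fst e))"

definition CW_complex :: "'b topology \<Rightarrow> 'b cell set \<Rightarrow> bool" where
  "CW_complex X E \<longleftrightarrow>
     Hausdorff_space X \<and>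
     (\<forall>(n, \<phi>) \<in> E. continuous_map (disc n) X \<phi> \<and> inj_on \<phi> (disc_interior n)) \<and>
     topspace X = (\<Union>e\<in>E. open_cell e) \<and>
     (\<forall>e\<in>E. \<forall>e'\<in>E. e \<noteq> e' \<longrightarrow> open_cell e \<inter> open_cell e' = {}) \<and>
     (\<forall>(n, \<phi>) \<in> E. \<exists>D. finite D \<and> D \<subseteq> E \<and> (\<forall>d\<in>D. fst d < n) \<and>
        \<phi> ` disc_boundary n \<subseteq> (\<Union>d\<in>D. open_cell d)) \<and>
     (\<forall>A. A \<subseteq> topspace X \<longrightarrow>
        (closedin X A \<longleftrightarrow> (\<forall>e\<in>E. closedin X (A \<inter> closed_cell e))))"

definition CW_subcomplex :: "'b cell set \<Rightarrow> 'b cell set \<Rightarrow> 'b set \<Rightarrow> bool" where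
  "CW_subcomplex E D A \<longleftrightarrow>
     D \<subseteq> E \<and> A = (\<Union>e\<in>D. open_cell e) \<and> (\<forall>e\<in>D. closed_cell e \<subseteq> A)"

text \<open>Cell structures transport along homeomorphisms, so a space homeomorphic to a CW-complex is a
  space carrying a cell structure, and likewise for pairs.\<close>

definition CW_space :: "'b topology \<Rightarrow> bool" where
  "CW_space X \<longleftrightarrow> (\<exists>E. CW_complex X E)"

definition CW_pair :: "'b topology \<Rightarrow> 'b set \<Rightarrow> bool" where
  "CW_pair X A \<longleftrightarrow> (\<exists>E D. CW_complex X E \<and> CW_subcomplex E D A)"

definition skeleton :: "'b cell set \<Rightarrow> nat \<Rightarrow> 'b set" where
  "skeleton E n = (\<Union>e \<in> {e \<in> E. fst e \<le> n}. open_cell e)"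

definition cellular :: "'b cell set \<Rightarrow> 'b cell set \<Rightarrow> ('b \<Rightarrow> 'b) \<Rightarrow> bool" where
  "cellular D E h \<longleftrightarrow> (\<forall>n. h ` skeleton D n \<subseteq> skeleton E n)"


subsection \<open>Quotients, push-outs and sequential colimits in \<open>Top\<close>\<close>

definition quotient_space :: "'a topology \<Rightarrow> ('a \<times> 'a) set \<Rightarrow> 'a set topology" where
  "quotient_space X r =
     topology (\<lambda>U. U \<subseteq> topspace X // r \<and> openin X {x \<in> topspace X. r `` {x} \<in> U})"

lemma istopology_quotient_space:
  "istopology (\<lambda>U. U \<subseteq> topspace X // r \<and> openin X {x \<in> topspace X. r `` {x} \<in> U})"
proof -
  have 1: "{x \<in> topspace X. r `` {x} \<in> S \<inter> T} =
      {x \<in> topspace X. r `` {x} \<in> S} \<inter> {x \<in> topspace X. r `` {x} \<in> T}" for S T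
    by auto
  have 2: "{x \<in> topspace X. r `` {x} \<in> \<Union>\<K>} = (\<Union>U\<in>\<K>. {x \<in> topspace X. r `` {x} \<in> U})" for \<K>
    by auto
  show ?thesis
    unfolding istopology_def 1 2 by blast
qed

definition generated_equiv :: "('a \<times> 'a) set \<Rightarrow> ('a \<times> 'a) set" where
  "generated_equiv r = (r \<union> r\<inverse>)\<^sup>*"

text \<open>The square with corners \<open>A, X, Y, Z\<close> and maps \<open>f: A \<rightarrow> X\<close>, \<open>i: A \<rightarrow> Y\<close>, \<open>j: X \<rightarrow> Z\<close>, \<open>g: Y \<rightarrow> Z\<close>
  commutes, and \<open>j\<close>, \<open>g\<close> exhibit \<open>Z\<close> as the quotient space of the disjoint union of \<open>X\<close> and \<open>Y\<close>
  by the equivalence relation generated by \<open>f a \<sim> i a\<close>.\<close>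

definition pushout_Top ::
  "'a topology \<Rightarrow> 'x topology \<Rightarrow> 'y topology \<Rightarrow> 'z topology \<Rightarrow>
   ('a \<Rightarrow> 'x) \<Rightarrow> ('a \<Rightarrow> 'y) \<Rightarrow> ('x \<Rightarrow> 'z) \<Rightarrow> ('y \<Rightarrow> 'z) \<Rightarrow> bool" where
  "pushout_Top A X Y Z f i j g \<longleftrightarrow>
     continuous_map A X f \<and> continuous_map A Y i \<and>
     continuous_map X Z j \<and> continuous_map Y Z g \<and>
     (\<forall>a \<in> topspace A. j (f a) = g (i a)) \<and>
     topspace Z = j ` topspace X \<union> g ` topspace Y \<and>
     (\<forall>U. U \<subseteq> topspace Z \<longrightarrow>
        (openin Z U \<longleftrightarrow>
           openin X {x \<in> topspace X. j x \<in> U} \<and> openin Y {y \<in> topspace Y. g y \<in> U})) \<and>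
     (\<forall>u \<in> topspace X <+> topspace Y. \<forall>v \<in> topspace X <+> topspace Y.
        case_sum j g u = case_sum j g v \<longrightarrow>
        (u, v) \<in> generated_equiv ((\<lambda>a. (Inl (f a), Inr (i a))) ` topspace A))"

definition lim_Top :: "'a topology \<Rightarrow> (nat \<Rightarrow> 'a set) \<Rightarrow> bool" where
  "lim_Top X A \<longleftrightarrow>
     (\<forall>n. A n \<subseteq> A (Suc n)) \<and> (\<Union>n. A n) = topspace X \<and>
     (\<forall>U. U \<subseteq> topspace X \<longrightarrow> (openin X U \<longleftrightarrow> (\<forall>n. openin (subtopology X (A n)) (U \<inter> A n))))"


subsection \<open>Stratified spaces\<close>

text \<open>\<open>strat_fil S n\<close> is the underlying set of \<open>X\<^sub>n\<close>, whose topology is the subspace topology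
  (the inclusions are closed embeddings).  Only the indices \<open>i \<ge> 1\<close> of the attaching data
  \<open>(M\<^sub>i, A\<^sub>i)\<close>, \<open>h\<^sub>i: A\<^sub>i \<rightarrow> X\<^sub>i\<^sub>-\<^sub>1\<close> and \<open>g\<^sub>i: M\<^sub>i \<rightarrow> X\<^sub>i\<close> (the structure map of the push-out) matter.\<close>

record 'b stratification =
  strat_space :: "'b topology"
  strat_fil :: "nat \<Rightarrow> 'b set"
  strat_M :: "nat \<Rightarrow> 'b topology"
  strat_A :: "nat \<Rightarrow> 'b set"
  strat_h :: "nat \<Rightarrow> 'b \<Rightarrow> 'b"
  strat_g :: "nat \<Rightarrow> 'b \<Rightarrow> 'b"

definition strat_sub :: "'b stratification \<Rightarrow> nat \<Rightarrow> 'b topology" where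
  "strat_sub S n = subtopology (strat_space S) (strat_fil S n)"

fun stratum :: "'b stratification \<Rightarrow> nat \<Rightarrow> 'b set" where
  "stratum S 0 = strat_fil S 0"
| "stratum S (Suc n) = strat_fil S (Suc n) - strat_fil S n"

text \<open>The cells of \<open>X\<^sub>n\<close> obtained from cells \<open>C\<close> of \<open>X\<^sub>0\<close> by adding the images of the cells of
  \<open>M\<^sub>i\<close> (given by \<open>E i\<close>) outside \<open>A\<^sub>i\<close> (given by \<open>D i\<close>).\<close>

fun strat_cells ::
  "'b stratification \<Rightarrow> 'b cell set \<Rightarrow> (nat \<Rightarrow> 'b cell set) \<Rightarrow> (nat \<Rightarrow> 'b cell set) \<Rightarrow> nat \<Rightarrow> 'b cell set"
where
  "strat_cells S C E D 0 = C"
| "strat_cells S C E D (Suc n) =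
     strat_cells S C E D n \<union> (\<lambda>(k, \<phi>). (k, strat_g S (Suc n) \<circ> \<phi>)) ` (E (Suc n) - D (Suc n))"

definition stratified_CW :: "'b stratification \<Rightarrow> bool" where
  "stratified_CW S \<longleftrightarrow>
     (\<exists>C E D. CW_complex (strat_sub S 0) C \<and>
        (\<forall>n. CW_complex (strat_M S (Suc n)) (E (Suc n)) \<and>
             CW_subcomplex (E (Suc n)) (D (Suc n)) (strat_A S (Suc n)) \<and>
             cellular (D (Suc n)) (strat_cells S C E D n) (strat_h S (Suc n))))"

definition stratified_space :: "'b stratification \<Rightarrow> bool" where
  "stratified_space S \<longleftrightarrow>
     lim_Top (strat_space S) (strat_fil S) \<and>
     CW_space (strat_sub S 0) \<and>
     (\<forall>n. CW_pair (strat_M S (Suc n)) (strat_A S (Suc n)) \<and>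
        pushout_Top (subtopology (strat_M S (Suc n)) (strat_A S (Suc n)))
          (strat_sub S n) (strat_M S (Suc n)) (strat_sub S (Suc n))
          (strat_h S (Suc n)) id id (strat_g S (Suc n))) \<and>
     (finite {n. stratum S n \<noteq> {}} \<or> stratified_CW S)"


subsection \<open>Structure categories\<close>

text \<open>A small category together with a functor to \<open>Top\<close>; \<open>Comp C \<psi> \<phi>\<close> is \<open>\<psi>\<phi>\<close>.\<close>

record ('o, 'h, 'v) structure_category =
  Obj :: "'o set"
  Arr :: "'h set"
  Src :: "'h \<Rightarrow> 'o"
  Trg :: "'h \<Rightarrow> 'o"
  Idn :: "'o \<Rightarrow> 'h"
  Comp :: "'h \<Rightarrow> 'h \<Rightarrow> 'h"
  Fob :: "'o \<Rightarrow> 'v topology"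
  Far :: "'h \<Rightarrow> 'v \<Rightarrow> 'v"

definition Hom :: "('o, 'h, 'v) structure_category \<Rightarrow> 'o \<Rightarrow> 'o \<Rightarrow> 'h set" where
  "Hom C V W = {\<phi> \<in> Arr C. Src C \<phi> = V \<and> Trg C \<phi> = W}"

definition structure_category :: "('o, 'h, 'v) structure_category \<Rightarrow> bool" where
  "structure_category C \<longleftrightarrow>
     (\<forall>\<phi> \<in> Arr C. Src C \<phi> \<in> Obj C \<and> Trg C \<phi> \<in> Obj C) \<and>
     (\<forall>V \<in> Obj C. Idn C V \<in> Hom C V V) \<and>
     (\<forall>\<phi> \<in> Arr C. \<forall>\<psi> \<in> Arr C. Trg C \<phi> = Src C \<psi> \<longrightarrow> Comp C \<psi> \<phi> \<in> Hom C (Src C \<phi>) (Trg C \<psi>)) \<and>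
     (\<forall>\<phi> \<in> Arr C. Comp C \<phi> (Idn C (Src C \<phi>)) = \<phi> \<and> Comp C (Idn C (Trg C \<phi>)) \<phi> = \<phi>) \<and>
     (\<forall>\<phi> \<in> Arr C. \<forall>\<psi> \<in> Arr C. \<forall>\<theta> \<in> Arr C. Trg C \<phi> = Src C \<psi> \<and> Trg C \<psi> = Src C \<theta> \<longrightarrow>
        Comp C \<theta> (Comp C \<psi> \<phi>) = Comp C (Comp C \<theta> \<psi>) \<phi>) \<and>
     (\<forall>V \<in> Obj C. locally_compact_space (Fob C V) \<and> second_countable (Fob C V) \<and>
        Hausdorff_space (Fob C V)) \<and>
     (\<forall>\<phi> \<in> Arr C. continuous_map (Fob C (Src C \<phi>)) (Fob C (Trg C \<phi>)) (Far C \<phi>)) \<and>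
     (\<forall>V \<in> Obj C. \<forall>v \<in> topspace (Fob C V). Far C (Idn C V) v = v) \<and>
     (\<forall>\<phi> \<in> Arr C. \<forall>\<psi> \<in> Arr C. Trg C \<phi> = Src C \<psi> \<longrightarrow>
        (\<forall>v \<in> topspace (Fob C (Src C \<phi>)). Far C (Comp C \<psi> \<phi>) v = Far C \<psi> (Far C \<phi> v)))"

definition faithful :: "('o, 'h, 'v) structure_category \<Rightarrow> bool" where
  "faithful C \<longleftrightarrow>
     (\<forall>V \<in> Obj C. \<forall>W \<in> Obj C. \<forall>\<phi> \<in> Hom C V W. \<forall>\<psi> \<in> Hom C V W.
        (\<forall>v \<in> topspace (Fob C V). Far C \<phi> v = Far C \<psi> v) \<longrightarrow> \<phi> = \<psi>)"

definition invertible_arrow :: "('o, 'h, 'v) structure_category \<Rightarrow> 'h \<Rightarrow> bool" where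
  "invertible_arrow C \<phi> \<longleftrightarrow>
     (\<exists>\<psi> \<in> Hom C (Trg C \<phi>) (Src C \<phi>).
        Comp C \<psi> \<phi> = Idn C (Src C \<phi>) \<and> Comp C \<phi> \<psi> = Idn C (Trg C \<phi>))"


subsection \<open>Families of spaces and bundles\<close>

record ('o, 'v, 'x, 'b) family =
  tot :: "'x topology"
  base :: "'b topology"
  prj :: "'x \<Rightarrow> 'b"
  fob :: "'b \<Rightarrow> 'o"
  chart :: "'b \<Rightarrow> 'x \<Rightarrow> 'v"

definition fibre :: "('o, 'v, 'x, 'b) family \<Rightarrow> 'b \<Rightarrow> 'x set" where
  "fibre X b = {x \<in> topspace (tot X). prj X x = b}"

definition family :: "('o, 'h, 'v) structure_category \<Rightarrow> ('o, 'v, 'x, 'b) family \<Rightarrow> bool" where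
  "family C X \<longleftrightarrow>
     continuous_map (tot X) (base X) (prj X) \<and>
     (\<forall>b \<in> topspace (base X). fob X b \<in> Obj C \<and>
        homeomorphic_map (subtopology (tot X) (fibre X b)) (Fob C (fob X b)) (chart X b))"

text \<open>Through the charts, \<open>f\<close> acts on the fibre over \<open>b\<close> as the morphism \<open>\<phi>\<close>.\<close>

definition fibre_arrow ::
  "('o, 'h, 'v) structure_category \<Rightarrow> ('o, 'v, 'x, 'b) family \<Rightarrow> ('o, 'v, 'y, 'c) family \<Rightarrow>
   ('x \<Rightarrow> 'y) \<Rightarrow> ('b \<Rightarrow> 'c) \<Rightarrow> 'b \<Rightarrow> 'h \<Rightarrow> bool" where
  "fibre_arrow C X Y f fb b \<phi> \<longleftrightarrow>
     \<phi> \<in> Hom C (fob X b) (fob Y (fb b)) \<and>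
     (\<forall>x \<in> fibre X b. chart Y (fb b) (f x) = Far C \<phi> (chart X b x))"

definition fam_map ::
  "('o, 'h, 'v) structure_category \<Rightarrow> ('o, 'v, 'x, 'b) family \<Rightarrow> ('o, 'v, 'y, 'c) family \<Rightarrow>
   ('x \<Rightarrow> 'y) \<Rightarrow> ('b \<Rightarrow> 'c) \<Rightarrow> bool" where
  "fam_map C X Y f fb \<longleftrightarrow>
     continuous_map (tot X) (tot Y) f \<and> continuous_map (base X) (base Y) fb \<and>
     (\<forall>x \<in> topspace (tot X). prj Y (f x) = fb (prj X x)) \<and>
     (\<forall>b \<in> topspace (base X). \<exists>\<phi>. fibre_arrow C X Y f fb b \<phi>)"

definition fam_iso ::
  "('o, 'h, 'v) structure_category \<Rightarrow> ('o, 'v, 'x, 'b) family \<Rightarrow> ('o, 'v, 'y, 'c) family \<Rightarrow>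
   ('x \<Rightarrow> 'y) \<Rightarrow> ('b \<Rightarrow> 'c) \<Rightarrow> bool" where
  "fam_iso C X Y f fb \<longleftrightarrow>
     fam_map C X Y f fb \<and>
     (\<exists>g gb. fam_map C Y X g gb \<and>
        (\<forall>x \<in> topspace (tot X). g (f x) = x) \<and> (\<forall>y \<in> topspace (tot Y). f (g y) = y) \<and>
        (\<forall>b \<in> topspace (base X). gb (fb b) = b) \<and> (\<forall>c \<in> topspace (base Y). fb (gb c) = c))"

definition fam_restrict :: "('o, 'v, 'x, 'b) family \<Rightarrow> 'b set \<Rightarrow> ('o, 'v, 'x, 'b) family" where
  "fam_restrict X U =
     X\<lparr>tot := subtopology (tot X) {x \<in> topspace (tot X). prj X x \<in> U},
       base := subtopology (base X) U\<rparr>"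

definition object_family ::
  "('o, 'h, 'v) structure_category \<Rightarrow> 'o \<Rightarrow> ('o, 'v, 'v, unit) family" where
  "object_family C V =
     \<lparr>tot = Fob C V, base = discrete_topology {()}, prj = (\<lambda>_. ()),
      fob = (\<lambda>_. V), chart = (\<lambda>_ v. v)\<rparr>"

definition product_family ::
  "('o, 'h, 'v) structure_category \<Rightarrow> 'b topology \<Rightarrow> 'o \<Rightarrow> ('o, 'v, 'b \<times> 'v, 'b) family" where
  "product_family C B V =
     \<lparr>tot = prod_topology B (Fob C V), base = B, prj = fst,
      fob = (\<lambda>_. V), chart = (\<lambda>_. snd)\<rparr>"

definition fibre_bundle :: "('o, 'h, 'v) structure_category \<Rightarrow> ('o, 'v, 'x, 'b) family \<Rightarrow> bool" where
  "fibre_bundle C X \<longleftrightarrow>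
     family C X \<and>
     (\<forall>b \<in> topspace (base X). \<exists>U N. U \<subseteq> topspace (base X) \<and> openin (base X) N \<and> b \<in> N \<and> N \<subseteq> U \<and>
        (\<exists>V \<in> Obj C. \<exists>f fb.
           fam_iso C (fam_restrict X U) (product_family C (subtopology (base X) U) V) f fb))"

text \<open>\<open>Z\<close> is the push-out of \<open>X \<leftarrow> A \<rightarrow> Y\<close> along the inclusion \<open>A \<subseteq> Y\<close>, where \<open>A = Y|A'\<close>, with
  structure maps the inclusion \<open>X \<subseteq> Z\<close> and \<open>g\<close>.  The push-out family carries the charts of \<open>X\<close>
  over \<open>X\<close> and those of \<open>Y\<close> over the complement of \<open>A'\<close>: up to isomorphism of families this says
  that the structure maps act there by invertible morphisms, and it is what makes every
  compatible pair of \<open>\<FF>\<close>-maps on \<open>X\<close> and \<open>Y\<close> induce an \<open>\<FF>\<close>-map on \<open>Z\<close>.\<close>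

definition fam_pushout ::
  "('o, 'h, 'v) structure_category \<Rightarrow> ('o, 'v, 'x, 'b) family \<Rightarrow> ('o, 'v, 'y, 'b) family \<Rightarrow> 'b set \<Rightarrow>
   ('o, 'v, 'x, 'b) family \<Rightarrow> ('y \<Rightarrow> 'x) \<Rightarrow> ('b \<Rightarrow> 'b) \<Rightarrow> ('y \<Rightarrow> 'x) \<Rightarrow> ('b \<Rightarrow> 'b) \<Rightarrow> bool" where
  "fam_pushout C X Y A' Z h hb g gb \<longleftrightarrow>
     fam_map C (fam_restrict Y A') X h hb \<and>
     fam_map C X Z id id \<and> fam_map C Y Z g gb \<and>
     pushout_Top (tot (fam_restrict Y A')) (tot X) (tot Y) (tot Z) h id id g \<and>
     pushout_Top (base (fam_restrict Y A')) (base X) (base Y) (base Z) hb id id gb \<and>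
     (\<forall>b \<in> topspace (base X). \<exists>\<phi>. fibre_arrow C X Z id id b \<phi> \<and> invertible_arrow C \<phi>) \<and>
     (\<forall>b \<in> topspace (base Y) - A'. \<exists>\<phi>. fibre_arrow C Y Z g gb b \<phi> \<and> invertible_arrow C \<phi>)"

definition stratified_bundle ::
  "('o, 'h, 'v) structure_category \<Rightarrow> 'b stratification \<Rightarrow> ('o, 'v, 'x, 'b) family \<Rightarrow> bool" where
  "stratified_bundle C S X \<longleftrightarrow>
     stratified_space S \<and> family C X \<and> base X = strat_space S \<and>
     fibre_bundle C (fam_restrict X (strat_fil S 0)) \<and>
     (\<forall>n. \<exists>(M :: ('o, 'v, 'b \<times> 'v, 'b) family) h g.
        fibre_bundle C M \<and> base M = strat_M S (Suc n) \<and>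
        fam_pushout C (fam_restrict X (strat_fil S n)) M (strat_A S (Suc n))
          (fam_restrict X (strat_fil S (Suc n)))
          h (strat_h S (Suc n)) g (strat_g S (Suc n))) \<and>
     lim_Top (tot X) (\<lambda>n. {x \<in> topspace (tot X). prj X x \<in> strat_fil S n})"


subsection \<open>Function spaces and the NKC condition\<close>

definition compact_open :: "'a topology \<Rightarrow> 'c topology \<Rightarrow> ('a \<Rightarrow> 'c) topology" where
  "compact_open X Y =
     topology_generated_by
       {{f \<in> extensional (topspace X). continuous_map X Y f \<and> f ` K \<subseteq> U} | K U.
          compactin X K \<and> openin Y U}"

text \<open>The space \<open>Y\<^sup>V\<close>.  An \<open>\<FF>\<close>-map \<open>V \<rightarrow> Y\<close> is a pair of maps \<open>f: F V \<rightarrow> Y\<close> and \<open>* \<rightarrow> base Y\<close>; the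
  latter is recorded as a point \<open>b\<close> of the base.  If \<open>F V\<close> is non-empty then
  \<open>b = p (f v\<^sub>0)\<close> for every \<open>v\<^sub>0\<close>, so the second factor adds neither points nor open sets, and the
  projection of \<open>Y\<^sup>V\<close> to the base is \<open>snd\<close>.\<close>

definition mapspace ::
  "('o, 'h, 'v) structure_category \<Rightarrow> 'o \<Rightarrow> ('o, 'v, 'y, 'b) family \<Rightarrow> (('v \<Rightarrow> 'y) \<times> 'b) topology" where
  "mapspace C V Y =
     subtopology (prod_topology (compact_open (Fob C V) (tot Y)) (base Y))
       {(f, b). fam_map C (object_family C V) Y f (\<lambda>_. b)}"

definition Hom_top :: "('o, 'h, 'v) structure_category \<Rightarrow> 'o \<Rightarrow> 'o \<Rightarrow> 'h topology" where
  "Hom_top C V W =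
     pullback_topology (Hom C V W) (\<lambda>\<phi>. restrict (Far C \<phi>) (topspace (Fob C V)))
       (compact_open (Fob C V) (Fob C W))"

definition N_sets ::
  "('o, 'h, 'v) structure_category \<Rightarrow> 'o \<Rightarrow> ('o, 'v, 'y, 'b) family \<Rightarrow> 'v set \<Rightarrow> 'y set \<Rightarrow>
   (('v \<Rightarrow> 'y) \<times> 'b) set" where
  "N_sets C V Y K U = {a \<in> topspace (mapspace C V Y). fst a ` K \<subseteq> U}"

text \<open>The whole space, being the empty intersection, is added to the sub-basis.\<close>

definition generating ::
  "'b itself \<Rightarrow> ('o, 'h, 'v) structure_category \<Rightarrow> 'o \<Rightarrow> 'v set set \<Rightarrow> bool" where
  "generating _ C V \<K> \<longleftrightarrow>
     (\<forall>K \<in> \<K>. compactin (Fob C V) K) \<and>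
     (\<forall>Y :: ('o, 'v, 'b \<times> 'v, 'b) family. family C Y \<longrightarrow>
        mapspace C V Y =
        topology_generated_by
          (insert (topspace (mapspace C V Y))
             {N_sets C V Y K U | K U. K \<in> \<K> \<and> openin (tot Y) U}))"

definition NKC :: "'b itself \<Rightarrow> ('o, 'h, 'v) structure_category \<Rightarrow> bool" where
  "NKC T C \<longleftrightarrow>
     structure_category C \<and> faithful C \<and>
     (\<forall>V \<in> Obj C. \<exists>\<K>. generating T C V \<K> \<and>
        (\<forall>K \<in> \<K>. \<forall>W \<in> Obj C. \<forall>L. compactin (Fob C W) L \<longrightarrow>
           compactin (Hom_top C V W) {\<phi> \<in> Hom C V W. Far C \<phi> ` K \<subseteq> L}))"


subsection \<open>Bundle diagrams\<close>

text \<open>A functor from the opposite category to spaces over \<open>dbase\<close>, with \<open>dact \<alpha>: D W \<rightarrow> D V\<close> for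
  \<open>\<alpha>: V \<rightarrow> W\<close>, together with fibrewise charts \<open>dchart b V\<close> to \<open>hom(V, D\<^sub>b)\<close>.\<close>

record ('o, 'h, 'p, 'b) diagram =
  dsp :: "'o \<Rightarrow> 'p topology"
  dbase :: "'b topology"
  dprj :: "'o \<Rightarrow> 'p \<Rightarrow> 'b"
  dact :: "'h \<Rightarrow> 'p \<Rightarrow> 'p"
  dob :: "'b \<Rightarrow> 'o"
  dchart :: "'b \<Rightarrow> 'o \<Rightarrow> 'p \<Rightarrow> 'h"

definition dfibre :: "('o, 'h, 'p, 'b) diagram \<Rightarrow> 'b \<Rightarrow> 'o \<Rightarrow> 'p set" where
  "dfibre D b V = {x \<in> topspace (dsp D V). dprj D V x = b}"

definition diagram_over ::
  "('o, 'h, 'v) structure_category \<Rightarrow> ('o, 'h, 'p, 'b) diagram \<Rightarrow> bool" where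
  "diagram_over C D \<longleftrightarrow>
     (\<forall>V \<in> Obj C. continuous_map (dsp D V) (dbase D) (dprj D V)) \<and>
     (\<forall>\<alpha> \<in> Arr C. continuous_map (dsp D (Trg C \<alpha>)) (dsp D (Src C \<alpha>)) (dact D \<alpha>) \<and>
        (\<forall>x \<in> topspace (dsp D (Trg C \<alpha>)).
           dprj D (Src C \<alpha>) (dact D \<alpha> x) = dprj D (Trg C \<alpha>) x)) \<and>
     (\<forall>V \<in> Obj C. \<forall>x \<in> topspace (dsp D V). dact D (Idn C V) x = x) \<and>
     (\<forall>\<alpha> \<in> Arr C. \<forall>\<beta> \<in> Arr C. Trg C \<alpha> = Src C \<beta> \<longrightarrow>
        (\<forall>x \<in> topspace (dsp D (Trg C \<beta>)). dact D (Comp C \<beta> \<alpha>) x = dact D \<alpha> (dact D \<beta> x)))"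

definition diagram_family ::
  "('o, 'h, 'v) structure_category \<Rightarrow> ('o, 'h, 'p, 'b) diagram \<Rightarrow> bool" where
  "diagram_family C D \<longleftrightarrow>
     diagram_over C D \<and>
     (\<forall>b \<in> topspace (dbase D). dob D b \<in> Obj C \<and>
        (\<forall>V \<in> Obj C.
           homeomorphic_map (subtopology (dsp D V) (dfibre D b V)) (Hom_top C V (dob D b))
             (dchart D b V)) \<and>
        (\<forall>\<alpha> \<in> Arr C. \<forall>x \<in> dfibre D b (Trg C \<alpha>).
           dchart D b (Src C \<alpha>) (dact D \<alpha> x) = Comp C (dchart D b (Trg C \<alpha>) x) \<alpha>))"

definition dfibre_arrow ::
  "('o, 'h, 'v) structure_category \<Rightarrow> ('o, 'h, 'p, 'b) diagram \<Rightarrow> ('o, 'h, 'q, 'c) diagram \<Rightarrow>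
   ('o \<Rightarrow> 'p \<Rightarrow> 'q) \<Rightarrow> ('b \<Rightarrow> 'c) \<Rightarrow> 'b \<Rightarrow> 'h \<Rightarrow> bool" where
  "dfibre_arrow C D E f fb b \<phi> \<longleftrightarrow>
     \<phi> \<in> Hom C (dob D b) (dob E (fb b)) \<and>
     (\<forall>V \<in> Obj C. \<forall>x \<in> dfibre D b V. dchart E (fb b) V (f V x) = Comp C \<phi> (dchart D b V x))"

definition diag_map ::
  "('o, 'h, 'v) structure_category \<Rightarrow> ('o, 'h, 'p, 'b) diagram \<Rightarrow> ('o, 'h, 'q, 'c) diagram \<Rightarrow>
   ('o \<Rightarrow> 'p \<Rightarrow> 'q) \<Rightarrow> ('b \<Rightarrow> 'c) \<Rightarrow> bool" where
  "diag_map C D E f fb \<longleftrightarrow>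
     continuous_map (dbase D) (dbase E) fb \<and>
     (\<forall>V \<in> Obj C. continuous_map (dsp D V) (dsp E V) (f V) \<and>
        (\<forall>x \<in> topspace (dsp D V). dprj E V (f V x) = fb (dprj D V x))) \<and>
     (\<forall>\<alpha> \<in> Arr C. \<forall>x \<in> topspace (dsp D (Trg C \<alpha>)).
        f (Src C \<alpha>) (dact D \<alpha> x) = dact E \<alpha> (f (Trg C \<alpha>) x)) \<and>
     (\<forall>b \<in> topspace (dbase D). \<exists>\<phi>. dfibre_arrow C D E f fb b \<phi>)"

definition diag_iso ::
  "('o, 'h, 'v) structure_category \<Rightarrow> ('o, 'h, 'p, 'b) diagram \<Rightarrow> ('o, 'h, 'q, 'c) diagram \<Rightarrow>
   ('o \<Rightarrow> 'p \<Rightarrow> 'q) \<Rightarrow> ('b \<Rightarrow> 'c) \<Rightarrow> bool" where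
  "diag_iso C D E f fb \<longleftrightarrow>
     diag_map C D E f fb \<and>
     (\<exists>g gb. diag_map C E D g gb \<and>
        (\<forall>V \<in> Obj C. (\<forall>x \<in> topspace (dsp D V). g V (f V x) = x) \<and>
                     (\<forall>y \<in> topspace (dsp E V). f V (g V y) = y)) \<and>
        (\<forall>b \<in> topspace (dbase D). gb (fb b) = b) \<and> (\<forall>c \<in> topspace (dbase E). fb (gb c) = c))"

definition diag_restrict :: "('o, 'h, 'p, 'b) diagram \<Rightarrow> 'b set \<Rightarrow> ('o, 'h, 'p, 'b) diagram" where
  "diag_restrict D U =
     D\<lparr>dsp := (\<lambda>V. subtopology (dsp D V) {x \<in> topspace (dsp D V). dprj D V x \<in> U}),
       dbase := subtopology (dbase D) U\<rparr>"

definition product_diagram ::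
  "('o, 'h, 'v) structure_category \<Rightarrow> 'b topology \<Rightarrow> 'o \<Rightarrow> ('o, 'h, 'b \<times> 'h, 'b) diagram" where
  "product_diagram C B W =
     \<lparr>dsp = (\<lambda>V. prod_topology B (Hom_top C V W)), dbase = B, dprj = (\<lambda>_. fst),
      dact = (\<lambda>\<alpha> (b, \<phi>). (b, Comp C \<phi> \<alpha>)), dob = (\<lambda>_. W), dchart = (\<lambda>_ _. snd)\<rparr>"

definition diagram_bundle ::
  "('o, 'h, 'v) structure_category \<Rightarrow> ('o, 'h, 'p, 'b) diagram \<Rightarrow> bool" where
  "diagram_bundle C D \<longleftrightarrow>
     diagram_family C D \<and>
     (\<forall>b \<in> topspace (dbase D). \<exists>U N.
        U \<subseteq> topspace (dbase D) \<and> openin (dbase D) N \<and> b \<in> N \<and> N \<subseteq> U \<and>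
        (\<exists>W \<in> Obj C. \<exists>f fb.
           diag_iso C (diag_restrict D U) (product_diagram C (subtopology (dbase D) U) W) f fb))"

definition diag_pushout ::
  "('o, 'h, 'v) structure_category \<Rightarrow> ('o, 'h, 'p, 'b) diagram \<Rightarrow> ('o, 'h, 'q, 'b) diagram \<Rightarrow> 'b set \<Rightarrow>
   ('o, 'h, 'p, 'b) diagram \<Rightarrow> ('o \<Rightarrow> 'q \<Rightarrow> 'p) \<Rightarrow> ('b \<Rightarrow> 'b) \<Rightarrow> ('o \<Rightarrow> 'q \<Rightarrow> 'p) \<Rightarrow> ('b \<Rightarrow> 'b) \<Rightarrow> bool"
where
  "diag_pushout C D E A' Z h hb g gb \<longleftrightarrow>
     diag_map C (diag_restrict E A') D h hb \<and>
     diag_map C D Z (\<lambda>_. id) id \<and> diag_map C E Z g gb \<and>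
     (\<forall>V \<in> Obj C. pushout_Top (dsp (diag_restrict E A') V) (dsp D V) (dsp E V) (dsp Z V)
        (h V) id id (g V)) \<and>
     pushout_Top (dbase (diag_restrict E A')) (dbase D) (dbase E) (dbase Z) hb id id gb \<and>
     (\<forall>b \<in> topspace (dbase D). \<exists>\<phi>. dfibre_arrow C D Z (\<lambda>_. id) id b \<phi> \<and> invertible_arrow C \<phi>) \<and>
     (\<forall>b \<in> topspace (dbase E) - A'. \<exists>\<phi>. dfibre_arrow C E Z g gb b \<phi> \<and> invertible_arrow C \<phi>)"

definition principal_stratified_bundle_diagram ::
  "('o, 'h, 'v) structure_category \<Rightarrow> 'b stratification \<Rightarrow> ('o, 'h, 'p, 'b) diagram \<Rightarrow> bool" where
  "principal_stratified_bundle_diagram C S P \<longleftrightarrow>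
     stratified_space S \<and> diagram_family C P \<and> dbase P = strat_space S \<and>
     diagram_bundle C (diag_restrict P (strat_fil S 0)) \<and>
     (\<forall>n. \<exists>(M :: ('o, 'h, 'b \<times> 'h, 'b) diagram) h g.
        diagram_bundle C M \<and> dbase M = strat_M S (Suc n) \<and>
        diag_pushout C (diag_restrict P (strat_fil S n)) M (strat_A S (Suc n))
          (diag_restrict P (strat_fil S (Suc n)))
          h (strat_h S (Suc n)) g (strat_g S (Suc n))) \<and>
     (\<forall>V \<in> Obj C.
        lim_Top (dsp P V) (\<lambda>n. {x \<in> topspace (dsp P V). dprj P V x \<in> strat_fil S n}))"

text \<open>The associated diagram \<open>X\<^sup>\<circ>\<close>.  The chart of \<open>(f, b)\<close> is the morphism which \<open>f\<close> is through the
  chart of \<open>X\<close> over \<open>b\<close>; it is unique when the fibre functor is faithful.\<close>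

definition associated_diagram ::
  "('o, 'h, 'v) structure_category \<Rightarrow> ('o, 'v, 'x, 'b) family \<Rightarrow>
   ('o, 'h, ('v \<Rightarrow> 'x) \<times> 'b, 'b) diagram" where
  "associated_diagram C X =
     \<lparr>dsp = (\<lambda>V. mapspace C V X), dbase = base X, dprj = (\<lambda>_. snd),
      dact = (\<lambda>\<alpha> (f, b). (restrict (f \<circ> Far C \<alpha>) (topspace (Fob C (Src C \<alpha>))), b)),
      dob = fob X,
      dchart = (\<lambda>b V a. THE \<phi>. fibre_arrow C (object_family C V) X (fst a) (\<lambda>_. b) () \<phi>)\<rparr>"


subsection \<open>Coends\<close>

definition coend_sum ::
  "('o, 'h, 'v) structure_category \<Rightarrow> ('o, 'h, 'p, 'b) diagram \<Rightarrow> ('o \<times> 'p \<times> 'v) topology" where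
  "coend_sum C P = sum_topology (\<lambda>V. prod_topology (dsp P V) (Fob C V)) (Obj C)"

definition coend_rel ::
  "('o, 'h, 'v) structure_category \<Rightarrow> ('o, 'h, 'p, 'b) diagram \<Rightarrow>
   (('o \<times> 'p \<times> 'v) \<times> ('o \<times> 'p \<times> 'v)) set" where
  "coend_rel C P =
     generated_equiv
       {((Src C \<alpha>, dact P \<alpha> x, y), (Trg C \<alpha>, x, Far C \<alpha> y)) | \<alpha> x y.
          \<alpha> \<in> Arr C \<and> x \<in> topspace (dsp P (Trg C \<alpha>)) \<and> y \<in> topspace (Fob C (Src C \<alpha>))}"

definition coend_class ::
  "('o, 'h, 'v) structure_category \<Rightarrow> ('o, 'h, 'p, 'b) diagram \<Rightarrow> 'o \<Rightarrow> 'p \<Rightarrow> 'v \<Rightarrow>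
   ('o \<times> 'p \<times> 'v) set" where
  "coend_class C P V x y = coend_rel C P `` {(V, x, y)}"

text \<open>The family \<open>P \<otimes> F\<close>: projection and charts send the class of \<open>(x, y)\<close>, \<open>x \<in> P V\<close>, \<open>y \<in> F V\<close>,
  to the projection of \<open>x\<close> and to the image of \<open>y\<close> under the morphism \<open>V \<rightarrow> P\<^sub>b\<close> given by the
  chart of \<open>P\<close> at \<open>x\<close>.  Neither depends on the representative.\<close>

definition coend_family ::
  "('o, 'h, 'v) structure_category \<Rightarrow> ('o, 'h, 'p, 'b) diagram \<Rightarrow>
   ('o, 'v, ('o \<times> 'p \<times> 'v) set, 'b) family" where
  "coend_family C P =
     \<lparr>tot = quotient_space (coend_sum C P) (coend_rel C P), base = dbase P,
      prj = (\<lambda>c. case (SOME t. t \<in> c) of (V, x, y) \<Rightarrow> dprj P V x),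
      fob = dob P,
      chart = (\<lambda>b c. case (SOME t. t \<in> c) of (V, x, y) \<Rightarrow> Far C (dchart P b V x) y)\<rparr>"

end

theory Submission
  imports Defs
begin

text \<open>
  The first claim rests on the fact that \<open>X\<^sup>V\<close> is built from the function spaces of the pieces \<open>X\<^sub>0\<close> and
  \<open>M\<^sub>i\<close> in the same way as \<open>X\<close> is built from the pieces. Let \<open>O\<close> be a subset of \<open>X\<^sup>V\<close> whose trace on
  every piece is open, and let \<open>a\<^sub>0\<close> be in \<open>O\<close>. One constructs, for finitely many compact sets \<open>K\<close> of a
  generating family, real functions \<open>u\<^sub>K\<close> on the stages \<open>X\<^sub>n\<close>, equal to 1 on \<open>a\<^sub>0 K\<close>, such that \<open>O\<close> contains
  every map \<open>a\<close> into \<open>X\<^sub>n\<close> with \<open>u\<^sub>K > c\<^sub>n\<close> on \<open>a K\<close> for all \<open>K\<close>, with thresholds \<open>c\<^sub>n\<close> that increase but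
  stay below \<open>3/4\<close>. The functions are extended over \<open>M\<^sub>i\<close> cell by cell with the Tietze theorem. The NKC
  condition enters there: over a compact base the maps \<open>a\<close> with \<open>a K\<close> in a compact set form a compact set,
  so open sets \<open>U\<^sub>K\<close> which force \<open>a\<close> into \<open>O\<close> over a closed part of the base can be replaced by open sets
  which do so over the whole base and contain any given closed subset of \<open>U\<^sub>K\<close> over that part.

  A class in \<open>P \<otimes> F\<close> is determined by its base point and the value of its chart, and products with the
  locally compact spaces \<open>F V\<close> preserve push-outs and sequential colimits; this gives the converse.
  The evaluation \<open>X\<^sup>\<circ> \<otimes> F \<rightarrow> X\<close> is a continuous bijection, and its inverse is continuous on \<open>X\<^sub>0\<close> and on
  every \<open>M\<^sub>i\<close> because bundles have local sections.
\<close>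

text \<open>The first claim is not formal: mapping spaces need not commute with push-outs and
  colimits, and infinitely many successive shrinkings of open sets need not leave a neighbourhood.
  Recording the neighbourhoods by real functions turns each shrinking into a rise of a threshold: a
  closed condition with a slightly larger threshold sits inside the open condition with the smaller
  one, and this leaves room for an extension at every cell and every stage. The compactness behind
  one extension is that of a set of bad maps, those with values in a compact set but outside
  \<open>O'\<close>.

  A generating family may consist of empty sets only. The functions then see nothing; this case is
  settled separately, because it forces the base type to have a single point.

  For coends the obstacle is that quotient topologies do not restrict to arbitrary subsets, so
  fibres and stages must be closed and trivialising sets open. Finally, attached pieces are required
  to have points in \<open>'b \<times> 'v\<close> or \<open>'b \<times> 'h\<close>, so the pieces
  that are constructed have to be transported to such a normal form.\<close>

lemma topology_eq_by_id:
  assumes "continuous_map X Y (\<lambda>x. x)" "continuous_map Y X (\<lambda>x. x)"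
  shows "X = Y"
proof -
  have T: "topspace X = topspace Y" using assms by (auto simp: continuous_map_def Pi_iff)
  have "openin X U \<longleftrightarrow> openin Y U" for U
  proof
    assume U: "openin X U"
    then have "openin Y {x \<in> topspace Y. x \<in> U}" using assms(2) by (auto simp: continuous_map_def)
    moreover have "{x \<in> topspace Y. x \<in> U} = U" using openin_subset[OF U] T by auto
    ultimately show "openin Y U" by simp
  next
    assume U: "openin Y U"
    then have "openin X {x \<in> topspace X. x \<in> U}" using assms(1) by (auto simp: continuous_map_def)
    moreover have "{x \<in> topspace X. x \<in> U} = U" using openin_subset[OF U] T by auto
    ultimately show "openin X U" by simp
  qed
  then show ?thesis by (simp add: topology_eq)
qed

lemma continuous_map_local:
  assumes "\<And>x. x \<in> topspace X \<Longrightarrow>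
             \<exists>U. openin X U \<and> x \<in> U \<and> continuous_map (subtopology X U) Y f"
  shows "continuous_map X Y f"
proof -
  obtain U where U: "\<And>x. x \<in> topspace X \<Longrightarrow>
      openin X (U x) \<and> x \<in> U x \<and> continuous_map (subtopology X (U x)) Y f" using assms by metis
  show ?thesis by (rule pasting_lemma[where I = "topspace X" and T = U and f = "\<lambda>_. f"]) (use U in auto)
qed

lemma openin_local:
  assumes "\<And>x. x \<in> U \<Longrightarrow> \<exists>V. openin X V \<and> x \<in> V \<and> V \<subseteq> U"
  shows "openin X U" using assms openin_subopen by metis


subsection \<open>The compact-open topology\<close>

lemma topspace_compact_open [simp]:
  "topspace (compact_open X Y) = {f \<in> extensional (topspace X). continuous_map X Y f}"
proof
  show "topspace (compact_open X Y) \<subseteq> {f \<in> extensional (topspace X). continuous_map X Y f}"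
    unfolding compact_open_def topology_generated_by_topspace by auto
  show "{f \<in> extensional (topspace X). continuous_map X Y f} \<subseteq> topspace (compact_open X Y)"
  proof
    fix f assume f: "f \<in> {f \<in> extensional (topspace X). continuous_map X Y f}"
    \<comment> \<open>Empty \<open>K\<close> and empty \<open>U\<close> give a basic set without any
      condition, so the basic sets cover all continuous maps.\<close>
    have "{f \<in> extensional (topspace X). continuous_map X Y f \<and> f ` {} \<subseteq> {}} \<in>
       {{f \<in> extensional (topspace X). continuous_map X Y f \<and> f ` K \<subseteq> U} | K U.
          compactin X K \<and> openin Y U}" using compactin_empty[of X] openin_empty[of Y] by blast
    with f show "f \<in> topspace (compact_open X Y)"
      unfolding compact_open_def topology_generated_by_topspace by blast
  qed
qed

lemma openin_compact_open_basic:
  assumes "compactin X K" "openin Y U"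
  shows "openin (compact_open X Y) {f \<in> topspace (compact_open X Y). f ` K \<subseteq> U}"
proof -
  have "{f \<in> topspace (compact_open X Y). f ` K \<subseteq> U} =
      {f \<in> extensional (topspace X). continuous_map X Y f \<and> f ` K \<subseteq> U}" by auto
  then show ?thesis unfolding compact_open_def using assms by (auto intro!: topology_generated_by_Basis)
qed

lemma continuous_map_into_compact_open:
  assumes "\<And>t. t \<in> topspace T \<Longrightarrow> f t \<in> topspace (compact_open X Y)"
    and "\<And>K U. compactin X K \<Longrightarrow> openin Y U \<Longrightarrow> openin T {t \<in> topspace T. f t ` K \<subseteq> U}"
  shows "continuous_map T (compact_open X Y) f"
  unfolding compact_open_def
proof (rule continuous_on_generated_topo)
  fix U assume "U \<in> {{f \<in> extensional (topspace X). continuous_map X Y f \<and> f ` K \<subseteq> U} | K U.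
          compactin X K \<and> openin Y U}"
  then obtain K W where U: "U = {f \<in> extensional (topspace X). continuous_map X Y f \<and> f ` K \<subseteq> W}"
    and K: "compactin X K" "openin Y W" by blast
  have "f -` U \<inter> topspace T = {t \<in> topspace T. f t ` K \<subseteq> W}" using assms(1) unfolding U by auto
  then show "openin T (f -` U \<inter> topspace T)" using assms(2)[OF K] by simp
next
  show "f ` topspace T \<subseteq> \<Union>{{f \<in> extensional (topspace X). continuous_map X Y f \<and> f ` K \<subseteq> U} | K U.
          compactin X K \<and> openin Y U}"
    using assms(1) topspace_compact_open[of X Y] unfolding compact_open_def topology_generated_by_topspace by blast
qed

text \<open>The tube lemma supplies one neighbourhood of \<open>t\<close> that works for all points
  of \<open>K\<close>; compactness of \<open>K\<close> is what makes a condition on a whole set of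
  values open in the parameter.\<close>

lemma openin_tube:
  assumes g: "continuous_map (prod_topology T X) Y g" and K: "compactin X K" and U: "openin Y U"
  shows "openin T {t \<in> topspace T. \<forall>k\<in>K. g (t, k) \<in> U}"
proof (rule openin_local)
  fix t assume t: "t \<in> {t \<in> topspace T. \<forall>k\<in>K. g (t, k) \<in> U}"
  let ?W = "{z \<in> topspace (prod_topology T X). g z \<in> U}"
  have W: "openin (prod_topology T X) ?W" by (rule openin_continuous_map_preimage[OF g U])
  have "{t} \<times> K \<subseteq> ?W" using t compactin_subset_topspace[OF K] by auto
  then obtain A B where AB: "openin T A" "t \<in> A" "K \<subseteq> B" "A \<times> B \<subseteq> ?W"
    using tube_lemma_right[OF W K, of t] t by auto
  then have "A \<subseteq> {t \<in> topspace T. \<forall>k\<in>K. g (t, k) \<in> U}"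
    using openin_subset[OF AB(1)] by auto
  with AB show "\<exists>V. openin T V \<and> t \<in> V \<and> V \<subseteq> {t \<in> topspace T. \<forall>k\<in>K. g (t, k) \<in> U}"
    by blast
qed

lemma continuous_map_curry:
  assumes g: "continuous_map (prod_topology T X) Y (\<lambda>(t, x). g t x)"
  shows "continuous_map T (compact_open X Y) (\<lambda>t. restrict (g t) (topspace X))"
proof (rule continuous_map_into_compact_open)
  fix t assume t: "t \<in> topspace T"
  have "continuous_map X (prod_topology T X) (\<lambda>x. (t, x))"
    using t by (simp add: continuous_map_pairwise o_def)
  from continuous_map_compose[OF this g] have "continuous_map X Y (g t)" by (simp add: o_def)
  then show "restrict (g t) (topspace X) \<in> topspace (compact_open X Y)" by (auto intro: continuous_map_eq)
next
  fix K U assume K: "compactin X K" "openin Y U"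
  have "{t \<in> topspace T. restrict (g t) (topspace X) ` K \<subseteq> U} =
      {t \<in> topspace T. \<forall>k\<in>K. (\<lambda>(t, x). g t x) (t, k) \<in> U}"
    using compactin_subset_topspace[OF K(1)] by (auto simp: restrict_def subset_iff)
  then show "openin T {t \<in> topspace T. restrict (g t) (topspace X) ` K \<subseteq> U}"
    using openin_tube[OF g K] by simp
qed

lemma locally_compact_nbhd:
  assumes "locally_compact_space X" "Hausdorff_space X" "openin X U" "x \<in> U"
  obtains V K where "openin X V" "compactin X K" "x \<in> V" "V \<subseteq> K" "K \<subseteq> U"
  using assms locally_compact_space_neighbourhood_base[of X] unfolding neighbourhood_base_of by meson

text \<open>Local compactness gives \<open>x\<close> a compact neighbourhood that \<open>f\<close>
  still maps into \<open>U\<close>; the maps with this property form a neighbourhood of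
  \<open>f\<close>.\<close>

lemma continuous_map_eval:
  assumes "locally_compact_space X" "Hausdorff_space X"
  shows "continuous_map (prod_topology (compact_open X Y) X) Y (\<lambda>(f, x). f x)"
  unfolding continuous_map_def
proof (intro conjI allI impI)
  show "(\<lambda>(f, x). f x) \<in> topspace (prod_topology (compact_open X Y) X) \<rightarrow> topspace Y"
    by (auto simp: continuous_map_def)
next
  fix U assume U: "openin Y U"
  let ?W = "{z \<in> topspace (prod_topology (compact_open X Y) X). (\<lambda>(f, x). f x) z \<in> U}"
  show "openin (prod_topology (compact_open X Y) X) ?W"
  proof (rule openin_local)
    fix z assume z: "z \<in> ?W"
    then obtain f x where zf: "z = (f, x)" "f \<in> topspace (compact_open X Y)" "x \<in> topspace X" "f x \<in> U"
      by auto
    then have "openin X {x \<in> topspace X. f x \<in> U}" using U by (auto simp: continuous_map_def)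
    then obtain V K where VK: "openin X V" "compactin X K" "x \<in> V" "V \<subseteq> K"
      "K \<subseteq> {x \<in> topspace X. f x \<in> U}" using locally_compact_nbhd[OF assms, of _ x] zf by blast
    let ?N = "{f \<in> topspace (compact_open X Y). f ` K \<subseteq> U} \<times> V"
    have "openin (prod_topology (compact_open X Y) X) ?N"
      using openin_compact_open_basic[OF VK(2) U] VK(1) by (simp add: openin_prod_Times_iff)
    moreover have "z \<in> ?N" using zf VK by auto
    moreover have "?N \<subseteq> ?W" using VK(3,4) openin_subset[OF VK(1)] by (fastforce simp: image_subset_iff)
    ultimately show "\<exists>V. openin (prod_topology (compact_open X Y) X) V \<and> z \<in> V \<and> V \<subseteq> ?W"
      by blast
  qed
qed

text \<open>Openness in a product with a locally compact factor is tested on the sets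
  \<open>{z. {z} \<times> K \<subseteq> U}\<close>; hence the product with a locally compact space preserves coherent
  topologies, also for covers by spaces of different types.\<close>

lemma openin_prod_locally_compact:
  assumes L: "locally_compact_space L" "Hausdorff_space L" and U: "U \<subseteq> topspace Z \<times> topspace L"
    and sl: "\<And>z. z \<in> topspace Z \<Longrightarrow> openin L {l \<in> topspace L. (z, l) \<in> U}"
    and tu: "\<And>K. compactin L K \<Longrightarrow> openin Z {z \<in> topspace Z. \<forall>k\<in>K. (z, k) \<in> U}"
  shows "openin (prod_topology Z L) U"
proof (rule openin_local)
  fix p assume p: "p \<in> U"
  then obtain z l where zl: "p = (z, l)" "z \<in> topspace Z" "l \<in> topspace L" using U by auto
  obtain V K where VK: "openin L V" "compactin L K" "l \<in> V" "V \<subseteq> K" "K \<subseteq> {l \<in> topspace L. (z, l) \<in> U}"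
    using locally_compact_nbhd[OF L sl[OF zl(2)], of l] p zl by auto
  let ?N = "{z \<in> topspace Z. \<forall>k\<in>K. (z, k) \<in> U} \<times> V"
  have "openin (prod_topology Z L) ?N" using tu[OF VK(2)] VK(1) by (simp add: openin_prod_Times_iff)
  moreover have "p \<in> ?N" using zl VK by auto
  moreover have "?N \<subseteq> U" using VK by auto
  ultimately show "\<exists>V. openin (prod_topology Z L) V \<and> p \<in> V \<and> V \<subseteq> U" by blast
qed


subsection \<open>Push-outs along inclusions and transport of topologies\<close>

text \<open>All push-outs below are along inclusions, of \<open>A\<close> into \<open>Y\<close> and
  of \<open>X\<close> into \<open>Z\<close>. For these the generated equivalence relation can be
  eliminated: on \<open>A\<close> the map \<open>g\<close> is given by \<open>f\<close>, and off
  \<open>A\<close> it identifies nothing and avoids \<open>X\<close>.\<close>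

lemma pushout_Top_inclusionI:
  assumes A: "A \<subseteq> topspace Y" and f: "continuous_map (subtopology Y A) X f" and j: "continuous_map X Z id"
    and g: "continuous_map Y Z g" and gf: "\<And>a. a \<in> A \<Longrightarrow> g a = f a"
    and Z: "topspace Z \<subseteq> topspace X \<union> g ` topspace Y"
    and op: "\<And>U. U \<subseteq> topspace Z \<Longrightarrow> openin X (topspace X \<inter> U) \<Longrightarrow>
               openin Y {y \<in> topspace Y. g y \<in> U} \<Longrightarrow> openin Z U"
    and inj: "inj_on g (topspace Y - A)" and dis: "g ` (topspace Y - A) \<inter> topspace X = {}"
  shows "pushout_Top (subtopology Y A) X Y Z f id id g"
proof -
  have TA: "topspace (subtopology Y A) = A" using A by auto
  have XZ: "topspace X \<subseteq> topspace Z" using j by (auto simp: continuous_map_def)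
  have YZ: "g ` topspace Y \<subseteq> topspace Z" using g by (auto simp: continuous_map_def)
  have fX: "f ` A \<subseteq> topspace X" using f TA by (auto simp: continuous_map_def Pi_iff)
  let ?r = "(\<lambda>a. (Inl (f a), Inr (id a))) ` A"
  have step: "(Inl (f a), Inr a) \<in> generated_equiv ?r" "(Inr a, Inl (f a)) \<in> generated_equiv ?r"
    if "a \<in> A" for a unfolding generated_equiv_def using that by (auto intro!: r_into_rtrancl)
  have tr: "(u, w) \<in> generated_equiv ?r"
    if "(u, v) \<in> generated_equiv ?r" "(v, w) \<in> generated_equiv ?r" for u v w
    using that unfolding generated_equiv_def by (rule rtrancl_trans)
  have refl: "(u, u) \<in> generated_equiv ?r" for u unfolding generated_equiv_def by simp
  have eq: "(u, v) \<in> generated_equiv ?r"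
    if u: "u \<in> topspace X <+> topspace Y" and v: "v \<in> topspace X <+> topspace Y"
      and e: "case_sum id g u = case_sum id g v" for u v
  proof -
    \<comment> \<open>Normal form of a point of the disjoint union: a point of \<open>A\<close> is
      replaced by its image in \<open>X\<close>. A point is related to its normal form by at most
      one step, and points with the same image in \<open>Z\<close> have the same normal
      form.\<close>
    define n where "n u = (case u of Inl x \<Rightarrow> Inl x | Inr y \<Rightarrow> if y \<in> A then Inl (f y) else Inr y)"
      for u :: "'b + 'a"
    have n: "(u, n u) \<in> generated_equiv ?r" "(n u, u) \<in> generated_equiv ?r" for u
      unfolding n_def using step refl by (auto split: sum.splits)
    have XX: "x = f y" if "x \<in> topspace X" "y \<in> topspace Y" "x = g y" "y \<in> A" for x y
      using gf that by auto
    have XN: False if "x \<in> topspace X" "y \<in> topspace Y" "x = g y" "y \<notin> A" for x y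
      using dis that by (auto simp: disjoint_iff)
    have YN: False if "y \<in> topspace Y" "y' \<in> topspace Y" "g y = g y'" "y \<in> A" "y' \<notin> A" for y y'
      using XN[of "f y" y'] gf fX that by auto
    have YY: "y = y'" if "y \<in> topspace Y" "y' \<in> topspace Y" "g y = g y'" "y \<notin> A" "y' \<notin> A" for y y'
      using inj that by (auto simp: inj_on_def)
    have "n u = n v"
    proof (cases u)
      case u': (Inl x)
      show ?thesis
      proof (cases v)
        case (Inl x')
        then show ?thesis using u' e by (simp add: n_def)
      next
        case (Inr y)
        then show ?thesis using u' e u v XX[of x y] XN[of x y] by (cases "y \<in> A") (auto simp: n_def)
      qed
    next
      case u': (Inr y)
      show ?thesis
      proof (cases v)
        case (Inl x)
        then have "x \<in> topspace X" "y \<in> topspace Y" "x = g y" using u' e u v by auto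
        then show ?thesis using Inl u' XX[of x y] XN[of x y] by (cases "y \<in> A") (auto simp: n_def)
      next
        case (Inr y')
        then have "y \<in> topspace Y" "y' \<in> topspace Y" "g y = g y'" using u' e u v by auto
        then show ?thesis using Inr u' YN[of y y'] YN[of y' y] YY[of y y'] gf
          by (cases "y \<in> A"; cases "y' \<in> A") (auto simp: n_def)
      qed
    qed
    then have "(n u, v) \<in> generated_equiv ?r" using n(2)[of v] by simp
    then show ?thesis by (rule tr[OF n(1)])
  qed
  have opn: "openin Z U \<longleftrightarrow> openin X {x \<in> topspace X. id x \<in> U} \<and> openin Y {y \<in> topspace Y. g y \<in> U}"
    if "U \<subseteq> topspace Z" for U using op[OF that] j g by (auto simp: continuous_map_def Int_def)
  show ?thesis
    unfolding pushout_Top_def TA using f j g gf Z XZ YZ opn eq by (auto simp: continuous_map_from_subtopology)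
qed

lemma pushout_Top_inclusionD:
  assumes p: "pushout_Top (subtopology Y A) X Y Z f id id g" and A: "A \<subseteq> topspace Y"
  shows "continuous_map (subtopology Y A) X f" "continuous_map X Z id" "continuous_map Y Z g"
    "\<And>a. a \<in> A \<Longrightarrow> g a = f a" "\<And>a. a \<in> A \<Longrightarrow> f a \<in> topspace X"
    "topspace Z = topspace X \<union> g ` topspace Y"
    "\<And>U. U \<subseteq> topspace Z \<Longrightarrow> openin X (topspace X \<inter> U) \<Longrightarrow>
               openin Y {y \<in> topspace Y. g y \<in> U} \<Longrightarrow> openin Z U"
    "inj_on g (topspace Y - A)" "g ` (topspace Y - A) \<inter> topspace X = {}"
proof -
  have TA: "topspace (subtopology Y A) = A" using A by auto
  note p' = p[unfolded pushout_Top_def TA]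
  show f: "continuous_map (subtopology Y A) X f" and "continuous_map X Z id" "continuous_map Y Z g" using p' by auto
  show "\<And>a. a \<in> A \<Longrightarrow> g a = f a" using p' by auto
  show fX: "\<And>a. a \<in> A \<Longrightarrow> f a \<in> topspace X"
    using f TA by (auto simp: continuous_map_def Pi_iff)
  show "topspace Z = topspace X \<union> g ` topspace Y" using p' by auto
  show "openin Z U" if "U \<subseteq> topspace Z" "openin X (topspace X \<inter> U)"
               "openin Y {y \<in> topspace Y. g y \<in> U}" for U using p' that by (auto simp: Int_def)
  let ?r = "(\<lambda>a. (Inl (f a), Inr (id a))) ` A"
  \<comment> \<open>The normal form does not change along a generating step, so it is constant on
    classes; injectivity and disjointness are read off from it.\<close>
  define n where "n u = (case u of Inl x \<Rightarrow> Inl x | Inr y \<Rightarrow> if y \<in> A then Inl (f y) else Inr y)"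
    for u :: "'b + 'a"
  have n: "n u = n v" if "(u, v) \<in> generated_equiv ?r" for u v
    using that unfolding generated_equiv_def by (induction rule: rtrancl_induct) (auto simp: n_def)
  have eq: "n u = n v" if "u \<in> topspace X <+> topspace Y" "v \<in> topspace X <+> topspace Y"
      "case_sum id g u = case_sum id g v" for u v using p' that n by blast
  show "inj_on g (topspace Y - A)"
  proof (rule inj_onI)
    fix x y assume "x \<in> topspace Y - A" "y \<in> topspace Y - A" "g x = g y"
    then show "x = y" using eq[of "Inr x" "Inr y"] by (auto simp: n_def)
  qed
  show "g ` (topspace Y - A) \<inter> topspace X = {}"
  proof -
    have False if "y \<in> topspace Y - A" "g y \<in> topspace X" for y
      using eq[of "Inr y" "Inl (g y)"] that by (auto simp: n_def)
    then show ?thesis by auto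
  qed
qed

text \<open>The topology is pulled back along a left inverse, so for injective \<open>f\<close> it
  is the one that makes \<open>f\<close> a homeomorphism onto its image.\<close>

definition transport_topology :: "('x \<Rightarrow> 'y) \<Rightarrow> 'x topology \<Rightarrow> 'y topology" where
  "transport_topology f X = pullback_topology (f ` topspace X) (inv_into (topspace X) f) X"

lemma homeomorphic_map_transport:
  assumes "inj_on f (topspace X)"
  shows "homeomorphic_map X (transport_topology f X) f"
    and "continuous_map (transport_topology f X) X (inv_into (topspace X) f)"
    and "topspace (transport_topology f X) = f ` topspace X"
proof -
  let ?g = "inv_into (topspace X) f"
  show T: "topspace (transport_topology f X) = f ` topspace X"
    unfolding transport_topology_def topspace_pullback_topology by (auto simp: inv_into_into)
  have 1: "continuous_map X (transport_topology f X) f"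
    unfolding transport_topology_def
  proof (rule continuous_map_pullback')
    show "continuous_map X X (?g \<circ> f)" by (rule continuous_map_eq[of _ _ "\<lambda>x. x"]) (use assms in auto)
  qed auto
  show 2: "continuous_map (transport_topology f X) X ?g"
    using continuous_map_pullback[OF continuous_map_id[of X], of "f ` topspace X" ?g]
    unfolding transport_topology_def by simp
  have "homeomorphic_maps X (transport_topology f X) f ?g"
    unfolding homeomorphic_maps_def using 1 2 T assms by (auto simp: f_inv_into_f)
  then show "homeomorphic_map X (transport_topology f X) f" by (rule homeomorphic_maps_imp_map)
qed

subsection \<open>Cells and strata\<close>

lemma compactin_disc_sets:
  shows "compactin (disc n) (topspace (disc n))" "compactin (disc n) (disc_boundary n)"
    "disc_interior n \<union> disc_boundary n = topspace (disc n)"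
proof -
  let ?P = "powertop_real (UNIV :: nat set)"
  \<comment> \<open>Both sets are closed subsets of a cube that is constantly 0 in the coordinates
    from \<open>n\<close> on, and the cube is compact in the product topology by Tychonoff's
    theorem.\<close>
  let ?K = "PiE (UNIV :: nat set) (\<lambda>i. if i < n then {-1..1} else {0::real})"
  have K: "compactin ?P ?K" by (auto simp: compactin_PiE)
  let ?q = "\<lambda>x::nat \<Rightarrow> real. \<Sum>i<n. x i ^ 2"
  have q: "continuous_map ?P euclideanreal ?q" by (intro continuous_intros continuous_map_product_projection) auto
  have T: "topspace (Euclidean_space n) = {x. \<forall>i\<ge>n. x i = 0}" by (simp add: topspace_Euclidean_space)
  have *: "compactin (Euclidean_space n) {x \<in> topspace (Euclidean_space n). ?q x \<in> C}"
    if C: "closed C" "C \<subseteq> {..1}" for C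
  proof -
    have sub: "{x \<in> topspace (Euclidean_space n). ?q x \<in> C} \<subseteq> ?K"
    proof
      fix x assume x: "x \<in> {x \<in> topspace (Euclidean_space n). ?q x \<in> C}"
      have "x i \<in> {-1..1}" if "i < n" for i
      proof -
        have "x i ^ 2 \<le> ?q x" using that by (intro member_le_sum) auto
        also have "\<dots> \<le> 1" using x C by auto
        finally show ?thesis by (simp add: abs_square_le_1 abs_le_iff)
      qed
      then show "x \<in> ?K" using x T by auto
    qed
    have clo: "closedin ?P {x \<in> topspace ?P. ?q x \<in> C}"
      using q C closedin_continuous_map_preimage[of ?P euclideanreal ?q C] by simp
    have "{x \<in> topspace (Euclidean_space n). ?q x \<in> C} = ?K \<inter> {x \<in> topspace ?P. ?q x \<in> C}"
      using sub T by (auto simp: PiE_iff split: if_splits)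
    then have "compactin ?P {x \<in> topspace (Euclidean_space n). ?q x \<in> C}"
      using compact_Int_closedin[OF K clo] by simp
    then show ?thesis unfolding Euclidean_space_def by (auto simp: compactin_subtopology)
  qed
  have t: "topspace (disc n) = {x \<in> topspace (Euclidean_space n). ?q x \<in> {..1}}" by (auto simp: disc_def)
  have b: "disc_boundary n = {x \<in> topspace (Euclidean_space n). ?q x \<in> {1}}" by (auto simp: disc_boundary_def)
  show "compactin (disc n) (topspace (disc n))"
    using *[of "{..1}"] unfolding t by (simp add: disc_def compactin_subtopology subset_iff)
  show "compactin (disc n) (disc_boundary n)"
    using *[of "{1}"] unfolding b by (simp add: disc_def compactin_subtopology subset_iff)
  show "disc_interior n \<union> disc_boundary n = topspace (disc n)" unfolding t b disc_interior_def by auto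
qed

lemma open_cell_subset: "open_cell e \<subseteq> closed_cell e"
  unfolding open_cell_def closed_cell_def using compactin_disc_sets(3)[of "fst e"] by blast

context
  fixes X :: "'b topology" and E
  assumes CW: "CW_complex X E"
begin

lemma CW_Hausdorff: "Hausdorff_space X"
  and CW_covered: "topspace X = (\<Union>e\<in>E. open_cell e)" using CW unfolding CW_complex_def by simp_all

lemma CW_disjoint: "e \<in> E \<Longrightarrow> e' \<in> E \<Longrightarrow> e \<noteq> e' \<Longrightarrow> open_cell e \<inter> open_cell e' = {}"
proof -
  have "\<forall>e\<in>E. \<forall>e'\<in>E. e \<noteq> e' \<longrightarrow> open_cell e \<inter> open_cell e' = {}"
    using CW unfolding CW_complex_def by (elim conjE)
  then show "e \<in> E \<Longrightarrow> e' \<in> E \<Longrightarrow> e \<noteq> e' \<Longrightarrow> open_cell e \<inter> open_cell e' = {}" by blast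
qed

lemma CW_closedin: "A \<subseteq> topspace X \<Longrightarrow> (\<And>e. e \<in> E \<Longrightarrow> closedin X (A \<inter> closed_cell e)) \<Longrightarrow> closedin X A"
proof -
  have "\<forall>A. A \<subseteq> topspace X \<longrightarrow> (closedin X A \<longleftrightarrow> (\<forall>e\<in>E. closedin X (A \<inter> closed_cell e)))"
    using CW unfolding CW_complex_def by (elim conjE)
  then show "A \<subseteq> topspace X \<Longrightarrow> (\<And>e. e \<in> E \<Longrightarrow> closedin X (A \<inter> closed_cell e)) \<Longrightarrow> closedin X A"
    by blast
qed

lemma CW_continuous: "e \<in> E \<Longrightarrow> continuous_map (disc (fst e)) X (snd e)"
proof -
  have "\<forall>(n, \<phi>) \<in> E. continuous_map (disc n) X \<phi> \<and> inj_on \<phi> (disc_interior n)"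
    using CW unfolding CW_complex_def by (elim conjE)
  then show "e \<in> E \<Longrightarrow> continuous_map (disc (fst e)) X (snd e)" by auto
qed

lemma CW_compact_cell: "e \<in> E \<Longrightarrow> compactin X (closed_cell e)"
  unfolding closed_cell_def using CW_continuous compactin_disc_sets(1) image_compactin by blast

lemma CW_closed_cell: "e \<in> E \<Longrightarrow> closedin X (closed_cell e)"
  using CW_compact_cell CW_Hausdorff compactin_imp_closedin by blast

text \<open>The boundary sphere is mapped into cells of lower dimension, which are disjoint from the
  open cell. So the closed cell minus the open cell is exactly the image of the sphere, a compact
  and hence closed set.\<close>

lemma CW_boundary:
  assumes e: "e \<in> E"
  obtains D where "finite D" "D \<subseteq> E" "\<And>d. d \<in> D \<Longrightarrow> fst d < fst e"
    "closed_cell e - open_cell e \<subseteq> (\<Union>d\<in>D. open_cell d)"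
    "closedin X (closed_cell e - open_cell e)"
proof -
  obtain n \<phi> where e': "e = (n, \<phi>)" by (cases e)
  obtain D where D: "finite D" "D \<subseteq> E" "\<And>d. d \<in> D \<Longrightarrow> fst d < n"
    "\<phi> ` disc_boundary n \<subseteq> (\<Union>d\<in>D. open_cell d)"
  proof -
    have "\<forall>(n, \<phi>) \<in> E. \<exists>D. finite D \<and> D \<subseteq> E \<and> (\<forall>d\<in>D. fst d < n) \<and>
        \<phi> ` disc_boundary n \<subseteq> (\<Union>d\<in>D. open_cell d)"
      using CW unfolding CW_complex_def by (elim conjE)
    from bspec[OF this e] obtain D where "finite D \<and> D \<subseteq> E \<and> (\<forall>d\<in>D. fst d < n) \<and>
        \<phi> ` disc_boundary n \<subseteq> (\<Union>d\<in>D. open_cell d)" unfolding e' prod.case by (elim exE)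
    then show thesis using that[of D] by blast
  qed
  have "open_cell e \<inter> open_cell d = {}" if "d \<in> D" for d
  proof -
    have "d \<noteq> e" using D(3)[OF that] e' by auto
    then show ?thesis using CW_disjoint[OF e, of d] D(2) that by auto
  qed
  then have "open_cell e \<inter> (\<Union>d\<in>D. open_cell d) = {}" by (simp add: Int_UN_distrib)
  then have "open_cell e \<inter> \<phi> ` disc_boundary n = {}" using D(4) by (meson disjoint_iff subsetD)
  moreover have "closed_cell e = open_cell e \<union> \<phi> ` disc_boundary n"
    unfolding closed_cell_def open_cell_def e' compactin_disc_sets(3)[symmetric] by (simp add: image_Un)
  ultimately have eq: "closed_cell e - open_cell e = \<phi> ` disc_boundary n" by blast
  have "compactin X (\<phi> ` disc_boundary n)"
    using image_compactin[OF compactin_disc_sets(2) CW_continuous[OF e]] e' by simp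
  then have "closedin X (\<phi> ` disc_boundary n)" using CW_Hausdorff compactin_imp_closedin by blast
  then show thesis using that[of D] D eq e' by auto
qed

lemma CW_openin:
  assumes S: "S \<subseteq> topspace X"
    and op: "\<And>e. e \<in> E \<Longrightarrow> openin (subtopology X (closed_cell e)) (S \<inter> closed_cell e)"
  shows "openin X S"
proof -
  have "closedin X (topspace X - S)"
  proof (rule CW_closedin)
    fix e assume e: "e \<in> E"
    have sub: "closed_cell e \<subseteq> topspace X" using closedin_subset[OF CW_closed_cell[OF e]] .
    have "closedin (subtopology X (closed_cell e))
        (topspace (subtopology X (closed_cell e)) - S \<inter> closed_cell e)" using op[OF e] by blast
    moreover have "topspace (subtopology X (closed_cell e)) - S \<inter> closed_cell e =
        (topspace X - S) \<inter> closed_cell e" using sub by auto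
    ultimately show "closedin X ((topspace X - S) \<inter> closed_cell e)"
      using CW_closed_cell[OF e] closedin_trans_full by metis
  qed auto
  then show ?thesis using S by (simp add: openin_closedin_eq)
qed

text \<open>A closed cell meets only finitely many open cells, namely its own and those that contain
  its boundary. On it \<open>A\<close> therefore agrees with a finite union of closed cells.\<close>

lemma CW_subcomplex_closed:
  assumes "CW_subcomplex E D A"
  shows "closedin X A"
proof (rule CW_closedin)
  have D: "D \<subseteq> E" "A = (\<Union>e\<in>D. open_cell e)" "\<And>e. e \<in> D \<Longrightarrow> closed_cell e \<subseteq> A"
    using assms by (auto simp: CW_subcomplex_def)
  then show "A \<subseteq> topspace X" using CW_covered by auto
  fix e assume e: "e \<in> E"
  obtain F where F: "finite F" "F \<subseteq> E" "closed_cell e - open_cell e \<subseteq> (\<Union>d\<in>F. open_cell d)"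
    using CW_boundary[OF e] by metis
  let ?F = "insert e F \<inter> D"
  have "A \<inter> closed_cell e = (\<Union>d\<in>?F. closed_cell d) \<inter> closed_cell e"
  proof
    show "A \<inter> closed_cell e \<subseteq> (\<Union>d\<in>?F. closed_cell d) \<inter> closed_cell e"
    proof
      fix x assume x: "x \<in> A \<inter> closed_cell e"
      then obtain d where d: "d \<in> D" "x \<in> open_cell d" using D by blast
      have "x \<in> open_cell e \<or> x \<in> (\<Union>d\<in>F. open_cell d)" using x F(3) by blast
      then obtain d' where d': "d' \<in> insert e F" "x \<in> open_cell d'" by blast
      have "d \<in> E" "d' \<in> E" using d(1) d'(1) D(1) F(2) e by auto
      then have "d = d'" using CW_disjoint[of d d'] d(2) d'(2) by (meson disjoint_iff)
      then show "x \<in> (\<Union>d\<in>?F. closed_cell d) \<inter> closed_cell e"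
        using d d'(1) x subsetD[OF open_cell_subset d(2)] by (intro IntI UN_I[of d]) simp_all
    qed
    show "(\<Union>d\<in>?F. closed_cell d) \<inter> closed_cell e \<subseteq> A \<inter> closed_cell e" using D(3) by blast
  qed
  moreover have "closedin X (\<Union>d\<in>?F. closed_cell d)"
    using F D(1) CW_closed_cell by (intro closedin_Union) auto
  ultimately show "closedin X (A \<inter> closed_cell e)" using CW_closed_cell[OF e] closedin_Int by metis
qed

end

lemma CW_pair_closed: "CW_pair X A \<Longrightarrow> closedin X A"
  unfolding CW_pair_def using CW_subcomplex_closed by blast

lemma pushout_Top_preimage:
  assumes p: "pushout_Top (subtopology Y A) X Y Z f id id g" and A: "A \<subseteq> topspace Y"
    and y: "y \<in> topspace Y"
  shows "g y \<in> topspace X \<longleftrightarrow> y \<in> A"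
proof
  show "y \<in> A" if "g y \<in> topspace X"
    using pushout_Top_inclusionD(9)[OF p A] y that by (meson DiffI disjoint_iff imageI)
  show "g y \<in> topspace X" if "y \<in> A" using pushout_Top_inclusionD(4,5)[OF p A that] by simp
qed

lemma pushout_Top_closed:
  assumes p: "pushout_Top (subtopology Y A) X Y Z f id id g" and A: "closedin Y A"
  shows "closedin Z (topspace X)"
proof -
  note d = pushout_Top_inclusionD[OF p closedin_subset[OF A]]
  have "openin Z (topspace Z - topspace X)"
  proof (rule d(7))
    have "topspace X \<inter> (topspace Z - topspace X) = {}" by auto
    then show "openin X (topspace X \<inter> (topspace Z - topspace X))" by (simp only: openin_empty)
    have "{y \<in> topspace Y. g y \<in> topspace Z - topspace X} = topspace Y - A"
      using d(6) pushout_Top_preimage[OF p closedin_subset[OF A]] by auto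
    then show "openin Y {y \<in> topspace Y. g y \<in> topspace Z - topspace X}" using A by (simp add: closedin_def)
  qed auto
  then show ?thesis using d(6) by (auto simp: closedin_def)
qed

text \<open>The preimage of \<open>z\<close> in \<open>Y\<close> is a fibre of the attaching map
  inside the closed set \<open>A\<close>, a single point, or empty. Closed points are wanted because
  the fibre of a coend over \<open>b\<close> is found by restricting to \<open>{b}\<close>.\<close>

lemma pushout_Top_T1:
  assumes p: "pushout_Top (subtopology Y A) X Y Z f id id g" and A: "closedin Y A"
    and X: "\<And>x. x \<in> topspace X \<Longrightarrow> closedin X {x}" and Y: "\<And>y. y \<in> topspace Y \<Longrightarrow> closedin Y {y}"
    and z: "z \<in> topspace Z"
  shows "closedin Z {z}"
proof -
  note d = pushout_Top_inclusionD[OF p closedin_subset[OF A]]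
  have AY: "A \<subseteq> topspace Y" by (rule closedin_subset[OF A])
  have "openin Z (topspace Z - {z})"
  proof (rule d(7))
    have XZ: "topspace X \<subseteq> topspace Z" using d(6) by auto
    show "openin X (topspace X \<inter> (topspace Z - {z}))"
    proof (cases "z \<in> topspace X")
      case True
      have "topspace X \<inter> (topspace Z - {z}) = topspace X - {z}" using XZ by auto
      then show ?thesis using X[OF True] by (simp add: closedin_def)
    next
      case False
      then have "topspace X \<inter> (topspace Z - {z}) = topspace X" using XZ by auto
      then show ?thesis by simp
    qed
    have "closedin Y {y \<in> topspace Y. g y = z}"
    proof (cases "z \<in> topspace X")
      case True
      then have "{y \<in> topspace Y. g y = z} = {y \<in> topspace (subtopology Y A). f y \<in> {z}}"
        using d(4) AY pushout_Top_preimage[OF p AY] by auto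
      moreover have "closedin (subtopology Y A) {y \<in> topspace (subtopology Y A). f y \<in> {z}}"
        using closedin_continuous_map_preimage[OF d(1) X[OF True]] .
      ultimately show ?thesis using A closedin_trans_full by metis
    next
      case False
      then have nA: "y \<in> topspace Y - A" if "y \<in> topspace Y" "g y = z" for y
        using that pushout_Top_preimage[OF p AY, of y] False by auto
      show ?thesis
      proof (cases "\<exists>y\<in>topspace Y. g y = z")
        case True
        then obtain y where y: "y \<in> topspace Y" "g y = z" by auto
        then have "{y \<in> topspace Y. g y = z} = {y}" using nA d(8) by (auto simp: inj_on_def)
        then show ?thesis using Y[OF y(1)] by simp
      next
        case False
        then have "{y \<in> topspace Y. g y = z} = {}" by auto
        then show ?thesis by (simp only: closedin_empty)
      qed
    qed
    then have "openin Y (topspace Y - {y \<in> topspace Y. g y = z})" by (simp add: closedin_def)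
    moreover have "{y \<in> topspace Y. g y \<in> topspace Z - {z}} = topspace Y - {y \<in> topspace Y. g y = z}"
      using d(6) by auto
    ultimately show "openin Y {y \<in> topspace Y. g y \<in> topspace Z - {z}}" by simp
  qed auto
  then show ?thesis using z by (simp add: closedin_def)
qed

section \<open>Stages and points of stratified spaces\<close>

lemma strat_sub_topspace:
  assumes "stratified_space S"
  shows "strat_fil S n \<subseteq> topspace (strat_space S)" "topspace (strat_sub S n) = strat_fil S n"
    "(\<Union>n. strat_fil S n) = topspace (strat_space S)" "strat_fil S n \<subseteq> strat_fil S (Suc n)"
  using assms unfolding stratified_space_def lim_Top_def strat_sub_def by (auto simp: topspace_subtopology)

lemma strat_fil_mono:
  assumes "stratified_space S" "m \<le> n"
  shows "strat_fil S m \<subseteq> strat_fil S n"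
  using lift_Suc_mono_le[of "strat_fil S", OF strat_sub_topspace(4)[OF assms(1)] assms(2)] .

lemma strat_pushout:
  assumes "stratified_space S"
  shows "pushout_Top (subtopology (strat_M S (Suc n)) (strat_A S (Suc n)))
          (strat_sub S n) (strat_M S (Suc n)) (strat_sub S (Suc n)) (strat_h S (Suc n)) id id (strat_g S (Suc n))"
  and "closedin (strat_M S (Suc n)) (strat_A S (Suc n))" and "\<exists>E. CW_complex (strat_M S (Suc n)) E"
  and "\<exists>E. CW_complex (strat_sub S 0) E"
  using assms unfolding stratified_space_def CW_space_def by (auto intro: CW_pair_closed simp: CW_pair_def)

text \<open>A stage is closed in the next one because \<open>strat_A\<close> is closed in
  \<open>strat_M\<close>, and so in every later one by transitivity; the colimit topology tests
  closedness on the stages.\<close>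

lemma strat_fil_closed:
  assumes S: "stratified_space S"
  shows "closedin (strat_space S) (strat_fil S n)"
proof -
  let ?X = "strat_space S"
  have l: "openin ?X U" if "U \<subseteq> topspace ?X" "\<And>m. openin (subtopology ?X (strat_fil S m)) (U \<inter> strat_fil S m)" for U
    using S that unfolding stratified_space_def lim_Top_def by auto
  have c: "closedin (strat_sub S (n + k)) (strat_fil S n)" for k
  proof (induction k)
    case 0
    then show ?case using strat_sub_topspace(2)[OF S, of n] closedin_topspace[of "strat_sub S n"] by simp
  next
    case (Suc k)
    have "closedin (strat_sub S (Suc (n + k))) (strat_fil S (n + k))"
      using pushout_Top_closed[OF strat_pushout(1,2)[OF S, of "n + k"]] by (simp add: strat_sub_topspace[OF S])
    moreover have "strat_sub S (n + k) = subtopology (strat_sub S (Suc (n + k))) (strat_fil S (n + k))"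
      unfolding strat_sub_def subtopology_subtopology
      using strat_sub_topspace(4)[OF S, of "n + k"] by (simp add: inf.absorb2)
    ultimately show ?case using Suc closedin_trans_full by (metis add_Suc_right)
  qed
  have "openin ?X (topspace ?X - strat_fil S n)"
  proof (rule l)
    fix m
    show "openin (subtopology ?X (strat_fil S m)) ((topspace ?X - strat_fil S n) \<inter> strat_fil S m)"
    proof (cases "m \<le> n")
      case True
      then have "(topspace ?X - strat_fil S n) \<inter> strat_fil S m = {}" using strat_fil_mono[OF S True] by auto
      then show ?thesis by (simp only: openin_empty)
    next
      case False
      then obtain k where k: "m = n + k" using nat_le_linear le_Suc_ex by metis
      have "(topspace ?X - strat_fil S n) \<inter> strat_fil S m = topspace (strat_sub S m) - strat_fil S n"
        using strat_sub_topspace[OF S] by auto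
      then show ?thesis using c[of k] k by (simp add: strat_sub_def closedin_def)
    qed
  qed auto
  then show ?thesis using strat_sub_topspace(1)[OF S] by (auto simp: closedin_def)
qed

lemma strat_T1:
  assumes S: "stratified_space S" and b: "b \<in> topspace (strat_space S)"
  shows "closedin (strat_space S) {b}"
proof -
  have "\<forall>b \<in> strat_fil S n. closedin (strat_sub S n) {b}" for n
  proof (induction n)
    case 0
    then show ?case
      using strat_pushout(4)[OF S] CW_Hausdorff closedin_Hausdorff_singleton strat_sub_topspace(2)[OF S] by metis
  next
    case (Suc n)
    show ?case
    proof
      fix b assume b: "b \<in> strat_fil S (Suc n)"
      show "closedin (strat_sub S (Suc n)) {b}"
      proof (rule pushout_Top_T1[OF strat_pushout(1,2)[OF S]])
        show "closedin (strat_M S (Suc n)) {y}" if "y \<in> topspace (strat_M S (Suc n))" for y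
          using strat_pushout(3)[OF S, of n] that CW_Hausdorff closedin_Hausdorff_singleton by metis
      qed (use Suc b strat_sub_topspace(2)[OF S] in auto)
    qed
  qed
  moreover obtain n where "b \<in> strat_fil S n" using b strat_sub_topspace(3)[OF S] by auto
  ultimately show ?thesis using strat_fil_closed[OF S, of n] closedin_trans_full unfolding strat_sub_def by blast
qed

subsection \<open>Structure categories, families and function spaces\<close>

lemma continuous_map_prodI: "continuous_map X X' f \<Longrightarrow> continuous_map Y Y' g \<Longrightarrow>
    continuous_map (prod_topology X Y) (prod_topology X' Y') (\<lambda>(x, y). (f x, g y))"
  by (simp add: continuous_map_prod_top)

abbreviation tpts :: "('o, 'v, 'x, 'b) family \<Rightarrow> 'x set" where "tpts Y \<equiv> topspace (tot Y)"
abbreviation bpts :: "('o, 'v, 'x, 'b) family \<Rightarrow> 'b set" where "bpts Y \<equiv> topspace (base Y)"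
abbreviation dpts :: "('o, 'h, 'p, 'b) diagram \<Rightarrow> 'o \<Rightarrow> 'p set" where "dpts D V \<equiv> topspace (dsp D V)"
abbreviation dbpts :: "('o, 'h, 'p, 'b) diagram \<Rightarrow> 'b set" where "dbpts D \<equiv> topspace (dbase D)"

locale str_cat =
  fixes C :: "('o, 'h, 'v) structure_category"
  assumes sc: "structure_category C" and ff: "faithful C"
begin

abbreviation pts :: "'o \<Rightarrow> 'v set" where "pts V \<equiv> topspace (Fob C V)"

abbreviation Ma :: "'o \<Rightarrow> ('o, 'v, 'y, 'b) family \<Rightarrow> (('v \<Rightarrow> 'y) \<times> 'b) set" where
  "Ma V Y \<equiv> topspace (mapspace C V Y)"

lemmas sc' = sc[unfolded structure_category_def]

lemma Hom_Obj: "\<phi> \<in> Hom C V W \<Longrightarrow> V \<in> Obj C \<and> W \<in> Obj C"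
  using sc'[THEN conjunct1] by (auto simp: Hom_def)

lemma Idn_Hom: "V \<in> Obj C \<Longrightarrow> Idn C V \<in> Hom C V V"
  using sc'[THEN conjunct2, THEN conjunct1] by blast

lemma Comp_Hom: "\<phi> \<in> Hom C U V \<Longrightarrow> \<psi> \<in> Hom C V W \<Longrightarrow> Comp C \<psi> \<phi> \<in> Hom C U W"
  using sc'[THEN conjunct2, THEN conjunct2, THEN conjunct1] by (auto simp: Hom_def)

lemma Comp_Idn: "\<phi> \<in> Hom C V W \<Longrightarrow> Comp C \<phi> (Idn C V) = \<phi>" "\<phi> \<in> Hom C V W \<Longrightarrow> Comp C (Idn C W) \<phi> = \<phi>"
  using sc'[THEN conjunct2, THEN conjunct2, THEN conjunct2, THEN conjunct1] by (auto simp: Hom_def)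

lemma Comp_assoc:
  "\<phi> \<in> Hom C U V \<Longrightarrow> \<psi> \<in> Hom C V W \<Longrightarrow> \<theta> \<in> Hom C W Z \<Longrightarrow>
    Comp C \<theta> (Comp C \<psi> \<phi>) = Comp C (Comp C \<theta> \<psi>) \<phi>"
  using sc'[THEN conjunct2, THEN conjunct2, THEN conjunct2, THEN conjunct2, THEN conjunct1] by (auto simp: Hom_def)

lemmas sc_Fob = sc'[THEN conjunct2, THEN conjunct2, THEN conjunct2, THEN conjunct2, THEN conjunct2]

lemma Far_continuous: "\<phi> \<in> Hom C V W \<Longrightarrow> continuous_map (Fob C V) (Fob C W) (Far C \<phi>)"
  using sc_Fob[THEN conjunct2, THEN conjunct1] by (auto simp: Hom_def)

lemma Far_pts: "\<phi> \<in> Hom C V W \<Longrightarrow> v \<in> pts V \<Longrightarrow> Far C \<phi> v \<in> pts W"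
  using Far_continuous by (auto simp: continuous_map_def Pi_iff)

lemma Far_Idn: "V \<in> Obj C \<Longrightarrow> v \<in> pts V \<Longrightarrow> Far C (Idn C V) v = v"
  using sc_Fob[THEN conjunct2, THEN conjunct2, THEN conjunct1] by blast

lemma Far_Comp: "\<phi> \<in> Hom C U V \<Longrightarrow> \<psi> \<in> Hom C V W \<Longrightarrow> v \<in> pts U \<Longrightarrow>
    Far C (Comp C \<psi> \<phi>) v = Far C \<psi> (Far C \<phi> v)"
  using sc_Fob[THEN conjunct2, THEN conjunct2, THEN conjunct2] by (auto simp: Hom_def)

lemma Fob_space: "V \<in> Obj C \<Longrightarrow> locally_compact_space (Fob C V)" "V \<in> Obj C \<Longrightarrow> second_countable (Fob C V)"
  "V \<in> Obj C \<Longrightarrow> Hausdorff_space (Fob C V)" using sc_Fob[THEN conjunct1] by blast+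

lemma Far_inject:
  assumes "\<phi> \<in> Hom C V W" "\<psi> \<in> Hom C V W" "\<And>v. v \<in> pts V \<Longrightarrow> Far C \<phi> v = Far C \<psi> v"
  shows "\<phi> = \<psi>" using ff assms Hom_Obj[OF assms(1)] unfolding faithful_def by blast

lemma invertible_arrowE:
  assumes "invertible_arrow C \<phi>" "\<phi> \<in> Hom C V W"
  obtains \<psi> where "\<psi> \<in> Hom C W V" "Comp C \<psi> \<phi> = Idn C V" "Comp C \<phi> \<psi> = Idn C W"
    "\<And>v. v \<in> pts V \<Longrightarrow> Far C \<psi> (Far C \<phi> v) = v" "\<And>w. w \<in> pts W \<Longrightarrow> Far C \<phi> (Far C \<psi> w) = w"
    "invertible_arrow C \<psi>"
proof -
  obtain \<psi> where p: "\<psi> \<in> Hom C W V" "Comp C \<psi> \<phi> = Idn C V" "Comp C \<phi> \<psi> = Idn C W"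
    using assms unfolding invertible_arrow_def Hom_def by blast
  have a: "Far C \<psi> (Far C \<phi> v) = v" if "v \<in> pts V" for v
    using Far_Comp[OF assms(2) p(1) that] p(2) Far_Idn[OF _ that] Hom_Obj[OF assms(2)] by simp
  have b: "Far C \<phi> (Far C \<psi> w) = w" if "w \<in> pts W" for w
    using Far_Comp[OF p(1) assms(2) that] p(3) Far_Idn[OF _ that] Hom_Obj[OF assms(2)] by simp
  have c: "invertible_arrow C \<psi>"
    unfolding invertible_arrow_def using p assms(2) by (intro bexI[of _ \<phi>]) (auto simp: Hom_def)
  show thesis by (rule that) (fact p a b c)+
qed

lemma invertible_arrowI:
  assumes "\<phi> \<in> Hom C V W" "\<psi> \<in> Hom C W V"
    "\<And>v. v \<in> pts V \<Longrightarrow> Far C \<psi> (Far C \<phi> v) = v" "\<And>w. w \<in> pts W \<Longrightarrow> Far C \<phi> (Far C \<psi> w) = w"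
  shows "invertible_arrow C \<phi>" "Comp C \<psi> \<phi> = Idn C V" "Comp C \<phi> \<psi> = Idn C W"
proof -
  note o = Hom_Obj[OF assms(1)]
  show 1: "Comp C \<psi> \<phi> = Idn C V" by (rule Far_inject[OF Comp_Hom[OF assms(1,2)] Idn_Hom])
      (use o assms in \<open>auto simp: Far_Comp[OF assms(1,2)] Far_Idn\<close>)
  show 2: "Comp C \<phi> \<psi> = Idn C W" by (rule Far_inject[OF Comp_Hom[OF assms(2,1)] Idn_Hom])
      (use o assms in \<open>auto simp: Far_Comp[OF assms(2,1)] Far_Idn\<close>)
  show "invertible_arrow C \<phi>" using 1 2 assms(1,2) unfolding invertible_arrow_def Hom_def by auto
qed

lemma invertible_Idn: "V \<in> Obj C \<Longrightarrow> invertible_arrow C (Idn C V)"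
  using invertible_arrowI(1)[OF Idn_Hom Idn_Hom] Far_Idn by auto

lemma topspace_Hom_top [simp]: "topspace (Hom_top C V W) = Hom C V W"
  unfolding Hom_top_def topspace_pullback_topology using Far_continuous by (auto intro: continuous_map_eq)

lemma Hom_ev:
  assumes "V \<in> Obj C"
  shows "continuous_map (prod_topology (Hom_top C V W) (Fob C V)) (Fob C W) (\<lambda>(\<phi>, v). Far C \<phi> v)"
proof -
  let ?r = "\<lambda>\<phi>. restrict (Far C \<phi>) (pts V)"
  have "continuous_map (Hom_top C V W) (compact_open (Fob C V) (Fob C W)) (id \<circ> ?r)"
    unfolding Hom_top_def by (rule continuous_map_pullback) simp
  then have r: "continuous_map (Hom_top C V W) (compact_open (Fob C V) (Fob C W)) ?r" by simp
  have "continuous_map (prod_topology (Hom_top C V W) (Fob C V))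
      (prod_topology (compact_open (Fob C V) (Fob C W)) (Fob C V)) (\<lambda>(\<phi>, v). (?r \<phi>, v))"
    using continuous_map_prodI[OF r continuous_map_id] by simp
  from continuous_map_compose[OF this continuous_map_eval[OF Fob_space(1,3)[OF assms]]]
  have "continuous_map (prod_topology (Hom_top C V W) (Fob C V)) (Fob C W)
    ((\<lambda>(f, x). f x) \<circ> (\<lambda>(\<phi>, v). (?r \<phi>, v)))" .
  then show ?thesis by (rule continuous_map_eq) auto
qed

lemma Hom_curry:
  assumes "continuous_map (prod_topology T (Fob C V)) (Fob C W) (\<lambda>(t, v). Far C (g t) v)"
    and "\<And>t. t \<in> topspace T \<Longrightarrow> g t \<in> Hom C V W"
  shows "continuous_map T (Hom_top C V W) g"
  unfolding Hom_top_def
proof (rule continuous_map_pullback')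
  have "continuous_map T (compact_open (Fob C V) (Fob C W)) (\<lambda>t. restrict (Far C (g t)) (pts V))"
    using continuous_map_curry[OF assms(1)] .
  then show "continuous_map T (compact_open (Fob C V) (Fob C W)) ((\<lambda>\<phi>. restrict (Far C \<phi>) (pts V)) \<circ> g)"
    by (simp add: o_def)
qed (use assms(2) in auto)

text \<open>The members of the function space \<open>Y\<^sup>V\<close> over \<open>b\<close> are parametrised by \<open>hom(V, Y\<^sub>b)\<close>.\<close>

definition fpt :: "('o, 'v, 'y, 'b) family \<Rightarrow> 'b \<Rightarrow> 'v \<Rightarrow> 'y" where
  "fpt Y b = inv_into (fibre Y b) (chart Y b)"

definition marr :: "'o \<Rightarrow> ('o, 'v, 'y, 'b) family \<Rightarrow> ('v \<Rightarrow> 'y) \<times> 'b \<Rightarrow> 'h" where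
  "marr V Y a = (THE \<phi>. fibre_arrow C (object_family C V) Y (fst a) (\<lambda>_. snd a) () \<phi>)"

definition mpt :: "'o \<Rightarrow> ('o, 'v, 'y, 'b) family \<Rightarrow> 'b \<Rightarrow> 'h \<Rightarrow> ('v \<Rightarrow> 'y) \<times> 'b" where
  "mpt V Y b \<phi> = (restrict (\<lambda>v. fpt Y b (Far C \<phi> v)) (pts V), b)"

context
  fixes Y :: "('o, 'v, 'y, 'b) family"
  assumes Y: "family C Y"
begin

lemma prj_continuous: "continuous_map (tot Y) (base Y) (prj Y)" using Y unfolding family_def by blast

lemma prj_base: "x \<in> tpts Y \<Longrightarrow> prj Y x \<in> bpts Y"
  using prj_continuous by (auto simp: continuous_map_def)

lemma fob_Obj: "b \<in> bpts Y \<Longrightarrow> fob Y b \<in> Obj C" using Y unfolding family_def by blast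

lemma chart_homeo: "b \<in> bpts Y \<Longrightarrow>
    homeomorphic_map (subtopology (tot Y) (fibre Y b)) (Fob C (fob Y b)) (chart Y b)"
  using Y unfolding family_def by blast

lemma fibre_sub: "fibre Y b \<subseteq> tpts Y" unfolding fibre_def by blast

lemma topspace_fibre: "topspace (subtopology (tot Y) (fibre Y b)) = fibre Y b" using fibre_sub by auto

lemma chart_continuous: "b \<in> bpts Y \<Longrightarrow>
    continuous_map (subtopology (tot Y) (fibre Y b)) (Fob C (fob Y b)) (chart Y b)"
  using chart_homeo homeomorphic_imp_continuous_map by blast

lemma chart_inj: "b \<in> bpts Y \<Longrightarrow> inj_on (chart Y b) (fibre Y b)"
  using chart_homeo[of b] homeomorphic_imp_injective_map topspace_fibre by metis

lemma chart_image: "b \<in> bpts Y \<Longrightarrow> chart Y b ` fibre Y b = pts (fob Y b)"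
  using chart_homeo[of b] homeomorphic_imp_surjective_map topspace_fibre by metis

lemma chart_pts: "x \<in> fibre Y b \<Longrightarrow> b \<in> bpts Y \<Longrightarrow> chart Y b x \<in> pts (fob Y b)"
  using chart_image by blast

lemma fpt_fibre: "b \<in> bpts Y \<Longrightarrow> w \<in> pts (fob Y b) \<Longrightarrow> fpt Y b w \<in> fibre Y b"
  unfolding fpt_def using chart_image by (metis inv_into_into)

lemma chart_fpt: "b \<in> bpts Y \<Longrightarrow> w \<in> pts (fob Y b) \<Longrightarrow> chart Y b (fpt Y b w) = w"
  unfolding fpt_def using chart_image by (metis f_inv_into_f)

lemma fpt_chart: "b \<in> bpts Y \<Longrightarrow> x \<in> fibre Y b \<Longrightarrow> fpt Y b (chart Y b x) = x"
  unfolding fpt_def using chart_inj by (metis inv_into_f_f)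

lemma fpt_continuous:
  assumes b: "b \<in> bpts Y"
  shows "continuous_map (Fob C (fob Y b)) (tot Y) (fpt Y b)"
proof -
  obtain g where g: "homeomorphic_maps (subtopology (tot Y) (fibre Y b)) (Fob C (fob Y b)) (chart Y b) g"
    using chart_homeo[OF b] homeomorphic_map_maps by blast
  then have c: "continuous_map (Fob C (fob Y b)) (tot Y) g"
    and e: "\<And>w. w \<in> pts (fob Y b) \<Longrightarrow> chart Y b (g w) = w \<and> g w \<in> fibre Y b"
    unfolding homeomorphic_maps_def by (auto simp: continuous_map_in_subtopology)
  show ?thesis by (rule continuous_map_eq[OF c]) (metis e fpt_chart b)
qed

lemma mapspace_mem: "a \<in> Ma V Y \<longleftrightarrow>
     fst a \<in> extensional (pts V) \<and> continuous_map (Fob C V) (tot Y) (fst a) \<and>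
     snd a \<in> bpts Y \<and> (\<forall>v\<in>pts V. prj Y (fst a v) = snd a) \<and>
     (\<exists>\<phi>\<in>Hom C V (fob Y (snd a)). \<forall>v\<in>pts V. chart Y (snd a) (fst a v) = Far C \<phi> v)"
proof (cases a)
  case (Pair f b)
  have 1: "fibre (object_family C V) () = pts V" by (auto simp: fibre_def object_family_def)
  have "a \<in> Ma V Y \<longleftrightarrow> f \<in> extensional (pts V) \<and> continuous_map (Fob C V) (tot Y) f \<and>
     b \<in> bpts Y \<and> fam_map C (object_family C V) Y f (\<lambda>_. b)" unfolding mapspace_def Pair by auto
  also have "\<dots> \<longleftrightarrow> f \<in> extensional (pts V) \<and> continuous_map (Fob C V) (tot Y) f \<and>
     b \<in> bpts Y \<and> (\<forall>v\<in>pts V. prj Y (f v) = b) \<and>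
     (\<exists>\<phi>\<in>Hom C V (fob Y b). \<forall>v\<in>pts V. chart Y b (f v) = Far C \<phi> v)"
    unfolding fam_map_def fibre_arrow_def by (simp add: 1) (auto simp: object_family_def)
  finally show ?thesis by (simp add: Pair)
qed

lemma mapspace_fibre:
  "a \<in> Ma V Y \<Longrightarrow> v \<in> pts V \<Longrightarrow> fst a v \<in> fibre Y (snd a)"
  unfolding mapspace_mem fibre_def by (auto simp: continuous_map_def)

text \<open>Continuity comes from the chart over \<open>b\<close>: through its inverse,
  \<open>f\<close> is \<open>Far C \<phi>\<close> followed by \<open>fpt Y b\<close>.\<close>

lemma mapspace_memI:
  assumes b: "b \<in> bpts Y" and \<phi>: "\<phi> \<in> Hom C V (fob Y b)" and f: "f \<in> extensional (pts V)"
    and c: "\<And>v. v \<in> pts V \<Longrightarrow> f v \<in> fibre Y b \<and> chart Y b (f v) = Far C \<phi> v"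
  shows "(f, b) \<in> Ma V Y"
proof -
  have "continuous_map (Fob C V) (tot Y) (fpt Y b \<circ> Far C \<phi>)"
    using continuous_map_compose[OF Far_continuous[OF \<phi>] fpt_continuous[OF b]] .
  then have "continuous_map (Fob C V) (tot Y) f"
  proof (rule continuous_map_eq)
    fix v assume "v \<in> pts V"
    then show "(fpt Y b \<circ> Far C \<phi>) v = f v" using c fpt_chart[OF b, of "f v"] by auto
  qed
  then show ?thesis using assms by (auto simp: mapspace_mem fibre_def)
qed

text \<open>Faithfulness makes the morphism behind a member of the function space unique, so the
  definite description in \<open>marr\<close> denotes it.\<close>

lemma marr:
  assumes a: "a \<in> Ma V Y"
  shows "marr V Y a \<in> Hom C V (fob Y (snd a))"
    "\<And>v. v \<in> pts V \<Longrightarrow> chart Y (snd a) (fst a v) = Far C (marr V Y a) v"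
    "\<And>\<phi>. \<phi> \<in> Hom C V (fob Y (snd a)) \<Longrightarrow> (\<And>v. v \<in> pts V \<Longrightarrow> chart Y (snd a) (fst a v) = Far C \<phi> v) \<Longrightarrow>
        marr V Y a = \<phi>"
proof -
  have fa: "fibre_arrow C (object_family C V) Y (fst a) (\<lambda>_. snd a) () \<phi> \<longleftrightarrow>
     \<phi> \<in> Hom C V (fob Y (snd a)) \<and> (\<forall>v\<in>pts V. chart Y (snd a) (fst a v) = Far C \<phi> v)" for \<phi>
    by (auto simp: fibre_arrow_def fibre_def object_family_def)
  obtain \<phi> where \<phi>: "\<phi> \<in> Hom C V (fob Y (snd a))" "\<forall>v\<in>pts V. chart Y (snd a) (fst a v) = Far C \<phi> v"
    using a unfolding mapspace_mem by blast
  have u: "\<psi> = \<phi>" if "\<psi> \<in> Hom C V (fob Y (snd a))" "\<forall>v\<in>pts V. chart Y (snd a) (fst a v) = Far C \<psi> v" for \<psi>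
    using Far_inject[OF that(1) \<phi>(1)] that \<phi> by auto
  have m: "marr V Y a = \<phi>" unfolding marr_def fa using \<phi> u by (intro the_equality) auto
  show "marr V Y a \<in> Hom C V (fob Y (snd a))"
    "\<And>v. v \<in> pts V \<Longrightarrow> chart Y (snd a) (fst a v) = Far C (marr V Y a) v"
    unfolding m using \<phi> by auto
  show "marr V Y a = \<psi>" if "\<psi> \<in> Hom C V (fob Y (snd a))"
    "\<And>v. v \<in> pts V \<Longrightarrow> chart Y (snd a) (fst a v) = Far C \<psi> v" for \<psi>
    unfolding m using u that by auto
qed

lemma mapspace_snd: "a \<in> Ma V Y \<Longrightarrow> snd a \<in> bpts Y" by (simp add: mapspace_mem)

lemma mpt_mapspace:
  assumes b: "b \<in> bpts Y" and \<phi>: "\<phi> \<in> Hom C V (fob Y b)"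
  shows "mpt V Y b \<phi> \<in> Ma V Y" "marr V Y (mpt V Y b \<phi>) = \<phi>" "snd (mpt V Y b \<phi>) = b"
    "\<And>v. v \<in> pts V \<Longrightarrow> fst (mpt V Y b \<phi>) v = fpt Y b (Far C \<phi> v)"
proof -
  show m: "mpt V Y b \<phi> \<in> Ma V Y"
    unfolding mpt_def
    by (rule mapspace_memI[OF b \<phi>]) (use fpt_fibre[OF b] chart_fpt[OF b] Far_pts[OF \<phi>] in auto)
  show "snd (mpt V Y b \<phi>) = b" "\<And>v. v \<in> pts V \<Longrightarrow> fst (mpt V Y b \<phi>) v = fpt Y b (Far C \<phi> v)"
    by (auto simp: mpt_def)
  then show "marr V Y (mpt V Y b \<phi>) = \<phi>"
    using chart_fpt[OF b] Far_pts[OF \<phi>] \<phi> by (intro marr(3)[OF m]) auto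
qed

lemma fst_marr:
  assumes a: "a \<in> Ma V Y" and v: "v \<in> pts V"
  shows "fst a v = fpt Y (snd a) (Far C (marr V Y a) v)"
  using marr(2)[OF a v] fpt_chart[OF mapspace_snd[OF a] mapspace_fibre[OF a v]] by simp

lemma mapspace_eqI:
  assumes a: "a \<in> Ma V Y" and b: "b \<in> Ma V Y" and "snd a = snd b" "marr V Y a = marr V Y b"
  shows "a = b"
proof -
  have "fst a = fst b"
  proof (rule extensionalityI[of _ "pts V"])
    show "fst a \<in> extensional (pts V)" "fst b \<in> extensional (pts V)" using a b by (auto simp: mapspace_mem)
    show "fst a v = fst b v" if "v \<in> pts V" for v using fst_marr[OF a that] fst_marr[OF b that] assms by simp
  qed
  then show ?thesis using assms(3) by (simp add: prod_eq_iff)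
qed

lemma mpt_marr: "a \<in> Ma V Y \<Longrightarrow> mpt V Y (snd a) (marr V Y a) = a"
  using mpt_mapspace[OF mapspace_snd marr(1)] mapspace_eqI by metis

end

lemma mapspace_snd_continuous: "continuous_map (mapspace C V Y) (base Y) snd"
  unfolding mapspace_def by (intro continuous_map_from_subtopology) (simp add: continuous_map_snd)

lemma mapspace_fst_continuous: "continuous_map (mapspace C V Y) (compact_open (Fob C V) (tot Y)) fst"
  unfolding mapspace_def by (intro continuous_map_from_subtopology) (simp add: continuous_map_fst)

lemma mapspace_ev:
  assumes "V \<in> Obj C"
  shows "continuous_map (prod_topology (mapspace C V Y) (Fob C V)) (tot Y) (\<lambda>(a, v). fst a v)"
proof -
  have "continuous_map (prod_topology (mapspace C V Y) (Fob C V))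
      (prod_topology (compact_open (Fob C V) (tot Y)) (Fob C V)) (\<lambda>(a, v). (fst a, v))"
    using continuous_map_prodI[OF mapspace_fst_continuous continuous_map_id] by simp
  from continuous_map_compose[OF this continuous_map_eval[OF Fob_space(1,3)[OF assms]]]
  show ?thesis by (rule continuous_map_eq) auto
qed

lemma mapspace_ev1:
  assumes "V \<in> Obj C" "v \<in> pts V"
  shows "continuous_map (mapspace C V Y) (tot Y) (\<lambda>a. fst a v)"
proof -
  have "continuous_map (mapspace C V Y) (prod_topology (mapspace C V Y) (Fob C V)) (\<lambda>a. (a, v))"
    using assms by (simp add: continuous_map_pairwise o_def)
  from continuous_map_compose[OF this mapspace_ev[OF assms(1)]] show ?thesis by (simp add: o_def)
qed

lemma openin_mapspace_basic:
  assumes "compactin (Fob C V) K" "openin (tot Y) U"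
  shows "openin (mapspace C V Y) {a \<in> Ma V Y. fst a ` K \<subseteq> U}"
proof -
  have "{a \<in> Ma V Y. fst a ` K \<subseteq> U} =
    {a \<in> Ma V Y. fst a \<in> {f \<in> topspace (compact_open (Fob C V) (tot Y)). f ` K \<subseteq> U}}"
    using mapspace_fst_continuous[of V Y] by (auto simp: continuous_map_def Pi_iff)
  then show ?thesis
    using openin_continuous_map_preimage[OF mapspace_fst_continuous[of V Y] openin_compact_open_basic[OF assms]]
    by simp
qed

lemma mapspace_curry:
  assumes "continuous_map (prod_topology T (Fob C V)) (tot Y) (\<lambda>(t, v). g t v)"
    and "continuous_map T (base Y) \<beta>"
    and "\<And>t. t \<in> topspace T \<Longrightarrow> (restrict (g t) (pts V), \<beta> t) \<in> Ma V Y"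
  shows "continuous_map T (mapspace C V Y) (\<lambda>t. (restrict (g t) (pts V), \<beta> t))"
proof -
  have "continuous_map T (prod_topology (compact_open (Fob C V) (tot Y)) (base Y))
      (\<lambda>t. (restrict (g t) (pts V), \<beta> t))"
    using continuous_map_curry[OF assms(1)] assms(2) by (simp add: continuous_map_pairwise o_def)
  then show ?thesis using assms(3) unfolding mapspace_def by (auto simp: continuous_map_in_subtopology)
qed

lemma mapspace_curry':
  assumes Y: "family C Y" and "continuous_map (prod_topology T (Fob C V)) (tot Y) (\<lambda>(t, v). fst (a t) v)"
    and "continuous_map T (base Y) (\<lambda>t. snd (a t))"
    and "\<And>t. t \<in> topspace T \<Longrightarrow> a t \<in> Ma V Y"
  shows "continuous_map T (mapspace C V Y) a"
proof -
  have r: "(restrict (fst (a t)) (pts V), snd (a t)) = a t" if "t \<in> topspace T" for t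
    using assms(4)[OF that] unfolding mapspace_mem[OF Y] by (auto simp: prod_eq_iff extensional_restrict)
  have "continuous_map T (mapspace C V Y) (\<lambda>t. (restrict (fst (a t)) (pts V), snd (a t)))"
    by (rule mapspace_curry[OF assms(2,3)]) (simp add: r assms(4))
  then show ?thesis by (rule continuous_map_eq) (simp add: r)
qed

definition mapspace_map :: "'o \<Rightarrow> ('x \<Rightarrow> 'y) \<Rightarrow> ('b \<Rightarrow> 'c) \<Rightarrow> ('v \<Rightarrow> 'x) \<times> 'b \<Rightarrow> ('v \<Rightarrow> 'y) \<times> 'c" where
  "mapspace_map V f fb a = (restrict (\<lambda>v. f (fst a v)) (pts V), fb (snd a))"

lemma fam_mapD:
  assumes "fam_map C X Y f fb"
  shows "continuous_map (tot X) (tot Y) f" "continuous_map (base X) (base Y) fb"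
    "\<And>x. x \<in> tpts X \<Longrightarrow> prj Y (f x) = fb (prj X x)"
    "\<And>b. b \<in> bpts X \<Longrightarrow> \<exists>\<phi>. fibre_arrow C X Y f fb b \<phi>"
    "\<And>b x. b \<in> bpts X \<Longrightarrow> x \<in> fibre X b \<Longrightarrow> f x \<in> fibre Y (fb b)"
    "\<And>b. b \<in> bpts X \<Longrightarrow> fb b \<in> bpts Y"
  using assms unfolding fam_map_def fibre_def by (auto simp: continuous_map_def Pi_iff)

text \<open>Post-composition with a map of families acts on the morphisms behind the members by
  composition with the morphism of the fibre; this is what makes the associated diagram functorial
  in the family.\<close>

lemma mapspace_map_mem:
  assumes X: "family C X" and Y: "family C Y" and f: "fam_map C X Y f fb"
    and a: "a \<in> Ma V X" and \<phi>: "fibre_arrow C X Y f fb (snd a) \<phi>"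
  shows "mapspace_map V f fb a \<in> Ma V Y" "marr V Y (mapspace_map V f fb a) = Comp C \<phi> (marr V X a)"
proof -
  note sa = mapspace_snd[OF X a]
  note ma = marr[OF X a]
  have c: "Comp C \<phi> (marr V X a) \<in> Hom C V (fob Y (fb (snd a)))"
    using \<phi> ma Comp_Hom unfolding fibre_arrow_def by blast
  have e: "f (fst a v) \<in> fibre Y (fb (snd a)) \<and>
      chart Y (fb (snd a)) (f (fst a v)) = Far C (Comp C \<phi> (marr V X a)) v" if v: "v \<in> pts V" for v
  proof
    have x: "fst a v \<in> fibre X (snd a)" using mapspace_fibre[OF X a v] .
    show "f (fst a v) \<in> fibre Y (fb (snd a))" using fam_mapD(5)[OF f sa x] .
    have p: "\<phi> \<in> Hom C (fob X (snd a)) (fob Y (fb (snd a)))" using \<phi> unfolding fibre_arrow_def by blast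
    show "chart Y (fb (snd a)) (f (fst a v)) = Far C (Comp C \<phi> (marr V X a)) v"
      using \<phi> x ma(2)[OF v] Far_Comp[OF ma(1) p v] unfolding fibre_arrow_def by simp
  qed
  show m: "mapspace_map V f fb a \<in> Ma V Y"
    unfolding mapspace_map_def by (rule mapspace_memI[OF Y fam_mapD(6)[OF f sa] c]) (use e in auto)
  show "marr V Y (mapspace_map V f fb a) = Comp C \<phi> (marr V X a)"
    by (rule marr(3)[OF Y m]) (use c e in \<open>auto simp: mapspace_map_def\<close>)
qed

lemma mapspace_map_mem':
  assumes X: "family C X" and Y: "family C Y" and f: "fam_map C X Y f fb" and a: "a \<in> Ma V X"
  shows "mapspace_map V f fb a \<in> Ma V Y"
  using mapspace_map_mem(1)[OF assms] fam_mapD(4)[OF f mapspace_snd[OF X a]] by blast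

lemma mapspace_map_continuous:
  assumes X: "family C X" and Y: "family C Y" and f: "fam_map C X Y f fb" and V: "V \<in> Obj C"
  shows "continuous_map (mapspace C V X) (mapspace C V Y) (mapspace_map V f fb)"
  unfolding mapspace_map_def
proof (rule mapspace_curry)
  show "continuous_map (prod_topology (mapspace C V X) (Fob C V)) (tot Y) (\<lambda>(a, v). f (fst a v))"
    using continuous_map_compose[OF mapspace_ev[OF V] fam_mapD(1)[OF f]] by (simp add: o_def case_prod_unfold)
  show "continuous_map (mapspace C V X) (base Y) (\<lambda>a. fb (snd a))"
    using continuous_map_compose[OF mapspace_snd_continuous fam_mapD(2)[OF f]] by (simp add: o_def)
  show "(restrict (\<lambda>v. f (fst a v)) (pts V), fb (snd a)) \<in> Ma V Y" if "a \<in> Ma V X" for a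
    using mapspace_map_mem'[OF X Y f that] unfolding mapspace_map_def .
qed


subsection \<open>Restrictions and local trivialisations\<close>

abbreviation over :: "('o, 'v, 'x, 'b) family \<Rightarrow> 'b set \<Rightarrow> 'x set" where
  "over X U \<equiv> {x \<in> tpts X. prj X x \<in> U}"

lemma fam_restrict_simps [simp]: "tot (fam_restrict X U) = subtopology (tot X) (over X U)"
  "base (fam_restrict X U) = subtopology (base X) U"
  "prj (fam_restrict X U) = prj X" "fob (fam_restrict X U) = fob X" "chart (fam_restrict X U) = chart X"
  by (simp_all add: fam_restrict_def)

lemma fibre_restrict: "b \<in> U \<Longrightarrow> fibre (fam_restrict (X :: ('o, 'v, 'x, 'b) family) U) b = fibre X b"
  by (auto simp: fibre_def)

lemma family_restrict:
  assumes X: "family C X"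
  shows "family C (fam_restrict X U)"
proof -
  have "subtopology (subtopology (tot X) (over X U)) (fibre X b) = subtopology (tot X) (fibre X b)"
    if "b \<in> U" for b
  proof -
    have "over X U \<inter> fibre X b = fibre X b" using that by (auto simp: fibre_def)
    then show ?thesis by (simp add: subtopology_subtopology)
  qed
  then show ?thesis
    using X unfolding family_def
    by (auto simp: fibre_restrict continuous_map_in_subtopology continuous_map_from_subtopology)
qed

lemma fam_map_restrict_incl:
  assumes X: "family C X" and U: "U \<subseteq> U'"
  shows "fam_map C (fam_restrict X U) (fam_restrict X U') id id"
    "b \<in> bpts X \<Longrightarrow> fibre_arrow C (fam_restrict X U) (fam_restrict X U') id id b (Idn C (fob X b))"
proof -
  show *: "fibre_arrow C (fam_restrict X U) (fam_restrict X U') id id b (Idn C (fob X b))"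
    if b: "b \<in> bpts X" for b
    using Idn_Hom[OF fob_Obj[OF X b]] Far_Idn[OF fob_Obj[OF X b]] chart_pts[OF X _ b]
    by (auto simp: fibre_arrow_def fibre_def)
  show "fam_map C (fam_restrict X U) (fam_restrict X U') id id"
    unfolding fam_map_def using * U by (auto simp: continuous_map_in_subtopology continuous_map_from_subtopology)
qed

lemma fam_map_restrict_UNIV:
  assumes X: "family C X"
  shows "fam_map C (fam_restrict X U) X id id"
    "b \<in> bpts X \<Longrightarrow> fibre_arrow C (fam_restrict X U) X id id b (Idn C (fob X b))"
proof -
  show *: "fibre_arrow C (fam_restrict X U) X id id b (Idn C (fob X b))" if b: "b \<in> bpts X" for b
    using Idn_Hom[OF fob_Obj[OF X b]] Far_Idn[OF fob_Obj[OF X b]] chart_pts[OF X _ b]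
    by (auto simp: fibre_arrow_def fibre_def)
  show "fam_map C (fam_restrict X U) X id id"
    unfolding fam_map_def using * by (auto simp: continuous_map_in_subtopology continuous_map_from_subtopology)
qed

lemma topspace_mapspace_restrict:
  assumes X: "family C X"
  shows "a \<in> Ma V (fam_restrict X U) \<longleftrightarrow> a \<in> Ma V X \<and> snd a \<in> U"
  unfolding mapspace_mem[OF X] mapspace_mem[OF family_restrict[OF X]]
  using continuous_map_funspace[of "Fob C V" "tot X" "fst a"] by (auto simp: continuous_map_in_subtopology Pi_iff)

text \<open>The two topologies are compared through continuity of the identity. Towards the function
  space of the restriction this is currying of the evaluation, whose values lie over
  \<open>U\<close>.\<close>

lemma mapspace_restrict:
  assumes X: "family C X" and V: "V \<in> Obj C"
  shows "mapspace C V (fam_restrict X U) =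
    subtopology (mapspace C V X) {a \<in> Ma V X. snd a \<in> U}" (is "?L = ?R")
proof (rule topology_eq_by_id)
  have T: "topspace ?R = topspace ?L" using topspace_mapspace_restrict[OF X] by auto
  have "continuous_map ?L (mapspace C V X) (mapspace_map V id id)"
    by (rule mapspace_map_continuous[OF family_restrict[OF X] X fam_map_restrict_UNIV(1)[OF X] V])
  then have "continuous_map ?L (mapspace C V X) (\<lambda>x. x)" by (rule continuous_map_eq)
      (auto simp: mapspace_map_def topspace_mapspace_restrict[OF X] mapspace_mem[OF X] prod_eq_iff extensional_restrict)
  then show "continuous_map ?L ?R (\<lambda>x. x)"
    using topspace_mapspace_restrict[OF X, of _ V U] by (auto simp: continuous_map_in_subtopology)
  show "continuous_map ?R ?L (\<lambda>x. x)"
  proof (rule mapspace_curry'[OF family_restrict[OF X]])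
    have "continuous_map (prod_topology ?R (Fob C V)) (tot X) (\<lambda>(a, v). fst a v)"
      using continuous_map_from_subtopology[OF mapspace_ev[OF V, of X],
          of "{a \<in> Ma V X. snd a \<in> U} \<times> pts V"] by (simp add: prod_topology_subtopology)
    then show "continuous_map (prod_topology ?R (Fob C V)) (tot (fam_restrict X U)) (\<lambda>(a, v). fst a v)"
      using mapspace_fibre[OF X] by (auto simp: continuous_map_in_subtopology fibre_def)
    show "continuous_map ?R (base (fam_restrict X U)) snd"
      by (auto simp: continuous_map_in_subtopology continuous_map_from_subtopology mapspace_snd_continuous)
  qed (use T in auto)
qed

abbreviation tot_on :: "('o, 'v, 'x, 'b) family \<Rightarrow> 'b set \<Rightarrow> 'x topology" where
  "tot_on Y N \<equiv> subtopology (tot Y) (over Y N)"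

text \<open>A trivialisation over an open set in coordinates: \<open>t b\<close> parametrises the
  fibre over \<open>b\<close>, and \<open>s\<close> reads off the coordinate. The last clause keeps
  the relation with the charts, which need not vary continuously with \<open>b\<close>.\<close>

definition loc_triv ::
  "('o, 'v, 'y, 'b) family \<Rightarrow> 'b set \<Rightarrow> 'o \<Rightarrow> ('b \<Rightarrow> 'v \<Rightarrow> 'y) \<Rightarrow> ('y \<Rightarrow> 'v) \<Rightarrow> bool" where
  "loc_triv Y N W t s \<longleftrightarrow> openin (base Y) N \<and> W \<in> Obj C \<and>
     continuous_map (prod_topology (subtopology (base Y) N) (Fob C W)) (tot Y) (\<lambda>(b, w). t b w) \<and>
     continuous_map (tot_on Y N) (Fob C W) s \<and>
     (\<forall>b\<in>N. \<forall>w\<in>pts W. t b w \<in> fibre Y b \<and> s (t b w) = w) \<and>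
     (\<forall>x\<in>over Y N. t (prj Y x) (s x) = x) \<and>
     (\<forall>b\<in>N. \<exists>\<phi>\<in>Hom C W (fob Y b). invertible_arrow C \<phi> \<and>
        (\<forall>w\<in>pts W. chart Y b (t b w) = Far C \<phi> w))"

lemma fibre_bundleD: "fibre_bundle C Y \<Longrightarrow> family C Y" unfolding fibre_bundle_def by blast

lemma bundle_loc_triv:
  assumes Y: "fibre_bundle C Y" and b0: "b0 \<in> bpts Y" obtains N W t s where "b0 \<in> N" "loc_triv Y N W t s"
proof -
  note fY = fibre_bundleD[OF Y]
  obtain U N W f fb where U: "U \<subseteq> bpts Y" "openin (base Y) N" "b0 \<in> N" "N \<subseteq> U" "W \<in> Obj C"
    and iso: "fam_iso C (fam_restrict Y U) (product_family C (subtopology (base Y) U) W) f fb"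
    using Y b0 unfolding fibre_bundle_def by blast
  let ?P = "product_family C (subtopology (base Y) U) W"
  have P: "tot ?P = prod_topology (subtopology (base Y) U) (Fob C W)" "base ?P = subtopology (base Y) U"
    "prj ?P = fst" "fob ?P = (\<lambda>_. W)" "chart ?P = (\<lambda>_. snd)" by (simp_all add: product_family_def)
  obtain g gb where fm: "fam_map C (fam_restrict Y U) ?P f fb" and gm: "fam_map C ?P (fam_restrict Y U) g gb"
    and gf: "\<And>x. x \<in> over Y U \<Longrightarrow> g (f x) = x"
    and fg: "\<And>y. y \<in> tpts ?P \<Longrightarrow> f (g y) = y"
    and gfb: "\<And>b. b \<in> U \<Longrightarrow> gb (fb b) = b" and fgb: "\<And>b. b \<in> U \<Longrightarrow> fb (gb b) = b"
    using iso U(1) unfolding fam_iso_def by (auto simp: P Int_absorb1 subset_iff)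
  have TU: "topspace (subtopology (base Y) U) = U" using U(1) by auto
  have fbU: "fb b \<in> U" if "b \<in> U" for b using fam_mapD(6)[OF fm] that TU by (auto simp: P)
  \<comment> \<open>The isomorphism in the definition of a bundle may move the base by
    \<open>fb\<close>; inserting \<open>fb b\<close> makes \<open>t\<close> lie over the identity of
    the base.\<close>
  define t where "t b w = g (fb b, w)" for b w
  define s where "s x = snd (f x)" for x
  have NB: "N \<subseteq> bpts Y" using U by auto
  have "continuous_map (prod_topology (subtopology (base Y) N) (Fob C W))
      (prod_topology (subtopology (base Y) U) (Fob C W)) (\<lambda>(b, w). (fb b, w))"
  proof -
    have "continuous_map (subtopology (base Y) U) (subtopology (base Y) U) fb"
      using fam_mapD(2)[OF fm] by (simp add: P)
    then have "continuous_map (subtopology (base Y) N) (subtopology (base Y) U) fb"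
      using U(4) continuous_map_from_subtopology_mono by blast
    then show ?thesis using continuous_map_prodI[OF _ continuous_map_id] by fastforce
  qed
  from continuous_map_compose[OF this fam_mapD(1)[OF gm, unfolded P]]
  have tc: "continuous_map (prod_topology (subtopology (base Y) N) (Fob C W)) (tot Y) (\<lambda>(b, w). t b w)"
    by (simp add: t_def o_def case_prod_unfold continuous_map_in_subtopology)
  have "continuous_map (tot_on Y U) (Fob C W) s"
    using continuous_map_compose[OF fam_mapD(1)[OF fm, unfolded P] continuous_map_snd]
    by (simp add: s_def[abs_def] o_def)
  then have scont: "continuous_map (tot_on Y N) (Fob C W) s"
    by (rule continuous_map_from_subtopology_mono) (use U in auto)
  have ts: "t b w \<in> fibre Y b \<and> s (t b w) = w" if bw: "b \<in> N" "w \<in> pts W" for b w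
  proof -
    have bU: "b \<in> U" using bw U by auto
    have m: "(fb b, w) \<in> tpts ?P" using fbU[OF bU] bw TU by (auto simp: P)
    have "f (g (fb b, w)) = (fb b, w)" using fg[OF m] .
    moreover have "t b w \<in> fibre (fam_restrict Y U) (gb (fb b))"
      unfolding t_def by (rule fam_mapD(5)[OF gm]) (use fbU[OF bU] bw TU in \<open>auto simp: P fibre_def\<close>)
    ultimately show ?thesis using gfb[OF bU] fibre_restrict[OF bU, of Y] by (simp add: t_def s_def)
  qed
  have st: "t (prj Y x) (s x) = x" if x: "x \<in> over Y N" for x
  proof -
    have xU: "x \<in> over Y U" using x U by auto
    have "fst (f x) = fb (prj Y x)" using fam_mapD(3)[OF fm, of x] xU by (auto simp: P)
    then have "(fb (prj Y x), s x) = f x" by (simp add: s_def prod_eq_iff)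
    then show ?thesis using gf[OF xU] by (simp add: t_def)
  qed
  have ch: "\<exists>\<phi>\<in>Hom C W (fob Y b). invertible_arrow C \<phi> \<and> (\<forall>w\<in>pts W. chart Y b (t b w) = Far C \<phi> w)"
    if b: "b \<in> N" for b
  proof -
    have bU: "b \<in> U" using b U by auto
    have bY: "b \<in> bpts Y" using bU U by auto
    obtain \<phi> where p: "fibre_arrow C ?P (fam_restrict Y U) g gb (fb b) \<phi>"
      using fam_mapD(4)[OF gm, of "fb b"] fbU[OF bU] TU by (auto simp: P)
    obtain \<psi> where q: "fibre_arrow C (fam_restrict Y U) ?P f fb b \<psi>"
      using fam_mapD(4)[OF fm, of b] bU TU by auto
    have \<phi>: "\<phi> \<in> Hom C W (fob Y b)" "\<And>w. w \<in> pts W \<Longrightarrow> chart Y b (t b w) = Far C \<phi> w"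
      using p gfb[OF bU] fbU[OF bU] TU unfolding fibre_arrow_def by (auto simp: P t_def fibre_def)
    have \<psi>: "\<psi> \<in> Hom C (fob Y b) W" "\<And>x. x \<in> fibre Y b \<Longrightarrow> s x = Far C \<psi> (chart Y b x)"
      using q fibre_restrict[OF bU, of Y] unfolding fibre_arrow_def by (auto simp: P s_def)
    \<comment> \<open>The morphism \<open>\<psi>\<close> of the opposite map is the inverse;
      faithfulness allows both identities to be checked on points.\<close>
    have "invertible_arrow C \<phi>"
    proof (rule invertible_arrowI(1)[OF \<phi>(1) \<psi>(1)])
      show e: "Far C \<psi> (Far C \<phi> w) = w" if w: "w \<in> pts W" for w
        using ts[OF b w] \<psi>(2)[of "t b w"] \<phi>(2)[OF w] by simp
      show "Far C \<phi> (Far C \<psi> w) = w" if w: "w \<in> pts (fob Y b)" for w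
      proof -
        let ?x = "fpt Y b w"
        have x: "?x \<in> fibre Y b" "chart Y b ?x = w" using fpt_fibre[OF fY bY w] chart_fpt[OF fY bY w] by auto
        have "s ?x = Far C \<psi> w" using \<psi>(2)[OF x(1)] x(2) by simp
        moreover have "t b (s ?x) = ?x" using st[of ?x] x(1) b by (auto simp: fibre_def)
        moreover have "s ?x \<in> pts W" using calculation Far_pts[OF \<psi>(1) w] by simp
        ultimately show ?thesis using \<phi>(2)[of "s ?x"] x by simp
      qed
    qed
    then show ?thesis using \<phi> by blast
  qed
  have "loc_triv Y N W t s" unfolding loc_triv_def using U tc scont ts st ch by blast
  then show thesis using that U by blast
qed

lemma loc_triv_bundle:
  assumes Y: "family C Y"
    and lt: "\<And>b. b \<in> bpts Y \<Longrightarrow> \<exists>N W t s. b \<in> N \<and> loc_triv Y N W t s"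
  shows "fibre_bundle C Y"
  unfolding fibre_bundle_def
proof (intro conjI ballI Y)
  fix b assume "b \<in> bpts Y"
  then obtain N W t s where b: "b \<in> N" and l: "loc_triv Y N W t s" using lt by blast
  note l' = l[unfolded loc_triv_def]
  let ?P = "product_family C (subtopology (base Y) N) W"
  have P: "tot ?P = prod_topology (subtopology (base Y) N) (Fob C W)" "base ?P = subtopology (base Y) N"
    "prj ?P = fst" "fob ?P = (\<lambda>_. W)" "chart ?P = (\<lambda>_. snd)" by (simp_all add: product_family_def)
  have NB: "N \<subseteq> bpts Y" using l' openin_subset by blast
  let ?f = "\<lambda>x. (prj Y x, s x)" and ?g = "\<lambda>(b, w). t b w"
  have arrows: "\<exists>\<phi>. fibre_arrow C ?P (fam_restrict Y N) ?g id b \<phi>"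
    "\<exists>\<phi>. fibre_arrow C (fam_restrict Y N) ?P ?f id b \<phi>" if b: "b \<in> N" for b
  proof -
    have bY: "b \<in> bpts Y" using b NB by auto
    obtain \<phi> where \<phi>: "\<phi> \<in> Hom C W (fob Y b)" "invertible_arrow C \<phi>"
      "\<And>w. w \<in> pts W \<Longrightarrow> chart Y b (t b w) = Far C \<phi> w" using l' b by blast
    show "\<exists>\<phi>. fibre_arrow C ?P (fam_restrict Y N) ?g id b \<phi>"
      using \<phi> by (intro exI[of _ \<phi>]) (auto simp: fibre_arrow_def P fibre_def)
    obtain \<psi> where \<psi>: "\<psi> \<in> Hom C (fob Y b) W" "\<And>v. v \<in> pts W \<Longrightarrow> Far C \<psi> (Far C \<phi> v) = v"
      using invertible_arrowE[OF \<phi>(2,1)] by metis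
    have "s x = Far C \<psi> (chart Y b x)" if x: "x \<in> fibre Y b" for x
    proof -
      have xo: "x \<in> over Y N" "prj Y x = b" using x b by (auto simp: fibre_def)
      then have "s x \<in> pts W" using l' by (auto simp: continuous_map_def)
      moreover have "t b (s x) = x" using l' xo by auto
      ultimately show ?thesis using \<phi>(3)[of "s x"] \<psi>(2)[of "s x"] by simp
    qed
    then show "\<exists>\<phi>. fibre_arrow C (fam_restrict Y N) ?P ?f id b \<phi>"
      using \<psi> b by (intro exI[of _ \<psi>]) (auto simp: fibre_arrow_def P fibre_restrict)
  qed
  have iso: "fam_iso C (fam_restrict Y N) ?P ?f id"
    unfolding fam_iso_def
  proof (intro conjI exI[of _ ?g] exI[of _ id])
    show "fam_map C (fam_restrict Y N) ?P ?f id"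
      unfolding fam_map_def
    proof (intro conjI)
      show "continuous_map (tot (fam_restrict Y N)) (tot ?P) ?f"
        using l' prj_continuous[OF Y]
        by (auto simp: P continuous_map_pairwise o_def continuous_map_in_subtopology continuous_map_from_subtopology)
    qed (use arrows in \<open>auto simp: P\<close>)
    show "fam_map C ?P (fam_restrict Y N) ?g id"
      unfolding fam_map_def
    proof (intro conjI)
      show "continuous_map (tot ?P) (tot (fam_restrict Y N)) ?g"
        using l' by (auto simp: P continuous_map_in_subtopology fibre_def)
    qed (use arrows l' in \<open>auto simp: P fibre_def\<close>)
  qed (use l' NB in \<open>auto simp: P fibre_def\<close>)
  show "\<exists>U N. U \<subseteq> bpts Y \<and> openin (base Y) N \<and> b \<in> N \<and> N \<subseteq> U \<and>
        (\<exists>V \<in> Obj C. \<exists>f fb.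
           fam_iso C (fam_restrict Y U) (product_family C (subtopology (base Y) U) V) f fb)"
    using iso b NB l' by blast
qed

end

subsection \<open>Thickening closed sets\<close>

lemma finite_Inter_open:
  assumes "finite I" "openin X G0" "\<And>i. i \<in> I \<Longrightarrow> openin X (G i)"
  shows "openin X (G0 \<inter> (\<Inter>i\<in>I. G i))"
proof -
  have "openin X (\<Inter> (insert G0 (G ` I)))" using assms by (intro openin_Inter) auto
  then show ?thesis by simp
qed

lemma compact_closed_nbhd:
  assumes Y: "Hausdorff_space Y" "locally_compact_space Y" and S: "compactin Y S"
    and W: "openin Y W" "S \<subseteq> W"
  obtains G S' where "openin Y G" "compactin Y S'" "S \<subseteq> G" "G \<subseteq> S'" "S' \<subseteq> W"
proof -
  obtain U L where UL: "openin Y U" "compactin Y L" "S \<subseteq> U" "U \<subseteq> L"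
    using locally_compact_space_compact_closed_compact[of Y] Y S by blast
  have r: "regular_space Y" using Y locally_compact_Hausdorff_imp_regular_space by blast
  have "closedin Y (topspace Y - W)" using W by blast
  moreover have dj: "disjnt S (topspace Y - W)" using W(2) by (auto simp: disjnt_def)
  ultimately obtain U1 V1 where U1: "openin Y U1" "openin Y V1" "S \<subseteq> U1" "topspace Y - W \<subseteq> V1" "disjnt U1 V1"
    using regular_space_compact_closed_separation[OF r S _ dj] by blast
  show thesis
  proof
    show "openin Y (U \<inter> U1)" using UL U1 by blast
    show "compactin Y (L \<inter> (topspace Y - V1))" using UL U1 by (intro compact_Int_closedin) auto
    show "S \<subseteq> U \<inter> U1" using UL U1 by blast
    show "U \<inter> U1 \<subseteq> L \<inter> (topspace Y - V1)"
      using UL(4) U1(5) openin_subset[OF UL(1)] by (auto simp: disjnt_iff)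
    show "L \<inter> (topspace Y - V1) \<subseteq> W" using U1(4) by blast
  qed
qed

lemma closedin_values:
  fixes MS :: "'m topology"
  assumes ev: "\<And>K k. K \<in> KK \<Longrightarrow> k \<in> K \<Longrightarrow> continuous_map MS Y (\<lambda>a. ev a k)"
    and S: "\<And>K. K \<in> KK \<Longrightarrow> closedin Y (S K)"
  shows "closedin MS {a \<in> topspace MS. \<forall>K\<in>KK. \<forall>k\<in>K. ev a k \<in> S K}"
proof -
  let ?N = "{a \<in> topspace MS. \<forall>K\<in>KK. \<forall>k\<in>K. ev a k \<in> S K}"
  have "openin MS (topspace MS - ?N)"
  proof (rule openin_local)
    fix a assume "a \<in> topspace MS - ?N"
    then obtain K k where a: "a \<in> topspace MS" "K \<in> KK" "k \<in> K" "ev a k \<notin> S K" by auto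
    let ?V = "{a \<in> topspace MS. ev a k \<in> topspace Y - S K}"
    have "openin MS ?V" using ev[OF a(2,3)] S[OF a(2)] by (intro openin_continuous_map_preimage) auto
    moreover have "a \<in> ?V" using a continuous_map_funspace[OF ev[OF a(2,3)]] by auto
    moreover have "?V \<subseteq> topspace MS - ?N" using a by auto
    ultimately show "\<exists>V. openin MS V \<and> a \<in> V \<and> V \<subseteq> topspace MS - ?N" by blast
  qed
  then show ?thesis by (auto simp: closedin_def)
qed

text \<open>The maps with values in slightly larger compact sets \<open>S0 K\<close> that are not in
  \<open>Q\<close> form a compact set \<open>T\<close>, by \<open>prp\<close>. Each of them has some
  value outside the corresponding \<open>S K\<close>, separated from it by disjoint open sets.
  Finitely many of these separations exclude all of \<open>T\<close>, and cutting them out of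
  \<open>S0 K\<close> still leaves neighbourhoods of \<open>S K\<close>.\<close>

lemma thicken_step:
  fixes MS :: "'m topology" and Y :: "'y topology" and ev :: "'m \<Rightarrow> 'k \<Rightarrow> 'y"
  assumes Y: "Hausdorff_space Y" "locally_compact_space Y" and KK: "finite KK"
    and ev: "\<And>K k. K \<in> KK \<Longrightarrow> k \<in> K \<Longrightarrow> continuous_map MS Y (\<lambda>a. ev a k)"
    and prp: "\<And>L. compactin Y L \<Longrightarrow> compactin MS {a \<in> topspace MS. \<forall>K\<in>KK. \<forall>k\<in>K. ev a k \<in> L}"
    and oO: "openin MS Q" and S: "\<And>K. K \<in> KK \<Longrightarrow> compactin Y (S K)"
    and W: "\<And>K. K \<in> KK \<Longrightarrow> openin Y (W K)" "\<And>K. K \<in> KK \<Longrightarrow> S K \<subseteq> W K"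
    and NS: "\<And>a. a \<in> topspace MS \<Longrightarrow> (\<forall>K\<in>KK. \<forall>k\<in>K. ev a k \<in> S K) \<Longrightarrow> a \<in> Q"
  obtains G S' where "\<And>K. K \<in> KK \<Longrightarrow> openin Y (G K) \<and> compactin Y (S' K) \<and> S K \<subseteq> G K \<and> G K \<subseteq> S' K \<and> S' K \<subseteq> W K"
    "\<And>a. a \<in> topspace MS \<Longrightarrow> (\<forall>K\<in>KK. \<forall>k\<in>K. ev a k \<in> S' K) \<Longrightarrow> a \<in> Q"
proof -
  have "\<exists>G S'. openin Y G \<and> compactin Y S' \<and> S K \<subseteq> G \<and> G \<subseteq> S' \<and> S' \<subseteq> W K" if "K \<in> KK" for K
    using compact_closed_nbhd[OF Y S[OF that] W(1)[OF that] W(2)[OF that]] by metis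
  then obtain G0 S0 where GS: "\<And>K. K \<in> KK \<Longrightarrow> openin Y (G0 K) \<and> compactin Y (S0 K) \<and> S K \<subseteq> G0 K \<and> G0 K \<subseteq> S0 K \<and> S0 K \<subseteq> W K"
    by metis
  define N0 where "N0 = {a \<in> topspace MS. \<forall>K\<in>KK. \<forall>k\<in>K. ev a k \<in> S0 K}"
  have "closedin MS N0"
    unfolding N0_def
  proof (rule closedin_values[OF ev])
    show "closedin Y (S0 K)" if "K \<in> KK" for K using GS[OF that] Y(1) compactin_imp_closedin by blast
  qed
  \<comment> \<open>\<open>prp\<close> speaks of one compact set for all \<open>K\<close>, so the
    union is taken; \<open>T\<close> is then a closed subset of the compact set of maps with values
    in it.\<close>
  let ?L = "\<Union>K\<in>KK. S0 K"
  let ?P = "{a \<in> topspace MS. \<forall>K\<in>KK. \<forall>k\<in>K. ev a k \<in> ?L}"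
  have "compactin Y ?L" using KK GS by (intro compactin_Union) auto
  then have P: "compactin MS ?P" by (rule prp)
  define T where "T = N0 - Q"
  have "closedin MS T" unfolding T_def using \<open>closedin MS N0\<close> oO by (rule closedin_diff)
  then have "compactin MS (T \<inter> ?P)" using P by (rule closed_Int_compactin)
  moreover have "T \<inter> ?P = T" by (auto simp: T_def N0_def)
  ultimately have T: "compactin MS T" by simp
  have "\<exists>K k G H. K \<in> KK \<and> k \<in> K \<and> openin Y G \<and> openin Y H \<and> S K \<subseteq> G \<and> ev a k \<in> H \<and> disjnt G H"
    if a: "a \<in> T" for a
  proof -
    have at: "a \<in> topspace MS" "a \<notin> Q" using a by (auto simp: T_def N0_def)
    then obtain K k where k: "K \<in> KK" "k \<in> K" "ev a k \<notin> S K" using NS by blast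
    have y: "ev a k \<in> topspace Y" using continuous_map_funspace[OF ev[OF k(1,2)]] at by auto
    have r: "regular_space Y" using Y locally_compact_Hausdorff_imp_regular_space by blast
    have c: "closedin Y {ev a k}" by (rule closedin_Hausdorff_singleton[OF Y(1) y])
    have dj: "disjnt (S K) {ev a k}" using k(3) by (auto simp: disjnt_def)
    obtain G H where "openin Y G" "openin Y H" "S K \<subseteq> G" "{ev a k} \<subseteq> H" "disjnt G H"
      using regular_space_compact_closed_separation[OF r S[OF k(1)] c dj] by blast
    then show ?thesis using k by blast
  qed
  then obtain Kf kf Gf Hf where f: "\<And>a. a \<in> T \<Longrightarrow> Kf a \<in> KK \<and> kf a \<in> Kf a \<and> openin Y (Gf a) \<and>
      openin Y (Hf a) \<and> S (Kf a) \<subseteq> Gf a \<and> ev a (kf a) \<in> Hf a \<and> disjnt (Gf a) (Hf a)"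
    by metis
  let ?B = "\<lambda>d. {a \<in> topspace MS. ev a (kf d) \<in> Hf d}"
  have "openin MS U" if "U \<in> ?B ` T" for U
  proof -
    from that obtain d where d: "d \<in> T" "U = ?B d" by blast
    have "continuous_map MS Y (\<lambda>a. ev a (kf d))" using f[OF d(1)] ev by blast
    moreover have "openin Y (Hf d)" using f[OF d(1)] by blast
    ultimately show ?thesis unfolding d(2) by (rule openin_continuous_map_preimage)
  qed
  moreover have "T \<subseteq> \<Union>(?B ` T)"
  proof
    fix a assume a: "a \<in> T"
    then have "a \<in> ?B a" using f[OF a] compactin_subset_topspace[OF T] by blast
    then show "a \<in> \<Union>(?B ` T)" using a by (intro UnionI[of "?B a"] imageI)
  qed
  ultimately have "\<exists>\<F>. finite \<F> \<and> \<F> \<subseteq> ?B ` T \<and> T \<subseteq> \<Union>\<F>"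
    by (rule compactinD[OF T])
  then obtain \<F> where F: "finite \<F>" "\<F> \<subseteq> ?B ` T" "T \<subseteq> \<Union>\<F>" by (elim exE conjE)
  from finite_subset_image[OF F(1,2)] obtain D where D: "finite D" "D \<subseteq> T" "\<F> = ?B ` D"
    by (elim exE conjE)
  \<comment> \<open>Each separation concerns a value at a point of one particular \<open>K\<close>,
    so only the sets belonging to that \<open>K\<close> are cut down.\<close>
  define G where "G K = G0 K \<inter> (\<Inter>a\<in>{a \<in> D. Kf a = K}. Gf a)" for K
  define S' where "S' K = S0 K \<inter> (topspace Y - (\<Union>a\<in>{a \<in> D. Kf a = K}. Hf a))" for K
  show thesis
  proof
    fix K assume K: "K \<in> KK"
    have fd: "openin Y (Gf a)" "openin Y (Hf a)" "S K \<subseteq> Gf a" "disjnt (Gf a) (Hf a)"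
      if "a \<in> {a \<in> D. Kf a = K}" for a using that f[of a] D(2) by auto
    have g: "openin Y (G0 K)" "compactin Y (S0 K)" "S K \<subseteq> G0 K" "G0 K \<subseteq> S0 K" "S0 K \<subseteq> W K"
      using GS[OF K] by auto
    have fin: "finite {a \<in> D. Kf a = K}" using D(1) by simp
    have "openin Y (G K)" unfolding G_def by (rule finite_Inter_open[OF fin g(1) fd(1)])
    moreover have "openin Y (\<Union>a\<in>{a \<in> D. Kf a = K}. Hf a)" using fd(2) by (intro openin_Union) auto
    then have "compactin Y (S' K)"
      unfolding S'_def by (intro compact_Int_closedin[OF g(2)] openin_closedin_eq[THEN iffD1, THEN conjunct2]) auto
    moreover have "S K \<subseteq> G K" unfolding G_def using fd(3) g(3) by blast
    moreover have "G K \<subseteq> S' K"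
    proof
      fix x assume x: "x \<in> G K"
      have "x \<in> S0 K" using x g(4) unfolding G_def by blast
      moreover have "x \<in> topspace Y" using x openin_subset[OF g(1)] unfolding G_def by blast
      moreover have "x \<notin> Hf a" if "a \<in> {a \<in> D. Kf a = K}" for a
        using x that fd(4)[OF that] unfolding G_def disjnt_iff by blast
      ultimately show "x \<in> S' K" unfolding S'_def by blast
    qed
    moreover have "S' K \<subseteq> W K" unfolding S'_def using g(5) by blast
    ultimately show "openin Y (G K) \<and> compactin Y (S' K) \<and> S K \<subseteq> G K \<and> G K \<subseteq> S' K \<and> S' K \<subseteq> W K" by blast
  next
    fix a assume a: "a \<in> topspace MS" "\<forall>K\<in>KK. \<forall>k\<in>K. ev a k \<in> S' K"
    show "a \<in> Q"
    proof (rule ccontr)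
      assume "a \<notin> Q"
      then have "a \<in> T" using a by (auto simp: T_def N0_def S'_def)
      then obtain d where d: "d \<in> D" "ev a (kf d) \<in> Hf d" using F(3) D(3) by auto
      then have "Kf d \<in> KK" "kf d \<in> Kf d" using D f by auto
      then have "ev a (kf d) \<in> S' (Kf d)" using a by blast
      then show False using d unfolding S'_def by auto
    qed
  qed
qed

text \<open>The exhaustion by compact sets makes the neighbourhoods shrink towards infinity. A map not
  over \<open>A\<close> which takes values in the part of \<open>Q\<close> added at some stage is excluded since
  \<open>Q\<close> lies over \<open>A\<close>; this is why only the sets of the previous stage matter.\<close>

lemma thicken:
  fixes MS :: "'m topology" and Y :: "'y topology" and ev :: "'m \<Rightarrow> 'k \<Rightarrow> 'y"
  assumes Y: "Hausdorff_space Y" "locally_compact_space Y" and KK: "finite KK" "K0 \<in> KK" "K0 \<noteq> {}"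
    and ev: "\<And>K k. K \<in> KK \<Longrightarrow> k \<in> K \<Longrightarrow> continuous_map MS Y (\<lambda>a. ev a k)"
    and prp: "\<And>L. compactin Y L \<Longrightarrow> compactin MS {a \<in> topspace MS. \<forall>K\<in>KK. \<forall>k\<in>K. ev a k \<in> L}"
    and im: "\<And>a K. a \<in> topspace MS \<Longrightarrow> K \<in> KK \<Longrightarrow> compactin Y (ev a ` K)"
    and oO: "openin MS O'" and A: "closedin Y A"
    and MA: "\<And>a K k. a \<in> topspace MS \<Longrightarrow> K \<in> KK \<Longrightarrow> k \<in> K \<Longrightarrow> ev a k \<in> A \<longleftrightarrow> a \<in> MA"
    and L: "\<And>j. compactin Y (L (j :: nat))" "topspace Y = (\<Union>j. L j)"
    and Q: "\<And>K. K \<in> KK \<Longrightarrow> closedin Y (Q K) \<and> Q K \<subseteq> A \<inter> U K"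
    and U: "\<And>K. K \<in> KK \<Longrightarrow> openin Y (U K)"
    and UO: "\<And>a. a \<in> topspace MS \<Longrightarrow> a \<in> MA \<Longrightarrow> (\<forall>K\<in>KK. \<forall>k\<in>K. ev a k \<in> U K) \<Longrightarrow> a \<in> O'"
  obtains U' where "\<And>K. K \<in> KK \<Longrightarrow> openin Y (U' K) \<and> Q K \<subseteq> U' K"
    "\<And>a. a \<in> topspace MS \<Longrightarrow> (\<forall>K\<in>KK. \<forall>k\<in>K. ev a k \<in> U' K) \<Longrightarrow> a \<in> O'"
proof -
  \<comment> \<open>\<open>?W K\<close> forbids only the points of \<open>A\<close> outside
    \<open>U K\<close>. A map over \<open>A\<close> with values in \<open>?W K\<close> has them in
    \<open>U K\<close>, so \<open>UO\<close> applies to it.\<close>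
  let ?W = "\<lambda>K. U K \<union> (topspace Y - A)"
  have W: "openin Y (?W K)" if "K \<in> KK" for K using U[OF that] A by blast
  define P where "P S \<longleftrightarrow> (\<forall>K\<in>KK. compactin Y (S K) \<and> S K \<subseteq> ?W K) \<and>
    (\<forall>a\<in>topspace MS. (\<forall>K\<in>KK. \<forall>k\<in>K. ev a k \<in> S K) \<longrightarrow> a \<in> O')" for S
  \<comment> \<open>The open sets \<open>G\<close> between consecutive stages are what is kept in
    the end, since their union over \<open>j\<close> is open; the compact sets serve the induction.
    Stage \<open>j\<close> absorbs the part of \<open>Q K\<close> inside \<open>L j\<close>.\<close>
  define R where "R j S S' \<longleftrightarrow> (\<exists>G. \<forall>K\<in>KK. openin Y (G K) \<and> S K \<union> (Q K \<inter> L j) \<subseteq> G K \<and> G K \<subseteq> S' K)" for j S S'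
  \<comment> \<open>Empty sets can start the induction because no map takes values in them:
    \<open>K0\<close> is nonempty.\<close>
  have P0: "P (\<lambda>_. {})" unfolding P_def using KK by auto
  have step: "\<exists>S'. P S' \<and> R j S S'" if S: "P S" for S j
  proof -
    let ?S = "\<lambda>K. S K \<union> (Q K \<inter> L j)"
    have 1: "compactin Y (?S K)" "?S K \<subseteq> ?W K" if "K \<in> KK" for K
    proof -
      have "compactin Y (Q K \<inter> L j)" using Q[OF that] L(1) by (intro closed_Int_compactin) auto
      then show "compactin Y (?S K)" using S that unfolding P_def by (intro compactin_Un) auto
      show "?S K \<subseteq> ?W K" using S that Q[OF that] unfolding P_def by blast
    qed
    have 2: "a \<in> O'" if a: "a \<in> topspace MS" "\<forall>K\<in>KK. \<forall>k\<in>K. ev a k \<in> ?S K" for a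
    proof (cases "a \<in> MA")
      case True
      have "ev a k \<in> U K" if k: "K \<in> KK" "k \<in> K" for K k
      proof -
        have "ev a k \<in> ?W K" using a(2) k 1(2)[OF k(1)] by blast
        then show ?thesis using MA[OF a(1) k] True by blast
      qed
      then show ?thesis using UO[OF a(1) True] by blast
    next
      case False
      have "ev a k \<in> S K" if k: "K \<in> KK" "k \<in> K" for K k
        using a(2) k MA[OF a(1) k] False Q[OF k(1)] by blast
      then show ?thesis using S a(1) unfolding P_def by blast
    qed
    show ?thesis
    proof (rule thicken_step[of Y KK MS ev O' ?S ?W])
      fix G S' assume GS: "\<And>K. K \<in> KK \<Longrightarrow> openin Y (G K) \<and> compactin Y (S' K) \<and> ?S K \<subseteq> G K \<and> G K \<subseteq> S' K \<and> S' K \<subseteq> ?W K"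
        "\<And>a. a \<in> topspace MS \<Longrightarrow> (\<forall>K\<in>KK. \<forall>k\<in>K. ev a k \<in> S' K) \<Longrightarrow> a \<in> O'"
      have "P S'" unfolding P_def using GS by blast
      moreover have "R j S S'" unfolding R_def using GS(1) by blast
      ultimately show ?thesis by blast
    qed (fact Y KK(1) ev prp oO 1 W 2)+
  qed
  obtain f where f: "\<And>j. P (f j)" "\<And>j. R j (f j) (f (Suc j))"
    using dependent_nat_choice[of "\<lambda>_. P" R] P0 step by blast
  obtain G where G: "\<And>j K. K \<in> KK \<Longrightarrow> openin Y (G j K) \<and> f j K \<union> (Q K \<inter> L j) \<subseteq> G j K \<and> G j K \<subseteq> f (Suc j) K"
    using f(2) unfolding R_def by metis
  show thesis
  proof
    fix K assume K: "K \<in> KK"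
    have "openin Y (\<Union>j. G j K)" using G[OF K] by blast
    moreover have "Q K \<subseteq> (\<Union>j. G j K)"
    proof
      fix x assume x: "x \<in> Q K"
      then have "x \<in> topspace Y" using Q[OF K] closedin_subset by blast
      then obtain j where "x \<in> L j" using L(2) by blast
      then show "x \<in> (\<Union>j. G j K)" using G[OF K, of j] x by blast
    qed
    ultimately show "openin Y (\<Union>j. G j K) \<and> Q K \<subseteq> (\<Union>j. G j K)" by blast
  next
    fix a assume a: "a \<in> topspace MS" "\<forall>K\<in>KK. \<forall>k\<in>K. ev a k \<in> (\<Union>j. G j K)"
    have mono: "f i K \<subseteq> f j K" if "i \<le> j" "K \<in> KK" for i j K
      using that(1) by (rule lift_Suc_mono_le[rotated]) (use G[OF that(2)] in blast)
    \<comment> \<open>The image of \<open>K\<close> under \<open>a\<close> is compact and covered by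
      the open sets of all stages, so it lies in one stage of the increasing sequence; as
      \<open>KK\<close> is finite, one stage serves all \<open>K\<close>.\<close>
    have "\<exists>j. ev a ` K \<subseteq> f j K" if K: "K \<in> KK" for K
    proof -
      have "openin Y V" if "V \<in> range (\<lambda>j. G j K)" for V using that G[OF K] by blast
      moreover have "ev a ` K \<subseteq> \<Union>(range (\<lambda>j. G j K))" using a(2) K by blast
      ultimately obtain \<F> where F: "finite \<F>" "\<F> \<subseteq> range (\<lambda>j. G j K)" "ev a ` K \<subseteq> \<Union>\<F>"
        using compactinD[OF im[OF a(1) K], of "range (\<lambda>j. G j K)"] by metis
      obtain J where J: "finite J" "\<F> = (\<lambda>j. G j K) ` J" using finite_subset_image[OF F(1,2)] by blast
      have "G j K \<subseteq> f (Suc (Max (insert 0 J))) K" if "j \<in> J" for j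
      proof -
        have "G j K \<subseteq> f (Suc j) K" using G[OF K] by blast
        also have "\<dots> \<subseteq> f (Suc (Max (insert 0 J))) K" using J that K by (intro mono) auto
        finally show ?thesis .
      qed
      then show ?thesis using F(3) J(2) by blast
    qed
    then obtain jf where jf: "\<And>K. K \<in> KK \<Longrightarrow> ev a ` K \<subseteq> f (jf K) K" by metis
    let ?m = "Max (jf ` KK)"
    have "ev a k \<in> f ?m K" if "K \<in> KK" "k \<in> K" for K k
      using jf[OF that(1)] mono[of "jf K" ?m K] KK(1) that by fastforce
    then show "a \<in> O'" using f(1)[of ?m] a(1) unfolding P_def by blast
  qed
qed

text \<open>The bound on \<open>D\<close> is secured before the global extension: \<open>u\<close>
  is first extended from \<open>P \<inter> D\<close> to \<open>D\<close> with values at most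
  \<open>c\<close>, and the function so obtained on the closed set \<open>P \<union> D\<close> is
  extended to \<open>Y\<close>.\<close>

lemma Tietze_bounded:
  fixes u :: "'a \<Rightarrow> real"
  assumes Y: "normal_space Y" and P: "closedin Y P" and D: "closedin Y D"
    and u: "continuous_map (subtopology Y P) euclideanreal u"
    and c: "\<And>x. x \<in> P \<Longrightarrow> x \<in> D \<Longrightarrow> u x \<le> c"
  obtains w where "continuous_map Y euclideanreal w" "\<And>x. x \<in> P \<Longrightarrow> w x = u x" "\<And>x. x \<in> D \<Longrightarrow> w x \<le> c"
proof -
  have nD: "normal_space (subtopology Y D)" using normal_space_closed_subtopology[OF Y D] .
  have cPD: "closedin (subtopology Y D) (P \<inter> D)" using P by (metis closedin_subtopology)
  have TD: "topspace (subtopology Y D) = D" using closedin_subset[OF D] by auto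
  have uPD: "continuous_map (subtopology (subtopology Y D) (P \<inter> D)) euclideanreal u"
    using continuous_map_from_subtopology_mono[OF u, of "D \<inter> (P \<inter> D)"] by (auto simp: subtopology_subtopology)
  obtain v where v: "continuous_map (subtopology Y D) euclideanreal v" "v ` topspace (subtopology Y D) \<subseteq> {..c}"
    "\<And>x. x \<in> P \<inter> D \<Longrightarrow> v x = u x"
    using Tietze_extension_realinterval[OF nD cPD, of "{..c}" u] uPD c by (auto simp: is_interval_ic)
  define e where "e x = (if x \<in> P then u x else v x)" for x
  have ce: "continuous_map (subtopology Y (P \<union> D)) euclideanreal e"
  proof (rule pasting_lemma_closed[where I = "{True, False}" and T = "\<lambda>b. if b then P else D" and f = "\<lambda>b. if b then u else v"])
    fix i :: bool
    show "closedin (subtopology Y (P \<union> D)) (if i then P else D)"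
      using P D by (auto intro: closedin_subset_topspace)
    show "continuous_map (subtopology (subtopology Y (P \<union> D)) (if i then P else D)) euclideanreal (if i then u else v)"
      using u v(1) by (auto simp: subtopology_subtopology Int_absorb1)
  next
    fix x assume "x \<in> topspace (subtopology Y (P \<union> D))"
    then show "\<exists>j. j \<in> {True, False} \<and> x \<in> (if j then P else D) \<and> e x = (if j then u else v) x"
      by (cases "x \<in> P") (auto simp: e_def intro: exI[of _ True] exI[of _ False])
  qed (use v(3) in \<open>auto split: if_splits\<close>)
  have cPD': "closedin Y (P \<union> D)" using P D by blast
  obtain w where w: "continuous_map Y euclideanreal w" "\<And>x. x \<in> P \<union> D \<Longrightarrow> w x = e x"
    using Y[unfolded normal_space_iff_Tietze, rule_format, OF conjI[OF cPD' ce]] by metis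
  show thesis
  proof
    show "continuous_map Y euclideanreal w" by (rule w(1))
    show "w x = u x" if "x \<in> P" for x using w(2)[of x] that by (simp add: e_def)
    show "w x \<le> c" if "x \<in> D" for x using w(2)[of x] that c[of x] v(2) TD by (auto simp: e_def)
  qed
qed

text \<open>Local compactness gives a cover by open sets that lie in compact sets, and countably
  many of them suffice.\<close>

lemma locally_compact_Lindelof_exhaustion:
  assumes "locally_compact_space X" "Lindelof_space X"
  shows "\<exists>\<K>. countable \<K> \<and> (\<forall>K\<in>\<K>. compactin X K) \<and> \<Union>\<K> = topspace X"
proof -
  obtain U K where UK: "\<And>x. x \<in> topspace X \<Longrightarrow> openin X (U x) \<and> compactin X (K x) \<and> x \<in> U x \<and> U x \<subseteq> K x"
    using assms(1) unfolding locally_compact_space_def by metis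
  have "\<forall>V\<in>U ` topspace X. openin X V" "topspace X \<subseteq> \<Union>(U ` topspace X)" using UK by blast+
  then have "\<exists>\<V>. countable \<V> \<and> \<V> \<subseteq> U ` topspace X \<and> topspace X \<subseteq> \<Union>\<V>"
    using assms(2)[unfolded Lindelof_space_alt, rule_format, of "U ` topspace X"] by blast
  then obtain \<V> where V: "countable \<V>" "\<V> \<subseteq> U ` topspace X" "topspace X \<subseteq> \<Union>\<V>" by blast
  obtain T where T: "countable T" "T \<subseteq> topspace X" "\<V> = U ` T"
    using countable_subset_image[of \<V> U "topspace X"] V by metis
  show ?thesis
  proof (intro exI conjI)
    show "countable (K ` T)" using T by blast
    show "\<forall>L\<in>K ` T. compactin X L" using T UK by auto
    show "\<Union>(K ` T) = topspace X"
    proof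
      show "\<Union>(K ` T) \<subseteq> topspace X" using T UK compactin_subset_topspace by blast
      show "topspace X \<subseteq> \<Union>(K ` T)" using V(3) T UK by blast
    qed
  qed
qed

text \<open>Globalises statements that hold over trivialising open sets: a compact subset of a
  Hausdorff space is a finite union of compact sets, each inside one of the given open sets.\<close>

lemma compact_local_induct:
  assumes X: "Hausdorff_space X" and B: "compactin X B"
    and loc: "\<And>b. b \<in> B \<Longrightarrow> \<exists>N. openin X N \<and> b \<in> N \<and> (\<forall>D. compactin X D \<longrightarrow> D \<subseteq> N \<inter> B \<longrightarrow> P D)"
    and P: "P {}" "\<And>D D'. P D \<Longrightarrow> P D' \<Longrightarrow> P (D \<union> D')"
  shows "P B"
proof -
  have Bs: "B \<subseteq> topspace X" using B compactin_subset_topspace by blast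
  let ?X = "subtopology X B"
  have H: "Hausdorff_space ?X" using X by (rule Hausdorff_space_subtopology)
  have lc: "locally_compact_space ?X" using B by (simp add: compactin_subspace compact_imp_locally_compact_space)
  have "\<exists>G D. openin ?X G \<and> b \<in> G \<and> G \<subseteq> D \<and> D \<subseteq> B \<and> P D" if b: "b \<in> B" for b
  proof -
    obtain N where N: "openin X N" "b \<in> N" "\<And>D. compactin X D \<Longrightarrow> D \<subseteq> N \<inter> B \<Longrightarrow> P D"
      using loc[OF b] by metis
    have o: "openin ?X (N \<inter> B)" using N(1) by (rule openin_subtopology_Int)
    obtain V K where VK: "openin ?X V" "compactin ?X K" "b \<in> V" "V \<subseteq> K" "K \<subseteq> N \<inter> B"
      using locally_compact_nbhd[OF lc H o, of b] N(2) b by auto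
    have "compactin X K" using VK(2) by (simp add: compactin_subtopology)
    then have "P K" using N(3) VK(5) by blast
    then show ?thesis using VK by blast
  qed
  then obtain G D where GD: "\<And>b. b \<in> B \<Longrightarrow> openin ?X (G b) \<and> b \<in> G b \<and> G b \<subseteq> D b \<and> D b \<subseteq> B \<and> P (D b)"
    by metis
  have "compactin ?X B" using B by (simp add: compactin_subtopology)
  moreover have "openin ?X U" if "U \<in> G ` B" for U using that GD by auto
  moreover have "B \<subseteq> \<Union>(G ` B)" using GD by blast
  ultimately have "\<exists>\<F>. finite \<F> \<and> \<F> \<subseteq> G ` B \<and> B \<subseteq> \<Union>\<F>" by (rule compactinD)
  then obtain \<F> where F: "finite \<F>" "\<F> \<subseteq> G ` B" "B \<subseteq> \<Union>\<F>" by (elim exE conjE)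
  from finite_subset_image[OF F(1,2)] obtain I where I: "finite I" "I \<subseteq> B" "\<F> = G ` I"
    by (elim exE conjE)
  have "P (\<Union>i\<in>J. D i)" if "finite J" "J \<subseteq> B" for J
    using that by (induction J rule: finite_induct) (use P GD in auto)
  then have "P (\<Union>i\<in>I. D i)" using I by blast
  moreover have "(\<Union>i\<in>I. D i) = B"
  proof
    show "(\<Union>i\<in>I. D i) \<subseteq> B" using I(2) GD by blast
    show "B \<subseteq> (\<Union>i\<in>I. D i)"
    proof
      fix x assume "x \<in> B"
      then obtain i where "i \<in> I" "x \<in> G i" using F(3) I(3) by auto
      then show "x \<in> (\<Union>i\<in>I. D i)" using GD[of i] I(2) by blast
    qed
  qed
  ultimately show ?thesis by simp
qed

context str_cat
begin

subsection \<open>Bundles over compact bases\<close>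

lemma over_open: "family C Y \<Longrightarrow> openin (base Y) N \<Longrightarrow> openin (tot Y) (over Y N)"
  by (rule openin_continuous_map_preimage[OF prj_continuous])

lemma over_closed: "family C Y \<Longrightarrow> closedin (base Y) N \<Longrightarrow> closedin (tot Y) (over Y N)"
  by (rule closedin_continuous_map_preimage[OF prj_continuous])

lemma loc_trivD:
  assumes l: "loc_triv Y N W t s"
  shows "openin (base Y) N" "W \<in> Obj C"
    "continuous_map (prod_topology (subtopology (base Y) N) (Fob C W)) (tot Y) (\<lambda>(b, w). t b w)"
    "continuous_map (tot_on Y N) (Fob C W) s"
    "\<And>b w. b \<in> N \<Longrightarrow> w \<in> pts W \<Longrightarrow> t b w \<in> fibre Y b"
    "\<And>b w. b \<in> N \<Longrightarrow> w \<in> pts W \<Longrightarrow> s (t b w) = w"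
    "\<And>x. x \<in> tpts Y \<Longrightarrow> prj Y x \<in> N \<Longrightarrow> t (prj Y x) (s x) = x"
    "\<And>x. x \<in> tpts Y \<Longrightarrow> prj Y x \<in> N \<Longrightarrow> s x \<in> pts W"
    "\<And>b. b \<in> N \<Longrightarrow> \<exists>\<phi>\<in>Hom C W (fob Y b). invertible_arrow C \<phi> \<and>
        (\<forall>w\<in>pts W. chart Y b (t b w) = Far C \<phi> w)" "topspace (subtopology (base Y) N) = N"
proof -
  note l' = l[unfolded loc_triv_def]
  show "openin (base Y) N" "W \<in> Obj C"
    "continuous_map (prod_topology (subtopology (base Y) N) (Fob C W)) (tot Y) (\<lambda>(b, w). t b w)"
    and s: "continuous_map (tot_on Y N) (Fob C W) s" using l' by simp_all
  then show "topspace (subtopology (base Y) N) = N" using openin_subset[of "base Y" N] by auto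
  show "\<And>b w. b \<in> N \<Longrightarrow> w \<in> pts W \<Longrightarrow> t b w \<in> fibre Y b" "\<And>b w. b \<in> N \<Longrightarrow> w \<in> pts W \<Longrightarrow> s (t b w) = w"
    "\<And>x. x \<in> tpts Y \<Longrightarrow> prj Y x \<in> N \<Longrightarrow> t (prj Y x) (s x) = x"
    "\<And>b. b \<in> N \<Longrightarrow> \<exists>\<phi>\<in>Hom C W (fob Y b). invertible_arrow C \<phi> \<and>
        (\<forall>w\<in>pts W. chart Y b (t b w) = Far C \<phi> w)" using l' by simp_all
  show "s x \<in> pts W" if "x \<in> tpts Y" "prj Y x \<in> N" for x using continuous_map_funspace[OF s] that by auto
qed

text \<open>Counterpart of \<open>marr\<close> for a trivialisation: the morphism is read in the
  coordinate \<open>s\<close> rather than in the chart over the base point, so that it varies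
  continuously with the member (\<open>tarr_continuous\<close>).\<close>

definition tarr :: "'o \<Rightarrow> 'o \<Rightarrow> ('y \<Rightarrow> 'v) \<Rightarrow> ('v \<Rightarrow> 'y) \<times> 'b \<Rightarrow> 'h" where
  "tarr V W s a = (SOME \<phi>. \<phi> \<in> Hom C V W \<and> (\<forall>v\<in>pts V. Far C \<phi> v = s (fst a v)))"

definition tpt :: "'o \<Rightarrow> ('b \<Rightarrow> 'v \<Rightarrow> 'y) \<Rightarrow> 'b \<Rightarrow> 'h \<Rightarrow> ('v \<Rightarrow> 'y) \<times> 'b" where
  "tpt V t b \<phi> = (restrict (\<lambda>v. t b (Far C \<phi> v)) (pts V), b)"

context
  fixes Y :: "('o, 'v, 'y, 'b) family" and N W t s
  assumes Y: "family C Y" and l: "loc_triv Y N W t s"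
begin

lemma loc_triv_base: "b \<in> N \<Longrightarrow> b \<in> bpts Y" using openin_subset[OF loc_trivD(1)[OF l]] by auto

lemma tarr:
  assumes a: "a \<in> Ma V Y" and b: "snd a \<in> N"
  shows "tarr V W s a \<in> Hom C V W" "\<And>v. v \<in> pts V \<Longrightarrow> Far C (tarr V W s a) v = s (fst a v)"
    "\<And>v. v \<in> pts V \<Longrightarrow> fst a v = t (snd a) (Far C (tarr V W s a) v)"
    "tpt V t (snd a) (tarr V W s a) = a"
proof -
  obtain \<phi> where \<phi>: "\<phi> \<in> Hom C W (fob Y (snd a))" "invertible_arrow C \<phi>"
    "\<And>w. w \<in> pts W \<Longrightarrow> chart Y (snd a) (t (snd a) w) = Far C \<phi> w"
    using loc_trivD(9)[OF l b] by auto
  obtain \<psi> where \<psi>: "\<psi> \<in> Hom C (fob Y (snd a)) W" "\<And>v. v \<in> pts W \<Longrightarrow> Far C \<psi> (Far C \<phi> v) = v"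
    using invertible_arrowE[OF \<phi>(2,1)] by metis
  have x: "fst a v \<in> tpts Y" "prj Y (fst a v) = snd a" if "v \<in> pts V" for v
    using mapspace_fibre[OF Y a that] by (auto simp: fibre_def)
  have sv: "s (fst a v) \<in> pts W" "t (snd a) (s (fst a v)) = fst a v" if "v \<in> pts V" for v
    using loc_trivD(7,8)[OF l x(1)[OF that]] x(2)[OF that] b by auto
  have "Far C (Comp C \<psi> (marr V Y a)) v = s (fst a v)" if v: "v \<in> pts V" for v
    using Far_Comp[OF marr(1)[OF Y a] \<psi>(1) v] marr(2)[OF Y a v] sv[OF v] \<phi>(3)[OF sv(1)[OF v]]
      \<psi>(2)[OF sv(1)[OF v]] by simp
  then have ex: "\<exists>\<phi>. \<phi> \<in> Hom C V W \<and> (\<forall>v\<in>pts V. Far C \<phi> v = s (fst a v))"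
    using Comp_Hom[OF marr(1)[OF Y a] \<psi>(1)] by auto
  show 1: "tarr V W s a \<in> Hom C V W" and 2: "\<And>v. v \<in> pts V \<Longrightarrow> Far C (tarr V W s a) v = s (fst a v)"
    unfolding tarr_def using someI_ex[OF ex] by auto
  show 3: "\<And>v. v \<in> pts V \<Longrightarrow> fst a v = t (snd a) (Far C (tarr V W s a) v)" using 2 sv by simp
  have "fst a \<in> extensional (pts V)" using a by (simp add: mapspace_mem[OF Y])
  then have "restrict (\<lambda>v. t (snd a) (Far C (tarr V W s a) v)) (pts V) = fst a"
    using 3 by (auto simp: restrict_def extensional_def)
  then show "tpt V t (snd a) (tarr V W s a) = a" by (simp add: tpt_def prod_eq_iff)
qed

lemma tpt:
  assumes b: "b \<in> N" and \<phi>: "\<phi> \<in> Hom C V W"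
  shows "tpt V t b \<phi> \<in> Ma V Y" "tarr V W s (tpt V t b \<phi>) = \<phi>"
    "\<And>\<rho>. \<rho> \<in> Hom C W (fob Y b) \<Longrightarrow> (\<And>w. w \<in> pts W \<Longrightarrow> chart Y b (t b w) = Far C \<rho> w) \<Longrightarrow>
      marr V Y (tpt V t b \<phi>) = Comp C \<rho> \<phi>" "snd (tpt V t b \<phi>) = b"
proof -
  obtain \<rho> where \<rho>: "\<rho> \<in> Hom C W (fob Y b)"
    "\<And>w. w \<in> pts W \<Longrightarrow> chart Y b (t b w) = Far C \<rho> w" using loc_trivD(9)[OF l b] by auto
  have m: "tpt V t b \<phi> \<in> Ma V Y"
    unfolding tpt_def
  proof (rule mapspace_memI[OF Y loc_triv_base[OF b] Comp_Hom[OF \<phi> \<rho>(1)]])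
    fix v assume v: "v \<in> pts V"
    show "restrict (\<lambda>v. t b (Far C \<phi> v)) (pts V) v \<in> fibre Y b \<and>
        chart Y b (restrict (\<lambda>v. t b (Far C \<phi> v)) (pts V) v) = Far C (Comp C \<rho> \<phi>) v"
      using v loc_trivD(5)[OF l b Far_pts[OF \<phi> v]] \<rho>(2)[OF Far_pts[OF \<phi> v]] Far_Comp[OF \<phi> \<rho>(1) v] by simp
  qed simp
  then show "tpt V t b \<phi> \<in> Ma V Y" .
  show s: "snd (tpt V t b \<phi>) = b" by (simp add: tpt_def)
  show "marr V Y (tpt V t b \<phi>) = Comp C \<rho> \<phi>" if \<rho>: "\<rho> \<in> Hom C W (fob Y b)"
    "\<And>w. w \<in> pts W \<Longrightarrow> chart Y b (t b w) = Far C \<rho> w" for \<rho>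
  proof (rule marr(3)[OF Y m])
    show "Comp C \<rho> \<phi> \<in> Hom C V (fob Y (snd (tpt V t b \<phi>)))" using Comp_Hom[OF \<phi> \<rho>(1)] s by simp
    show "chart Y (snd (tpt V t b \<phi>)) (fst (tpt V t b \<phi>) v) = Far C (Comp C \<rho> \<phi>) v" if v: "v \<in> pts V" for v
      using v \<rho>(2)[OF Far_pts[OF \<phi> v]] Far_Comp[OF \<phi> \<rho>(1) v] by (simp add: tpt_def)
  qed
  show "tarr V W s (tpt V t b \<phi>) = \<phi>"
  proof (rule Far_inject[OF _ \<phi>])
    have bs: "snd (tpt V t b \<phi>) \<in> N" using b s by simp
    show "tarr V W s (tpt V t b \<phi>) \<in> Hom C V W" using tarr(1)[OF m bs] .
    show "Far C (tarr V W s (tpt V t b \<phi>)) v = Far C \<phi> v" if v: "v \<in> pts V" for v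
      using tarr(2)[OF m bs v] loc_trivD(6)[OF l b Far_pts[OF \<phi> v]] v by (simp add: tpt_def)
  qed
qed

text \<open>Obtained by currying the evaluation of morphisms. Together with
  \<open>tarr_continuous\<close> it identifies the function space over \<open>N\<close> with the
  product of \<open>N\<close> and the space of morphisms from \<open>V\<close> to
  \<open>W\<close>.\<close>

lemma tpt_continuous:
  assumes V: "V \<in> Obj C"
  shows "continuous_map (prod_topology (subtopology (base Y) N) (Hom_top C V W)) (mapspace C V Y)
    (\<lambda>(b, \<phi>). tpt V t b \<phi>)"
proof -
  let ?T = "prod_topology (subtopology (base Y) N) (Hom_top C V W)"
  have 1: "continuous_map (prod_topology ?T (Fob C V)) (Fob C W) (\<lambda>(p, v). Far C (snd p) v)"
    using continuous_map_compose[OF continuous_map_prodI[OF continuous_map_snd continuous_map_id] Hom_ev[OF V]]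
    by (simp add: o_def case_prod_unfold)
  have 2: "continuous_map (prod_topology ?T (Fob C V)) (subtopology (base Y) N) (\<lambda>(p, v). fst p)"
    using continuous_map_compose[OF continuous_map_fst continuous_map_fst] by (simp add: o_def case_prod_unfold)
  have "continuous_map (prod_topology ?T (Fob C V)) (prod_topology (subtopology (base Y) N) (Fob C W))
      (\<lambda>(p, v). (fst p, Far C (snd p) v))"
    using 1 2 by (simp add: continuous_map_pairwise o_def case_prod_unfold)
  from continuous_map_compose[OF this loc_trivD(3)[OF l]]
  have g: "continuous_map (prod_topology ?T (Fob C V)) (tot Y) (\<lambda>(p, v). t (fst p) (Far C (snd p) v))"
    by (simp add: o_def case_prod_unfold)
  have "continuous_map ?T (mapspace C V Y) (\<lambda>p. (restrict (\<lambda>v. t (fst p) (Far C (snd p) v)) (pts V), fst p))"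
  proof (rule mapspace_curry[OF g])
    show "continuous_map ?T (base Y) fst"
      using continuous_map_fst[of "subtopology (base Y) N" "Hom_top C V W"]
      by (simp add: continuous_map_in_subtopology)
    show "(restrict (\<lambda>v. t (fst p) (Far C (snd p) v)) (pts V), fst p) \<in> Ma V Y"
      if "p \<in> topspace ?T" for p using tpt(1)[of "fst p" "snd p" V] that by (auto simp: tpt_def)
  qed
  then show ?thesis by (simp add: tpt_def case_prod_unfold)
qed

lemma tarr_continuous:
  assumes V: "V \<in> Obj C"
  shows "continuous_map (subtopology (mapspace C V Y) {a \<in> Ma V Y. snd a \<in> N}) (Hom_top C V W) (tarr V W s)"
proof (rule Hom_curry)
  let ?T = "subtopology (mapspace C V Y) {a \<in> Ma V Y. snd a \<in> N}"
  have "continuous_map (prod_topology ?T (Fob C V)) (tot Y) (\<lambda>(a, v). fst a v)"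
    using continuous_map_from_subtopology[OF mapspace_ev[OF V, of Y],
        of "{a \<in> Ma V Y. snd a \<in> N} \<times> pts V"] by (simp add: prod_topology_subtopology)
  then have "continuous_map (prod_topology ?T (Fob C V)) (tot_on Y N) (\<lambda>(a, v). fst a v)"
    using mapspace_fibre[OF Y] by (auto simp: continuous_map_in_subtopology fibre_def)
  from continuous_map_compose[OF this loc_trivD(4)[OF l]]
  have "continuous_map (prod_topology ?T (Fob C V)) (Fob C W) (\<lambda>(a, v). s (fst a v))"
    by (simp add: o_def case_prod_unfold)
  then show "continuous_map (prod_topology ?T (Fob C V)) (Fob C W) (\<lambda>(a, v). Far C (tarr V W s a) v)"
    by (rule continuous_map_eq) (auto simp: tarr(2))
qed (auto simp: tarr(1))

end

text \<open>Points over different base points are separated in the base, points of one fibre by the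
  coordinate of a trivialisation.\<close>

lemma bundle_Hausdorff:
  assumes M: "fibre_bundle C M" and H: "Hausdorff_space (base M)"
  shows "Hausdorff_space (tot M)"
  unfolding Hausdorff_space_def
proof (intro allI impI)
  note fM = fibre_bundleD[OF M]
  fix x y assume xy: "x \<in> tpts M \<and> y \<in> tpts M \<and> x \<noteq> y"
  then have b: "prj M x \<in> bpts M" "prj M y \<in> bpts M" using prj_base[OF fM] by auto
  show "\<exists>U V. openin (tot M) U \<and> openin (tot M) V \<and> x \<in> U \<and> y \<in> V \<and> disjnt U V"
  proof (cases "prj M x = prj M y")
    case False
    then obtain U V where UV: "openin (base M) U" "openin (base M) V" "prj M x \<in> U" "prj M y \<in> V" "disjnt U V"
      using H b unfolding Hausdorff_space_def by blast
    have "disjnt (over M U) (over M V)" using UV(5) by (auto simp: disjnt_iff)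
    then show ?thesis
      using over_open[OF fM UV(1)] over_open[OF fM UV(2)] UV(3,4) xy
      by (intro exI[of _ "over M U"] exI[of _ "over M V"]) auto
  next
    case True
    obtain N W t s where N: "prj M x \<in> N" and l: "loc_triv M N W t s" using bundle_loc_triv[OF M b(1)] .
    have ne: "s x \<noteq> s y"
    proof
      assume "s x = s y"
      then have "t (prj M x) (s x) = t (prj M y) (s y)" using True by simp
      then show False using loc_trivD(7)[OF l, of x] loc_trivD(7)[OF l, of y] N True xy by simp
    qed
    have "s x \<in> pts W" "s y \<in> pts W" using loc_trivD(8)[OF l, of x] loc_trivD(8)[OF l, of y] N True xy by auto
    then obtain U V where UV: "openin (Fob C W) U" "openin (Fob C W) V" "s x \<in> U" "s y \<in> V" "disjnt U V"
      using Fob_space(3)[OF loc_trivD(2)[OF l]] ne unfolding Hausdorff_space_def by blast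
    let ?p = "\<lambda>U. {z \<in> topspace (tot_on M N). s z \<in> U}"
    have o: "openin (tot M) (?p U)" if "openin (Fob C W) U" for U
      using openin_continuous_map_preimage[OF loc_trivD(4)[OF l] that] over_open[OF fM loc_trivD(1)[OF l]]
      by (rule openin_trans_full)
    have "disjnt (?p U) (?p V)" using UV(5) by (auto simp: disjnt_iff)
    moreover have "x \<in> ?p U" "y \<in> ?p V" using UV xy N True by auto
    ultimately show ?thesis using o[OF UV(1)] o[OF UV(2)] by blast
  qed
qed

lemma bundle_locally_compact:
  assumes M: "fibre_bundle C M" and H: "Hausdorff_space (base M)" and B: "compactin (base M) B"
  shows "locally_compact_space (tot_on M B)"
  unfolding locally_compact_space_def
proof
  note fM = fibre_bundleD[OF M]
  let ?X = "subtopology (base M) B"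
  have HX: "Hausdorff_space ?X" using H by (rule Hausdorff_space_subtopology)
  have lX: "locally_compact_space ?X" using B by (simp add: compactin_subspace compact_imp_locally_compact_space)
  fix x assume "x \<in> topspace (tot_on M B)"
  then have x: "x \<in> tpts M" "prj M x \<in> B" by auto
  obtain N W t s where N: "prj M x \<in> N" and l: "loc_triv M N W t s"
    using bundle_loc_triv[OF M prj_base[OF fM x(1)]] .
  have o: "openin ?X (N \<inter> B)" using loc_trivD(1)[OF l] by (rule openin_subtopology_Int)
  obtain V K where VK: "openin ?X V" "compactin ?X K" "prj M x \<in> V" "V \<subseteq> K" "K \<subseteq> N \<inter> B"
    using locally_compact_nbhd[OF lX HX o, of "prj M x"] N x by auto
  note FW = Fob_space[OF loc_trivD(2)[OF l]]
  have sx: "s x \<in> pts W" using loc_trivD(8)[OF l x(1) N] .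
  obtain U' K' where UK': "openin (Fob C W) U'" "compactin (Fob C W) K'" "s x \<in> U'" "U' \<subseteq> K'"
    using locally_compact_nbhd[OF FW(1,3) openin_topspace sx] by metis
  have cK: "compactin (subtopology (base M) N) K" using VK(2,5) by (simp add: compactin_subtopology)
  have "compactin (tot M) ((\<lambda>(b, w). t b w) ` (K \<times> K'))"
    by (rule image_compactin[OF _ loc_trivD(3)[OF l]]) (use cK UK'(2) in \<open>simp add: compactin_Times\<close>)
  moreover have "(\<lambda>(b, w). t b w) ` (K \<times> K') \<subseteq> over M B"
    using loc_trivD(5)[OF l] VK(5) compactin_subset_topspace[OF UK'(2)] by (fastforce simp: fibre_def)
  ultimately have c: "compactin (tot_on M B) ((\<lambda>(b, w). t b w) ` (K \<times> K'))"
    by (simp add: compactin_subtopology)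
  obtain V' where V': "openin (base M) V'" "V = V' \<inter> B" using VK(1) by (auto simp: openin_subtopology)
  let ?p = "{z \<in> topspace (tot_on M N). s z \<in> U'}"
  have "openin (tot M) ?p"
    using openin_continuous_map_preimage[OF loc_trivD(4)[OF l] UK'(1)] over_open[OF fM loc_trivD(1)[OF l]]
    by (rule openin_trans_full)
  then have "openin (tot_on M B) ((?p \<inter> over M V') \<inter> over M B)"
    using over_open[OF fM V'(1)] by (intro openin_subtopology_Int openin_Int)
  moreover have "x \<in> (?p \<inter> over M V') \<inter> over M B" using x N UK'(3) VK(3) V'(2) by auto
  moreover have "(?p \<inter> over M V') \<inter> over M B \<subseteq> (\<lambda>(b, w). t b w) ` (K \<times> K')"
  proof
    fix z assume z: "z \<in> (?p \<inter> over M V') \<inter> over M B"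
    then have "prj M z \<in> K" "s z \<in> K'" "t (prj M z) (s z) = z"
      using V'(2) VK(4) UK'(4) loc_trivD(7)[OF l, of z] by auto
    then show "z \<in> (\<lambda>(b, w). t b w) ` (K \<times> K')" by (intro image_eqI[of _ _ "(prj M z, s z)"]) auto
  qed
  ultimately show "\<exists>U K. openin (tot_on M B) U \<and>
      compactin (tot_on M B) K \<and> x \<in> U \<and> U \<subseteq> K" using c by blast
qed

text \<open>Second countability makes a fibre the union of countably many compact sets; over a
  compact part of a trivialising set the total space is covered by the images of the products with
  these.\<close>

lemma bundle_sigma_compact:
  assumes M: "fibre_bundle C M" and H: "Hausdorff_space (base M)" and B: "compactin (base M) B"
  shows "\<exists>\<K>. countable \<K> \<and> (\<forall>K\<in>\<K>. compactin (tot M) K) \<and> \<Union>\<K> = over M B"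
proof (rule compact_local_induct[OF H B])
  fix b assume b: "b \<in> B"
  then have "b \<in> bpts M" using compactin_subset_topspace[OF B] by auto
  then obtain N W t s where N: "b \<in> N" and l: "loc_triv M N W t s" using bundle_loc_triv[OF M] by metis
  have "\<exists>\<K>. countable \<K> \<and> (\<forall>K\<in>\<K>. compactin (tot M) K) \<and> \<Union>\<K> = over M D"
    if D: "compactin (base M) D" "D \<subseteq> N \<inter> B" for D
  proof -
    note FW = Fob_space[OF loc_trivD(2)[OF l]]
    obtain \<L> where L: "countable \<L>" "\<forall>K\<in>\<L>. compactin (Fob C W) K" "\<Union>\<L> = pts W"
      using locally_compact_Lindelof_exhaustion[OF FW(1) second_countable_imp_Lindelof_space[OF FW(2)]]
      by (elim exE conjE)
    let ?f = "\<lambda>K. (\<lambda>(b, w). t b w) ` (D \<times> K)"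
    have cD: "compactin (subtopology (base M) N) D" using D by (simp add: compactin_subtopology)
    have "compactin (tot M) (?f K)" if "K \<in> \<L>" for K
      by (rule image_compactin[OF _ loc_trivD(3)[OF l]]) (use cD L(2) that in \<open>simp add: compactin_Times\<close>)
    moreover have "\<Union>(?f ` \<L>) = over M D"
    proof
      show "\<Union>(?f ` \<L>) \<subseteq> over M D"
      proof clarify
        fix x K b w assume *: "K \<in> \<L>" "b \<in> D" "w \<in> K"
        then have "t b w \<in> fibre M b" using loc_trivD(5)[OF l, of b w] L(3) D(2) by auto
        then show "t b w \<in> tpts M \<and> prj M (t b w) \<in> D" using * by (auto simp: fibre_def)
      qed
      show "over M D \<subseteq> \<Union>(?f ` \<L>)"
      proof
        fix x assume x: "x \<in> over M D"
        then have "prj M x \<in> N" using D(2) by auto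
        then have sx: "s x \<in> pts W" "t (prj M x) (s x) = x" using loc_trivD(7,8)[OF l, of x] x by auto
        then obtain K where "K \<in> \<L>" "s x \<in> K" using L(3) by blast
        then show "x \<in> \<Union>(?f ` \<L>)" using x sx(2) by (intro UN_I[of K] image_eqI[of _ _ "(prj M x, s x)"]) auto
      qed
    qed
    ultimately show ?thesis using L(1) by (intro exI[of _ "?f ` \<L>"]) auto
  qed
  then show "\<exists>N. openin (base M) N \<and> b \<in> N \<and> (\<forall>D. compactin (base M) D \<longrightarrow> D \<subseteq> N \<inter> B \<longrightarrow>
      (\<exists>\<K>. countable \<K> \<and> (\<forall>K\<in>\<K>. compactin (tot M) K) \<and> \<Union>\<K> = over M D))"
    using loc_trivD(1)[OF l] N by blast
next
  show "\<exists>\<K>. countable \<K> \<and> (\<forall>K\<in>\<K>. compactin (tot M) K) \<and> \<Union>\<K> = over M {}"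
    by (intro exI[of _ "{}"]) auto
next
  fix D D' assume "\<exists>\<K>. countable \<K> \<and> (\<forall>K\<in>\<K>. compactin (tot M) K) \<and> \<Union>\<K> = over M D"
    "\<exists>\<K>. countable \<K> \<and> (\<forall>K\<in>\<K>. compactin (tot M) K) \<and> \<Union>\<K> = over M D'"
  then obtain \<K> \<K>' where "countable \<K>" "\<forall>K\<in>\<K>. compactin (tot M) K" "\<Union>\<K> = over M D"
    "countable \<K>'" "\<forall>K\<in>\<K>'. compactin (tot M) K" "\<Union>\<K>' = over M D'" by (elim exE conjE)
  then show "\<exists>\<K>. countable \<K> \<and> (\<forall>K\<in>\<K>. compactin (tot M) K) \<and> \<Union>\<K> = over M (D \<union> D')"
    by (intro exI[of _ "\<K> \<union> \<K>'"]) auto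
qed

text \<open>A countable union of compact sets is Lindelof, and a regular Lindelof space is normal:
  this makes the Tietze theorem available over a compact base. The exhaustion itself is what
  \<open>thicken\<close> asks for.\<close>

lemma bundle_exhaustion:
  assumes M: "fibre_bundle C M" and H: "Hausdorff_space (base M)" and B: "compactin (base M) B"
  shows "\<exists>L :: nat \<Rightarrow> _. (\<forall>j. compactin (tot_on M B) (L j)) \<and>
    topspace (tot_on M B) = (\<Union>j. L j)" "normal_space (tot_on M B)"
proof -
  let ?Y = "tot_on M B"
  obtain \<K> where K: "countable \<K>" "\<forall>K\<in>\<K>. compactin (tot M) K" "\<Union>\<K> = over M B"
    using bundle_sigma_compact[OF M H B] by (elim exE conjE)
  have cK: "compactin ?Y K" if "K \<in> insert {} \<K>" for K using that K by (auto simp: compactin_subtopology)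
  \<comment> \<open>The empty set is added so that the countable family is nonempty and can be
    enumerated by the natural numbers.\<close>
  define L where "L = from_nat_into (insert {} \<K>)"
  have r: "range L = insert {} \<K>" unfolding L_def using K(1) by (intro range_from_nat_into) auto
  have 1: "compactin ?Y (L j)" for j
  proof -
    have "L j \<in> range L" by simp
    then show ?thesis unfolding r by (rule cK)
  qed
  have T: "topspace ?Y = over M B" by auto
  have "(\<Union>j. L j) = \<Union>(insert {} \<K>)" by (simp only: r)
  then have 2: "topspace ?Y = (\<Union>j. L j)" using K(3) T by simp
  have "Lindelof_space (subtopology ?Y (\<Union>\<K>))"
  proof (rule Lindelof_space_Union[OF K(1)])
    show "Lindelof_space (subtopology ?Y U)" if "U \<in> \<K>" for U
      using cK[of U] that by (intro compact_imp_Lindelof_space compact_space_subtopology) auto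
  qed
  then have "Lindelof_space ?Y" using K(3) by (simp add: subtopology_subtopology)
  moreover have "regular_space ?Y"
    using locally_compact_Hausdorff_imp_regular_space[OF bundle_locally_compact[OF assms]]
      Hausdorff_space_subtopology[OF bundle_Hausdorff[OF M H]] by blast
  ultimately show "normal_space ?Y" by (rule regular_Lindelof_imp_normal_space[rotated])
  show "\<exists>L :: nat \<Rightarrow> _. (\<forall>j. compactin ?Y (L j)) \<and> topspace ?Y = (\<Union>j. L j)"
    using 1 2 by (intro exI[of _ L] conjI allI)
qed

abbreviation above :: "'v set set \<Rightarrow> ('v set \<Rightarrow> 'y \<Rightarrow> real) \<Rightarrow> ('v \<Rightarrow> 'y) \<times> 'b \<Rightarrow> real \<Rightarrow> bool" where
  "above KK u a c \<equiv> \<forall>K\<in>KK. \<forall>k\<in>K. u K (fst a k) > c"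

text \<open>The finite families that describe neighbourhoods, with the compactness condition of NKC.
  The nonempty member keeps the condition \<open>above\<close> from being vacuous.\<close>

definition proper_sets :: "'o \<Rightarrow> 'v set set \<Rightarrow> bool" where
  "proper_sets V KK \<longleftrightarrow> finite KK \<and> (\<exists>K\<in>KK. K \<noteq> {}) \<and>
     (\<forall>K\<in>KK. compactin (Fob C V) K \<and> (\<forall>W\<in>Obj C. \<forall>L. compactin (Fob C W) L \<longrightarrow>
        compactin (Hom_top C V W) {\<phi> \<in> Hom C V W. Far C \<phi> ` K \<subseteq> L}))"

lemma proper_sets_pts: "proper_sets V KK \<Longrightarrow> K \<in> KK \<Longrightarrow> k \<in> K \<Longrightarrow> k \<in> pts V"
  unfolding proper_sets_def using compactin_subset_topspace by blast

text \<open>Locally such a map is given by a base point and a morphism. Bounding its values on a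
  single set \<open>K0\<close> by a compact set confines the morphism to a compact set, by NKC; so
  the maps form a closed subset of a compact image. This is the properness that
  \<open>thicken\<close> uses.\<close>

lemma mapspace_proper:
  assumes M: "fibre_bundle C M" and H: "Hausdorff_space (base M)" and B: "compactin (base M) B"
    and V: "V \<in> Obj C" and KK: "proper_sets V KK" and L: "compactin (tot M) L"
  shows "compactin (mapspace C V M) {a \<in> Ma V M. snd a \<in> B \<and> (\<forall>K\<in>KK. \<forall>k\<in>K. fst a k \<in> L)}"
proof (rule compact_local_induct[OF H B])
  note fM = fibre_bundleD[OF M]
  let ?Z = "\<lambda>D. {a \<in> Ma V M. snd a \<in> D \<and> (\<forall>K\<in>KK. \<forall>k\<in>K. fst a k \<in> L)}"
  obtain K0 where K0: "K0 \<in> KK" using KK unfolding proper_sets_def by blast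
  fix b assume b: "b \<in> B"
  then have "b \<in> bpts M" using compactin_subset_topspace[OF B] by auto
  then obtain N W t s where N: "b \<in> N" and l: "loc_triv M N W t s" using bundle_loc_triv[OF M] by metis
  note W = loc_trivD(2)[OF l]
  have "compactin (mapspace C V M) (?Z D)" if D: "compactin (base M) D" "D \<subseteq> N \<inter> B" for D
  proof -
    have Dc: "closedin (base M) D" using H D(1) by (rule compactin_imp_closedin)
    have Lc: "closedin (tot M) L" using bundle_Hausdorff[OF M H] L by (rule compactin_imp_closedin)
    have "closedin (mapspace C V M) {a \<in> Ma V M. snd a \<in> D}"
      by (rule closedin_continuous_map_preimage[OF mapspace_snd_continuous Dc])
    moreover have "closedin (mapspace C V M) {a \<in> Ma V M. \<forall>K\<in>KK. \<forall>k\<in>K. fst a k \<in> L}"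
      by (rule closedin_values[OF mapspace_ev1[OF V proper_sets_pts[OF KK]] Lc])
    ultimately have "closedin (mapspace C V M) ({a \<in> Ma V M. snd a \<in> D} \<inter>
       {a \<in> Ma V M. \<forall>K\<in>KK. \<forall>k\<in>K. fst a k \<in> L})" by (rule closedin_Int)
    moreover have "{a \<in> Ma V M. snd a \<in> D} \<inter>
       {a \<in> Ma V M. \<forall>K\<in>KK. \<forall>k\<in>K. fst a k \<in> L} = ?Z D" by blast
    ultimately have Zc: "closedin (mapspace C V M) (?Z D)" by simp
    \<comment> \<open>The coordinates of the points of \<open>L\<close> over \<open>D\<close>: a
      compact set in the fibre that contains the values at \<open>K0\<close> of all morphisms in
      question.\<close>
    let ?L = "s ` (over M D \<inter> L)"
    have "compactin (tot M) (over M D \<inter> L)" by (rule closed_Int_compactin[OF over_closed[OF fM Dc] L])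
    then have "compactin (tot_on M N) (over M D \<inter> L)" using D(2) by (auto simp: compactin_subtopology)
    then have "compactin (Fob C W) ?L" using loc_trivD(4)[OF l] by (rule image_compactin)
    then have "compactin (Hom_top C V W) {\<phi> \<in> Hom C V W. Far C \<phi> ` K0 \<subseteq> ?L}"
      using KK K0 W unfolding proper_sets_def by blast
    moreover have "compactin (subtopology (base M) N) D" using D by (simp add: compactin_subtopology)
    ultimately have "compactin (prod_topology (subtopology (base M) N) (Hom_top C V W))
        (D \<times> {\<phi> \<in> Hom C V W. Far C \<phi> ` K0 \<subseteq> ?L})" by (simp add: compactin_Times)
    from image_compactin[OF this tpt_continuous[OF fM l V]]
    have P: "compactin (mapspace C V M) ((\<lambda>(b, \<phi>). tpt V t b \<phi>) ` (D \<times> {\<phi> \<in> Hom C V W. Far C \<phi> ` K0 \<subseteq> ?L}))" .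
    have "?Z D \<subseteq> (\<lambda>(b, \<phi>). tpt V t b \<phi>) ` (D \<times> {\<phi> \<in> Hom C V W. Far C \<phi> ` K0 \<subseteq> ?L})"
    proof
      fix a assume a: "a \<in> ?Z D"
      then have am: "a \<in> Ma V M" and aN: "snd a \<in> N" using D(2) by auto
      have "Far C (tarr V W s a) k \<in> ?L" if k: "k \<in> K0" for k
      proof -
        have kV: "k \<in> pts V" using proper_sets_pts[OF KK K0 k] .
        have "fst a k \<in> L" using a k K0 by blast
        moreover have "fst a k \<in> over M D" using mapspace_fibre[OF fM am kV] a by (auto simp: fibre_def)
        ultimately show ?thesis unfolding tarr(2)[OF fM l am aN kV] by blast
      qed
      then show "a \<in> (\<lambda>(b, \<phi>). tpt V t b \<phi>) ` (D \<times> {\<phi> \<in> Hom C V W. Far C \<phi> ` K0 \<subseteq> ?L})"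
        using tarr(1,4)[OF fM l am aN] a by (intro image_eqI[of _ _ "(snd a, tarr V W s a)"]) auto
    qed
    then have "?Z D = ?Z D \<inter> (\<lambda>(b, \<phi>). tpt V t b \<phi>) ` (D \<times> {\<phi> \<in> Hom C V W. Far C \<phi> ` K0 \<subseteq> ?L})" by blast
    then show ?thesis using closed_Int_compactin[OF Zc P] by simp
  qed
  then show "\<exists>N. openin (base M) N \<and> b \<in> N \<and> (\<forall>D. compactin (base M) D \<longrightarrow> D \<subseteq> N \<inter> B \<longrightarrow>
      compactin (mapspace C V M) (?Z D))" using loc_trivD(1)[OF l] N by blast
next
  show "compactin (mapspace C V M) {a \<in> Ma V M. snd a \<in> {} \<and> (\<forall>K\<in>KK. \<forall>k\<in>K. fst a k \<in> L)}"
    by simp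
next
  fix D D'
  let ?Z = "\<lambda>D. {a \<in> Ma V M. snd a \<in> D \<and> (\<forall>K\<in>KK. \<forall>k\<in>K. fst a k \<in> L)}"
  assume "compactin (mapspace C V M) (?Z D)" "compactin (mapspace C V M) (?Z D')"
  then have "compactin (mapspace C V M) (?Z D \<union> ?Z D')" by (rule compactin_Un)
  moreover have "?Z D \<union> ?Z D' = ?Z (D \<union> D')" by blast
  ultimately show "compactin (mapspace C V M) (?Z (D \<union> D'))" by simp
qed

text \<open>\<open>thicken\<close> yields open sets \<open>U'\<close> over \<open>B\<close> that
  force maps into \<open>O'\<close> and contain the part over \<open>A\<close> where
  \<open>u\<close> is large. The Tietze theorem extends \<open>u\<close> so that it stays small off
  \<open>U'\<close>; large values of the extension then force a map into \<open>U'\<close>.\<close>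

lemma cell_extension:
  fixes M :: "('o, 'v, 'y, 'b) family" and u :: "'v set \<Rightarrow> 'y \<Rightarrow> real"
  assumes M: "fibre_bundle C M" and H: "Hausdorff_space (base M)" and B: "compactin (base M) B"
    and A: "closedin (base M) A" "A \<subseteq> B" and V: "V \<in> Obj C" and KK: "proper_sets V KK"
    and oO: "openin (mapspace C V M) O'" and st: "s < t"
    and u: "\<And>K. K \<in> KK \<Longrightarrow> continuous_map (tot_on M A) euclideanreal (u K)"
    and uO: "\<And>a. a \<in> Ma V M \<Longrightarrow> snd a \<in> A \<Longrightarrow>
               above KK u a s \<Longrightarrow> a \<in> O'"
  shows "\<exists>w. (\<forall>K\<in>KK. continuous_map (tot_on M B) euclideanreal (w K) \<and>
      (\<forall>x\<in>over M A. w K x = u K x)) \<and>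
    (\<forall>a\<in>Ma V M. snd a \<in> B \<longrightarrow> above KK w a t \<longrightarrow> a \<in> O')"
proof -
  note fM = fibre_bundleD[OF M]
  let ?Y = "tot_on M B" and ?MS = "subtopology (mapspace C V M) {a. snd a \<in> B}"
  have TY: "topspace ?Y = over M B" by auto
  have BA: "over M A \<subseteq> over M B" using A(2) by auto
  have Ac: "closedin ?Y (over M A)" using over_closed[OF fM A(1)] BA by (intro closedin_subset_topspace) auto
  have YA: "subtopology ?Y (over M A) = tot_on M A" using BA by (simp add: subtopology_subtopology inf.absorb2)
  obtain L :: "nat \<Rightarrow> 'y set" where L': "\<forall>j. compactin ?Y (L j)" "topspace ?Y = (\<Union>j. L j)"
    using bundle_exhaustion(1)[OF M H B] by (elim exE conjE)
  note L = L'(1)[rule_format] L'(2) bundle_exhaustion(2)[OF M H B]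
  have HY: "Hausdorff_space ?Y" by (rule Hausdorff_space_subtopology[OF bundle_Hausdorff[OF M H]])
  have lY: "locally_compact_space ?Y" by (rule bundle_locally_compact[OF M H B])
  have TM: "topspace ?MS = {a \<in> Ma V M. snd a \<in> B}" by auto
  have finKK: "finite KK" using KK unfolding proper_sets_def by blast
  obtain K0 where K0: "K0 \<in> KK" "K0 \<noteq> {}" using KK unfolding proper_sets_def by blast
  have fp: "fst a k \<in> tpts M \<and> prj M (fst a k) = snd a"
    if "a \<in> Ma V M" "K \<in> KK" "k \<in> K" for a K k
    using mapspace_fibre[OF fM that(1) proper_sets_pts[OF KK that(2,3)]] by (auto simp: fibre_def)
  have ev: "continuous_map ?MS ?Y (\<lambda>a. fst a k)" if "K \<in> KK" "k \<in> K" for K k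
  proof -
    have "continuous_map ?MS (tot M) (\<lambda>a. fst a k)"
      by (rule continuous_map_from_subtopology[OF mapspace_ev1[OF V proper_sets_pts[OF KK that]]])
    then show ?thesis using fp[OF _ that] by (auto simp: continuous_map_in_subtopology)
  qed
  have prp: "compactin ?MS {a \<in> topspace ?MS. \<forall>K\<in>KK. \<forall>k\<in>K. fst a k \<in> L'}" if "compactin ?Y L'" for L'
  proof -
    have "compactin (tot M) L'" using that by (simp add: compactin_subtopology)
    from mapspace_proper[OF M H B V KK this]
    have "compactin (mapspace C V M) {a \<in> topspace ?MS. \<forall>K\<in>KK. \<forall>k\<in>K. fst a k \<in> L'}"
      unfolding TM by (simp add: conj_assoc)
    then show ?thesis by (auto simp: compactin_subtopology)
  qed
  have im: "compactin ?Y (fst a ` K)" if a: "a \<in> topspace ?MS" and K: "K \<in> KK" for a K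
  proof -
    have "continuous_map (Fob C V) (tot M) (fst a)" using a by (simp add: mapspace_mem[OF fM])
    moreover have "compactin (Fob C V) K" using KK K unfolding proper_sets_def by blast
    ultimately have "compactin (tot M) (fst a ` K)" by (intro image_compactin)
    moreover have am: "a \<in> Ma V M" "snd a \<in> B" using a by auto
    have "fst a ` K \<subseteq> over M B" using fp[OF am(1) K] am(2) by auto
    ultimately show ?thesis by (simp add: compactin_subtopology)
  qed
  \<comment> \<open>Room on both sides: \<open>s < t'\<close> puts the closed set \<open>Q K\<close>
    inside the open set \<open>U K\<close>, and \<open>t' < t\<close> rules out values above
    \<open>t\<close> off \<open>U' K\<close>, where the extension is at most
    \<open>t'\<close>.\<close>
  define t' where "t' = (s + t) / 2"
  have t': "s < t'" "t' < t" using st by (auto simp: t'_def)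
  \<comment> \<open>Imposes the old condition over \<open>A\<close> and none elsewhere; it is open
    because the points over \<open>A\<close> with \<open>u K x \<le> s\<close> form a closed
    set.\<close>
  define U where "U K = {x \<in> over M B. x \<in> over M A \<longrightarrow> u K x > s}" for K
  define Q where "Q K = {x \<in> over M A. u K x \<ge> t'}" for K
  have cl: "closedin ?Y {x \<in> over M A. u K x \<in> S}" if "K \<in> KK" "closed S" for K S
  proof -
    have c: "closedin (subtopology ?Y (over M A)) {x \<in> topspace (subtopology ?Y (over M A)). u K x \<in> S}"
      using u[OF that(1)] that(2) unfolding YA by (intro closedin_continuous_map_preimage) auto
    have "topspace (subtopology ?Y (over M A)) = over M A" using BA by auto
    from closedin_trans_full[OF c[unfolded this] Ac] show ?thesis .
  qed
  have Q: "closedin ?Y (Q K) \<and> Q K \<subseteq> over M A \<inter> U K" if K: "K \<in> KK" for K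
    using cl[OF K closed_atLeast[of t']] t' BA by (auto simp: Q_def U_def)
  have U: "openin ?Y (U K)" if K: "K \<in> KK" for K
  proof -
    have "openin ?Y (topspace ?Y - {x \<in> over M A. u K x \<in> {..s}})" using cl[OF K closed_atMost[of s]] by blast
    moreover have "topspace ?Y - {x \<in> over M A. u K x \<in> {..s}} = U K" unfolding TY U_def by auto
    ultimately show ?thesis by simp
  qed
  have oO': "openin ?MS (O' \<inter> {a. snd a \<in> B})" by (rule openin_subtopology_Int[OF oO])
  have MA: "fst a k \<in> over M A \<longleftrightarrow> a \<in> {a. snd a \<in> A}" if "a \<in> topspace ?MS" "K \<in> KK" "k \<in> K" for a K k
    using fp[OF _ that(2,3), of a] that(1) by auto
  have UO: "a \<in> O' \<inter> {a. snd a \<in> B}" if a: "a \<in> topspace ?MS" "a \<in> {a. snd a \<in> A}"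
    "\<forall>K\<in>KK. \<forall>k\<in>K. fst a k \<in> U K" for a
  proof -
    have "u K (fst a k) > s" if "K \<in> KK" "k \<in> K" for K k
      using a MA[OF a(1) that] that unfolding U_def by blast
    then show ?thesis using uO[of a] a by auto
  qed
  have "\<exists>U'. (\<forall>K\<in>KK. openin ?Y (U' K) \<and> Q K \<subseteq> U' K) \<and>
    (\<forall>a\<in>topspace ?MS. (\<forall>K\<in>KK. \<forall>k\<in>K. fst a k \<in> U' K) \<longrightarrow> a \<in> O' \<inter> {a. snd a \<in> B})"
  proof (rule thicken[of ?Y KK K0 ?MS fst "O' \<inter> {a. snd a \<in> B}" "over M A" "{a. snd a \<in> A}" L Q U])
    fix U' assume U1: "\<And>K. K \<in> KK \<Longrightarrow> openin ?Y (U' K) \<and> Q K \<subseteq> U' K"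
      and U2: "\<And>a. a \<in> topspace ?MS \<Longrightarrow> (\<forall>K\<in>KK. \<forall>k\<in>K. fst a k \<in> U' K) \<Longrightarrow> a \<in> O' \<inter> {a. snd a \<in> B}"
    show ?thesis by (rule exI[of _ U'], rule conjI, rule ballI, erule U1, rule ballI, rule impI, erule U2)
  qed (fact HY lY finKK K0 ev prp im oO' Ac MA L Q U UO)+
  then obtain U' where U'0: "\<forall>K\<in>KK. openin ?Y (U' K) \<and> Q K \<subseteq> U' K"
    "\<forall>a\<in>topspace ?MS. (\<forall>K\<in>KK. \<forall>k\<in>K. fst a k \<in> U' K) \<longrightarrow> a \<in> O' \<inter> {a. snd a \<in> B}"
    by (elim exE conjE)
  note U' = U'0(1)[rule_format] U'0(2)[rule_format]
  have "\<exists>w. continuous_map ?Y euclideanreal w \<and> (\<forall>x\<in>over M A. w x = u K x) \<and>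
      (\<forall>x\<in>topspace ?Y - U' K. w x \<le> t')" if K: "K \<in> KK" for K
  proof -
    have D: "closedin ?Y (topspace ?Y - U' K)" using U'(1)[OF K] by blast
    have uK: "continuous_map (subtopology ?Y (over M A)) euclideanreal (u K)" unfolding YA by (rule u[OF K])
    have le: "u K x \<le> t'" if "x \<in> over M A" "x \<in> topspace ?Y - U' K" for x
    proof (rule ccontr)
      assume "\<not> u K x \<le> t'"
      then have "x \<in> Q K" using that(1) by (auto simp: Q_def)
      then show False using U'(1)[OF K] that(2) by blast
    qed
    show ?thesis by (rule Tietze_bounded[OF L(3) Ac D uK le]) auto
  qed
  then have "\<forall>K\<in>KK. \<exists>w. continuous_map ?Y euclideanreal w \<and> (\<forall>x\<in>over M A. w x = u K x) \<and>
      (\<forall>x\<in>topspace ?Y - U' K. w x \<le> t')" by (rule ballI)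
  from bchoice[OF this] obtain w where w0: "\<forall>K\<in>KK. continuous_map ?Y euclideanreal (w K) \<and>
      (\<forall>x\<in>over M A. w K x = u K x) \<and> (\<forall>x\<in>topspace ?Y - U' K. w K x \<le> t')" by (rule exE)
  note w = bspec[OF w0]
  have "a \<in> O'" if a: "a \<in> Ma V M" "snd a \<in> B" "above KK w a t" for a
  proof -
    have aM: "a \<in> topspace ?MS" using a by auto
    have "fst a k \<in> U' K" if k: "K \<in> KK" "k \<in> K" for K k
    proof (rule ccontr)
      assume "fst a k \<notin> U' K"
      moreover have "fst a k \<in> topspace ?Y" unfolding TY using fp[OF a(1) k] a(2) by auto
      ultimately have "w K (fst a k) \<le> t'" using w[OF k(1)] by blast
      moreover have "w K (fst a k) > t" using a(3) k by blast
      ultimately show False using t' by simp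
    qed
    then show ?thesis using U'(2)[OF aM] by blast
  qed
  then show ?thesis using w by (intro exI[of _ w]) blast
qed


subsection \<open>Bundles over CW-complexes\<close>

text \<open>In a trivialisation the total space is a product with a locally compact fibre, and such
  a product inherits the coherent topology of the base.\<close>

lemma bundle_coherent:
  assumes M: "fibre_bundle C M" and CW: "CW_complex (base M) E"
    and f: "\<And>e. e \<in> E \<Longrightarrow> continuous_map (tot_on M (closed_cell e)) Z f"
  shows "continuous_map (tot M) Z f"
proof (rule continuous_map_local)
  note fM = fibre_bundleD[OF M]
  fix x assume x: "x \<in> tpts M"
  obtain N W t s where N: "prj M x \<in> N" and l: "loc_triv M N W t s"
    using bundle_loc_triv[OF M prj_base[OF fM x]] .
  let ?B = "subtopology (base M) N"
  let ?P = "prod_topology ?B (Fob C W)"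
  note FW = Fob_space[OF loc_trivD(2)[OF l]]
  have NB: "N \<subseteq> bpts M" by (rule openin_subset[OF loc_trivD(1)[OF l]])
  have tp: "t b w \<in> tpts M" "prj M (t b w) = b" if "b \<in> N" "w \<in> pts W" for b w
    using loc_trivD(5)[OF l that] by (auto simp: fibre_def)
  have tc: "continuous_map (prod_topology (subtopology (base M) (N \<inter> closed_cell e)) (Fob C W)) Z
      (\<lambda>(b, w). f (t b w))" if e: "e \<in> E" for e
  proof -
    have "continuous_map (prod_topology (subtopology (base M) (N \<inter> closed_cell e)) (Fob C W)) (tot M) (\<lambda>(b, w). t b w)"
    proof -
      have eq: "N \<times> pts W \<inter> (N \<inter> closed_cell e) \<times> pts W = (N \<inter> closed_cell e) \<times> pts W" by auto
      show ?thesis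
        using continuous_map_from_subtopology[OF loc_trivD(3)[OF l], of "(N \<inter> closed_cell e) \<times> pts W"]
        by (simp add: prod_topology_subtopology subtopology_subtopology eq)
    qed
    then have "continuous_map (prod_topology (subtopology (base M) (N \<inter> closed_cell e)) (Fob C W))
        (tot_on M (closed_cell e)) (\<lambda>(b, w). t b w)" using tp NB by (auto simp: continuous_map_in_subtopology)
    from continuous_map_compose[OF this f[OF e]] show ?thesis by (simp add: o_def case_prod_unfold)
  qed
  have cell: "\<exists>e\<in>E. b \<in> closed_cell e" if "b \<in> N" for b
  proof -
    have "b \<in> (\<Union>e\<in>E. open_cell e)" using subsetD[OF NB that] unfolding CW_covered[OF CW] .
    then obtain e where "e \<in> E" "b \<in> open_cell e" by (rule UN_E)
    then show ?thesis using subsetD[OF open_cell_subset[of e]] by blast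
  qed
  have "continuous_map ?P Z (\<lambda>(b, w). f (t b w))"
    unfolding continuous_map_def
  proof (intro conjI allI impI)
    show "(\<lambda>(b, w). f (t b w)) \<in> topspace ?P \<rightarrow> topspace Z"
    proof (rule Pi_I, clarify)
      fix b w assume "(b, w) \<in> topspace ?P"
      then have bw: "b \<in> N" "w \<in> pts W" by auto
      obtain e where e: "e \<in> E" "b \<in> closed_cell e" using cell[OF bw(1)] by blast
      have "t b w \<in> topspace (tot_on M (closed_cell e))" using tp[OF bw] e by auto
      then show "f (t b w) \<in> topspace Z" using continuous_map_funspace[OF f[OF e(1)]] by blast
    qed
  next
    fix U assume U: "openin Z U"
    let ?S = "{p \<in> topspace ?P. (case p of (b, w) \<Rightarrow> f (t b w)) \<in> U}"
    show "openin ?P ?S"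
    proof (rule openin_prod_locally_compact[OF FW(1,3)])
      show "?S \<subseteq> topspace ?B \<times> pts W" by auto
    next
      fix b assume "b \<in> topspace ?B"
      then have b: "b \<in> N" "b \<in> bpts M" by auto
      obtain e where e: "e \<in> E" "b \<in> closed_cell e" using cell[OF b(1)] by blast
      have "continuous_map (Fob C W) (prod_topology (subtopology (base M) (N \<inter> closed_cell e)) (Fob C W)) (\<lambda>w. (b, w))"
        using b e by (simp add: continuous_map_pairwise o_def)
      from continuous_map_compose[OF this tc[OF e(1)]]
      have "continuous_map (Fob C W) Z (\<lambda>w. f (t b w))" by (simp add: o_def)
      from openin_continuous_map_preimage[OF this U]
      have "openin (Fob C W) {w \<in> pts W. f (t b w) \<in> U}" .
      moreover have "{w \<in> pts W. f (t b w) \<in> U} = {l \<in> pts W. (b, l) \<in> ?S}" using b by auto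
      ultimately show "openin (Fob C W) {l \<in> pts W. (b, l) \<in> ?S}" by simp
    next
      fix K assume K: "compactin (Fob C W) K"
      let ?R = "{b \<in> topspace ?B. \<forall>k\<in>K. (b, k) \<in> ?S}"
      have RN: "?R \<subseteq> N" by auto
      have "openin (base M) ?R"
      proof (rule CW_openin[OF CW])
        show "?R \<subseteq> bpts M" by auto
        fix e assume e: "e \<in> E"
        let ?T = "subtopology (base M) (N \<inter> closed_cell e)"
        have "openin ?T {b \<in> topspace ?T. \<forall>k\<in>K. (\<lambda>(b, w). f (t b w)) (b, k) \<in> U}"
          by (rule openin_tube[OF tc[OF e] K U])
        moreover have "{b \<in> topspace ?T. \<forall>k\<in>K. (\<lambda>(b, w). f (t b w)) (b, k) \<in> U} = ?R \<inter> closed_cell e"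
          using compactin_subset_topspace[OF K] by auto
        moreover have "?T = subtopology (subtopology (base M) (closed_cell e)) (N \<inter> closed_cell e)"
          by (simp add: subtopology_subtopology Int_absorb1 Int_commute)
        moreover have "openin (subtopology (base M) (closed_cell e)) (N \<inter> closed_cell e)"
          by (rule openin_subtopology_Int[OF loc_trivD(1)[OF l]])
        ultimately show "openin (subtopology (base M) (closed_cell e)) (?R \<inter> closed_cell e)"
          by (metis (no_types, lifting) openin_trans_full)
      qed
      then have "openin ?B (?R \<inter> N)" by (rule openin_subtopology_Int)
      moreover have "?R \<inter> N = ?R" using RN by blast
      ultimately show "openin ?B ?R" by simp
    qed
  qed
  moreover have "continuous_map (tot_on M N) ?P (\<lambda>x. (prj M x, s x))"
    using loc_trivD(4)[OF l] prj_continuous[OF fM]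
    by (auto simp: continuous_map_pairwise o_def continuous_map_in_subtopology continuous_map_from_subtopology)
  ultimately have "continuous_map (tot_on M N) Z ((\<lambda>(b, w). f (t b w)) \<circ> (\<lambda>x. (prj M x, s x)))"
    by (rule continuous_map_compose[rotated])
  then have "continuous_map (tot_on M N) Z f"
    by (rule continuous_map_eq) (use loc_trivD(7)[OF l] in auto)
  then show "\<exists>U. openin (tot M) U \<and> x \<in> U \<and> continuous_map (subtopology (tot M) U) Z f"
    using over_open[OF fM loc_trivD(1)[OF l]] x N by blast
qed

text \<open>Induction over the dimension of the cells of the base, starting from \<open>A\<close>:
  \<open>cell_extension\<close> is applied to each cell relative to its boundary and its part in
  \<open>A\<close>. Cells of one dimension are treated independently of each other, so the threshold
  rises only with the dimension.\<close>

lemma bundle_extension: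
  fixes M :: "('o, 'v, 'y, 'b) family" and u :: "'v set \<Rightarrow> 'y \<Rightarrow> real"
  assumes M: "fibre_bundle C M" and CW: "CW_complex (base M) E"
    and A: "closedin (base M) A" and V: "V \<in> Obj C" and KK: "proper_sets V KK"
    and oO: "openin (mapspace C V M) O'" and st: "s < t"
    and u: "\<And>K. K \<in> KK \<Longrightarrow> continuous_map (tot_on M A) euclideanreal (u K)"
    and uO: "\<And>a. a \<in> Ma V M \<Longrightarrow> snd a \<in> A \<Longrightarrow>
               above KK u a s \<Longrightarrow> a \<in> O'"
  shows "\<exists>w. (\<forall>K\<in>KK. continuous_map (tot M) euclideanreal (w K) \<and> (\<forall>x\<in>over M A. w K x = u K x)) \<and>
    (\<forall>a\<in>Ma V M. above KK w a t \<longrightarrow> a \<in> O')"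
proof -
  note fM = fibre_bundleD[OF M]
  note H = CW_Hausdorff[OF CW]
  \<comment> \<open>Thresholds for the successive skeleta: they start at \<open>s\<close>, increase
    strictly and stay below \<open>t\<close>, which leaves room for infinitely many
    dimensions.\<close>
  define \<theta> where "\<theta> n = t - (t - s) / (real n + 1)" for n :: nat
  have th: "\<theta> 0 = s" "\<theta> n < \<theta> (Suc n)" "\<theta> n < t" for n
    using st by (auto simp: \<theta>_def field_simps)
  \<comment> \<open>The cell whose interior contains \<open>b\<close>; it is unique because open
    cells are disjoint.\<close>
  define cl where "cl b = (SOME e. e \<in> E \<and> b \<in> open_cell e)" for b
  have cl: "cl b \<in> E \<and> b \<in> open_cell (cl b)" if "b \<in> bpts M" for b
  proof -
    have "\<exists>e. e \<in> E \<and> b \<in> open_cell e" using that CW_covered[OF CW] by auto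
    then show ?thesis unfolding cl_def by (rule someI_ex)
  qed
  have cl_eq: "cl b = e" if "e \<in> E" "b \<in> open_cell e" for b e
  proof -
    have "b \<in> bpts M" using CW_covered[OF CW] that by auto
    from cl[OF this] show ?thesis using CW_disjoint[OF CW, of "cl b" e] that by (meson disjoint_iff)
  qed
  \<comment> \<open>The inequality is strict: \<open>SK 0\<close> is \<open>A\<close>, and step
    \<open>n\<close> treats the cells of dimension \<open>n\<close>.\<close>
  define SK where "SK n = A \<union> {b \<in> bpts M. fst (cl b) < n}" for n
  have SKmono: "SK m \<subseteq> SK n" if "m \<le> n" for m n using that by (auto simp: SK_def)
  have bd: "fst (cl b) < fst e" if e: "e \<in> E" and b: "b \<in> closed_cell e - open_cell e" for b e
  proof -
    obtain D where D: "D \<subseteq> E" "\<And>d. d \<in> D \<Longrightarrow> fst d < fst e" "closed_cell e - open_cell e \<subseteq> (\<Union>d\<in>D. open_cell d)"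
      using CW_boundary[OF CW e] by metis
    obtain d where "d \<in> D" "b \<in> open_cell d" using b D(3) by blast
    moreover from this have "cl b = d" using cl_eq[of d b] D(1) by blast
    ultimately show ?thesis using D(2)[of d] by simp
  qed
  have cle: "fst (cl b) \<le> fst e" if e: "e \<in> E" and b: "b \<in> closed_cell e" for b e
    using bd[OF e] cl_eq[OF e] b by (cases "b \<in> open_cell e") (auto intro: less_imp_le)
  \<comment> \<open>Continuity is recorded cell by cell and only assembled at the end, by
    \<open>bundle_coherent\<close>. Outside the parts named here the values of \<open>w\<close> are
    arbitrary.\<close>
  define P where "P n w \<longleftrightarrow> (\<forall>K\<in>KK. (\<forall>x\<in>over M A. w K x = u K x) \<and>
      (\<forall>e\<in>E. fst e < n \<longrightarrow> continuous_map (tot_on M (closed_cell e)) euclideanreal (w K))) \<and>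
      (\<forall>a\<in>Ma V M. snd a \<in> SK n \<longrightarrow> (\<forall>K\<in>KK. \<forall>k\<in>K. w K (fst a k) > \<theta> n) \<longrightarrow> a \<in> O')"
    for n and w :: "'v set \<Rightarrow> 'y \<Rightarrow> real"
  define R where "R n w w' \<longleftrightarrow> (\<forall>K\<in>KK. \<forall>x\<in>over M (SK n). w' K x = w K x)"
    for n and w w' :: "'v set \<Rightarrow> 'y \<Rightarrow> real"
  have fp: "fst a k \<in> tpts M" "prj M (fst a k) = snd a" if "a \<in> Ma V M" "K \<in> KK" "k \<in> K" for a K k
    using mapspace_fibre[OF fM that(1) proper_sets_pts[OF KK that(2,3)]] by (auto simp: fibre_def)
  have "P 0 u" unfolding P_def using uO th(1) by (auto simp: SK_def)
  moreover have "\<exists>w'. P (Suc n) w' \<and> R n w w'" if Pw: "P n w" for n w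
  proof -
    have wA: "w K x = u K x" if "K \<in> KK" "x \<in> over M A" for K x using Pw that unfolding P_def by blast
    have wc: "continuous_map (tot_on M (closed_cell e)) euclideanreal (w K)"
      if "K \<in> KK" "e \<in> E" "fst e < n" for K e using Pw that unfolding P_def by blast
    have wO: "a \<in> O'" if "a \<in> Ma V M" "snd a \<in> SK n"
      "\<forall>K\<in>KK. \<forall>k\<in>K. w K (fst a k) > \<theta> n" for a using Pw that unfolding P_def by blast
    \<comment> \<open>The part of the closed cell over which the values have already been
      fixed.\<close>
    define Ae where "Ae e = (A \<inter> closed_cell e) \<union> (closed_cell e - open_cell e)" for e
    define good where "good e v \<longleftrightarrow> (\<forall>K\<in>KK. continuous_map (tot_on M (closed_cell e)) euclideanreal (v K) \<and>
      (\<forall>x\<in>over M (Ae e). v K x = w K x)) \<and>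
      (\<forall>a\<in>Ma V M. snd a \<in> closed_cell e \<longrightarrow> (\<forall>K\<in>KK. \<forall>k\<in>K. v K (fst a k) > \<theta> (Suc n)) \<longrightarrow> a \<in> O')"
      for e v
    have "\<exists>v. good e v" if e: "e \<in> E" "fst e = n" for e
    proof -
      obtain D where D: "finite D" "D \<subseteq> E" "\<And>d. d \<in> D \<Longrightarrow> fst d < fst e"
        "closed_cell e - open_cell e \<subseteq> (\<Union>d\<in>D. open_cell d)" "closedin (base M) (closed_cell e - open_cell e)"
        using CW_boundary[OF CW e(1)] by metis
      have Ac: "closedin (base M) (Ae e)" unfolding Ae_def using A CW_closed_cell[OF CW e(1)] D(5) by blast
      have Asub: "Ae e \<subseteq> closed_cell e" unfolding Ae_def by blast
      have ASK: "Ae e \<subseteq> SK n"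
      proof
        fix b assume b: "b \<in> Ae e"
        then have "b \<in> bpts M" using closedin_subset[OF Ac] by auto
        then show "b \<in> SK n" using b bd[OF e(1), of b] e(2) unfolding Ae_def SK_def by blast
      qed
      \<comment> \<open>\<open>Ae e\<close> is covered by \<open>A\<close> and finitely many closed
        cells of lower dimension around the boundary, so continuity is pasted from finitely many
        closed pieces.\<close>
      have cont: "continuous_map (tot_on M (Ae e)) euclideanreal (w K)" if K: "K \<in> KK" for K
      proof (rule pasting_lemma_closed[where I = "insert A (closed_cell ` D)" and T = "\<lambda>S. over M (S \<inter> Ae e)" and f = "\<lambda>_. w K"])
        let ?X = "tot_on M (Ae e)"
        show "finite (insert A (closed_cell ` D))" using D(1) by simp
        fix S assume S: "S \<in> insert A (closed_cell ` D)"
        have "closedin (base M) S" using S A D(2) CW_closed_cell[OF CW] by auto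
        then have "closedin (base M) (S \<inter> Ae e)" using Ac by (rule closedin_Int)
        from over_closed[OF fM this] show "closedin ?X (over M (S \<inter> Ae e))"
          by (rule closedin_subset_topspace) auto
        have c: "continuous_map (tot_on M S) euclideanreal (w K)"
        proof (cases "S = A")
          case True
          show ?thesis unfolding True by (rule continuous_map_eq[OF u[OF K]]) (use wA[OF K] in auto)
        next
          case False
          then obtain d where d: "d \<in> D" "S = closed_cell d" using S by auto
          then show ?thesis using wc[OF K, of d] D(2,3) e(2) by auto
        qed
        have "continuous_map (tot_on M (S \<inter> Ae e)) euclideanreal (w K)"
          by (rule continuous_map_from_subtopology_mono[OF c]) auto
        moreover have "subtopology ?X (over M (S \<inter> Ae e)) = tot_on M (S \<inter> Ae e)"
          by (simp add: subtopology_subtopology) (rule arg_cong[where f = "subtopology (tot M)"], auto)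
        ultimately show "continuous_map (subtopology ?X (over M (S \<inter> Ae e))) euclideanreal (w K)" by simp
      next
        fix x assume "x \<in> topspace (tot_on M (Ae e))"
        then have x: "x \<in> tpts M" "prj M x \<in> Ae e" by auto
        have "\<exists>S\<in>insert A (closed_cell ` D). prj M x \<in> S"
        proof (cases "prj M x \<in> A")
          case False
          then have "prj M x \<in> (\<Union>d\<in>D. open_cell d)" using x(2) D(4) unfolding Ae_def by blast
          then obtain d where d: "d \<in> D" "prj M x \<in> open_cell d" by (rule UN_E)
          show ?thesis using d(1) subsetD[OF open_cell_subset d(2)] by (intro bexI[of _ "closed_cell d"]) auto
        qed blast
        then show "\<exists>S. S \<in> insert A (closed_cell ` D) \<and> x \<in> over M (S \<inter> Ae e) \<and> w K x = w K x"
          using x by blast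
      qed simp
      have uO': "a \<in> O'" if "a \<in> Ma V M" "snd a \<in> Ae e"
        "\<forall>K\<in>KK. \<forall>k\<in>K. w K (fst a k) > \<theta> n" for a
        using wO[OF that(1) _ that(3)] that(2) ASK by blast
      show ?thesis
        unfolding good_def by (rule cell_extension[OF M H CW_compact_cell[OF CW e(1)] Ac Asub V KK oO th(2) cont uO'])
    qed
    then have "\<exists>v. \<forall>e. e \<in> E \<and> fst e = n \<longrightarrow> good e (v e)" by metis
    then obtain v where v: "\<And>e. e \<in> E \<Longrightarrow> fst e = n \<Longrightarrow> good e (v e)" by blast
    \<comment> \<open>Points over open \<open>n\<close>-cells take the value of the extension over
      their cell. Those that also lie over \<open>A\<close> keep their old value, because each
      extension agrees with \<open>w\<close> over \<open>Ae e\<close>.\<close>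
    define w' where "w' K x = (if fst (cl (prj M x)) = n \<and> cl (prj M x) \<in> E then v (cl (prj M x)) K x else w K x)" for K x
    have vA: "v e K x = w K x" if "e \<in> E" "fst e = n" "K \<in> KK" "x \<in> over M (Ae e)" for e K x
      using v[OF that(1,2)] that(3,4) unfolding good_def by blast
    have w'SK: "w' K x = w K x" if K: "K \<in> KK" and x: "x \<in> over M (SK n)" for K x
    proof (cases "fst (cl (prj M x)) = n")
      case True
      let ?e = "cl (prj M x)"
      have b: "prj M x \<in> bpts M" using x prj_base[OF fM] by auto
      have "prj M x \<in> A" using x True unfolding SK_def by auto
      moreover have "prj M x \<in> closed_cell ?e" using cl[OF b] subsetD[OF open_cell_subset[of ?e]] by simp
      ultimately have "x \<in> over M (Ae ?e)" using x unfolding Ae_def by blast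
      then have "v ?e K x = w K x" using vA[OF _ True K] cl[OF b] by blast
      then show ?thesis unfolding w'_def by simp
    qed (simp add: w'_def)
    have w'v: "w' K x = v e K x" if e: "e \<in> E" "fst e = n" and K: "K \<in> KK" and x: "x \<in> over M (closed_cell e)" for e K x
    proof (cases "prj M x \<in> open_cell e")
      case True
      then have "cl (prj M x) = e" using cl_eq[OF e(1)] by blast
      then show ?thesis unfolding w'_def using e by simp
    next
      case False
      then have "prj M x \<in> closed_cell e - open_cell e" using x by blast
      then have "x \<in> over M (Ae e)" "fst (cl (prj M x)) < n" using x bd[OF e(1)] e(2) unfolding Ae_def by auto
      then show ?thesis using vA[OF e K] unfolding w'_def by simp
    qed
    have "P (Suc n) w'"
      unfolding P_def
    proof (intro conjI ballI impI)
      fix K x assume "K \<in> KK" "x \<in> over M A"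
      moreover have "x \<in> over M (SK n)" using calculation by (auto simp: SK_def)
      ultimately show "w' K x = u K x" using w'SK wA by simp
    next
      fix K e assume K: "K \<in> KK" and e: "e \<in> E" "fst e < Suc n"
      show "continuous_map (tot_on M (closed_cell e)) euclideanreal (w' K)"
      proof (cases "fst e = n")
        case True
        have "continuous_map (tot_on M (closed_cell e)) euclideanreal (v e K)"
          using v[OF e(1) True] K unfolding good_def by blast
        then show ?thesis by (rule continuous_map_eq) (use w'v[OF e(1) True K] in auto)
      next
        case False
        then have lt: "fst e < n" using e(2) by simp
        have "w K x = w' K x" if x: "x \<in> over M (closed_cell e)" for x
        proof -
          have "prj M x \<in> bpts M" using x prj_base[OF fM] by auto
          moreover have "fst (cl (prj M x)) \<le> fst e" using cle[OF e(1)] x by blast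
          ultimately have "x \<in> over M (SK n)" using x lt unfolding SK_def by auto
          then show ?thesis using w'SK[OF K] by simp
        qed
        then show ?thesis by (intro continuous_map_eq[OF wc[OF K e(1) lt]]) auto
      qed
    next
      fix a assume a: "a \<in> Ma V M" "snd a \<in> SK (Suc n)"
        "\<forall>K\<in>KK. \<forall>k\<in>K. \<theta> (Suc n) < w' K (fst a k)"
      show "a \<in> O'"
      proof (cases "snd a \<in> SK n")
        case True
        have "\<theta> n < w K (fst a k)" if k: "K \<in> KK" "k \<in> K" for K k
        proof -
          have "fst a k \<in> over M (SK n)" using fp[OF a(1) k] True by simp
          then have "w' K (fst a k) = w K (fst a k)" using w'SK[OF k(1)] by blast
          then show ?thesis using a(3) k th(2)[of n] by (metis less_trans)
        qed
        then show ?thesis using wO[OF a(1) True] by blast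
      next
        case False
        let ?e = "cl (snd a)"
        have b: "snd a \<in> bpts M" by (rule mapspace_snd[OF fM a(1)])
        have e: "?e \<in> E" "fst ?e = n" "snd a \<in> closed_cell ?e"
          using cl[OF b] False a(2) b open_cell_subset[of ?e] unfolding SK_def by auto
        have "\<theta> (Suc n) < v ?e K (fst a k)" if k: "K \<in> KK" "k \<in> K" for K k
        proof -
          have "fst a k \<in> over M (closed_cell ?e)" using fp[OF a(1) k] e(3) by simp
          then have "w' K (fst a k) = v ?e K (fst a k)" using w'v[OF e(1,2) k(1)] by blast
          then show ?thesis using a(3)[rule_format, OF k] by simp
        qed
        then show ?thesis using v[OF e(1,2)] a(1) e(3) unfolding good_def by blast
      qed
    qed
    moreover have "R n w w'" unfolding R_def using w'SK by blast
    ultimately show ?thesis by blast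
  qed
  ultimately obtain f where f: "\<And>n. P n (f n)" "\<And>n. R n (f n) (f (Suc n))"
    using dependent_nat_choice[of P R] by blast
  have stat: "f m K x = f n K x" if K: "K \<in> KK" and x: "x \<in> over M (SK n)" and nm: "n \<le> m" for m n K x
    using nm
  proof (induction m rule: dec_induct)
    case (step m)
    have "x \<in> over M (SK m)" using x SKmono[OF step(1)] by auto
    then show ?case using f(2)[of m] K step(3) unfolding R_def by simp
  qed simp
  \<comment> \<open>By \<open>stat\<close> the values over a cell no longer change once its
    dimension has been treated, so the first stage that has treated the cell of
    \<open>prj M x\<close> can be used.\<close>
  define w where "w K x = f (Suc (fst (cl (prj M x)))) K x" for K x
  have wO: "a \<in> O'" if a: "a \<in> Ma V M" "above KK w a t" for a
  proof -
    have b: "snd a \<in> bpts M" by (rule mapspace_snd[OF fM a(1)])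
    let ?n = "Suc (fst (cl (snd a)))"
    have "snd a \<in> SK ?n" using b by (auto simp: SK_def)
    moreover have "\<forall>K\<in>KK. \<forall>k\<in>K. f ?n K (fst a k) > \<theta> ?n"
    proof (intro ballI)
      fix K k assume k: "K \<in> KK" "k \<in> K"
      have "w K (fst a k) = f ?n K (fst a k)" unfolding w_def using fp(2)[OF a(1) k] by simp
      moreover have "w K (fst a k) > t" using a(2) k by blast
      ultimately show "f ?n K (fst a k) > \<theta> ?n" using th(3)[of ?n] by simp
    qed
    ultimately show ?thesis using f(1)[of ?n] a(1) unfolding P_def by blast
  qed
  have wA: "w K x = u K x" if "K \<in> KK" "x \<in> over M A" for K x
    using f(1)[of "Suc (fst (cl (prj M x)))"] that unfolding P_def w_def by blast
  have wc: "continuous_map (tot M) euclideanreal (w K)" if K: "K \<in> KK" for K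
  proof (rule bundle_coherent[OF M CW])
    fix e assume e: "e \<in> E"
    have c: "continuous_map (tot_on M (closed_cell e)) euclideanreal (f (Suc (fst e)) K)"
      using f(1)[of "Suc (fst e)"] K e unfolding P_def by blast
    show "continuous_map (tot_on M (closed_cell e)) euclideanreal (w K)"
    proof (rule continuous_map_eq[OF c])
      fix x assume "x \<in> topspace (tot_on M (closed_cell e))"
      then have x: "x \<in> tpts M" "prj M x \<in> closed_cell e" by auto
      let ?n = "Suc (fst (cl (prj M x)))"
      have "x \<in> over M (SK ?n)" using x prj_base[OF fM x(1)] by (auto simp: SK_def)
      moreover have "?n \<le> Suc (fst e)" using cle[OF e x(2)] by simp
      ultimately show "f (Suc (fst e)) K x = w K x" using stat[OF K] unfolding w_def by blast
    qed
  qed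
  show ?thesis using wO wA wc by blast
qed

end

section \<open>Neighbourhoods in generated topologies; maps out of push-outs and sequential
  colimits\<close>

lemma topology_generated_nbhd:
  assumes "openin (topology_generated_by \<S>) U" "a \<in> U"
  shows "\<exists>F. finite F \<and> F \<subseteq> \<S> \<and> F \<noteq> {} \<and> a \<in> \<Inter>F \<and> \<Inter>F \<subseteq> U"
proof -
  have "generate_topology_on \<S> U" using assms(1) by (rule openin_topology_generated_by)
  then show ?thesis using assms(2)
  proof (induction rule: generate_topology_on.induct)
    case Empty
    then show ?case by simp
  next
    case (Int A B)
    then have "a \<in> A" "a \<in> B" by auto
    from Int(3)[OF this(1)] obtain F1 where F1: "finite F1" "F1 \<subseteq> \<S>" "F1 \<noteq> {}" "a \<in> \<Inter>F1" "\<Inter>F1 \<subseteq> A"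
      by (elim exE conjE)
    from Int(4)[OF \<open>a \<in> B\<close>] obtain F2 where F2: "finite F2" "F2 \<subseteq> \<S>" "F2 \<noteq> {}" "a \<in> \<Inter>F2" "\<Inter>F2 \<subseteq> B"
      by (elim exE conjE)
    show ?case by (rule exI[of _ "F1 \<union> F2"]) (use F1 F2 in auto)
  next
    case (UN K)
    then obtain k where k: "k \<in> K" "a \<in> k" by auto
    from UN(2)[OF k] obtain F where F: "finite F" "F \<subseteq> \<S>" "F \<noteq> {}" "a \<in> \<Inter>F" "\<Inter>F \<subseteq> k"
      by (elim exE conjE)
    then have "\<Inter>F \<subseteq> \<Union>K" using k(1) by blast
    then show ?case using F by (intro exI[of _ F] conjI)
  next
    case (Basis s)
    then show ?case by (intro exI[of _ "{s}"]) auto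
  qed
qed

lemma pushout_Top_glue:
  assumes p: "pushout_Top (subtopology Y A) X Y Z f id id g" and A: "A \<subseteq> topspace Y"
    and u: "continuous_map X R u" and w: "continuous_map Y R w"
    and uw: "\<And>y. y \<in> A \<Longrightarrow> w y = u (f y)"
  shows "\<exists>z. continuous_map Z R z \<and> (\<forall>x\<in>topspace X. z x = u x) \<and> (\<forall>y\<in>topspace Y. z (g y) = w y)"
proof -
  note d = pushout_Top_inclusionD[OF p A]
  define z where "z x = (if x \<in> topspace X then u x else w (inv_into (topspace Y - A) g x))" for x
  have zx: "z x = u x" if "x \<in> topspace X" for x using that by (simp add: z_def)
  have zy: "z (g y) = w y" if y: "y \<in> topspace Y" for y
  proof (cases "y \<in> A")
    case True
    then show ?thesis using d(4,5)[OF True] uw[OF True] by (simp add: z_def)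
  next
    case False
    then have "g y \<notin> topspace X" using pushout_Top_preimage[OF p A y] by blast
    moreover have "inv_into (topspace Y - A) g (g y) = y" using y False by (intro inv_into_f_f[OF d(8)]) auto
    ultimately show ?thesis by (simp add: z_def)
  qed
  have "continuous_map Z R z"
    unfolding continuous_map_def
  proof (intro conjI allI impI)
    show "z \<in> topspace Z \<rightarrow> topspace R"
    proof
      fix x assume "x \<in> topspace Z"
      then consider "x \<in> topspace X" | y where "y \<in> topspace Y" "x = g y" using d(6) by auto
      then show "z x \<in> topspace R"
      proof cases
        case 1
        then show ?thesis using zx continuous_map_funspace[OF u] by auto
      next
        case 2
        then show ?thesis using zy continuous_map_funspace[OF w] by auto
      qed
    qed
    fix U assume U: "openin R U"
    show "openin Z {x \<in> topspace Z. z x \<in> U}"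
    proof (rule d(7))
      have "topspace X \<inter> {x \<in> topspace Z. z x \<in> U} = {x \<in> topspace X. u x \<in> U}"
        using d(6) zx by auto
      then show "openin X (topspace X \<inter> {x \<in> topspace Z. z x \<in> U})"
        using openin_continuous_map_preimage[OF u U] by simp
      have "{y \<in> topspace Y. g y \<in> {x \<in> topspace Z. z x \<in> U}} = {y \<in> topspace Y. w y \<in> U}"
      proof (rule Collect_cong)
        fix y show "(y \<in> topspace Y \<and> g y \<in> {x \<in> topspace Z. z x \<in> U}) = (y \<in> topspace Y \<and> w y \<in> U)"
          using d(6) zy[of y] by auto
      qed
      then show "openin Y {y \<in> topspace Y. g y \<in> {x \<in> topspace Z. z x \<in> U}}"
        using openin_continuous_map_preimage[OF w U] by simp
    qed auto
  qed
  then show ?thesis using zx zy by blast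
qed

lemma lim_Top_continuous:
  assumes l: "lim_Top X A" and c: "\<And>n. continuous_map (subtopology X (A n)) Z f"
  shows "continuous_map X Z f"
  unfolding continuous_map_def
proof (intro conjI allI impI)
  have U: "(\<Union>n. A n) = topspace X" and o: "\<And>U. U \<subseteq> topspace X \<Longrightarrow>
      (\<And>n. openin (subtopology X (A n)) (U \<inter> A n)) \<Longrightarrow> openin X U"
    using l unfolding lim_Top_def by blast+
  have T: "topspace (subtopology X (A n)) = A n" for n using U by auto
  show "f \<in> topspace X \<rightarrow> topspace Z"
  proof
    fix x assume "x \<in> topspace X"
    then obtain n where "x \<in> A n" using U by auto
    then show "f x \<in> topspace Z" using continuous_map_funspace[OF c[of n]] T by auto
  qed
  fix W assume W: "openin Z W"
  show "openin X {x \<in> topspace X. f x \<in> W}"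
  proof (rule o)
    fix n
    have "{x \<in> topspace X. f x \<in> W} \<inter> A n = {x \<in> topspace (subtopology X (A n)). f x \<in> W}" using T U by auto
    then show "openin (subtopology X (A n)) ({x \<in> topspace X. f x \<in> W} \<inter> A n)"
      using openin_continuous_map_preimage[OF c W] by simp
  qed auto
qed

context str_cat
begin

subsection \<open>Families in normal form\<close>

text \<open>The condition \<open>generating\<close> and the attached pieces of a stratified bundle
  are stated for families with points in \<open>'b \<times> 'v\<close>. Base point and chart value
  determine a point, so every family can be transported to that form.\<close>

definition flat_pt :: "('o, 'v, 'y, 'b) family \<Rightarrow> 'y \<Rightarrow> 'b \<times> 'v" where
  "flat_pt Y x = (prj Y x, chart Y (prj Y x) x)"

definition unflat_pt :: "('o, 'v, 'y, 'b) family \<Rightarrow> 'b \<times> 'v \<Rightarrow> 'y" where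
  "unflat_pt Y = inv_into (tpts Y) (flat_pt Y)"

definition flat :: "('o, 'v, 'y, 'b) family \<Rightarrow> ('o, 'v, 'b \<times> 'v, 'b) family" where
  "flat Y = \<lparr>tot = transport_topology (flat_pt Y) (tot Y), base = base Y, prj = fst,
     fob = fob Y, chart = (\<lambda>_. snd)\<rparr>"

lemma flat_simps [simp]: "tot (flat (Y :: ('o, 'v, 'y, 'b) family)) = transport_topology (flat_pt Y) (tot Y)"
  "base (flat (Y :: ('o, 'v, 'y, 'b) family)) = base Y"
  "prj (flat (Y :: ('o, 'v, 'y, 'b) family)) = fst" "fob (flat (Y :: ('o, 'v, 'y, 'b) family)) = fob Y"
  "chart (flat (Y :: ('o, 'v, 'y, 'b) family)) = (\<lambda>_. snd)" by (simp_all add: flat_def)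

context
  fixes Y :: "('o, 'v, 'y, 'b) family"
  assumes Y: "family C Y"
begin

lemma flat_pt_inj: "inj_on (flat_pt Y) (tpts Y)"
proof (rule inj_onI)
  fix x y assume xy: "x \<in> tpts Y" "y \<in> tpts Y" "flat_pt Y x = flat_pt Y y"
  then have p: "prj Y x = prj Y y" "chart Y (prj Y x) x = chart Y (prj Y x) y" by (auto simp: flat_pt_def)
  have "x \<in> fibre Y (prj Y x)" "y \<in> fibre Y (prj Y x)" using xy p by (auto simp: fibre_def)
  then show "x = y" using chart_inj[OF Y prj_base[OF Y xy(1)]] p(2) by (auto simp: inj_on_def)
qed

lemma topspace_flat: "tpts (flat Y) = flat_pt Y ` tpts Y" using homeomorphic_map_transport(3)[OF flat_pt_inj] by simp

lemma flat_continuous: "continuous_map (tot Y) (tot (flat Y)) (flat_pt Y)"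
  using homeomorphic_map_transport(1)[OF flat_pt_inj] homeomorphic_imp_continuous_map by simp

lemma unflat_continuous: "continuous_map (tot (flat Y)) (tot Y) (unflat_pt Y)"
  using homeomorphic_map_transport(2)[OF flat_pt_inj] by (simp add: unflat_pt_def)

lemma unflat_flat: "x \<in> tpts Y \<Longrightarrow> unflat_pt Y (flat_pt Y x) = x"
  unfolding unflat_pt_def by (rule inv_into_f_f[OF flat_pt_inj])

lemma flat_unflat: "y \<in> tpts (flat Y) \<Longrightarrow> flat_pt Y (unflat_pt Y y) = y"
  unfolding unflat_pt_def topspace_flat by (rule f_inv_into_f)

lemma unflat_top: "y \<in> tpts (flat Y) \<Longrightarrow> unflat_pt Y y \<in> tpts Y"
  using continuous_map_funspace[OF unflat_continuous] by auto

lemma unflat_chart: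
  assumes "y \<in> tpts (flat Y)"
  shows "prj Y (unflat_pt Y y) = fst y" "chart Y (fst y) (unflat_pt Y y) = snd y"
  using flat_unflat[OF assms] unfolding flat_pt_def by (metis fst_conv snd_conv)+

lemma fibre_flat:
  shows "x \<in> fibre Y b \<Longrightarrow> flat_pt Y x \<in> fibre (flat Y) b"
    "y \<in> fibre (flat Y) b \<Longrightarrow> unflat_pt Y y \<in> fibre Y b"
  using unflat_chart(1) unflat_top continuous_map_funspace[OF flat_continuous]
  by (auto simp: fibre_def flat_pt_def Pi_iff)

lemma flat_family: "family C (flat Y)"
  unfolding family_def
proof (intro conjI ballI)
  have "continuous_map (tot (flat Y)) (base Y) (prj Y \<circ> unflat_pt Y)"
    by (rule continuous_map_compose[OF unflat_continuous prj_continuous[OF Y]])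
  then show "continuous_map (tot (flat Y)) (base (flat Y)) (prj (flat Y))"
    unfolding flat_simps(2,3) by (rule continuous_map_eq) (simp add: unflat_chart(1))
  fix b assume b': "b \<in> bpts (flat Y)"
  then have b: "b \<in> bpts Y" by simp
  show "fob (flat Y) b \<in> Obj C" using fob_Obj[OF Y b] by simp
  let ?T = "subtopology (tot (flat Y)) (fibre (flat Y) b)"
  have "homeomorphic_maps ?T (Fob C (fob Y b)) snd (flat_pt Y \<circ> fpt Y b)"
    unfolding homeomorphic_maps_def
  proof (intro conjI ballI)
    have "continuous_map ?T (tot Y) (unflat_pt Y)" by (rule continuous_map_from_subtopology[OF unflat_continuous])
    then have "continuous_map ?T (subtopology (tot Y) (fibre Y b)) (unflat_pt Y)"
      using fibre_flat(2) by (auto simp: continuous_map_in_subtopology)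
    from continuous_map_compose[OF this chart_continuous[OF Y b]]
    have "continuous_map ?T (Fob C (fob Y b)) (chart Y b \<circ> unflat_pt Y)" .
    then show "continuous_map ?T (Fob C (fob Y b)) snd"
    proof (rule continuous_map_eq)
      fix y assume "y \<in> topspace ?T"
      then have y: "y \<in> tpts (flat Y)" "fst y = b" unfolding fibre_def by auto
      show "(chart Y b \<circ> unflat_pt Y) y = snd y" using unflat_chart(2)[OF y(1)] y(2) by simp
    qed
    have "continuous_map (Fob C (fob Y b)) (tot (flat Y)) (flat_pt Y \<circ> fpt Y b)"
      by (rule continuous_map_compose[OF fpt_continuous[OF Y b] flat_continuous])
    then show "continuous_map (Fob C (fob Y b)) ?T (flat_pt Y \<circ> fpt Y b)"
      using fibre_flat(1) fpt_fibre[OF Y b] by (auto simp: continuous_map_in_subtopology)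
    fix w assume w: "w \<in> pts (fob Y b)"
    have "prj Y (fpt Y b w) = b" using fpt_fibre[OF Y b w] by (auto simp: fibre_def)
    then show "snd ((flat_pt Y \<circ> fpt Y b) w) = w" using chart_fpt[OF Y b w] by (simp add: flat_pt_def)
  next
    fix y assume "y \<in> topspace ?T"
    then have y: "y \<in> tpts (flat Y)" "fst y = b" "y \<in> fibre (flat Y) b" unfolding fibre_def by auto
    have "fpt Y b (snd y) = unflat_pt Y y"
      using fpt_chart[OF Y b fibre_flat(2)[OF y(3)]] unflat_chart(2)[OF y(1)] y(2) by simp
    then show "(flat_pt Y \<circ> fpt Y b) (snd y) = y" using flat_unflat[OF y(1)] by simp
  qed
  then show "homeomorphic_map ?T (Fob C (fob (flat Y) b)) (chart (flat Y) b)" by (simp add: homeomorphic_maps_imp_map)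
qed

lemma flat_map:
  shows "fam_map C Y (flat Y) (flat_pt Y) id" "fam_map C (flat Y) Y (unflat_pt Y) id"
    "b \<in> bpts Y \<Longrightarrow> fibre_arrow C Y (flat Y) (flat_pt Y) id b (Idn C (fob Y b))"
    "b \<in> bpts Y \<Longrightarrow> fibre_arrow C (flat Y) Y (unflat_pt Y) id b (Idn C (fob Y b))"
proof -
  show 1: "fibre_arrow C Y (flat Y) (flat_pt Y) id b (Idn C (fob Y b))" if b: "b \<in> bpts Y" for b
    using Idn_Hom[OF fob_Obj[OF Y b]] Far_Idn[OF fob_Obj[OF Y b]] chart_pts[OF Y _ b]
    by (auto simp: fibre_arrow_def fibre_def flat_pt_def)
  show 2: "fibre_arrow C (flat Y) Y (unflat_pt Y) id b (Idn C (fob Y b))" if b: "b \<in> bpts Y" for b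
  proof -
    have "chart Y b (unflat_pt Y y) = Far C (Idn C (fob Y b)) (snd y)" if y: "y \<in> fibre (flat Y) b" for y
    proof -
      have yt: "y \<in> tpts (flat Y)" "fst y = b" using y by (auto simp: fibre_def)
      have "chart Y b (unflat_pt Y y) = snd y" using unflat_chart(2)[OF yt(1)] yt(2) by simp
      moreover have "snd y \<in> pts (fob Y b)" using chart_pts[OF Y fibre_flat(2)[OF y] b] calculation by simp
      ultimately show ?thesis using Far_Idn[OF fob_Obj[OF Y b]] by simp
    qed
    then show ?thesis using Idn_Hom[OF fob_Obj[OF Y b]] by (auto simp: fibre_arrow_def)
  qed
  show "fam_map C Y (flat Y) (flat_pt Y) id"
    unfolding fam_map_def
  proof (intro conjI)
    show "continuous_map (tot Y) (tot (flat Y)) (flat_pt Y)" by (rule flat_continuous)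
  qed (use 1 in \<open>auto simp: flat_pt_def\<close>)
  show "fam_map C (flat Y) Y (unflat_pt Y) id"
    unfolding fam_map_def
  proof (intro conjI)
    show "continuous_map (tot (flat Y)) (tot Y) (unflat_pt Y)" by (rule unflat_continuous)
    show "\<forall>x\<in>tpts (flat Y). prj Y (unflat_pt Y x) = id (prj (flat Y) x)" using unflat_chart(1) by simp
  qed (use 2 in auto)
qed

end

lemma flat_bundle:
  assumes "fibre_bundle C Y"
  shows "fibre_bundle C (flat Y)"
proof (rule loc_triv_bundle)
  note Y = fibre_bundleD[OF assms]
  show "family C (flat Y)" by (rule flat_family[OF Y])
  fix b assume "b \<in> bpts (flat Y)"
  then have "b \<in> bpts Y" by simp
  then obtain N W t s where N: "b \<in> N" and l: "loc_triv Y N W t s" by (rule bundle_loc_triv[OF assms])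
  note d = loc_trivD[OF l]
  have "loc_triv (flat Y) N W (\<lambda>b w. flat_pt Y (t b w)) (\<lambda>y. s (unflat_pt Y y))"
    unfolding loc_triv_def
  proof (intro conjI ballI)
    show "openin (base (flat Y)) N" "W \<in> Obj C" using d by auto
    show "continuous_map (prod_topology (subtopology (base (flat Y)) N) (Fob C W)) (tot (flat Y)) (\<lambda>(b, w). flat_pt Y (t b w))"
      using continuous_map_compose[OF d(3) flat_continuous[OF Y]] by (simp add: o_def case_prod_unfold)
    have "continuous_map (tot_on (flat Y) N) (tot Y) (unflat_pt Y)"
      by (rule continuous_map_from_subtopology[OF unflat_continuous[OF Y]])
    then have "continuous_map (tot_on (flat Y) N) (tot_on Y N) (unflat_pt Y)"
      using unflat_chart(1)[OF Y] unflat_top[OF Y] by (auto simp: continuous_map_in_subtopology)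
    from continuous_map_compose[OF this d(4)]
    show "continuous_map (tot_on (flat Y) N) (Fob C W) (\<lambda>y. s (unflat_pt Y y))"
      by (simp add: o_def)
  next
    fix b w assume bw: "b \<in> N" "w \<in> pts W"
    show "flat_pt Y (t b w) \<in> fibre (flat Y) b" by (rule fibre_flat(1)[OF Y d(5)[OF bw]])
    have "t b w \<in> tpts Y" using d(5)[OF bw] by (simp add: fibre_def)
    then show "s (unflat_pt Y (flat_pt Y (t b w))) = w" using unflat_flat[OF Y] d(6)[OF bw] by simp
  next
    fix y assume "y \<in> over (flat Y) N"
    then have y: "y \<in> tpts (flat Y)" "fst y \<in> N" by auto
    have "t (fst y) (s (unflat_pt Y y)) = unflat_pt Y y"
      using d(7)[OF unflat_top[OF Y y(1)]] unflat_chart(1)[OF Y y(1)] y(2) by simp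
    then show "flat_pt Y (t (prj (flat Y) y) (s (unflat_pt Y y))) = y" using flat_unflat[OF Y y(1)] by simp
  next
    fix b assume b: "b \<in> N"
    obtain \<phi> where \<phi>: "\<phi> \<in> Hom C W (fob Y b)" "invertible_arrow C \<phi>"
      "\<And>w. w \<in> pts W \<Longrightarrow> chart Y b (t b w) = Far C \<phi> w" using d(9)[OF b] by blast
    show "\<exists>\<phi>\<in>Hom C W (fob (flat Y) b). invertible_arrow C \<phi> \<and>
        (\<forall>w\<in>pts W. chart (flat Y) b (flat_pt Y (t b w)) = Far C \<phi> w)"
      using \<phi> d(5)[OF b] by (intro bexI[of _ \<phi>]) (auto simp: flat_pt_def fibre_def)
  qed
  then show "\<exists>N W t s. b \<in> N \<and> loc_triv (flat Y) N W t s" using N by blast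
qed

lemma mapspace_map_comp:
  assumes "\<And>v. v \<in> pts V \<Longrightarrow> g (f (fst a v)) = fst a v" "gb (fb (snd a)) = snd a" "fst a \<in> extensional (pts V)"
  shows "mapspace_map V g gb (mapspace_map V f fb a) = a"
  using assms by (auto simp: mapspace_map_def prod_eq_iff restrict_def extensional_def)


subsection \<open>Neighbourhoods given by a generating family\<close>

lemma generating_nbhd_flat:
  fixes Y :: "('o, 'v, 'b \<times> 'v, 'b) family"
  assumes gen: "generating TYPE('b) C V \<K>" and Y: "family C Y" and O': "openin (mapspace C V Y) O'" "a \<in> O'"
  shows "\<exists>KK U. finite KK \<and> KK \<subseteq> \<K> \<and> (\<forall>K\<in>KK. openin (tot Y) (U K) \<and> fst a ` K \<subseteq> U K) \<and>
    (\<forall>a'\<in>Ma V Y. (\<forall>K\<in>KK. fst a' ` K \<subseteq> U K) \<longrightarrow> a' \<in> O')"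
proof -
  let ?T = "Ma V Y"
  let ?N = "{N_sets C V Y K U | K U. K \<in> \<K> \<and> openin (tot Y) U}"
  have eq: "mapspace C V Y = topology_generated_by (insert ?T ?N)" using gen Y unfolding generating_def by blast
  have aT: "a \<in> ?T" using O' openin_subset by blast
  have "openin (topology_generated_by (insert ?T ?N)) O'" using O'(1) eq by simp
  from topology_generated_nbhd[OF this O'(2)]
  obtain F where F: "finite F" "F \<subseteq> insert ?T ?N" "F \<noteq> {}" "a \<in> \<Inter>F" "\<Inter>F \<subseteq> O'" by (elim exE conjE)
  have "\<exists>KK U. finite KK \<and> KK \<subseteq> \<K> \<and> (\<forall>K\<in>KK. openin (tot Y) (U K) \<and> fst a ` K \<subseteq> U K) \<and>
    (\<forall>a'\<in>?T. (\<forall>K\<in>KK. fst a' ` K \<subseteq> U K) \<longrightarrow> a' \<in> \<Inter>F)"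
    using F(1,2,4)
  proof (induction F rule: finite_induct)
    case empty
    show ?case by (intro exI[of _ "{}"]) simp
  next
    case (insert S F)
    have p: "F \<subseteq> insert ?T ?N" "a \<in> \<Inter>F" using insert.prems by blast+
    from insert.IH[OF p] obtain KK U where KU0: "finite KK" "KK \<subseteq> \<K>"
      "\<forall>K\<in>KK. openin (tot Y) (U K) \<and> fst a ` K \<subseteq> U K"
      "\<forall>a'\<in>?T. (\<forall>K\<in>KK. fst a' ` K \<subseteq> U K) \<longrightarrow> a' \<in> \<Inter>F" by (elim exE conjE)
    have KU: "finite KK" "KK \<subseteq> \<K>" "\<And>K. K \<in> KK \<Longrightarrow> openin (tot Y) (U K) \<and> fst a ` K \<subseteq> U K"
      "\<And>a'. a' \<in> ?T \<Longrightarrow> (\<And>K. K \<in> KK \<Longrightarrow> fst a' ` K \<subseteq> U K) \<Longrightarrow> a' \<in> \<Inter>F"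
      using KU0 by simp_all
    show ?case
    proof (cases "S = ?T")
      case True
      then show ?thesis using KU by (intro exI[of _ KK] exI[of _ U]) auto
    next
      case False
      then obtain K0 U0 where S: "S = N_sets C V Y K0 U0" "K0 \<in> \<K>" "openin (tot Y) U0"
        using insert.prems(1) by auto
      have aS: "fst a ` K0 \<subseteq> U0" using insert.prems(2) S(1) by (auto simp: N_sets_def)
      \<comment> \<open>If \<open>K0\<close> already occurs, the two open sets are intersected, so
        that a neighbourhood is given by one open set for each \<open>K\<close>.\<close>
      define U' where "U' K = (if K = K0 then (if K0 \<in> KK then U K0 \<inter> U0 else U0) else U K)" for K
      show ?thesis
      proof (intro exI[of _ "insert K0 KK"] exI[of _ U'] conjI ballI impI)
        show "finite (insert K0 KK)" "insert K0 KK \<subseteq> \<K>" using KU(1,2) S(2) by auto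
        show "openin (tot Y) (U' K)" "fst a ` K \<subseteq> U' K" if "K \<in> insert K0 KK" for K
          using that KU(3)[of K] aS S(3) by (auto simp: U'_def)
        fix a' assume a': "a' \<in> ?T" "\<forall>K\<in>insert K0 KK. fst a' ` K \<subseteq> U' K"
        have "fst a' ` K \<subseteq> U K" if "K \<in> KK" for K
          using bspec[OF a'(2), of K] that by (auto simp: U'_def split: if_splits)
        then have "a' \<in> \<Inter>F" using KU(4) a'(1) by blast
        moreover have "fst a' ` K0 \<subseteq> U0"
          using bspec[OF a'(2), of K0] by (auto simp: U'_def split: if_splits)
        then have "a' \<in> S" using a'(1) S(1) by (simp add: N_sets_def)
        ultimately show "a' \<in> \<Inter>(insert S F)" by simp
      qed
    qed
  qed
  then obtain KK U where KU: "finite KK" "KK \<subseteq> \<K>" "\<forall>K\<in>KK. openin (tot Y) (U K) \<and> fst a ` K \<subseteq> U K"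
    "\<forall>a'\<in>?T. (\<forall>K\<in>KK. fst a' ` K \<subseteq> U K) \<longrightarrow> a' \<in> \<Inter>F" by (elim exE conjE)
  have "\<forall>a'\<in>?T. (\<forall>K\<in>KK. fst a' ` K \<subseteq> U K) \<longrightarrow> a' \<in> O'" using KU(4) subsetD[OF F(5)] by simp
  then show ?thesis using KU(1-3) by (intro exI[of _ KK] exI[of _ U] conjI)
qed

text \<open>\<open>generating\<close> only speaks of families in normal form; the neighbourhood is
  found there and its open sets are pulled back along \<open>flat_pt\<close>.\<close>

lemma generating_nbhd:
  fixes Y :: "('o, 'v, 'y, 'b) family"
  assumes gen: "generating TYPE('b) C V \<K>" and V: "V \<in> Obj C" and Y: "family C Y"
    and O': "openin (mapspace C V Y) O'" "a \<in> O'"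
  shows "\<exists>KK U. finite KK \<and> KK \<subseteq> \<K> \<and> (\<forall>K\<in>KK. openin (tot Y) (U K) \<and> fst a ` K \<subseteq> U K) \<and>
    (\<forall>a'\<in>Ma V Y. (\<forall>K\<in>KK. fst a' ` K \<subseteq> U K) \<longrightarrow> a' \<in> O')"
proof -
  note fl = flat_family[OF Y] and fm = flat_map[OF Y]
  let ?r = "mapspace_map V (unflat_pt Y) id" and ?i = "mapspace_map V (flat_pt Y) id"
  have aT: "a \<in> Ma V Y" using O' openin_subset by blast
  have Kp: "K \<subseteq> pts V" if "K \<in> \<K>" for K
    using gen that compactin_subset_topspace unfolding generating_def by blast
  have ri: "?r (?i a') = a'" if a': "a' \<in> Ma V Y" for a'
  proof (rule mapspace_map_comp)
    show "unflat_pt Y (flat_pt Y (fst a' v)) = fst a' v" if "v \<in> pts V" for v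
      using mapspace_fibre[OF Y a' that] by (intro unflat_flat[OF Y]) (auto simp: fibre_def)
    show "fst a' \<in> extensional (pts V)" using a' by (simp add: mapspace_mem[OF Y])
  qed simp
  have it: "?i a' \<in> Ma V (flat Y)" if "a' \<in> Ma V Y" for a' by (rule mapspace_map_mem'[OF Y fl fm(1) that])
  let ?O = "{a' \<in> Ma V (flat Y). ?r a' \<in> O'}"
  have oo: "openin (mapspace C V (flat Y)) ?O"
    by (rule openin_continuous_map_preimage[OF mapspace_map_continuous[OF fl Y fm(2) V] O'(1)])
  have io: "?i a \<in> ?O" using ri[OF aT] it[OF aT] O'(2) by simp
  obtain KK U where KU: "finite KK" "KK \<subseteq> \<K>"
    "\<forall>K\<in>KK. openin (tot (flat Y)) (U K) \<and> fst (?i a) ` K \<subseteq> U K"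
    "\<forall>a'\<in>Ma V (flat Y). (\<forall>K\<in>KK. fst a' ` K \<subseteq> U K) \<longrightarrow> a' \<in> ?O"
    using generating_nbhd_flat[OF gen fl oo io] by (elim exE conjE)
  let ?U = "\<lambda>K. {x \<in> tpts Y. flat_pt Y x \<in> U K}"
  have sub: "fst a' ` K \<subseteq> ?U K \<longleftrightarrow> fst (?i a') ` K \<subseteq> U K"
    if a': "a' \<in> Ma V Y" and K: "K \<in> KK" for a' K
  proof -
    have "fst a' k \<in> tpts Y" "fst (?i a') k = flat_pt Y (fst a' k)" if "k \<in> K" for k
      using Kp[of K] K KU(2) that mapspace_fibre[OF Y a', of k] by (auto simp: mapspace_map_def fibre_def)
    then show ?thesis by auto
  qed
  show ?thesis
  proof (intro exI[of _ KK] exI[of _ ?U] conjI ballI impI)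
    fix K assume K: "K \<in> KK"
    show "openin (tot Y) (?U K)"
      using KU(3) K by (intro openin_continuous_map_preimage[OF flat_continuous[OF Y]]) blast
    show "fst a ` K \<subseteq> ?U K" using sub[OF aT K] KU(3) K by blast
  next
    fix a' assume a': "a' \<in> Ma V Y" "\<forall>K\<in>KK. fst a' ` K \<subseteq> ?U K"
    have "\<forall>K\<in>KK. fst (?i a') ` K \<subseteq> U K" using sub[OF a'(1)] a'(2) by blast
    then have "?r (?i a') \<in> O'" using KU(4) it[OF a'(1)] by blast
    then show "a' \<in> O'" using ri[OF a'(1)] by simp
  qed (use KU in auto)
qed

lemma product_family_family:
  assumes "V \<in> Obj C"
  shows "family C (product_family C B V)"
proof -
  let ?P = "product_family C B V"
  have P: "tot ?P = prod_topology B (Fob C V)" "base ?P = B" "prj ?P = fst" "fob ?P = (\<lambda>_. V)"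
    "chart ?P = (\<lambda>_. snd)" by (simp_all add: product_family_def)
  show ?thesis
    unfolding family_def
  proof (intro conjI ballI)
    show "continuous_map (tot ?P) (base ?P) (prj ?P)" by (simp add: P continuous_map_fst)
    fix b assume b: "b \<in> bpts ?P"
    show "fob ?P b \<in> Obj C" using assms by (simp add: P)
    have "homeomorphic_maps (subtopology (tot ?P) (fibre ?P b)) (Fob C V) snd (\<lambda>v. (b, v))"
      using b unfolding homeomorphic_maps_def
      by (auto simp: P fibre_def continuous_map_in_subtopology continuous_map_pairwise o_def
          continuous_map_from_subtopology continuous_map_snd)
    then show "homeomorphic_map (subtopology (tot ?P) (fibre ?P b)) (Fob C (fob ?P b)) (chart ?P b)"
      by (simp add: P homeomorphic_maps_imp_map)
  qed
qed

text \<open>Otherwise the function space of a product over the discrete space \<open>{b1, b2}\<close> would be indiscrete,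
  but the projection separates its points over \<open>b1\<close> and \<open>b2\<close>.\<close>

lemma generating_trivial:
  fixes b1 b2 :: 'b
  assumes gen: "generating TYPE('b) C V \<K>" and V: "V \<in> Obj C" and e: "\<And>K. K \<in> \<K> \<Longrightarrow> K = {}"
  shows "b1 = b2"
proof -
  let ?P = "product_family C (discrete_topology {b1, b2}) V"
  have B: "base ?P = discrete_topology {b1, b2}" "fob ?P = (\<lambda>_. V)" by (simp_all add: product_family_def)
  note fP = product_family_family[OF V, of "discrete_topology {b1, b2}"]
  have m: "mpt V ?P b (Idn C V) \<in> Ma V ?P" "snd (mpt V ?P b (Idn C V)) = b"
    if "b \<in> {b1, b2}" for b using mpt_mapspace(1,3)[OF fP, of b "Idn C V" V] that Idn_Hom[OF V] by (auto simp: B)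
  let ?O = "{a \<in> Ma V ?P. snd a \<in> {b1}}"
  have oo: "openin (mapspace C V ?P) ?O"
    by (rule openin_continuous_map_preimage[OF mapspace_snd_continuous]) (simp add: B)
  have io: "mpt V ?P b1 (Idn C V) \<in> ?O" using m[of b1] by simp
  obtain KK and U :: "'v set \<Rightarrow> ('b \<times> 'v) set" where KU: "finite KK" "KK \<subseteq> \<K>"
    "\<forall>K\<in>KK. openin (tot ?P) (U K) \<and> fst (mpt V ?P b1 (Idn C V)) ` K \<subseteq> U K"
    "\<forall>a'\<in>Ma V ?P. (\<forall>K\<in>KK. fst a' ` K \<subseteq> U K) \<longrightarrow> a' \<in> ?O"
    using generating_nbhd[OF gen V fP oo io] by (elim exE conjE)
  have "\<forall>K\<in>KK. fst (mpt V ?P b2 (Idn C V)) ` K \<subseteq> U K" using KU(2) e by blast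
  then have "mpt V ?P b2 (Idn C V) \<in> ?O" using KU(4) m[of b2] by blast
  then show ?thesis using m(2)[of b2] by simp
qed

text \<open>In the fibre over the base point of \<open>a0\<close> a Urysohn function separates the
  image of each \<open>K\<close> from the complement of its neighbourhood. With the value 0 over
  \<open>A\<close> it is prescribed on a closed part of the base and extended by
  \<open>bundle_extension\<close>. Vanishing over \<open>A\<close> permits a continuation by zero
  over the earlier stages.\<close>

lemma init_function:
  fixes M :: "('o, 'v, 'y, 'b) family"
  assumes gen: "generating TYPE('b) C V \<K>" and V: "V \<in> Obj C"
    and prp: "\<And>K W L. K \<in> \<K> \<Longrightarrow> W \<in> Obj C \<Longrightarrow> compactin (Fob C W) L \<Longrightarrow>
           compactin (Hom_top C V W) {\<phi> \<in> Hom C V W. Far C \<phi> ` K \<subseteq> L}"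
    and K1: "K1 \<in> \<K>" "K1 \<noteq> {}" and M: "fibre_bundle C M" and CW: "CW_complex (base M) E"
    and A: "closedin (base M) A" and O': "openin (mapspace C V M) O'" "a0 \<in> O'" and c0: "snd a0 \<notin> A"
  shows "\<exists>KK w. proper_sets V KK \<and>
    (\<forall>K\<in>KK. continuous_map (tot M) euclideanreal (w K) \<and> (\<forall>x\<in>over M A. w K x = 0) \<and> (\<forall>k\<in>K. w K (fst a0 k) = 1)) \<and>
    (\<forall>a\<in>Ma V M. above KK w a (1/2) \<longrightarrow> a \<in> O')"
proof -
  note fM = fibre_bundleD[OF M] and H = CW_Hausdorff[OF CW]
  have a0: "a0 \<in> Ma V M" using O' openin_subset by blast
  let ?c = "snd a0"
  have c: "?c \<in> bpts M" by (rule mapspace_snd[OF fM a0])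
  obtain KK0 U0 where KU0: "finite KK0" "KK0 \<subseteq> \<K>" "\<forall>K\<in>KK0. openin (tot M) (U0 K) \<and> fst a0 ` K \<subseteq> U0 K"
    "\<forall>a'\<in>Ma V M. (\<forall>K\<in>KK0. fst a' ` K \<subseteq> U0 K) \<longrightarrow> a' \<in> O'"
    using generating_nbhd[OF gen V fM O'] by (elim exE conjE)
  \<comment> \<open>The neighbourhood may be described without any nonempty set. Adding
    \<open>K1\<close> makes the family proper; when \<open>K1\<close> is new, \<open>U\<close>
    imposes no condition on it.\<close>
  define KK where "KK = insert K1 KK0"
  define U where "U K = (if K \<in> KK0 then U0 K else tpts M)" for K
  have cp: "compactin (Fob C V) K" if "K \<in> \<K>" for K using gen that unfolding generating_def by blast
  have PK: "proper_sets V KK" unfolding proper_sets_def using KU0(1,2) K1 cp prp by (auto simp: KK_def)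
  have a0K: "fst a0 k \<in> fibre M ?c" if "K \<in> KK" "k \<in> K" for K k
    using mapspace_fibre[OF fM a0 proper_sets_pts[OF PK that]] .
  have U: "openin (tot M) (U K) \<and> fst a0 ` K \<subseteq> U K" if K: "K \<in> KK" for K
    using KU0(3) a0K[OF K] by (auto simp: U_def fibre_def)
  have UO: "a' \<in> O'" if "a' \<in> Ma V M" "\<forall>K\<in>KK. fst a' ` K \<subseteq> U K" for a'
  proof -
    have "fst a' ` K \<subseteq> U0 K" if "K \<in> KK0" for K
      using bspec[OF \<open>\<forall>K\<in>KK. fst a' ` K \<subseteq> U K\<close>, of K] that by (simp add: U_def KK_def)
    then show ?thesis using KU0(4) that(1) by blast
  qed
  let ?Y = "subtopology (tot M) (over M {?c})"
  have TY: "topspace ?Y = over M {?c}" by auto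
  have cc: "compactin (base M) {?c}" using c by simp
  have cclosed: "closedin (base M) {?c}" by (rule closedin_Hausdorff_singleton[OF H c])
  have nY: "normal_space ?Y" by (rule bundle_exhaustion(2)[OF M H cc])
  have HY: "Hausdorff_space ?Y" by (rule Hausdorff_space_subtopology[OF bundle_Hausdorff[OF M H]])
  have "\<exists>f. continuous_map ?Y euclideanreal f \<and> f ` (topspace ?Y - U K) \<subseteq> {0} \<and> f ` (fst a0 ` K) \<subseteq> {1}"
    if K: "K \<in> KK" for K
  proof -
    have "continuous_map (Fob C V) (tot M) (fst a0)" using a0 by (simp add: mapspace_mem[OF fM])
    moreover have "compactin (Fob C V) K" using PK K unfolding proper_sets_def by blast
    ultimately have "compactin (tot M) (fst a0 ` K)" by (intro image_compactin)
    moreover have "fst a0 ` K \<subseteq> over M {?c}" using a0K[OF K] by (auto simp: fibre_def)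
    ultimately have "compactin ?Y (fst a0 ` K)" by (simp add: compactin_subtopology)
    then have 1: "closedin ?Y (fst a0 ` K)" using HY compactin_imp_closedin by blast
    have "openin ?Y (U K \<inter> over M {?c})" using U[OF K] by (intro openin_subtopology_Int) blast
    then have "closedin ?Y (topspace ?Y - U K \<inter> over M {?c})" by blast
    moreover have "topspace ?Y - U K \<inter> over M {?c} = topspace ?Y - U K" using TY by blast
    ultimately have 2: "closedin ?Y (topspace ?Y - U K)" by simp
    have 3: "disjnt (topspace ?Y - U K) (fst a0 ` K)" using U[OF K] by (auto simp: disjnt_iff)
    show ?thesis
      using nY[unfolded normal_space_iff_Urysohn_alt, rule_format, OF conjI[OF 2 conjI[OF 1 3]]] .
  qed
  then have "\<forall>K\<in>KK. \<exists>f. continuous_map ?Y euclideanreal f \<and> f ` (topspace ?Y - U K) \<subseteq> {0} \<and> f ` (fst a0 ` K) \<subseteq> {1}"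
    by (rule ballI)
  from bchoice[OF this] obtain f where f0: "\<forall>K\<in>KK. continuous_map ?Y euclideanreal (f K) \<and>
      f K ` (topspace ?Y - U K) \<subseteq> {0} \<and> f K ` (fst a0 ` K) \<subseteq> {1}" by (rule exE)
  note f = bspec[OF f0]
  define u where "u K x = (if prj M x = ?c then f K x else 0)" for K x
  let ?A = "A \<union> {?c}"
  have Ac: "closedin (base M) ?A" using A cclosed by (rule closedin_Un)
  have cont: "continuous_map (tot_on M ?A) euclideanreal (u K)" if K: "K \<in> KK" for K
  proof (rule pasting_lemma_closed[where I = "{True, False}" and T = "\<lambda>b. if b then over M {?c} else over M A"
        and f = "\<lambda>b. if b then f K else (\<lambda>_. 0)"])
    let ?X = "tot_on M ?A"
    fix i :: bool
    have 1: "closedin ?X (over M {?c})" by (rule closedin_subset_topspace[OF over_closed[OF fM cclosed]]) auto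
    have 2: "closedin ?X (over M A)" by (rule closedin_subset_topspace[OF over_closed[OF fM A]]) auto
    show "closedin ?X (if i then over M {?c} else over M A)" using 1 2 by simp
    have e: "over M ?A \<inter> over M {?c} = over M {?c}" by auto
    have "continuous_map (subtopology ?X (over M {?c})) euclideanreal (f K)"
      unfolding subtopology_subtopology e using f[OF K] by (rule conjunct1)
    then show "continuous_map (subtopology ?X (if i then over M {?c} else over M A)) euclideanreal
        (if i then f K else (\<lambda>_. 0))" by (cases i) simp_all
  next
    fix x assume "x \<in> topspace (tot_on M ?A)"
    then show "\<exists>j. j \<in> {True, False} \<and> x \<in> (if j then over M {?c} else over M A) \<and>
        u K x = (if j then f K else (\<lambda>_. 0)) x"
      using c0 by (cases "prj M x = ?c") (auto simp: u_def intro: exI[of _ True] exI[of _ False])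
  qed (use c0 in \<open>auto split: if_splits\<close>)
  \<comment> \<open>Maps over \<open>A\<close> are excluded: \<open>u\<close> is 0 there, while a
    positive value is demanded at a point of \<open>K1\<close>. So only maps over \<open>?c\<close>
    remain, and for these the Urysohn functions decide.\<close>
  have uO: "a \<in> O'" if a: "a \<in> Ma V M" "snd a \<in> ?A"
    "above KK u a 0" for a
  proof -
    have p: "fst a k \<in> tpts M" "prj M (fst a k) = snd a" if "K \<in> KK" "k \<in> K" for K k
      using mapspace_fibre[OF fM a(1) proper_sets_pts[OF PK that]] by (auto simp: fibre_def)
    obtain k1 where k1: "K1 \<in> KK" "k1 \<in> K1" using K1(2) by (auto simp: KK_def)
    have "u K1 (fst a k1) > 0" using a(3) k1 by blast
    then have sa: "snd a = ?c" using p(2)[OF k1] by (auto simp: u_def split: if_splits)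
    have "fst a k \<in> U K" if k: "K \<in> KK" "k \<in> K" for K k
    proof (rule ccontr)
      assume "fst a k \<notin> U K"
      then have "fst a k \<in> topspace ?Y - U K" using p[OF k] sa by auto
      then have "f K (fst a k) = 0" using f[OF k(1)] by blast
      moreover have "u K (fst a k) > 0" using a(3) k by blast
      ultimately show False using p(2)[OF k] sa by (simp add: u_def)
    qed
    then show ?thesis using UO[OF a(1)] by blast
  qed
  have half: "(0::real) < 1/2" by simp
  have "\<exists>w. (\<forall>K\<in>KK. continuous_map (tot M) euclideanreal (w K) \<and> (\<forall>x\<in>over M ?A. w K x = u K x)) \<and>
    (\<forall>a\<in>Ma V M. above KK w a (1/2) \<longrightarrow> a \<in> O')"
    by (rule bundle_extension[OF M CW Ac V PK O'(1) half]) (fact cont uO)+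
  then obtain w where w: "\<forall>K\<in>KK. continuous_map (tot M) euclideanreal (w K) \<and> (\<forall>x\<in>over M ?A. w K x = u K x)"
    "\<forall>a\<in>Ma V M. above KK w a (1/2) \<longrightarrow> a \<in> O'"
    by (elim exE conjE)
  have "w K x = 0" if "K \<in> KK" "x \<in> over M A" for K x
  proof -
    have "x \<in> over M ?A" using that(2) by blast
    then have "w K x = u K x" using w(1) that(1) by blast
    moreover have "prj M x \<noteq> ?c" using that(2) c0 by auto
    ultimately show ?thesis by (simp add: u_def)
  qed
  moreover have "w K (fst a0 k) = 1" if k: "K \<in> KK" "k \<in> K" for K k
  proof -
    have x: "fst a0 k \<in> over M ?A" "prj M (fst a0 k) = ?c" using a0K[OF k] by (auto simp: fibre_def)
    then have "w K (fst a0 k) = u K (fst a0 k)" using w(1) k(1) by blast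
    also have "\<dots> = f K (fst a0 k)" using x(2) by (simp add: u_def)
    also have "\<dots> = 1" using f[OF k(1)] k(2) by (simp add: image_subset_iff)
    finally show ?thesis .
  qed
  ultimately have "\<forall>K\<in>KK. continuous_map (tot M) euclideanreal (w K) \<and> (\<forall>x\<in>over M A. w K x = 0) \<and>
      (\<forall>k\<in>K. w K (fst a0 k) = 1)" using w(1) by simp
  then show ?thesis using w(2) PK by (intro exI[of _ KK] exI[of _ w] conjI)
qed

end

subsection \<open>Function spaces of stratified bundles\<close>

text \<open>Fixes one choice of attached bundles and structure maps for all stages; the definition
  of a stratified bundle asserts their existence stage by stage.\<close>

locale strat_family = str_cat C for C :: "('o, 'h, 'v) structure_category" +
  fixes S :: "'b stratification" and X :: "('o, 'v, 'x, 'b) family"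
    and M :: "nat \<Rightarrow> ('o, 'v, 'b \<times> 'v, 'b) family" and h g :: "nat \<Rightarrow> 'b \<times> 'v \<Rightarrow> 'x"
  assumes S: "stratified_space S" and fX: "family C X" and baseX: "base X = strat_space S"
    and X0: "fibre_bundle C (fam_restrict X (strat_fil S 0))"
    and Mb: "\<And>n. fibre_bundle C (M n)" and baseM: "\<And>n. base (M n) = strat_M S (Suc n)"
    and po: "\<And>n. fam_pushout C (fam_restrict X (strat_fil S n)) (M n) (strat_A S (Suc n))
          (fam_restrict X (strat_fil S (Suc n))) (h n) (strat_h S (Suc n)) (g n) (strat_g S (Suc n))"
    and limX: "lim_Top (tot X) (\<lambda>n. {x \<in> tpts X. prj X x \<in> strat_fil S n})"
begin

abbreviation fil :: "nat \<Rightarrow> 'b set" where "fil \<equiv> strat_fil S"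
abbreviation Xn :: "nat \<Rightarrow> ('o, 'v, 'x, 'b) family" where "Xn n \<equiv> fam_restrict X (fil n)"
abbreviation An :: "nat \<Rightarrow> 'b set" where "An n \<equiv> strat_A S (Suc n)"
abbreviation hb :: "nat \<Rightarrow> 'b \<Rightarrow> 'b" where "hb n \<equiv> strat_h S (Suc n)"
abbreviation gb :: "nat \<Rightarrow> 'b \<Rightarrow> 'b" where "gb n \<equiv> strat_g S (Suc n)"

lemmas fM = fibre_bundleD[OF Mb]
lemmas fXn = family_restrict[OF fX]

lemma base_Xn: "base (Xn n) = strat_sub S n" "bpts (Xn n) = fil n"
  using strat_sub_topspace(2)[OF S, of n] by (simp_all add: strat_sub_def baseX)

lemma An_closed: "closedin (base (M n)) (An n)" unfolding baseM by (rule strat_pushout(2)[OF S])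

lemma An_sub: "An n \<subseteq> bpts (M n)" by (rule closedin_subset[OF An_closed])

lemma hmap: "fam_map C (fam_restrict (M n) (An n)) (Xn n) (h n) (hb n)"
  and gmap: "fam_map C (M n) (Xn (Suc n)) (g n) (gb n)"
  and po_tot: "pushout_Top (tot_on (M n) (An n)) (tot (Xn n)) (tot (M n)) (tot (Xn (Suc n))) (h n) id id (g n)"
  and po_base: "pushout_Top (subtopology (base (M n)) (An n)) (base (Xn n)) (base (M n)) (base (Xn (Suc n))) (hb n) id id (gb n)"
  and g_inv: "b \<in> bpts (M n) - An n \<Longrightarrow> \<exists>\<phi>. fibre_arrow C (M n) (Xn (Suc n)) (g n) (gb n) b \<phi> \<and> invertible_arrow C \<phi>"
  using po[of n] unfolding fam_pushout_def by simp_all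

lemma over_sub: "over Y U \<subseteq> tpts Y" by blast

lemma g_on_An: "y \<in> over (M n) (An n) \<Longrightarrow> g n y = h n y"
  using pushout_Top_inclusionD(4)[OF po_tot over_sub] .

lemma gb_fil: "c \<in> bpts (M n) \<Longrightarrow> gb n c \<in> fil n \<longleftrightarrow> c \<in> An n"
  using pushout_Top_preimage[OF po_base An_sub, of c n] unfolding base_Xn(2) .

lemma topspace_tot_Xn: "tpts (Xn n) = over X (fil n)" by auto

lemma mapspace_Xn: "a \<in> Ma V (Xn n) \<longleftrightarrow> a \<in> Ma V X \<and> snd a \<in> fil n"
  by (rule topspace_mapspace_restrict[OF fX])

lemma marr_restrict: "marr V (fam_restrict Y U) a = marr V Y a" unfolding marr_def fibre_arrow_def by simp

abbreviation pull :: "'o \<Rightarrow> nat \<Rightarrow> ('v \<Rightarrow> 'b \<times> 'v) \<times> 'b \<Rightarrow> ('v \<Rightarrow> 'x) \<times> 'b" where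
  "pull V n \<equiv> mapspace_map V (g n) (gb n)"

lemma pull_simps: "snd (pull V n m) = gb n (snd m)" "v \<in> pts V \<Longrightarrow> fst (pull V n m) v = g n (fst m v)"
  by (simp_all add: mapspace_map_def)

lemma pull_mem: "m \<in> Ma V (M n) \<Longrightarrow> pull V n m \<in> Ma V (Xn (Suc n))"
  by (rule mapspace_map_mem'[OF fM fXn gmap])

text \<open>Off \<open>A\<close> the structure map acts on fibres by invertible morphisms, so the
  morphism behind a map over the new stratum can be carried back to the fibre of
  \<open>M n\<close>.\<close>

lemma pull_lift:
  assumes a: "a \<in> Ma V (Xn (Suc n))" and b: "snd a \<notin> fil n"
  shows "\<exists>m\<in>Ma V (M n). snd m \<notin> An n \<and> pull V n m = a"
proof -
  have "snd a \<in> bpts (Xn (Suc n))" by (rule mapspace_snd[OF fXn a])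
  then have "snd a \<in> bpts (Xn n) \<union> gb n ` bpts (M n)"
    unfolding pushout_Top_inclusionD(6)[OF po_base[of n] An_sub] .
  then obtain c where c: "c \<in> bpts (M n)" "snd a = gb n c" using b unfolding base_Xn(2) by blast
  have cA: "c \<notin> An n" using gb_fil[OF c(1)] b c(2) by simp
  obtain \<phi> where \<phi>: "fibre_arrow C (M n) (Xn (Suc n)) (g n) (gb n) c \<phi>" "invertible_arrow C \<phi>"
    using g_inv[of c n] c(1) cA by blast
  have pH: "\<phi> \<in> Hom C (fob (M n) c) (fob X (snd a))" using \<phi>(1) c(2) unfolding fibre_arrow_def by simp
  obtain \<psi> where \<psi>: "\<psi> \<in> Hom C (fob X (snd a)) (fob (M n) c)" "Comp C \<phi> \<psi> = Idn C (fob X (snd a))"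
    using invertible_arrowE[OF \<phi>(2) pH] by metis
  have ma: "marr V X a \<in> Hom C V (fob X (snd a))" using marr(1)[OF fX] a unfolding mapspace_Xn by blast
  let ?m = "mpt V (M n) c (Comp C \<psi> (marr V X a))"
  note m = mpt_mapspace[OF fM c(1) Comp_Hom[OF ma \<psi>(1)]]
  have \<phi>': "fibre_arrow C (M n) (Xn (Suc n)) (g n) (gb n) (snd ?m) \<phi>" using \<phi>(1) m(3) by simp
  note mm = mapspace_map_mem[OF fM fXn gmap m(1) \<phi>']
  have "pull V n ?m = a"
  proof (rule mapspace_eqI[OF fXn mm(1) a])
    show "snd (pull V n ?m) = snd a" using m(3) c(2) by (simp add: mapspace_map_def)
    have "marr V (Xn (Suc n)) (pull V n ?m) = Comp C \<phi> (Comp C \<psi> (marr V X a))" using mm(2) m(2) by simp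
    also have "\<dots> = Comp C (Comp C \<phi> \<psi>) (marr V X a)" by (rule Comp_assoc[OF ma \<psi>(1) pH])
    also have "\<dots> = marr V X a" using \<psi>(2) Comp_Idn(2)[OF ma] by simp
    finally show "marr V (Xn (Suc n)) (pull V n ?m) = marr V (Xn (Suc n)) a" by (simp add: marr_restrict)
  qed
  then show ?thesis using m(1,3) cA by (intro bexI[of _ ?m]) auto
qed

lemma pull_inj:
  assumes m: "m \<in> Ma V (M n)" "m' \<in> Ma V (M n)"
    and A: "snd m \<notin> An n" "snd m' \<notin> An n" and e: "pull V n m = pull V n m'"
  shows "m = m'"
proof -
  have b: "snd m \<in> bpts (M n) - An n" "snd m' \<in> bpts (M n) - An n" using mapspace_snd[OF fM] m A by blast+
  have "gb n (snd m) = gb n (snd m')" using e pull_simps(1) by metis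
  then have s: "snd m = snd m'" using pushout_Top_inclusionD(8)[OF po_base An_sub] b by (auto simp: inj_on_def)
  obtain \<phi> where \<phi>: "fibre_arrow C (M n) (Xn (Suc n)) (g n) (gb n) (snd m) \<phi>" "invertible_arrow C \<phi>"
    using g_inv[OF b(1)] by blast
  have pH: "\<phi> \<in> Hom C (fob (M n) (snd m)) (fob X (gb n (snd m)))" using \<phi>(1) unfolding fibre_arrow_def by simp
  obtain \<psi> where \<psi>: "\<psi> \<in> Hom C (fob X (gb n (snd m))) (fob (M n) (snd m))" "Comp C \<psi> \<phi> = Idn C (fob (M n) (snd m))"
    using invertible_arrowE[OF \<phi>(2) pH] by metis
  have c: "Comp C \<phi> (marr V (M n) m) = Comp C \<phi> (marr V (M n) m')"
    using mapspace_map_mem(2)[OF fM fXn gmap m(1) \<phi>(1)] mapspace_map_mem(2)[OF fM fXn gmap m(2)] \<phi>(1) s e by simp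
  have r: "marr V (M n) m = Comp C \<psi> (Comp C \<phi> (marr V (M n) m))" if "marr V (M n) m \<in> Hom C V (fob (M n) (snd m'))" for m
  proof -
    have "marr V (M n) m \<in> Hom C V (fob (M n) (snd m'))" by (rule that)
    then show ?thesis using Comp_assoc[OF _ pH[unfolded s] \<psi>(1)[unfolded s]] \<psi>(2)[unfolded s] Comp_Idn(2) by metis
  qed
  have "marr V (M n) m = marr V (M n) m'" using r[of m] r[of m'] marr(1)[OF fM m(1)] marr(1)[OF fM m(2)] s c by metis
  then show ?thesis by (rule mapspace_eqI[OF fM m s])
qed

text \<open>Together with \<open>lvl0\<close>, these conditions describe openness in the final
  topology determined by the pieces.\<close>

definition lvlH :: "'o \<Rightarrow> (('v \<Rightarrow> 'x) \<times> 'b) set \<Rightarrow> nat \<Rightarrow> bool" where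
  "lvlH V O' n \<longleftrightarrow> openin (mapspace C V (M n)) {m \<in> Ma V (M n). pull V n m \<in> O'}"

definition lvl0 :: "'o \<Rightarrow> (('v \<Rightarrow> 'x) \<times> 'b) set \<Rightarrow> bool" where
  "lvl0 V O' \<longleftrightarrow> openin (mapspace C V (Xn 0)) {a \<in> Ma V (Xn 0). a \<in> O'}"

text \<open>The functions \<open>w K\<close> cut out a neighbourhood contained in \<open>O'\<close> on stage \<open>n\<close>. Each extension to the next
  stage costs an increase of the threshold, which has to remain bounded away from the value 1 that the
  functions have on the given point.\<close>

definition thr :: "nat \<Rightarrow> real" where "thr n = 3/4 - 1 / (4 * (real n + 1))"

lemma thr: "thr 0 = 1/2" "thr n < thr (Suc n)" "thr n < 3/4" "1/2 \<le> thr n" by (auto simp: thr_def field_simps)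

definition good :: "'o \<Rightarrow> (('v \<Rightarrow> 'x) \<times> 'b) set \<Rightarrow> nat \<Rightarrow> 'v set set \<Rightarrow> ('v set \<Rightarrow> 'x \<Rightarrow> real) \<Rightarrow> bool" where
  "good V O' n KK w \<longleftrightarrow> (\<forall>K\<in>KK. continuous_map (tot (Xn n)) euclideanreal (w K)) \<and>
    (\<forall>a\<in>Ma V (Xn n). above KK w a (thr n) \<longrightarrow> a \<in> O')"

lemma goodD:
  assumes "good V O' n KK w"
  shows "K \<in> KK \<Longrightarrow> continuous_map (tot (Xn n)) euclideanreal (w K)"
    "a \<in> Ma V (Xn n) \<Longrightarrow> above KK w a (thr n) \<Longrightarrow> a \<in> O'"
  using assms unfolding good_def by blast+

lemma mapspace_X_pt:
  assumes a: "a \<in> Ma V X" and v: "v \<in> pts V"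
  shows "fst a v \<in> tpts X" "prj X (fst a v) = snd a" using mapspace_fibre[OF fX a v] by (auto simp: fibre_def)

text \<open>A map into stage \<open>Suc n\<close> lies over stage \<open>n\<close> or lifts to
  \<open>M n\<close> by \<open>pull_lift\<close>; the glued functions take on it the values of
  \<open>u\<close> in the one case and of \<open>w\<close> in the other.\<close>

lemma good_glue:
  assumes KK: "proper_sets V KK"
    and u: "\<And>K. K \<in> KK \<Longrightarrow> continuous_map (tot (Xn n)) euclideanreal (u K)"
    and w: "\<And>K. K \<in> KK \<Longrightarrow> continuous_map (tot (M n)) euclideanreal (w K)"
    and uw: "\<And>K y. K \<in> KK \<Longrightarrow> y \<in> over (M n) (An n) \<Longrightarrow> w K y = u K (h n y)"
    and uO: "\<And>a. a \<in> Ma V (Xn n) \<Longrightarrow> (above KK u a (thr (Suc n))) \<Longrightarrow> a \<in> O'"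
    and wO: "\<And>m. m \<in> Ma V (M n) \<Longrightarrow> (above KK w m (thr (Suc n))) \<Longrightarrow> pull V n m \<in> O'"
  shows "\<exists>z. good V O' (Suc n) KK z \<and> (\<forall>K\<in>KK. (\<forall>x\<in>over X (fil n). z K x = u K x) \<and>
    (\<forall>y\<in>tpts (M n). z K (g n y) = w K y))"
proof -
  have "\<exists>z. continuous_map (tot (Xn (Suc n))) euclideanreal z \<and> (\<forall>x\<in>tpts (Xn n). z x = u K x) \<and>
      (\<forall>y\<in>tpts (M n). z (g n y) = w K y)" if K: "K \<in> KK" for K
    by (rule pushout_Top_glue[OF po_tot over_sub u[OF K] w[OF K] uw[OF K]])
  then have "\<forall>K\<in>KK. \<exists>z. continuous_map (tot (Xn (Suc n))) euclideanreal z \<and> (\<forall>x\<in>tpts (Xn n). z x = u K x) \<and>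
      (\<forall>y\<in>tpts (M n). z (g n y) = w K y)" by (rule ballI)
  from bchoice[OF this] obtain z where z0: "\<forall>K\<in>KK. continuous_map (tot (Xn (Suc n))) euclideanreal (z K) \<and>
      (\<forall>x\<in>tpts (Xn n). z K x = u K x) \<and> (\<forall>y\<in>tpts (M n). z K (g n y) = w K y)" by (rule exE)
  have zc: "continuous_map (tot (Xn (Suc n))) euclideanreal (z K)" if "K \<in> KK" for K
    using bspec[OF z0 that] by (rule conjunct1)
  have zu: "z K x = u K x" if "K \<in> KK" "x \<in> over X (fil n)" for K x
    using bspec[OF z0 that(1)] that(2) unfolding topspace_tot_Xn by blast
  have zw: "z K (g n y) = w K y" if "K \<in> KK" "y \<in> tpts (M n)" for K y
    using bspec[OF z0 that(1)] that(2) by blast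
  have "a \<in> O'" if a: "a \<in> Ma V (Xn (Suc n))" and gt: "above KK z a (thr (Suc n))" for a
  proof (cases "snd a \<in> fil n")
    case True
    have am: "a \<in> Ma V X" using a unfolding mapspace_Xn by blast
    then have aX: "a \<in> Ma V (Xn n)" using True unfolding mapspace_Xn by blast
    have "u K (fst a k) > thr (Suc n)" if k: "K \<in> KK" "k \<in> K" for K k
    proof -
      have "fst a k \<in> over X (fil n)" using mapspace_X_pt[OF am proper_sets_pts[OF KK k]] True by simp
      then show ?thesis using zu[OF k(1)] gt[rule_format, OF k] by simp
    qed
    then show ?thesis using uO[OF aX] by blast
  next
    case False
    then obtain m where m: "m \<in> Ma V (M n)" "pull V n m = a" using pull_lift[OF a] by blast
    have "w K (fst m k) > thr (Suc n)" if k: "K \<in> KK" "k \<in> K" for K k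
    proof -
      have kV: "k \<in> pts V" by (rule proper_sets_pts[OF KK k])
      have y: "fst m k \<in> tpts (M n)" using mapspace_fibre[OF fM m(1) kV] by (simp add: fibre_def)
      have "fst a k = g n (fst m k)" using pull_simps(2)[OF kV, of n m] m(2) by simp
      then show ?thesis using zw[OF k(1) y] gt[rule_format, OF k] by simp
    qed
    then show ?thesis using wO[OF m(1)] m(2) by blast
  qed
  then have "good V O' (Suc n) KK z" unfolding good_def using zc by blast
  then show ?thesis using zu zw by blast
qed

text \<open>The functions \<open>u\<close> composed with the attaching map are prescribed over
  \<open>A\<close> and extended over \<open>M n\<close>. A map over \<open>A\<close> is pulled into
  stage \<open>n\<close>, where \<open>good\<close> already forces it into \<open>O'\<close>; this
  is the hypothesis that \<open>bundle_extension\<close> needs.\<close>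

lemma strat_step:
  assumes V: "V \<in> Obj C" and KK: "proper_sets V KK" and G: "good V O' n KK u" and H: "lvlH V O' n"
  shows "\<exists>z. good V O' (Suc n) KK z \<and> (\<forall>K\<in>KK. \<forall>x\<in>over X (fil n). z K x = u K x)"
proof -
  obtain E where CW: "CW_complex (base (M n)) E" using strat_pushout(3)[OF S, of n] unfolding baseM by blast
  let ?O = "{m \<in> Ma V (M n). pull V n m \<in> O'}"
  have oO: "openin (mapspace C V (M n)) ?O" using H unfolding lvlH_def .
  have cont: "continuous_map (tot_on (M n) (An n)) euclideanreal (\<lambda>y. u K (h n y))" if K: "K \<in> KK" for K
    using continuous_map_compose[OF fam_mapD(1)[OF hmap] goodD(1)[OF G K]] by (simp add: o_def)
  have uO: "m \<in> ?O" if m: "m \<in> Ma V (M n)" "snd m \<in> An n"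
    "\<forall>K\<in>KK. \<forall>k\<in>K. u K (h n (fst m k)) > thr n" for m
  proof -
    let ?a = "pull V n m"
    have b: "snd ?a \<in> fil n" using gb_fil[of "snd m" n] m(2) An_sub by (auto simp: pull_simps(1))
    then have a: "?a \<in> Ma V (Xn n)" using pull_mem[OF m(1)] unfolding mapspace_Xn by blast
    have "u K (fst ?a k) > thr n" if k: "K \<in> KK" "k \<in> K" for K k
    proof -
      have kV: "k \<in> pts V" by (rule proper_sets_pts[OF KK k])
      have "fst m k \<in> over (M n) (An n)" using mapspace_fibre[OF fM m(1) kV] m(2) by (auto simp: fibre_def)
      then have "fst ?a k = h n (fst m k)" using g_on_An pull_simps(2)[OF kV, of n m] by simp
      then show ?thesis using m(3)[rule_format, OF k] by simp
    qed
    then show ?thesis using goodD(2)[OF G a] m(1) by blast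
  qed
  have "\<exists>w. (\<forall>K\<in>KK. continuous_map (tot (M n)) euclideanreal (w K) \<and> (\<forall>x\<in>over (M n) (An n). w K x = u K (h n x))) \<and>
    (\<forall>a\<in>Ma V (M n). (above KK w a (thr (Suc n))) \<longrightarrow> a \<in> ?O)"
    by (rule bundle_extension[OF Mb CW An_closed V KK oO thr(2)]) (fact cont uO)+
  then obtain w where w: "\<forall>K\<in>KK. continuous_map (tot (M n)) euclideanreal (w K) \<and> (\<forall>x\<in>over (M n) (An n). w K x = u K (h n x))"
    "\<forall>a\<in>Ma V (M n). (above KK w a (thr (Suc n))) \<longrightarrow> a \<in> ?O"
    by (elim exE conjE)
  have "\<exists>z. good V O' (Suc n) KK z \<and> (\<forall>K\<in>KK. (\<forall>x\<in>over X (fil n). z K x = u K x) \<and>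
    (\<forall>y\<in>tpts (M n). z K (g n y) = w K y))"
  proof (rule good_glue[OF KK])
    show "continuous_map (tot (Xn n)) euclideanreal (u K)" if "K \<in> KK" for K by (rule goodD(1)[OF G that])
    show "continuous_map (tot (M n)) euclideanreal (w K)" if "K \<in> KK" for K using bspec[OF w(1) that] by blast
    show "w K y = u K (h n y)" if "K \<in> KK" "y \<in> over (M n) (An n)" for K y
      using bspec[OF w(1) that(1)] that(2) by blast
    show "a \<in> O'" if "a \<in> Ma V (Xn n)" "above KK u a (thr (Suc n))" for a
    proof (rule goodD(2)[OF G that(1)], intro ballI)
      fix K k assume "K \<in> KK" "k \<in> K"
      then show "u K (fst a k) > thr n" using that(2)[rule_format, of K k] thr(2)[of n] by simp
    qed
    show "pull V n m \<in> O'" if "m \<in> Ma V (M n)" "above KK w m (thr (Suc n))" for m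
      using bspec[OF w(2) that(1)] that(2) by blast
  qed
  then show ?thesis by blast
qed

text \<open>The construction starts at the first stage that contains the base point of
  \<open>a0\<close>. If that is not the lowest stage, \<open>a0\<close> lifts to a map into
  \<open>M m\<close> off \<open>A\<close>, and the functions found there are continued by zero over
  the earlier stages.\<close>

lemma strat_init:
  assumes gen: "generating TYPE('b) C V \<K>" and V: "V \<in> Obj C"
    and prp: "\<And>K W L. K \<in> \<K> \<Longrightarrow> W \<in> Obj C \<Longrightarrow> compactin (Fob C W) L \<Longrightarrow>
           compactin (Hom_top C V W) {\<phi> \<in> Hom C V W. Far C \<phi> ` K \<subseteq> L}"
    and K1: "K1 \<in> \<K>" "K1 \<noteq> {}" and a0: "a0 \<in> Ma V (Xn N)" "a0 \<in> O'"
    and H0: "lvl0 V O'" and H: "\<And>m. m < N \<Longrightarrow> lvlH V O' m"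
  shows "\<exists>n0 KK w. n0 \<le> N \<and> proper_sets V KK \<and> good V O' n0 KK w \<and> snd a0 \<in> fil n0 \<and>
    (\<forall>K\<in>KK. \<forall>k\<in>K. w K (fst a0 k) = 1)"
proof -
  define n0 where "n0 = (LEAST n. snd a0 \<in> fil n)"
  have aX: "a0 \<in> Ma V X" "snd a0 \<in> fil N" using a0 unfolding mapspace_Xn by blast+
  have n0: "snd a0 \<in> fil n0" "n0 \<le> N" unfolding n0_def using aX(2) by (rule LeastI, rule Least_le)
  have am: "a0 \<in> Ma V (Xn n0)" using aX n0 unfolding mapspace_Xn by blast
  show ?thesis
  proof (cases n0)
    case 0
    obtain E where CW: "CW_complex (base (Xn 0)) E" using strat_pushout(4)[OF S] unfolding base_Xn by blast
    let ?O = "{a \<in> Ma V (Xn 0). a \<in> O'}"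
    have oO: "openin (mapspace C V (Xn 0)) ?O" using H0 unfolding lvl0_def .
    have aO: "a0 \<in> ?O" using am a0(2) 0 by simp
    have "\<exists>KK w. proper_sets V KK \<and>
      (\<forall>K\<in>KK. continuous_map (tot (Xn 0)) euclideanreal (w K) \<and> (\<forall>x\<in>over (Xn 0) {}. w K x = 0) \<and> (\<forall>k\<in>K. w K (fst a0 k) = 1)) \<and>
      (\<forall>a\<in>Ma V (Xn 0). above KK w a (1/2) \<longrightarrow> a \<in> ?O)"
      by (rule init_function[OF gen V prp K1 X0 CW closedin_empty oO aO]) simp_all
    then obtain KK w where w: "proper_sets V KK"
      "\<forall>K\<in>KK. continuous_map (tot (Xn 0)) euclideanreal (w K) \<and> (\<forall>x\<in>over (Xn 0) {}. w K x = 0) \<and> (\<forall>k\<in>K. w K (fst a0 k) = 1)"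
      "\<forall>a\<in>Ma V (Xn 0). above KK w a (1/2) \<longrightarrow> a \<in> ?O"
      by (elim exE conjE)
    have "good V O' 0 KK w" unfolding good_def thr(1) using w(2,3) by simp
    moreover have "\<forall>K\<in>KK. \<forall>k\<in>K. w K (fst a0 k) = 1" using w(2) by simp
    ultimately show ?thesis using w(1) n0 0 by (intro exI[of _ n0] exI[of _ KK] exI[of _ w] conjI) simp_all
  next
    case (Suc m)
    obtain E where CW: "CW_complex (base (M m)) E" using strat_pushout(3)[OF S, of m] unfolding baseM by blast
    have "snd a0 \<notin> fil m" using not_less_Least[of m "\<lambda>n. snd a0 \<in> fil n"] Suc unfolding n0_def by simp
    then obtain m0 where m0: "m0 \<in> Ma V (M m)" "snd m0 \<notin> An m" "pull V m m0 = a0"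
      using pull_lift[of a0 V m] am Suc by blast
    let ?O = "{m' \<in> Ma V (M m). pull V m m' \<in> O'}"
    have mN: "m < N" using Suc n0(2) by simp
    have oO: "openin (mapspace C V (M m)) ?O" using H[OF mN] unfolding lvlH_def .
    have aO: "m0 \<in> ?O" using m0 a0(2) by simp
    have "\<exists>KK w. proper_sets V KK \<and>
      (\<forall>K\<in>KK. continuous_map (tot (M m)) euclideanreal (w K) \<and> (\<forall>x\<in>over (M m) (An m). w K x = 0) \<and> (\<forall>k\<in>K. w K (fst m0 k) = 1)) \<and>
      (\<forall>a\<in>Ma V (M m). above KK w a (1/2) \<longrightarrow> a \<in> ?O)"
      by (rule init_function[OF gen V prp K1 Mb CW An_closed oO aO m0(2)]) simp_all
    then obtain KK w where w: "proper_sets V KK"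
      "\<forall>K\<in>KK. continuous_map (tot (M m)) euclideanreal (w K) \<and> (\<forall>x\<in>over (M m) (An m). w K x = 0) \<and> (\<forall>k\<in>K. w K (fst m0 k) = 1)"
      "\<forall>a\<in>Ma V (M m). above KK w a (1/2) \<longrightarrow> a \<in> ?O"
      by (elim exE conjE)
    obtain K0 k0 where k0: "K0 \<in> KK" "k0 \<in> K0" using w(1) unfolding proper_sets_def by blast
    have "\<exists>z. good V O' (Suc m) KK z \<and> (\<forall>K\<in>KK. (\<forall>x\<in>over X (fil m). z K x = 0) \<and>
      (\<forall>y\<in>tpts (M m). z K (g m y) = w K y))"
    proof (rule good_glue[OF w(1)])
      show "continuous_map (tot (M m)) euclideanreal (w K)" if "K \<in> KK" for K using bspec[OF w(2) that] by blast
      show "w K y = 0" if "K \<in> KK" "y \<in> over (M m) (An m)" for K y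
        using bspec[OF w(2) that(1)] that(2) by blast
      \<comment> \<open>The zero function admits no map over the earlier stages, because the
        thresholds are positive and some \<open>K\<close> is nonempty.\<close>
      show "a \<in> O'" if "\<forall>K\<in>KK. \<forall>k\<in>K. (0::real) > thr (Suc m)" for a
      proof -
        have "0 > thr (Suc m)" using that k0 by blast
        then show ?thesis using thr(4)[of "Suc m"] by simp
      qed
      \<comment> \<open>Every threshold is at least 1/2, the value for which
        \<open>init_function\<close> gives its conclusion.\<close>
      show "pull V m a \<in> O'" if a: "a \<in> Ma V (M m)" "above KK w a (thr (Suc m))" for a
      proof -
        have "above KK w a (1/2)"
        proof (intro ballI)
          fix K k assume "K \<in> KK" "k \<in> K"
          then show "w K (fst a k) > 1/2" using a(2)[rule_format, of K k] thr(4)[of "Suc m"] by simp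
        qed
        then show ?thesis using bspec[OF w(3) a(1)] by blast
      qed
    qed simp
    then obtain z where z: "good V O' (Suc m) KK z"
      "\<forall>K\<in>KK. (\<forall>x\<in>over X (fil m). z K x = 0) \<and> (\<forall>y\<in>tpts (M m). z K (g m y) = w K y)"
      by (elim exE conjE)
    have "z K (fst a0 k) = 1" if k: "K \<in> KK" "k \<in> K" for K k
    proof -
      have kV: "k \<in> pts V" by (rule proper_sets_pts[OF w(1) k])
      have "fst m0 k \<in> tpts (M m)" using mapspace_fibre[OF fM m0(1) kV] by (simp add: fibre_def)
      moreover have "fst a0 k = g m (fst m0 k)" using pull_simps(2)[OF kV, of m m0] m0(3) by simp
      ultimately have "z K (fst a0 k) = w K (fst m0 k)" using bspec[OF z(2) k(1)] by simp
      then show ?thesis using bspec[OF w(2) k(1)] k(2) by simp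
    qed
    then show ?thesis using z(1) w(1) n0 Suc by (intro exI[of _ n0] exI[of _ KK] exI[of _ z] conjI) simp_all
  qed
qed

text \<open>With only empty sets available every nonempty open set of a function space is the whole
  space, and all maps have the same base point by \<open>generating_trivial\<close>. So
  \<open>a\<close> and \<open>a0\<close> come from the same piece, where the trace of
  \<open>O'\<close> is nonempty and hence everything.\<close>

lemma strat_trivial:
  assumes gen: "generating TYPE('b) C V \<K>" and V: "V \<in> Obj C" and K: "\<And>K. K \<in> \<K> \<Longrightarrow> K = {}"
    and a0: "a0 \<in> Ma V (Xn N)" "a0 \<in> O'" and a: "a \<in> Ma V (Xn N)"
    and H0: "lvl0 V O'" and H: "\<And>m. m < N \<Longrightarrow> lvlH V O' m"
  shows "a \<in> O'"
proof -
  have whole: "a2 \<in> U" if Y: "family C Y" and U: "openin (mapspace C V Y) U" "a1 \<in> U" and a2: "a2 \<in> Ma V Y"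
    for Y :: "('o, 'v, 'z, 'b) family" and U a1 a2
  proof -
    obtain KK U' where KU: "finite KK" "KK \<subseteq> \<K>" "\<forall>K\<in>KK. openin (tot Y) (U' K) \<and> fst a1 ` K \<subseteq> U' K"
      "\<forall>a'\<in>Ma V Y. (\<forall>K\<in>KK. fst a' ` K \<subseteq> U' K) \<longrightarrow> a' \<in> U"
      using generating_nbhd[OF gen V Y U] by (elim exE conjE)
    have "\<forall>K\<in>KK. fst a2 ` K \<subseteq> U' K" using KU(2) K by blast
    then show ?thesis using KU(4) a2 by blast
  qed
  have s: "snd a = snd a0" by (rule generating_trivial[OF gen V K])
  define n0 where "n0 = (LEAST n. snd a0 \<in> fil n)"
  have aX: "a0 \<in> Ma V X" "snd a0 \<in> fil N" "a \<in> Ma V X" using a0 a unfolding mapspace_Xn by blast+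
  have n0: "snd a0 \<in> fil n0" "n0 \<le> N" unfolding n0_def using aX(2) by (rule LeastI, rule Least_le)
  have am: "a0 \<in> Ma V (Xn n0)" "a \<in> Ma V (Xn n0)" using aX n0 s unfolding mapspace_Xn by simp_all
  show ?thesis
  proof (cases n0)
    case 0
    have "a \<in> {a \<in> Ma V (Xn 0). a \<in> O'}"
      by (rule whole[OF fXn H0[unfolded lvl0_def], of a0]) (use am a0(2) 0 in auto)
    then show ?thesis by blast
  next
    case (Suc m)
    have nm: "snd a0 \<notin> fil m" using not_less_Least[of m "\<lambda>n. snd a0 \<in> fil n"] Suc unfolding n0_def by simp
    obtain m0 where m0: "m0 \<in> Ma V (M m)" "pull V m m0 = a0" using pull_lift[of a0 V m] am(1) Suc nm by blast
    obtain m1 where m1: "m1 \<in> Ma V (M m)" "pull V m m1 = a" using pull_lift[of a V m] am(2) Suc nm s by auto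
    have mN: "m < N" using Suc n0(2) by simp
    have "m1 \<in> {m' \<in> Ma V (M m). pull V m m' \<in> O'}"
      by (rule whole[OF fM H[OF mN, unfolded lvlH_def], of m0]) (use m0 m1 a0(2) in auto)
    then show ?thesis using m1(2) by blast
  qed
qed

lemma NKC_generating:
  assumes "NKC TYPE('b) C" "V \<in> Obj C"
  shows "\<exists>\<K>. generating TYPE('b) C V \<K> \<and> (\<forall>K\<in>\<K>. \<forall>W\<in>Obj C. \<forall>L. compactin (Fob C W) L \<longrightarrow>
           compactin (Hom_top C V W) {\<phi> \<in> Hom C V W. Far C \<phi> ` K \<subseteq> L})"
  using assms unfolding NKC_def by blast

lemma openin_mapspace_values:
  assumes Y: "family C Y" and KK: "proper_sets V KK"
    and w: "\<And>K. K \<in> KK \<Longrightarrow> continuous_map (tot Y) euclideanreal (w K)"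
  shows "openin (mapspace C V Y) {a \<in> Ma V Y. above KK w a c}"
proof -
  let ?P = "\<lambda>K. {a \<in> Ma V Y. fst a ` K \<subseteq> {x \<in> tpts Y. w K x \<in> {c<..}}}"
  have o: "openin (mapspace C V Y) (?P K)" if K: "K \<in> KK" for K
  proof (rule openin_mapspace_basic)
    show "compactin (Fob C V) K" using KK K unfolding proper_sets_def by blast
    show "openin (tot Y) {x \<in> tpts Y. w K x \<in> {c<..}}"
      by (rule openin_continuous_map_preimage[OF w[OF K]]) simp
  qed
  have fin: "finite KK" using KK unfolding proper_sets_def by blast
  have "openin (mapspace C V Y) (Ma V Y \<inter> (\<Inter>K\<in>KK. ?P K))"
    by (rule finite_Inter_open[OF fin openin_topspace o])
  moreover have "Ma V Y \<inter> (\<Inter>K\<in>KK. ?P K) =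
      {a \<in> Ma V Y. above KK w a c}"
  proof -
    have "fst a k \<in> tpts Y" if "a \<in> Ma V Y" "K \<in> KK" "k \<in> K" for a K k
      using mapspace_fibre[OF Y that(1) proper_sets_pts[OF KK that(2,3)]] by (simp add: fibre_def)
    then show ?thesis by (auto simp: image_subset_iff)
  qed
  ultimately show ?thesis by simp
qed

lemma good_extend:
  assumes V: "V \<in> Obj C" and KK: "proper_sets V KK" and a: "a \<in> Ma V X" "snd a \<in> fil i"
    and u: "good V O' i KK u" "\<forall>K\<in>KK. \<forall>k\<in>K. u K (fst a k) = 1" and H: "lvlH V O' i"
  shows "\<exists>z. good V O' (Suc i) KK z \<and> (\<forall>K\<in>KK. \<forall>k\<in>K. z K (fst a k) = 1) \<and>
    (\<forall>K\<in>KK. \<forall>x\<in>over X (fil i). z K x = u K x)"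
proof -
  obtain z where z: "good V O' (Suc i) KK z" "\<forall>K\<in>KK. \<forall>x\<in>over X (fil i). z K x = u K x"
    using strat_step[OF V KK u(1) H] by (elim exE conjE)
  have "z K (fst a k) = 1" if k: "K \<in> KK" "k \<in> K" for K k
  proof -
    have "fst a k \<in> over X (fil i)" using a(2) mapspace_X_pt[OF a(1) proper_sets_pts[OF KK k]] by simp
    then have "z K (fst a k) = u K (fst a k)" using z(2) k(1) by blast
    then show ?thesis using u(2) k by simp
  qed
  then show ?thesis using z by (intro exI[of _ z] conjI ballI) simp_all
qed

text \<open>The functions of \<open>strat_init\<close> are carried up to stage \<open>N\<close>.
  There the maps on which they exceed the threshold form an open set around \<open>a0\<close>, since
  their values at \<open>a0\<close> are 1 and the threshold is below 3/4.\<close>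

lemma strat_open:
  assumes nkc: "NKC TYPE('b) C" and V: "V \<in> Obj C" and O': "O' \<subseteq> Ma V (Xn N)"
    and H0: "lvl0 V O'" and H: "\<And>m. m < N \<Longrightarrow> lvlH V O' m"
  shows "openin (mapspace C V (Xn N)) O'"
proof -
  obtain \<K> where gen: "generating TYPE('b) C V \<K>" and prp0: "\<forall>K\<in>\<K>. \<forall>W\<in>Obj C. \<forall>L. compactin (Fob C W) L \<longrightarrow>
           compactin (Hom_top C V W) {\<phi> \<in> Hom C V W. Far C \<phi> ` K \<subseteq> L}"
    using NKC_generating[OF nkc V] by (elim exE conjE)
  have prp: "\<And>K W L. K \<in> \<K> \<Longrightarrow> W \<in> Obj C \<Longrightarrow> compactin (Fob C W) L \<Longrightarrow>
           compactin (Hom_top C V W) {\<phi> \<in> Hom C V W. Far C \<phi> ` K \<subseteq> L}" using prp0 by blast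
  show ?thesis
  proof (cases "\<exists>K1\<in>\<K>. K1 \<noteq> {}")
    case True
    then obtain K1 where K1: "K1 \<in> \<K>" "K1 \<noteq> {}" by blast
    show ?thesis
    proof (rule openin_local)
      fix a0 assume a0: "a0 \<in> O'"
      have aN: "a0 \<in> Ma V (Xn N)" using a0 O' by blast
      have "\<exists>n0 KK w. n0 \<le> N \<and> proper_sets V KK \<and> good V O' n0 KK w \<and> snd a0 \<in> fil n0 \<and>
        (\<forall>K\<in>KK. \<forall>k\<in>K. w K (fst a0 k) = 1)"
        by (rule strat_init[OF gen V _ K1 aN a0 H0]) (fact prp H)+
      then obtain n0 KK w where w: "n0 \<le> N" "proper_sets V KK" "good V O' n0 KK w" "snd a0 \<in> fil n0"
        "\<forall>K\<in>KK. \<forall>k\<in>K. w K (fst a0 k) = 1" by (elim exE conjE)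
      have aX: "a0 \<in> Ma V X" using aN unfolding mapspace_Xn by blast
      have "n0 + j \<le> N \<Longrightarrow> \<exists>w. good V O' (n0 + j) KK w \<and> (\<forall>K\<in>KK. \<forall>k\<in>K. w K (fst a0 k) = 1)" for j
      proof (induction j)
        case 0
        then show ?case using w by auto
      next
        case (Suc j)
        then obtain u where u: "good V O' (n0 + j) KK u" "\<forall>K\<in>KK. \<forall>k\<in>K. u K (fst a0 k) = 1" by auto
        have Hj: "lvlH V O' (n0 + j)" using H Suc.prems by simp
        have "snd a0 \<in> fil (n0 + j)" using w(4) strat_fil_mono[OF S, of n0 "n0 + j"] by auto
        from good_extend[OF V w(2) aX this u Hj] show ?case by auto
      qed
      from this[of "N - n0"] w(1) obtain u where u: "good V O' N KK u" "\<forall>K\<in>KK. \<forall>k\<in>K. u K (fst a0 k) = 1" by auto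
      let ?P = "{a \<in> Ma V (Xn N). above KK u a (thr N)}"
      have "openin (mapspace C V (Xn N)) ?P" by (rule openin_mapspace_values[OF fXn w(2) goodD(1)[OF u(1)]])
      moreover have "a0 \<in> ?P" using aN u(2) thr(3)[of N] by simp
      moreover have "?P \<subseteq> O'" using goodD(2)[OF u(1)] by blast
      ultimately show "\<exists>P. openin (mapspace C V (Xn N)) P \<and> a0 \<in> P \<and> P \<subseteq> O'" by blast
    qed
  next
    case False
    then have e: "\<And>K. K \<in> \<K> \<Longrightarrow> K = {}" by blast
    show ?thesis
    proof (cases "O' = {}")
      case False
      then obtain a0 where a0: "a0 \<in> O'" by blast
      have aN: "a0 \<in> Ma V (Xn N)" using a0 O' by blast
      have "Ma V (Xn N) \<subseteq> O'" using strat_trivial[OF gen V e aN a0 _ H0 H] by blast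
      then have "O' = Ma V (Xn N)" using O' by blast
      then show ?thesis by simp
    qed simp
  qed
qed

text \<open>The functions of successive stages extend each other and define continuous functions on
  the colimit. All thresholds are below 3/4 and the values at \<open>a0\<close> are 1, so exceeding
  3/4 gives a single open set that lies in \<open>O'\<close> over every stage.\<close>

lemma strat_open_lim:
  assumes nkc: "NKC TYPE('b) C" and V: "V \<in> Obj C" and O': "O' \<subseteq> Ma V X"
    and H0: "lvl0 V O'" and H: "\<And>m. lvlH V O' m"
  shows "openin (mapspace C V X) O'"
proof -
  obtain \<K> where gen: "generating TYPE('b) C V \<K>" and prp0: "\<forall>K\<in>\<K>. \<forall>W\<in>Obj C. \<forall>L. compactin (Fob C W) L \<longrightarrow>
           compactin (Hom_top C V W) {\<phi> \<in> Hom C V W. Far C \<phi> ` K \<subseteq> L}"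
    using NKC_generating[OF nkc V] by (elim exE conjE)
  have prp: "\<And>K W L. K \<in> \<K> \<Longrightarrow> W \<in> Obj C \<Longrightarrow> compactin (Fob C W) L \<Longrightarrow>
           compactin (Hom_top C V W) {\<phi> \<in> Hom C V W. Far C \<phi> ` K \<subseteq> L}" using prp0 by blast
  have lev: "\<exists>N. a \<in> Ma V (Xn N)" if "a \<in> Ma V X" for a
  proof -
    have "snd a \<in> bpts X" by (rule mapspace_snd[OF fX that])
    then have "snd a \<in> (\<Union>n. fil n)" using strat_sub_topspace(3)[OF S] baseX by simp
    then show ?thesis using that unfolding mapspace_Xn by blast
  qed
  show ?thesis
  proof (cases "\<exists>K1\<in>\<K>. K1 \<noteq> {}")
    case True
    then obtain K1 where K1: "K1 \<in> \<K>" "K1 \<noteq> {}" by blast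
    show ?thesis
    proof (rule openin_local)
      fix a0 assume a0: "a0 \<in> O'"
      then have aX: "a0 \<in> Ma V X" using O' by blast
      then obtain N where aN: "a0 \<in> Ma V (Xn N)" using lev by blast
      have "\<exists>n0 KK w. n0 \<le> N \<and> proper_sets V KK \<and> good V O' n0 KK w \<and> snd a0 \<in> fil n0 \<and>
        (\<forall>K\<in>KK. \<forall>k\<in>K. w K (fst a0 k) = 1)"
        by (rule strat_init[OF gen V _ K1 aN a0 H0]) (fact prp | rule H)+
      then obtain n0 KK w where w: "n0 \<le> N" "proper_sets V KK" "good V O' n0 KK w" "snd a0 \<in> fil n0"
        "\<forall>K\<in>KK. \<forall>k\<in>K. w K (fst a0 k) = 1" by (elim exE conjE)
      define P where "P j u \<longleftrightarrow> good V O' (n0 + j) KK u \<and> (\<forall>K\<in>KK. \<forall>k\<in>K. u K (fst a0 k) = 1)" for j u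
      define R where "R j u z \<longleftrightarrow> (\<forall>K\<in>KK. \<forall>x\<in>over X (fil (n0 + j)). z K x = u K x)"
        for j and u z :: "'v set \<Rightarrow> 'x \<Rightarrow> real"
      have sa: "snd a0 \<in> fil (n0 + j)" for j using w(4) strat_fil_mono[OF S, of n0 "n0 + j"] by auto
      have "P 0 w" using w unfolding P_def by simp
      moreover have "\<exists>z. P (Suc j) z \<and> R j u z" if "P j u" for j u
      proof -
        have u: "good V O' (n0 + j) KK u" "\<forall>K\<in>KK. \<forall>k\<in>K. u K (fst a0 k) = 1" using that unfolding P_def by blast+
        obtain z where "good V O' (Suc (n0 + j)) KK z" "\<forall>K\<in>KK. \<forall>k\<in>K. z K (fst a0 k) = 1"
          "\<forall>K\<in>KK. \<forall>x\<in>over X (fil (n0 + j)). z K x = u K x"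
          using good_extend[OF V w(2) aX sa u H] by (elim exE conjE)
        then show ?thesis unfolding P_def R_def by (intro exI[of _ z]) simp
      qed
      ultimately obtain f where f: "\<And>j. P j (f j)" "\<And>j. R j (f j) (f (Suc j))"
        using dependent_nat_choice[of P R] by blast
      have stat: "f i K x = f j K x" if K: "K \<in> KK" and x: "x \<in> over X (fil (n0 + j))" and ij: "j \<le> i" for i j K x
        using ij
      proof (induction i rule: dec_induct)
        case (step i)
        have "x \<in> over X (fil (n0 + i))" using x strat_fil_mono[OF S, of "n0 + j" "n0 + i"] step(1) by auto
        then show ?case using f(2)[of i] K step(3) unfolding R_def by simp
      qed simp
      \<comment> \<open>The first stage, counted from \<open>n0\<close>, that contains the point; by
        \<open>stat\<close> all later functions agree with the one of that stage there.\<close>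
      define lv where "lv x = (LEAST j. prj X x \<in> fil (n0 + j))" for x
      define u where "u K x = f (lv x) K x" for K x
      have uf: "u K x = f j K x" if K: "K \<in> KK" and x: "x \<in> over X (fil (n0 + j))" for j K x
      proof -
        have p: "prj X x \<in> fil (n0 + j)" using x by blast
        have 1: "prj X x \<in> fil (n0 + lv x)" unfolding lv_def using p by (rule LeastI)
        have 2: "lv x \<le> j" unfolding lv_def using p by (rule Least_le)
        have "x \<in> over X (fil (n0 + lv x))" using x 1 by blast
        then show ?thesis unfolding u_def using stat[OF K _ 2] by simp
      qed
      have uc: "continuous_map (tot X) euclideanreal (u K)" if K: "K \<in> KK" for K
      proof (rule lim_Top_continuous[OF limX])
        fix n
        have "continuous_map (tot (Xn (n0 + n))) euclideanreal (f n K)"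
          using f(1)[of n] K goodD(1) unfolding P_def by blast
        then have "continuous_map (tot_on X (fil (n0 + n))) euclideanreal (u K)"
          unfolding fam_restrict_simps(1) by (rule continuous_map_eq) (use uf[OF K, of _ n] in auto)
        then show "continuous_map (tot_on X (fil n)) euclideanreal (u K)"
          by (rule continuous_map_from_subtopology_mono) (use strat_fil_mono[OF S, of n "n0 + n"] in auto)
      qed
      let ?P = "{a \<in> Ma V X. above KK u a (3/4)}"
      have "openin (mapspace C V X) ?P" by (rule openin_mapspace_values[OF fX w(2) uc])
      moreover have "a0 \<in> ?P"
      proof -
        have "u K (fst a0 k) = 1" if k: "K \<in> KK" "k \<in> K" for K k
        proof -
          have "fst a0 k \<in> over X (fil (n0 + 0))" using sa[of 0] mapspace_X_pt[OF aX proper_sets_pts[OF w(2) k]] by simp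
          from uf[OF k(1) this] show ?thesis using f(1)[of 0] k unfolding P_def by simp
        qed
        then show ?thesis using aX by simp
      qed
      moreover have "?P \<subseteq> O'"
      proof
        fix a assume a: "a \<in> ?P"
        then have aX: "a \<in> Ma V X" by blast
        then obtain N where "a \<in> Ma V (Xn N)" using lev by blast
        then have sn: "snd a \<in> fil (n0 + N)" unfolding mapspace_Xn using strat_fil_mono[OF S, of N "n0 + N"] by auto
        then have am: "a \<in> Ma V (Xn (n0 + N))" using aX unfolding mapspace_Xn by blast
        have "f N K (fst a k) > thr (n0 + N)" if k: "K \<in> KK" "k \<in> K" for K k
        proof -
          have "fst a k \<in> over X (fil (n0 + N))" using sn mapspace_X_pt[OF aX proper_sets_pts[OF w(2) k]] by simp
          from uf[OF k(1) this] have "f N K (fst a k) = u K (fst a k)" by simp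
          moreover have "u K (fst a k) > 3/4" using a k by blast
          ultimately show ?thesis using thr(3)[of "n0 + N"] by simp
        qed
        moreover have "good V O' (n0 + N) KK (f N)" using f(1)[of N] unfolding P_def by blast
        ultimately show "a \<in> O'" using goodD(2)[OF _ am] by blast
      qed
      ultimately show "\<exists>P. openin (mapspace C V X) P \<and> a0 \<in> P \<and> P \<subseteq> O'" by blast
    qed
  next
    case False
    then have e: "\<And>K. K \<in> \<K> \<Longrightarrow> K = {}" by blast
    show ?thesis
    proof (cases "O' = {}")
      case False
      then obtain a0 where a0: "a0 \<in> O'" by blast
      have "a \<in> O'" if aX: "a \<in> Ma V X" for a
      proof -
        have a0X: "a0 \<in> Ma V X" using a0 O' by blast
        obtain N where N: "a0 \<in> Ma V (Xn N)" using lev[OF a0X] by blast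
        have "snd a = snd a0" by (rule generating_trivial[OF gen V e])
        then have "a \<in> Ma V (Xn N)" using N aX unfolding mapspace_Xn by simp
        then show ?thesis using strat_trivial[OF gen V e N a0 _ H0 H] by blast
      qed
      then have "O' = Ma V X" using O' by blast
      then show ?thesis by simp
    qed simp
  qed
qed

end

text \<open>Lets the attached space be replaced by a homeomorphic copy, as the transport to normal
  form requires.\<close>

lemma pushout_Top_transport:
  assumes p: "pushout_Top (subtopology Y A) X Y Z f id id g" and A: "A \<subseteq> topspace Y"
    and k: "continuous_map Y' Y k" and k': "continuous_map Y Y' k'"
    and kk: "\<And>y. y \<in> topspace Y' \<Longrightarrow> k' (k y) = y" "\<And>y. y \<in> topspace Y \<Longrightarrow> k (k' y) = y"
    and A': "A' = {y \<in> topspace Y'. k y \<in> A}"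
  shows "pushout_Top (subtopology Y' A') X Y' Z (\<lambda>y. f (k y)) id id (\<lambda>y. g (k y))"
proof -
  note d = pushout_Top_inclusionD[OF p A]
  have kt: "k y \<in> topspace Y" if "y \<in> topspace Y'" for y using continuous_map_funspace[OF k] that by auto
  have k't: "k' y \<in> topspace Y'" if "y \<in> topspace Y" for y using continuous_map_funspace[OF k'] that by auto
  show ?thesis
  proof (rule pushout_Top_inclusionI)
    show "A' \<subseteq> topspace Y'" unfolding A' by blast
    have "continuous_map (subtopology Y' A') (subtopology Y A) k"
      using k unfolding A' by (auto simp: continuous_map_in_subtopology continuous_map_from_subtopology)
    from continuous_map_compose[OF this d(1)]
    show "continuous_map (subtopology Y' A') X (\<lambda>y. f (k y))" by (simp add: o_def)
    show "continuous_map X Z id" by (rule d(2))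
    show "continuous_map Y' Z (\<lambda>y. g (k y))" using continuous_map_compose[OF k d(3)] by (simp add: o_def)
    show "g (k a) = f (k a)" if "a \<in> A'" for a using d(4) that unfolding A' by blast
    show "topspace Z \<subseteq> topspace X \<union> (\<lambda>y. g (k y)) ` topspace Y'"
    proof
      fix z assume "z \<in> topspace Z"
      then consider "z \<in> topspace X" | y where "y \<in> topspace Y" "z = g y" using d(6) by auto
      then show "z \<in> topspace X \<union> (\<lambda>y. g (k y)) ` topspace Y'"
      proof cases
        case 2
        then show ?thesis using kk(2)[OF 2(1)] k't[OF 2(1)] by (intro UnI2 image_eqI[of _ _ "k' y"]) auto
      qed blast
    qed
    show "openin Z U" if U: "U \<subseteq> topspace Z" "openin X (topspace X \<inter> U)" "openin Y' {y \<in> topspace Y'. g (k y) \<in> U}" for U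
    proof (rule d(7)[OF U(1,2)])
      have "openin Y {y \<in> topspace Y. k' y \<in> {y \<in> topspace Y'. g (k y) \<in> U}}"
        by (rule openin_continuous_map_preimage[OF k' U(3)])
      moreover have "{y \<in> topspace Y. k' y \<in> {y \<in> topspace Y'. g (k y) \<in> U}} = {y \<in> topspace Y. g y \<in> U}"
        using kk(2) k't by auto
      ultimately show "openin Y {y \<in> topspace Y. g y \<in> U}" by simp
    qed
    show "inj_on (\<lambda>y. g (k y)) (topspace Y' - A')"
    proof (rule inj_onI)
      fix x y assume x: "x \<in> topspace Y' - A'" and y: "y \<in> topspace Y' - A'" and e: "g (k x) = g (k y)"
      have "k x \<in> topspace Y - A" "k y \<in> topspace Y - A" using x y kt unfolding A' by auto
      then have "k x = k y" using d(8) e by (auto simp: inj_on_def)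
      then have "k' (k x) = k' (k y)" by simp
      then show "x = y" using kk(1) x y by simp
    qed
    have "g (k y) \<notin> topspace X" if "y \<in> topspace Y' - A'" for y
      using pushout_Top_preimage[OF p A, of "k y"] kt that unfolding A' by auto
    then show "(\<lambda>y. g (k y)) ` (topspace Y' - A') \<inter> topspace X = {}" by auto
  qed
qed

context str_cat
begin

subsection \<open>Diagrams\<close>

lemma Arr_Hom: "\<alpha> \<in> Arr C \<Longrightarrow> \<alpha> \<in> Hom C (Src C \<alpha>) (Trg C \<alpha>)"
  by (simp add: Hom_def)

lemma Hom_Arr: "\<alpha> \<in> Hom C V W \<Longrightarrow> \<alpha> \<in> Arr C \<and> Src C \<alpha> = V \<and> Trg C \<alpha> = W"
  by (simp add: Hom_def)

context
  fixes D :: "('o, 'h, 'p, 'b) diagram"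
  assumes D: "diagram_family C D"
begin

lemma diagram_family_over: "diagram_over C D" using D unfolding diagram_family_def by (rule conjunct1)

lemma dprj_continuous: "V \<in> Obj C \<Longrightarrow> continuous_map (dsp D V) (dbase D) (dprj D V)"
  using diagram_family_over unfolding diagram_over_def by blast

lemma dprj_base: "V \<in> Obj C \<Longrightarrow> x \<in> dpts D V \<Longrightarrow> dprj D V x \<in> dbpts D"
  using continuous_map_funspace[OF dprj_continuous] by blast

lemma dact_continuous: "\<alpha> \<in> Hom C V W \<Longrightarrow> continuous_map (dsp D W) (dsp D V) (dact D \<alpha>)"
  using diagram_family_over unfolding diagram_over_def Hom_def by blast

lemma dact_top: "\<alpha> \<in> Hom C V W \<Longrightarrow> x \<in> dpts D W \<Longrightarrow> dact D \<alpha> x \<in> dpts D V"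
  using continuous_map_funspace[OF dact_continuous] by blast

lemma dprj_dact: "\<alpha> \<in> Hom C V W \<Longrightarrow> x \<in> dpts D W \<Longrightarrow> dprj D V (dact D \<alpha> x) = dprj D W x"
  using diagram_family_over unfolding diagram_over_def Hom_def by blast

lemma dact_Idn: "V \<in> Obj C \<Longrightarrow> x \<in> dpts D V \<Longrightarrow> dact D (Idn C V) x = x"
  using diagram_family_over unfolding diagram_over_def by blast

lemma dact_Comp: "\<alpha> \<in> Hom C U V \<Longrightarrow> \<beta> \<in> Hom C V W \<Longrightarrow> x \<in> dpts D W \<Longrightarrow>
    dact D (Comp C \<beta> \<alpha>) x = dact D \<alpha> (dact D \<beta> x)"
proof -
  have "\<forall>\<alpha> \<in> Arr C. \<forall>\<beta> \<in> Arr C. Trg C \<alpha> = Src C \<beta> \<longrightarrow>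
        (\<forall>x \<in> dpts D (Trg C \<beta>). dact D (Comp C \<beta> \<alpha>) x = dact D \<alpha> (dact D \<beta> x))"
    using diagram_family_over unfolding diagram_over_def by (elim conjE)
  then show "\<alpha> \<in> Hom C U V \<Longrightarrow> \<beta> \<in> Hom C V W \<Longrightarrow> x \<in> dpts D W \<Longrightarrow>
    dact D (Comp C \<beta> \<alpha>) x = dact D \<alpha> (dact D \<beta> x)" by (auto simp: Hom_def)
qed

lemma dob_Obj: "b \<in> dbpts D \<Longrightarrow> dob D b \<in> Obj C" using D unfolding diagram_family_def by blast

lemma dchart_homeo: "b \<in> dbpts D \<Longrightarrow> V \<in> Obj C \<Longrightarrow>
   homeomorphic_map (subtopology (dsp D V) (dfibre D b V)) (Hom_top C V (dob D b)) (dchart D b V)"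
  using D unfolding diagram_family_def by blast

lemma topspace_dfibre: "topspace (subtopology (dsp D V) (dfibre D b V)) = dfibre D b V" by (auto simp: dfibre_def)

lemma dfibreI: "x \<in> dpts D V \<Longrightarrow> x \<in> dfibre D (dprj D V x) V"
  by (simp add: dfibre_def)

lemma dchart_continuous: "b \<in> dbpts D \<Longrightarrow> V \<in> Obj C \<Longrightarrow>
   continuous_map (subtopology (dsp D V) (dfibre D b V)) (Hom_top C V (dob D b)) (dchart D b V)"
  using dchart_homeo homeomorphic_imp_continuous_map by blast

lemma dchart_Hom: "b \<in> dbpts D \<Longrightarrow> V \<in> Obj C \<Longrightarrow> x \<in> dfibre D b V \<Longrightarrow> dchart D b V x \<in> Hom C V (dob D b)"
  using continuous_map_funspace[OF dchart_continuous] topspace_dfibre by auto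

lemma dchart_inj: "b \<in> dbpts D \<Longrightarrow> V \<in> Obj C \<Longrightarrow> inj_on (dchart D b V) (dfibre D b V)"
  using homeomorphic_imp_injective_map[OF dchart_homeo] topspace_dfibre by simp

lemma dchart_surj:
  assumes "b \<in> dbpts D" "V \<in> Obj C" "\<phi> \<in> Hom C V (dob D b)"
  shows "\<exists>x\<in>dfibre D b V. dchart D b V x = \<phi>"
proof -
  have "dchart D b V ` dfibre D b V = Hom C V (dob D b)"
    using homeomorphic_imp_surjective_map[OF dchart_homeo[OF assms(1,2)]] topspace_dfibre by simp
  then show ?thesis using assms(3) by (metis imageE)
qed

lemma dchart_dact: "b \<in> dbpts D \<Longrightarrow> \<alpha> \<in> Hom C V W \<Longrightarrow> x \<in> dfibre D b W \<Longrightarrow>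
    dchart D b V (dact D \<alpha> x) = Comp C (dchart D b W x) \<alpha>"
  using D unfolding diagram_family_def Hom_def by blast

lemma dact_dfibre: "\<alpha> \<in> Hom C V W \<Longrightarrow> x \<in> dfibre D b W \<Longrightarrow> dact D \<alpha> x \<in> dfibre D b V"
  using dact_top dprj_dact by (simp add: dfibre_def)

end

lemma diag_mapD:
  assumes "diag_map C D E f fb"
  shows "continuous_map (dbase D) (dbase E) fb"
    "\<And>V. V \<in> Obj C \<Longrightarrow> continuous_map (dsp D V) (dsp E V) (f V)"
    "\<And>V x. V \<in> Obj C \<Longrightarrow> x \<in> dpts D V \<Longrightarrow> dprj E V (f V x) = fb (dprj D V x)"
    "\<And>V W \<alpha> x. \<alpha> \<in> Hom C V W \<Longrightarrow> x \<in> dpts D W \<Longrightarrow> f V (dact D \<alpha> x) = dact E \<alpha> (f W x)"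
    "\<And>b. b \<in> dbpts D \<Longrightarrow> \<exists>\<phi>. dfibre_arrow C D E f fb b \<phi>"
    "\<And>V x. V \<in> Obj C \<Longrightarrow> x \<in> dpts D V \<Longrightarrow> f V x \<in> dpts E V"
    "\<And>b. b \<in> dbpts D \<Longrightarrow> fb b \<in> dbpts E"
    "\<And>V b x. V \<in> Obj C \<Longrightarrow> x \<in> dfibre D b V \<Longrightarrow> f V x \<in> dfibre E (fb b) V"
proof -
  show 1: "continuous_map (dbase D) (dbase E) fb"
    and 2: "\<And>V. V \<in> Obj C \<Longrightarrow> continuous_map (dsp D V) (dsp E V) (f V)"
    and 3: "\<And>V x. V \<in> Obj C \<Longrightarrow> x \<in> dpts D V \<Longrightarrow> dprj E V (f V x) = fb (dprj D V x)"
    and "\<And>b. b \<in> dbpts D \<Longrightarrow> \<exists>\<phi>. dfibre_arrow C D E f fb b \<phi>"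
    using assms unfolding diag_map_def by simp_all
  show "\<And>V W \<alpha> x. \<alpha> \<in> Hom C V W \<Longrightarrow> x \<in> dpts D W \<Longrightarrow> f V (dact D \<alpha> x) = dact E \<alpha> (f W x)"
    using assms unfolding diag_map_def Hom_def by auto
  show 6: "\<And>V x. V \<in> Obj C \<Longrightarrow> x \<in> dpts D V \<Longrightarrow> f V x \<in> dpts E V"
    using continuous_map_funspace[OF 2] by blast
  show "\<And>b. b \<in> dbpts D \<Longrightarrow> fb b \<in> dbpts E" using continuous_map_funspace[OF 1] by blast
  show "\<And>V b x. V \<in> Obj C \<Longrightarrow> x \<in> dfibre D b V \<Longrightarrow> f V x \<in> dfibre E (fb b) V"
    using 3 6 by (simp add: dfibre_def)
qed

lemma diag_mapI:
  assumes "continuous_map (dbase D) (dbase E) fb"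
    "\<And>V. V \<in> Obj C \<Longrightarrow> continuous_map (dsp D V) (dsp E V) (f V)"
    "\<And>V x. V \<in> Obj C \<Longrightarrow> x \<in> dpts D V \<Longrightarrow> dprj E V (f V x) = fb (dprj D V x)"
    "\<And>V W \<alpha> x. \<alpha> \<in> Hom C V W \<Longrightarrow> x \<in> dpts D W \<Longrightarrow> f V (dact D \<alpha> x) = dact E \<alpha> (f W x)"
    "\<And>b. b \<in> dbpts D \<Longrightarrow> \<exists>\<phi>. dfibre_arrow C D E f fb b \<phi>"
  shows "diag_map C D E f fb" using assms unfolding diag_map_def by (simp add: Hom_def)

lemma dfibre_arrow_comp:
  assumes D: "diagram_family C D" and b: "b \<in> dbpts D" and f: "diag_map C D E f fb"
    and \<phi>: "dfibre_arrow C D E f fb b \<phi>" and \<psi>: "dfibre_arrow C E F g gb (fb b) \<psi>"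
  shows "dfibre_arrow C D F (\<lambda>V x. g V (f V x)) (\<lambda>b. gb (fb b)) b (Comp C \<psi> \<phi>)"
proof -
  have p: "\<phi> \<in> Hom C (dob D b) (dob E (fb b))" and q: "\<psi> \<in> Hom C (dob E (fb b)) (dob F (gb (fb b)))"
    using \<phi> \<psi> unfolding dfibre_arrow_def by blast+
  have "dchart F (gb (fb b)) V (g V (f V x)) = Comp C (Comp C \<psi> \<phi>) (dchart D b V x)"
    if V: "V \<in> Obj C" and x: "x \<in> dfibre D b V" for V x
  proof -
    have "dchart F (gb (fb b)) V (g V (f V x)) = Comp C \<psi> (dchart E (fb b) V (f V x))"
      using \<psi> diag_mapD(8)[OF f V x] V unfolding dfibre_arrow_def by blast
    also have "\<dots> = Comp C \<psi> (Comp C \<phi> (dchart D b V x))"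
      using \<phi> V x unfolding dfibre_arrow_def by simp
    also have "\<dots> = Comp C (Comp C \<psi> \<phi>) (dchart D b V x)"
      by (rule Comp_assoc[OF dchart_Hom[OF D b V x] p q])
    finally show ?thesis .
  qed
  then show ?thesis unfolding dfibre_arrow_def using Comp_Hom[OF p q] by blast
qed

lemma diag_map_comp:
  assumes D: "diagram_family C D" and f: "diag_map C D E f fb" and g: "diag_map C E F g gb"
  shows "diag_map C D F (\<lambda>V x. g V (f V x)) (\<lambda>b. gb (fb b))"
proof (rule diag_mapI)
  show "continuous_map (dbase D) (dbase F) (\<lambda>b. gb (fb b))"
    using continuous_map_compose[OF diag_mapD(1)[OF f] diag_mapD(1)[OF g]] by (simp add: o_def)
  show "continuous_map (dsp D V) (dsp F V) (\<lambda>x. g V (f V x))" if "V \<in> Obj C" for V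
    using continuous_map_compose[OF diag_mapD(2)[OF f that] diag_mapD(2)[OF g that]] by (simp add: o_def)
  show "dprj F V (g V (f V x)) = gb (fb (dprj D V x))" if "V \<in> Obj C" "x \<in> dpts D V" for V x
    using diag_mapD(3)[OF g that(1) diag_mapD(6)[OF f that]] diag_mapD(3)[OF f that] by simp
  show "g V (f V (dact D \<alpha> x)) = dact F \<alpha> (g W (f W x))" if "\<alpha> \<in> Hom C V W" "x \<in> dpts D W" for V W \<alpha> x
    using diag_mapD(4)[OF f that] diag_mapD(4)[OF g that(1) diag_mapD(6)[OF f _ that(2)]] Hom_Obj[OF that(1)] by simp
  show "\<exists>\<phi>. dfibre_arrow C D F (\<lambda>V x. g V (f V x)) (\<lambda>b. gb (fb b)) b \<phi>" if b: "b \<in> dbpts D" for b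
  proof -
    obtain \<phi> where "dfibre_arrow C D E f fb b \<phi>" using diag_mapD(5)[OF f b] by blast
    moreover obtain \<psi> where "dfibre_arrow C E F g gb (fb b) \<psi>"
      using diag_mapD(5)[OF g diag_mapD(7)[OF f b]] by blast
    ultimately show ?thesis using dfibre_arrow_comp[OF D b f] by blast
  qed
qed

lemma dfibre_arrow_cong:
  assumes "dfibre_arrow C D E f fb b \<phi>" "\<And>V x. V \<in> Obj C \<Longrightarrow> x \<in> dfibre D b V \<Longrightarrow> f V x = f' V x" "fb b = fb' b"
  shows "dfibre_arrow C D E f' fb' b \<phi>" using assms unfolding dfibre_arrow_def by simp

lemma diag_map_cong:
  assumes D: "diagram_family C D" and f: "diag_map C D E f fb"
    and e: "\<And>V x. V \<in> Obj C \<Longrightarrow> x \<in> dpts D V \<Longrightarrow> f V x = f' V x"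
    and eb: "\<And>b. b \<in> dbpts D \<Longrightarrow> fb b = fb' b"
  shows "diag_map C D E f' fb'"
proof (rule diag_mapI)
  show "continuous_map (dbase D) (dbase E) fb'" by (rule continuous_map_eq[OF diag_mapD(1)[OF f] eb])
  show "continuous_map (dsp D V) (dsp E V) (f' V)" if "V \<in> Obj C" for V
    by (rule continuous_map_eq[OF diag_mapD(2)[OF f that] e[OF that]])
  show "dprj E V (f' V x) = fb' (dprj D V x)" if "V \<in> Obj C" "x \<in> dpts D V" for V x
    using diag_mapD(3)[OF f that] e[OF that] eb[OF dprj_base[OF D that]] by simp
  show "f' V (dact D \<alpha> x) = dact E \<alpha> (f' W x)" if a: "\<alpha> \<in> Hom C V W" "x \<in> dpts D W" for V W \<alpha> x
  proof -
    have "V \<in> Obj C" "W \<in> Obj C" using Hom_Obj[OF a(1)] by auto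
    then show ?thesis using diag_mapD(4)[OF f a] e[of V "dact D \<alpha> x"] e[of W x] dact_top[OF D a] a(2) by simp
  qed
  show "\<exists>\<phi>. dfibre_arrow C D E f' fb' b \<phi>" if b: "b \<in> dbpts D" for b
  proof -
    obtain \<phi> where "dfibre_arrow C D E f fb b \<phi>" using diag_mapD(5)[OF f b] by blast
    then have "dfibre_arrow C D E f' fb' b \<phi>"
      by (rule dfibre_arrow_cong) (use e eb[OF b] in \<open>auto simp: dfibre_def\<close>)
    then show ?thesis by blast
  qed
qed

abbreviation dover :: "('o, 'h, 'p, 'b) diagram \<Rightarrow> 'o \<Rightarrow> 'b set \<Rightarrow> 'p set" where
  "dover D V U \<equiv> {x \<in> dpts D V. dprj D V x \<in> U}"

lemma diag_restrict_simps [simp]: "dsp (diag_restrict D U) V = subtopology (dsp D V) (dover D V U)"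
  "dbase (diag_restrict D U) = subtopology (dbase D) U"
  "dprj (diag_restrict D U) = dprj D" "dact (diag_restrict D U) = dact D" "dob (diag_restrict D U) = dob D"
  "dchart (diag_restrict D U) = dchart D" by (simp_all add: diag_restrict_def)

lemma dfibre_restrict: "b \<in> U \<Longrightarrow> dfibre (diag_restrict (D :: ('o, 'h, 'p, 'b) diagram) U) b V = dfibre D b V"
  by (auto simp: dfibre_def)

lemma diagram_family_restrict:
  assumes D: "diagram_family C D"
  shows "diagram_family C (diag_restrict D U)"
  unfolding diagram_family_def
proof (intro conjI ballI)
  have act: "dact D \<alpha> x \<in> dover D V U" if "\<alpha> \<in> Hom C V W" "x \<in> dover D W U" for \<alpha> x V W
    using dact_top[OF D that(1)] dprj_dact[OF D that(1)] that(2) by simp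
  show "diagram_over C (diag_restrict D U)"
    unfolding diagram_over_def
  proof (intro conjI ballI impI)
    show "continuous_map (dsp (diag_restrict D U) V) (dbase (diag_restrict D U)) (dprj (diag_restrict D U) V)"
      if "V \<in> Obj C" for V
      using dprj_continuous[OF D that] by (auto simp: continuous_map_in_subtopology continuous_map_from_subtopology)
  next
    fix \<alpha> assume "\<alpha> \<in> Arr C"
    then have a: "\<alpha> \<in> Hom C (Src C \<alpha>) (Trg C \<alpha>)" by (rule Arr_Hom)
    show "continuous_map (dsp (diag_restrict D U) (Trg C \<alpha>)) (dsp (diag_restrict D U) (Src C \<alpha>)) (dact (diag_restrict D U) \<alpha>)"
      using dact_continuous[OF D a] act[OF a] by (auto simp: continuous_map_in_subtopology continuous_map_from_subtopology)
    show "dprj (diag_restrict D U) (Src C \<alpha>) (dact (diag_restrict D U) \<alpha> x) = dprj (diag_restrict D U) (Trg C \<alpha>) x"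
      if "x \<in> dpts (diag_restrict D U) (Trg C \<alpha>)" for x using dprj_dact[OF D a, of x] that by simp
  next
    show "dact (diag_restrict D U) (Idn C V) x = x" if "V \<in> Obj C" "x \<in> dpts (diag_restrict D U) V" for V x
      using dact_Idn[OF D that(1), of x] that(2) by simp
  next
    fix \<alpha> \<beta> x assume a: "\<alpha> \<in> Arr C" "\<beta> \<in> Arr C" "Trg C \<alpha> = Src C \<beta>"
      and x: "x \<in> dpts (diag_restrict D U) (Trg C \<beta>)"
    show "dact (diag_restrict D U) (Comp C \<beta> \<alpha>) x = dact (diag_restrict D U) \<alpha> (dact (diag_restrict D U) \<beta> x)"
      using dact_Comp[OF D Arr_Hom[OF a(1), unfolded a(3)] Arr_Hom[OF a(2)], of x] x by simp
  qed
  fix b assume "b \<in> dbpts (diag_restrict D U)"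
  then have b: "b \<in> dbpts D" "b \<in> U" by auto
  show "dob (diag_restrict D U) b \<in> Obj C" using dob_Obj[OF D b(1)] by simp
  show "homeomorphic_map (subtopology (dsp (diag_restrict D U) V) (dfibre (diag_restrict D U) b V))
      (Hom_top C V (dob (diag_restrict D U) b)) (dchart (diag_restrict D U) b V)" if V: "V \<in> Obj C" for V
  proof -
    have "dover D V U \<inter> dfibre D b V = dfibre D b V" using b(2) by (auto simp: dfibre_def)
    then show ?thesis using dchart_homeo[OF D b(1) V] by (simp add: dfibre_restrict[OF b(2)] subtopology_subtopology)
  qed
  show "dchart (diag_restrict D U) b (Src C \<alpha>) (dact (diag_restrict D U) \<alpha> x) =
      Comp C (dchart (diag_restrict D U) b (Trg C \<alpha>) x) \<alpha>"
    if "\<alpha> \<in> Arr C" "x \<in> dfibre (diag_restrict D U) b (Trg C \<alpha>)" for \<alpha> x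
    using dchart_dact[OF D b(1) Arr_Hom[OF that(1)], of x] that(2) by (simp add: dfibre_restrict[OF b(2)])
qed

lemma diag_map_restrict:
  assumes D: "diagram_family C D" and f: "diag_map C D E f id"
  shows "diag_map C (diag_restrict D U) (diag_restrict E U) f id"
proof (rule diag_mapI)
  show "continuous_map (dbase (diag_restrict D U)) (dbase (diag_restrict E U)) id"
    using diag_mapD(1)[OF f] by (auto simp: continuous_map_in_subtopology continuous_map_from_subtopology)
  show "continuous_map (dsp (diag_restrict D U) V) (dsp (diag_restrict E U) V) (f V)" if V: "V \<in> Obj C" for V
    using diag_mapD(2)[OF f V] diag_mapD(3,6)[OF f V]
    by (auto simp: continuous_map_in_subtopology continuous_map_from_subtopology)
  show "\<exists>\<phi>. dfibre_arrow C (diag_restrict D U) (diag_restrict E U) f id b \<phi>"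
    if "b \<in> dbpts (diag_restrict D U)" for b
    using diag_mapD(5)[OF f, of b] that by (auto simp: dfibre_arrow_def dfibre_restrict)
qed (use diag_mapD(3,4)[OF f] in auto)


subsection \<open>Diagrams in normal form\<close>

text \<open>The same device as \<open>flat_pt\<close>: attached diagrams are required to have points
  in \<open>'b \<times> 'h\<close>, and base point and chart value determine a point.\<close>

definition dflat_pt :: "('o, 'h, 'p, 'b) diagram \<Rightarrow> 'o \<Rightarrow> 'p \<Rightarrow> 'b \<times> 'h" where
  "dflat_pt D V x = (dprj D V x, dchart D (dprj D V x) V x)"

definition dunflat_pt :: "('o, 'h, 'p, 'b) diagram \<Rightarrow> 'o \<Rightarrow> 'b \<times> 'h \<Rightarrow> 'p" where
  "dunflat_pt D V = inv_into (dpts D V) (dflat_pt D V)"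

definition dflat :: "('o, 'h, 'p, 'b) diagram \<Rightarrow> ('o, 'h, 'b \<times> 'h, 'b) diagram" where
  "dflat D = \<lparr>dsp = (\<lambda>V. transport_topology (dflat_pt D V) (dsp D V)), dbase = dbase D, dprj = (\<lambda>_. fst),
     dact = (\<lambda>\<alpha> (b, \<phi>). (b, Comp C \<phi> \<alpha>)), dob = dob D, dchart = (\<lambda>_ _. snd)\<rparr>"

lemma dflat_simps [simp]:
  "dsp (dflat (D :: ('o, 'h, 'p, 'b) diagram)) V = transport_topology (dflat_pt D V) (dsp D V)"
  "dbase (dflat (D :: ('o, 'h, 'p, 'b) diagram)) = dbase D" "dprj (dflat (D :: ('o, 'h, 'p, 'b) diagram)) = (\<lambda>_. fst)"
  "dact (dflat (D :: ('o, 'h, 'p, 'b) diagram)) = (\<lambda>\<alpha> (b, \<phi>). (b, Comp C \<phi> \<alpha>))"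
  "dob (dflat (D :: ('o, 'h, 'p, 'b) diagram)) = dob D" "dchart (dflat (D :: ('o, 'h, 'p, 'b) diagram)) = (\<lambda>_ _. snd)"
  by (simp_all add: dflat_def)

context
  fixes D :: "('o, 'h, 'p, 'b) diagram"
  assumes D: "diagram_family C D"
begin

lemma dflat_inj:
  assumes V: "V \<in> Obj C"
  shows "inj_on (dflat_pt D V) (dpts D V)"
proof (rule inj_onI)
  fix x y assume x: "x \<in> dpts D V" and y: "y \<in> dpts D V" and e: "dflat_pt D V x = dflat_pt D V y"
  have b: "dprj D V x = dprj D V y" "dchart D (dprj D V x) V x = dchart D (dprj D V x) V y"
    using e by (auto simp: dflat_pt_def)
  have "y \<in> dfibre D (dprj D V x) V" unfolding b(1) by (rule dfibreI[OF D y])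
  then show "x = y" using dchart_inj[OF D dprj_base[OF D V x] V] dfibreI[OF D x] b(2) by (auto simp: inj_on_def)
qed

lemma dflat_continuous: "V \<in> Obj C \<Longrightarrow> continuous_map (dsp D V) (dsp (dflat D) V) (dflat_pt D V)"
  unfolding dflat_simps(1) by (rule homeomorphic_imp_continuous_map[OF homeomorphic_map_transport(1)[OF dflat_inj]])

lemma dunflat_continuous: "V \<in> Obj C \<Longrightarrow> continuous_map (dsp (dflat D) V) (dsp D V) (dunflat_pt D V)"
  using homeomorphic_map_transport(2)[OF dflat_inj] by (simp add: dunflat_pt_def)

lemma topspace_dflat: "V \<in> Obj C \<Longrightarrow> dpts (dflat D) V = dflat_pt D V ` dpts D V"
  using homeomorphic_map_transport(3)[OF dflat_inj] by simp

lemma dunflat_dflat: "V \<in> Obj C \<Longrightarrow> x \<in> dpts D V \<Longrightarrow> dunflat_pt D V (dflat_pt D V x) = x"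
  unfolding dunflat_pt_def by (rule inv_into_f_f[OF dflat_inj])

lemma dflat_dunflat: "V \<in> Obj C \<Longrightarrow> y \<in> dpts (dflat D) V \<Longrightarrow> dflat_pt D V (dunflat_pt D V y) = y"
  unfolding dunflat_pt_def topspace_dflat by (rule f_inv_into_f)

lemma dunflat_top: "V \<in> Obj C \<Longrightarrow> y \<in> dpts (dflat D) V \<Longrightarrow> dunflat_pt D V y \<in> dpts D V"
  using continuous_map_funspace[OF dunflat_continuous] by blast

lemma dflat_top: "V \<in> Obj C \<Longrightarrow> x \<in> dpts D V \<Longrightarrow> dflat_pt D V x \<in> dpts (dflat D) V"
  using continuous_map_funspace[OF dflat_continuous] by blast

lemma dunflat_chart:
  assumes V: "V \<in> Obj C" and y: "y \<in> dpts (dflat D) V"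
  shows "dprj D V (dunflat_pt D V y) = fst y" "dchart D (fst y) V (dunflat_pt D V y) = snd y"
proof -
  show 1: "dprj D V (dunflat_pt D V y) = fst y"
    using arg_cong[OF dflat_dunflat[OF V y], of fst] by (simp add: dflat_pt_def)
  show "dchart D (fst y) V (dunflat_pt D V y) = snd y"
    using arg_cong[OF dflat_dunflat[OF V y], of snd] 1 by (simp add: dflat_pt_def)
qed

lemma dflat_dact:
  assumes a: "\<alpha> \<in> Hom C V W" and x: "x \<in> dpts D W"
  shows "dact (dflat D) \<alpha> (dflat_pt D W x) = dflat_pt D V (dact D \<alpha> x)"
proof -
  have o: "V \<in> Obj C" "W \<in> Obj C" using Hom_Obj[OF a] by auto
  show ?thesis
    using dprj_dact[OF D a x] dchart_dact[OF D dprj_base[OF D o(2) x] a dfibreI[OF D x]] by (simp add: dflat_pt_def)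
qed

lemma dfibre_dflat:
  assumes V: "V \<in> Obj C"
  shows "x \<in> dfibre D b V \<Longrightarrow> dflat_pt D V x \<in> dfibre (dflat D) b V"
    "y \<in> dfibre (dflat D) b V \<Longrightarrow> dunflat_pt D V y \<in> dfibre D b V"
  using dflat_top[OF V] dunflat_top[OF V] dunflat_chart(1)[OF V] by (auto simp: dfibre_def dflat_pt_def)

lemma dflat_family: "diagram_family C (dflat D)"
  unfolding diagram_family_def
proof (intro conjI ballI)
  let ?E = "dflat D"
  \<comment> \<open>The action of the normal form is composition by definition; expressing it
    through the action of \<open>D\<close> transfers continuity and the functor laws.\<close>
  have act: "dact ?E \<alpha> y = dflat_pt D V (dact D \<alpha> (dunflat_pt D W y))"
    if a: "\<alpha> \<in> Hom C V W" and y: "y \<in> dpts ?E W" for \<alpha> V W y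
  proof -
    have W: "W \<in> Obj C" using Hom_Obj[OF a] by simp
    show ?thesis using dflat_dact[OF a dunflat_top[OF W y]] dflat_dunflat[OF W y] by simp
  qed
  show "diagram_over C ?E"
    unfolding diagram_over_def
  proof (intro conjI ballI impI)
    fix V assume V: "V \<in> Obj C"
    have "continuous_map (dsp ?E V) (dbase D) (dprj D V \<circ> dunflat_pt D V)"
      by (rule continuous_map_compose[OF dunflat_continuous[OF V] dprj_continuous[OF D V]])
    then show "continuous_map (dsp ?E V) (dbase ?E) (dprj ?E V)"
      unfolding dflat_simps(2,3) by (rule continuous_map_eq) (simp add: dunflat_chart(1)[OF V])
  next
    fix \<alpha> assume "\<alpha> \<in> Arr C"
    then have a: "\<alpha> \<in> Hom C (Src C \<alpha>) (Trg C \<alpha>)" by (rule Arr_Hom)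
    then have o: "Src C \<alpha> \<in> Obj C" "Trg C \<alpha> \<in> Obj C" using Hom_Obj by auto
    have "continuous_map (dsp ?E (Trg C \<alpha>)) (dsp ?E (Src C \<alpha>))
        (dflat_pt D (Src C \<alpha>) \<circ> (dact D \<alpha> \<circ> dunflat_pt D (Trg C \<alpha>)))"
      by (intro continuous_map_compose[OF _ dflat_continuous[OF o(1)]]
          continuous_map_compose[OF dunflat_continuous[OF o(2)] dact_continuous[OF D a]])
    then show "continuous_map (dsp ?E (Trg C \<alpha>)) (dsp ?E (Src C \<alpha>)) (dact ?E \<alpha>)"
      by (rule continuous_map_eq) (simp only: act[OF a] o_def)
    show "dprj ?E (Src C \<alpha>) (dact ?E \<alpha> x) = dprj ?E (Trg C \<alpha>) x" for x
      by (simp add: case_prod_unfold)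
  next
    fix V x assume V: "V \<in> Obj C" and x: "x \<in> dpts ?E V"
    show "dact ?E (Idn C V) x = x"
      unfolding act[OF Idn_Hom[OF V] x] dact_Idn[OF D V dunflat_top[OF V x]] by (rule dflat_dunflat[OF V x])
  next
    fix \<alpha> \<beta> x assume a: "\<alpha> \<in> Arr C" "\<beta> \<in> Arr C" "Trg C \<alpha> = Src C \<beta>"
      and x: "x \<in> dpts ?E (Trg C \<beta>)"
    note a1 = Arr_Hom[OF a(1), unfolded a(3)] and a2 = Arr_Hom[OF a(2)]
    have o: "Src C \<beta> \<in> Obj C" "Trg C \<beta> \<in> Obj C" using Hom_Obj[OF a2] by auto
    let ?x = "dunflat_pt D (Trg C \<beta>) x"
    have xt: "?x \<in> dpts D (Trg C \<beta>)" by (rule dunflat_top[OF o(2) x])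
    have "dact ?E \<alpha> (dact ?E \<beta> x) = dact ?E \<alpha> (dflat_pt D (Src C \<beta>) (dact D \<beta> ?x))" by (simp only: act[OF a2 x])
    also have "\<dots> = dflat_pt D (Src C \<alpha>) (dact D \<alpha> (dact D \<beta> ?x))"
      by (rule dflat_dact[OF a1 dact_top[OF D a2 xt]])
    also have "\<dots> = dflat_pt D (Src C \<alpha>) (dact D (Comp C \<beta> \<alpha>) ?x)" by (simp only: dact_Comp[OF D a1 a2 xt])
    also have "\<dots> = dact ?E (Comp C \<beta> \<alpha>) x" by (simp only: act[OF Comp_Hom[OF a1 a2] x])
    finally show "dact ?E (Comp C \<beta> \<alpha>) x = dact ?E \<alpha> (dact ?E \<beta> x)" by simp
  qed
  fix b assume "b \<in> dbpts ?E"
  then have b: "b \<in> dbpts D" by simp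
  show "dob ?E b \<in> Obj C" using dob_Obj[OF D b] by simp
  show "homeomorphic_map (subtopology (dsp ?E V) (dfibre ?E b V)) (Hom_top C V (dob ?E b)) (dchart ?E b V)"
    if V: "V \<in> Obj C" for V
  proof -
    let ?T = "subtopology (dsp ?E V) (dfibre ?E b V)" and ?F = "subtopology (dsp D V) (dfibre D b V)"
    have "continuous_map ?T ?F (dunflat_pt D V)"
      using continuous_map_from_subtopology[OF dunflat_continuous[OF V]] dfibre_dflat(2)[OF V]
      by (auto simp: continuous_map_in_subtopology)
    moreover have "continuous_map ?F ?T (dflat_pt D V)"
      using continuous_map_from_subtopology[OF dflat_continuous[OF V]] dfibre_dflat(1)[OF V]
      by (auto simp: continuous_map_in_subtopology)
    ultimately have "homeomorphic_maps ?T ?F (dunflat_pt D V) (dflat_pt D V)"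
      unfolding homeomorphic_maps_def using dflat_dunflat[OF V] dunflat_dflat[OF V] by simp
    then have "homeomorphic_map ?T ?F (dunflat_pt D V)" by (rule homeomorphic_maps_imp_map)
    from homeomorphic_map_compose[OF this dchart_homeo[OF D b V]]
    have "homeomorphic_map ?T (Hom_top C V (dob D b)) (dchart D b V \<circ> dunflat_pt D V)" .
    then have "homeomorphic_map ?T (Hom_top C V (dob D b)) snd"
    proof (rule homeomorphic_map_eq)
      fix y assume "y \<in> topspace ?T"
      then have y: "y \<in> dpts ?E V" "fst y = b" unfolding dfibre_def by auto
      show "(dchart D b V \<circ> dunflat_pt D V) y = snd y" using dunflat_chart(2)[OF V y(1)] y(2) by simp
    qed
    then show ?thesis by simp
  qed
  show "dchart ?E b (Src C \<alpha>) (dact ?E \<alpha> x) = Comp C (dchart ?E b (Trg C \<alpha>) x) \<alpha>" for \<alpha> x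
    by (simp add: case_prod_unfold)
qed

lemma dflat_map:
  shows "diag_map C D (dflat D) (dflat_pt D) id" "diag_map C (dflat D) D (dunflat_pt D) id"
    "b \<in> dbpts D \<Longrightarrow> dfibre_arrow C D (dflat D) (dflat_pt D) id b (Idn C (dob D b))"
    "b \<in> dbpts D \<Longrightarrow> dfibre_arrow C (dflat D) D (dunflat_pt D) id b (Idn C (dob D b))"
proof -
  show 1: "dfibre_arrow C D (dflat D) (dflat_pt D) id b (Idn C (dob D b))" if b: "b \<in> dbpts D" for b
    unfolding dfibre_arrow_def
  proof (intro conjI ballI)
    show "Idn C (dob D b) \<in> Hom C (dob D b) (dob (dflat D) (id b))" using Idn_Hom[OF dob_Obj[OF D b]] by simp
    fix V x assume V: "V \<in> Obj C" and x: "x \<in> dfibre D b V"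
    show "dchart (dflat D) (id b) V (dflat_pt D V x) = Comp C (Idn C (dob D b)) (dchart D b V x)"
      using Comp_Idn(2)[OF dchart_Hom[OF D b V x]] x by (simp add: dflat_pt_def dfibre_def)
  qed
  show 2: "dfibre_arrow C (dflat D) D (dunflat_pt D) id b (Idn C (dob D b))" if b: "b \<in> dbpts D" for b
    unfolding dfibre_arrow_def
  proof (intro conjI ballI)
    show "Idn C (dob D b) \<in> Hom C (dob (dflat D) b) (dob D (id b))" using Idn_Hom[OF dob_Obj[OF D b]] by simp
    fix V y assume V: "V \<in> Obj C" and y: "y \<in> dfibre (dflat D) b V"
    have yt: "y \<in> dpts (dflat D) V" "fst y = b" using y by (auto simp: dfibre_def)
    have "dchart D b V (dunflat_pt D V y) = snd y" using dunflat_chart(2)[OF V yt(1)] yt(2) by simp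
    moreover have "snd y \<in> Hom C V (dob D b)" using dchart_Hom[OF D b V dfibre_dflat(2)[OF V y]] calculation by simp
    ultimately show "dchart D (id b) V (dunflat_pt D V y) = Comp C (Idn C (dob D b)) (dchart (dflat D) b V y)"
      using Comp_Idn(2) by simp
  qed
  show "diag_map C D (dflat D) (dflat_pt D) id"
  proof (rule diag_mapI)
    show "continuous_map (dsp D V) (dsp (dflat D) V) (dflat_pt D V)" if "V \<in> Obj C" for V
      by (rule dflat_continuous[OF that])
    show "dflat_pt D V (dact D \<alpha> x) = dact (dflat D) \<alpha> (dflat_pt D W x)" if "\<alpha> \<in> Hom C V W" "x \<in> dpts D W" for V W \<alpha> x
      using dflat_dact[OF that] by simp
    show "\<exists>\<phi>. dfibre_arrow C D (dflat D) (dflat_pt D) id b \<phi>" if "b \<in> dbpts D" for b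
      using 1[OF that] by blast
  qed (simp_all add: dflat_pt_def)
  show "diag_map C (dflat D) D (dunflat_pt D) id"
  proof (rule diag_mapI)
    show "continuous_map (dsp (dflat D) V) (dsp D V) (dunflat_pt D V)" if "V \<in> Obj C" for V
      by (rule dunflat_continuous[OF that])
    show "dprj D V (dunflat_pt D V x) = id (dprj (dflat D) V x)" if "V \<in> Obj C" "x \<in> dpts (dflat D) V" for V x
      using dunflat_chart(1)[OF that] by simp
    show "dunflat_pt D V (dact (dflat D) \<alpha> y) = dact D \<alpha> (dunflat_pt D W y)"
      if a: "\<alpha> \<in> Hom C V W" and y: "y \<in> dpts (dflat D) W" for V W \<alpha> y
    proof -
      have o: "V \<in> Obj C" "W \<in> Obj C" using Hom_Obj[OF a] by auto
      have "dact (dflat D) \<alpha> y = dflat_pt D V (dact D \<alpha> (dunflat_pt D W y))"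
        using dflat_dact[OF a dunflat_top[OF o(2) y]] dflat_dunflat[OF o(2) y] by simp
      then show ?thesis using dunflat_dflat[OF o(1) dact_top[OF D a dunflat_top[OF o(2) y]]] by simp
    qed
    show "\<exists>\<phi>. dfibre_arrow C (dflat D) D (dunflat_pt D) id b \<phi>" if "b \<in> dbpts (dflat D)" for b
      using 2[of b] that by auto
  qed simp
qed

end

lemma product_diagram_simps [simp]:
  "dsp (product_diagram C B W) V = prod_topology B (Hom_top C V W)" "dbase (product_diagram C B W) = B"
  "dprj (product_diagram C B W) = (\<lambda>_. fst)" "dact (product_diagram C B W) = (\<lambda>\<alpha> (b, \<phi>). (b, Comp C \<phi> \<alpha>))"
  "dob (product_diagram C B W) = (\<lambda>_. W)" "dchart (product_diagram C B W) = (\<lambda>_ _. snd)"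
  by (simp_all add: product_diagram_def)

lemma Far_app_continuous:
  assumes V: "V \<in> Obj C" and p: "continuous_map T (Hom_top C V W) p" and x: "continuous_map T (Fob C V) x"
  shows "continuous_map T (Fob C W) (\<lambda>t. Far C (p t) (x t))"
proof -
  have "continuous_map T (prod_topology (Hom_top C V W) (Fob C V)) (\<lambda>t. (p t, x t))"
    using p x by (simp add: continuous_map_pairwise o_def)
  from continuous_map_compose[OF this Hom_ev[OF V]] show ?thesis by (simp add: o_def)
qed

text \<open>Composition is jointly continuous because evaluation is, at the locally compact spaces
  of \<open>U\<close> and \<open>V\<close>; the composite evaluation is then curried.\<close>

lemma Comp_continuous:
  assumes U: "U \<in> Obj C" and V: "V \<in> Obj C"
    and p: "continuous_map T (Hom_top C V W) p" and q: "continuous_map T (Hom_top C U V) q"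
  shows "continuous_map T (Hom_top C U W) (\<lambda>t. Comp C (p t) (q t))"
proof (rule Hom_curry)
  have pt: "p t \<in> Hom C V W" "q t \<in> Hom C U V" if "t \<in> topspace T" for t
    using continuous_map_funspace[OF p] continuous_map_funspace[OF q] that by auto
  let ?T = "prod_topology T (Fob C U)"
  have p': "continuous_map ?T (Hom_top C V W) (\<lambda>z. p (fst z))"
    using continuous_map_compose[OF continuous_map_fst p] by (simp add: o_def)
  have q': "continuous_map ?T (Hom_top C U V) (\<lambda>z. q (fst z))"
    using continuous_map_compose[OF continuous_map_fst q] by (simp add: o_def)
  have "continuous_map ?T (Fob C W) (\<lambda>z. Far C (p (fst z)) (Far C (q (fst z)) (snd z)))"
    by (rule Far_app_continuous[OF V p' Far_app_continuous[OF U q' continuous_map_snd]])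
  then show "continuous_map ?T (Fob C W) (\<lambda>(t, v). Far C (Comp C (p t) (q t)) v)"
  proof (rule continuous_map_eq)
    fix z assume "z \<in> topspace ?T"
    then show "Far C (p (fst z)) (Far C (q (fst z)) (snd z)) = (case z of (t, v) \<Rightarrow> Far C (Comp C (p t) (q t)) v)"
      using Far_Comp[OF pt(2) pt(1)] by auto
  qed
  show "Comp C (p t) (q t) \<in> Hom C U W" if "t \<in> topspace T" for t
    by (rule Comp_Hom[OF pt(2)[OF that] pt(1)[OF that]])
qed

lemma product_diagram_family:
  assumes W: "W \<in> Obj C"
  shows "diagram_family C (product_diagram C B W)"
  unfolding diagram_family_def
proof (intro conjI ballI)
  let ?P = "product_diagram C B W"
  show "diagram_over C ?P"
    unfolding diagram_over_def
  proof (intro conjI ballI impI)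
    show "continuous_map (dsp ?P V) (dbase ?P) (dprj ?P V)" for V by (simp add: continuous_map_fst)
  next
    fix \<alpha> assume "\<alpha> \<in> Arr C"
    then have a: "\<alpha> \<in> Hom C (Src C \<alpha>) (Trg C \<alpha>)" by (rule Arr_Hom)
    then have o: "Src C \<alpha> \<in> Obj C" "Trg C \<alpha> \<in> Obj C" using Hom_Obj by auto
    let ?T = "prod_topology B (Hom_top C (Trg C \<alpha>) W)"
    have "continuous_map ?T (Hom_top C (Src C \<alpha>) W) (\<lambda>p. Comp C (snd p) \<alpha>)"
      by (rule Comp_continuous[OF o continuous_map_snd]) (use a in simp)
    then have "continuous_map ?T (prod_topology B (Hom_top C (Src C \<alpha>) W)) (\<lambda>p. (fst p, Comp C (snd p) \<alpha>))"
      by (simp add: continuous_map_pairwise o_def continuous_map_fst)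
    then show "continuous_map (dsp ?P (Trg C \<alpha>)) (dsp ?P (Src C \<alpha>)) (dact ?P \<alpha>)"
      by (simp add: case_prod_unfold)
    show "dprj ?P (Src C \<alpha>) (dact ?P \<alpha> x) = dprj ?P (Trg C \<alpha>) x" for x by (simp add: case_prod_unfold)
  next
    fix V x assume "V \<in> Obj C" "x \<in> dpts ?P V"
    then show "dact ?P (Idn C V) x = x" using Comp_Idn(1) by auto
  next
    fix \<alpha> \<beta> x assume a: "\<alpha> \<in> Arr C" "\<beta> \<in> Arr C" "Trg C \<alpha> = Src C \<beta>" and x: "x \<in> dpts ?P (Trg C \<beta>)"
    show "dact ?P (Comp C \<beta> \<alpha>) x = dact ?P \<alpha> (dact ?P \<beta> x)"
      using Comp_assoc[OF Arr_Hom[OF a(1), unfolded a(3)] Arr_Hom[OF a(2)]] x by auto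
  qed
  show "dob ?P b \<in> Obj C" for b using W by simp
  fix b assume b: "b \<in> dbpts ?P"
  show "homeomorphic_map (subtopology (dsp ?P V) (dfibre ?P b V)) (Hom_top C V (dob ?P b)) (dchart ?P b V)" for V
  proof -
    have "homeomorphic_maps (subtopology (dsp ?P V) (dfibre ?P b V)) (Hom_top C V W) snd (\<lambda>\<phi>. (b, \<phi>))"
      using b unfolding homeomorphic_maps_def
      by (auto simp: dfibre_def continuous_map_in_subtopology continuous_map_pairwise o_def
          continuous_map_from_subtopology continuous_map_snd)
    then show ?thesis by (simp add: homeomorphic_maps_imp_map)
  qed
  show "dchart ?P b (Src C \<alpha>) (dact ?P \<alpha> x) = Comp C (dchart ?P b (Trg C \<alpha>) x) \<alpha>" for \<alpha> x
    by (simp add: case_prod_unfold)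
qed

lemma dflat_bundle:
  assumes "diagram_bundle C D"
  shows "diagram_bundle C (dflat D)"
  unfolding diagram_bundle_def
proof (intro conjI ballI)
  have D: "diagram_family C D" using assms unfolding diagram_bundle_def by (rule conjunct1)
  show fE: "diagram_family C (dflat D)" by (rule dflat_family[OF D])
  fix b assume "b \<in> dbpts (dflat D)"
  then have "b \<in> dbpts D" by simp
  then obtain U N W f fb where U: "U \<subseteq> dbpts D" "openin (dbase D) N" "b \<in> N" "N \<subseteq> U" "W \<in> Obj C"
    and iso: "diag_iso C (diag_restrict D U) (product_diagram C (subtopology (dbase D) U) W) f fb"
    using assms unfolding diagram_bundle_def by blast
  let ?P = "product_diagram C (subtopology (dbase D) U) W"
  obtain k kb where f: "diag_map C (diag_restrict D U) ?P f fb" and k: "diag_map C ?P (diag_restrict D U) k kb"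
    and kf: "\<forall>V\<in>Obj C. (\<forall>x\<in>dpts (diag_restrict D U) V. k V (f V x) = x) \<and> (\<forall>y\<in>dpts ?P V. f V (k V y) = y)"
    and kfb: "\<forall>b\<in>dbpts (diag_restrict D U). kb (fb b) = b" "\<forall>c\<in>dbpts ?P. fb (kb c) = c"
    using iso unfolding diag_iso_def by blast
  have rf: "diagram_family C (diag_restrict (dflat D) U)" by (rule diagram_family_restrict[OF fE])
  have u: "diag_map C (diag_restrict (dflat D) U) (diag_restrict D U) (dunflat_pt D) id"
    by (rule diag_map_restrict[OF fE dflat_map(2)[OF D]])
  have v: "diag_map C (diag_restrict D U) (diag_restrict (dflat D) U) (dflat_pt D) id"
    by (rule diag_map_restrict[OF D dflat_map(1)[OF D]])
  have PF: "diagram_family C ?P" by (rule product_diagram_family[OF U(5)])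
  have "diag_iso C (diag_restrict (dflat D) U) ?P (\<lambda>V x. f V (dunflat_pt D V x)) (\<lambda>b. fb (id b))"
    unfolding diag_iso_def
  proof (intro conjI exI)
    show "diag_map C (diag_restrict (dflat D) U) ?P (\<lambda>V x. f V (dunflat_pt D V x)) (\<lambda>b. fb (id b))"
      by (rule diag_map_comp[OF rf u f])
    show "diag_map C ?P (diag_restrict (dflat D) U) (\<lambda>V x. dflat_pt D V (k V x)) (\<lambda>b. id (kb b))"
      by (rule diag_map_comp[OF PF k v])
    show "\<forall>V\<in>Obj C. (\<forall>x\<in>dpts (diag_restrict (dflat D) U) V. dflat_pt D V (k V (f V (dunflat_pt D V x))) = x) \<and>
        (\<forall>y\<in>dpts ?P V. f V (dunflat_pt D V (dflat_pt D V (k V y))) = y)"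
    proof (intro ballI conjI)
      fix V x assume V: "V \<in> Obj C" and x: "x \<in> dpts (diag_restrict (dflat D) U) V"
      have "dunflat_pt D V x \<in> dpts (diag_restrict D U) V" by (rule diag_mapD(6)[OF u V x])
      then have "k V (f V (dunflat_pt D V x)) = dunflat_pt D V x" using kf V by blast
      moreover have "x \<in> dpts (dflat D) V" using x by simp
      ultimately show "dflat_pt D V (k V (f V (dunflat_pt D V x))) = x" using dflat_dunflat[OF D V] by simp
    next
      fix V y assume V: "V \<in> Obj C" and y: "y \<in> dpts ?P V"
      have "k V y \<in> dpts (diag_restrict D U) V" by (rule diag_mapD(6)[OF k V y])
      then have "k V y \<in> dpts D V" by simp
      then have "dunflat_pt D V (dflat_pt D V (k V y)) = k V y" by (rule dunflat_dflat[OF D V])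
      moreover have "f V (k V y) = y" using kf V y by blast
      ultimately show "f V (dunflat_pt D V (dflat_pt D V (k V y))) = y" by simp
    qed
  qed (use kfb in simp_all)
  then show "\<exists>U N. U \<subseteq> dbpts (dflat D) \<and> openin (dbase (dflat D)) N \<and> b \<in> N \<and> N \<subseteq> U \<and>
        (\<exists>W \<in> Obj C. \<exists>f fb.
           diag_iso C (diag_restrict (dflat D) U) (product_diagram C (subtopology (dbase (dflat D)) U) W) f fb)"
    unfolding dflat_simps(2) using U by blast
qed


subsection \<open>The associated diagram\<close>

abbreviation AD :: "('o, 'v, 'x, 'b) family \<Rightarrow> ('o, 'h, ('v \<Rightarrow> 'x) \<times> 'b, 'b) diagram" where
  "AD X \<equiv> associated_diagram C X"

definition mapspace_pre :: "'o \<Rightarrow> 'h \<Rightarrow> ('v \<Rightarrow> 'x) \<times> 'b \<Rightarrow> ('v \<Rightarrow> 'x) \<times> 'b" where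
  "mapspace_pre V \<alpha> a = (restrict (\<lambda>v. fst a (Far C \<alpha> v)) (pts V), snd a)"

lemma AD_simps [simp]: "dsp (AD (X :: ('o, 'v, 'x, 'b) family)) V = mapspace C V X"
  "dbase (AD (X :: ('o, 'v, 'x, 'b) family)) = base X" "dprj (AD (X :: ('o, 'v, 'x, 'b) family)) = (\<lambda>_. snd)"
  "dact (AD (X :: ('o, 'v, 'x, 'b) family)) \<alpha> = mapspace_pre (Src C \<alpha>) \<alpha>"
  "dob (AD (X :: ('o, 'v, 'x, 'b) family)) = fob X"
  by (simp_all add: associated_diagram_def mapspace_pre_def o_def fun_eq_iff)

lemma AD_chart: "snd a = b \<Longrightarrow> dchart (AD X) b V a = marr V X a"
  by (simp add: associated_diagram_def marr_def)

lemma dfibre_AD: "dfibre (AD X) b V = {a \<in> Ma V X. snd a = b}" by (simp add: dfibre_def)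

lemma mapspace_pre:
  assumes X: "family C X" and \<alpha>: "\<alpha> \<in> Hom C V W" and a: "a \<in> Ma W X"
  shows "mapspace_pre V \<alpha> a \<in> Ma V X" "snd (mapspace_pre V \<alpha> a) = snd a"
    "marr V X (mapspace_pre V \<alpha> a) = Comp C (marr W X a) \<alpha>"
    "v \<in> pts V \<Longrightarrow> fst (mapspace_pre V \<alpha> a) v = fst a (Far C \<alpha> v)"
proof -
  note b = mapspace_snd[OF X a] and ma = marr[OF X a]
  have c: "Comp C (marr W X a) \<alpha> \<in> Hom C V (fob X (snd a))" by (rule Comp_Hom[OF \<alpha> ma(1)])
  have e: "fst a (Far C \<alpha> v) \<in> fibre X (snd a) \<and>
      chart X (snd a) (fst a (Far C \<alpha> v)) = Far C (Comp C (marr W X a) \<alpha>) v" if v: "v \<in> pts V" for v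
    using mapspace_fibre[OF X a Far_pts[OF \<alpha> v]] ma(2)[OF Far_pts[OF \<alpha> v]] Far_Comp[OF \<alpha> ma(1) v] by simp
  show m: "mapspace_pre V \<alpha> a \<in> Ma V X"
    unfolding mapspace_pre_def by (rule mapspace_memI[OF X b c]) (use e in auto)
  show s: "snd (mapspace_pre V \<alpha> a) = snd a" "v \<in> pts V \<Longrightarrow> fst (mapspace_pre V \<alpha> a) v = fst a (Far C \<alpha> v)"
    by (simp_all add: mapspace_pre_def)
  show "marr V X (mapspace_pre V \<alpha> a) = Comp C (marr W X a) \<alpha>"
    by (rule marr(3)[OF X m]) (use c e in \<open>auto simp: mapspace_pre_def\<close>)
qed

lemma mapspace_pre_continuous:
  assumes X: "family C X" and \<alpha>: "\<alpha> \<in> Hom C V W"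
  shows "continuous_map (mapspace C W X) (mapspace C V X) (mapspace_pre V \<alpha>)"
proof (rule mapspace_curry'[OF X])
  have o: "V \<in> Obj C" "W \<in> Obj C" using Hom_Obj[OF \<alpha>] by auto
  have "continuous_map (prod_topology (mapspace C W X) (Fob C V)) (prod_topology (mapspace C W X) (Fob C W)) (\<lambda>(a, v). (a, Far C \<alpha> v))"
    using continuous_map_prodI[OF continuous_map_id Far_continuous[OF \<alpha>]] by simp
  from continuous_map_compose[OF this mapspace_ev[OF o(2), of X]]
  have "continuous_map (prod_topology (mapspace C W X) (Fob C V)) (tot X) (\<lambda>(a, v). fst a (Far C \<alpha> v))"
    by (simp add: o_def case_prod_unfold)
  then show "continuous_map (prod_topology (mapspace C W X) (Fob C V)) (tot X) (\<lambda>(a, v). fst (mapspace_pre V \<alpha> a) v)"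
    by (rule continuous_map_eq) (auto simp: mapspace_pre_def)
  show "continuous_map (mapspace C W X) (base X) (\<lambda>a. snd (mapspace_pre V \<alpha> a))"
    unfolding mapspace_pre_def using mapspace_snd_continuous[of W X] by simp
qed (rule mapspace_pre(1)[OF X \<alpha>])

text \<open>The fibre over \<open>b\<close> is compared with the space of morphisms by
  \<open>marr\<close> and \<open>mpt\<close>. Both are continuous by currying, through the chart
  over \<open>b\<close> and its inverse.\<close>

lemma AD_family:
  assumes X: "family C X"
  shows "diagram_family C (AD X)"
  unfolding diagram_family_def
proof (intro conjI ballI)
  show "diagram_over C (AD X)"
    unfolding diagram_over_def
  proof (intro conjI ballI impI)
    show "continuous_map (dsp (AD X) V) (dbase (AD X)) (dprj (AD X) V)" for V by (simp add: mapspace_snd_continuous)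
  next
    fix \<alpha> assume "\<alpha> \<in> Arr C"
    then have a: "\<alpha> \<in> Hom C (Src C \<alpha>) (Trg C \<alpha>)" by (rule Arr_Hom)
    show "continuous_map (dsp (AD X) (Trg C \<alpha>)) (dsp (AD X) (Src C \<alpha>)) (dact (AD X) \<alpha>)"
      using mapspace_pre_continuous[OF X a] by simp
    show "dprj (AD X) (Src C \<alpha>) (dact (AD X) \<alpha> x) = dprj (AD X) (Trg C \<alpha>) x" for x
      by (simp add: mapspace_pre_def)
  next
    fix V x assume V: "V \<in> Obj C" and x: "x \<in> dpts (AD X) V"
    have x': "x \<in> Ma V X" using x by simp
    note p = mapspace_pre[OF X Idn_Hom[OF V] x']
    have "mapspace_pre V (Idn C V) x = x"
      by (rule mapspace_eqI[OF X p(1) x' p(2)]) (simp add: p(3) Comp_Idn(1)[OF marr(1)[OF X x']])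
    moreover have "Src C (Idn C V) = V" using Hom_Arr[OF Idn_Hom[OF V]] by blast
    ultimately show "dact (AD X) (Idn C V) x = x" by simp
  next
    fix \<alpha> \<beta> x assume a: "\<alpha> \<in> Arr C" "\<beta> \<in> Arr C" "Trg C \<alpha> = Src C \<beta>" and x: "x \<in> dpts (AD X) (Trg C \<beta>)"
    note a1 = Arr_Hom[OF a(1), unfolded a(3)] and a2 = Arr_Hom[OF a(2)]
    have x': "x \<in> Ma (Trg C \<beta>) X" using x by simp
    note p2 = mapspace_pre[OF X a2 x']
    note p1 = mapspace_pre[OF X a1 p2(1)]
    note p = mapspace_pre[OF X Comp_Hom[OF a1 a2] x']
    have "mapspace_pre (Src C \<alpha>) (Comp C \<beta> \<alpha>) x = mapspace_pre (Src C \<alpha>) \<alpha> (mapspace_pre (Src C \<beta>) \<beta> x)"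
      by (rule mapspace_eqI[OF X p(1) p1(1)]) (simp_all add: p p1 p2 Comp_assoc[OF a1 a2 marr(1)[OF X x']])
    moreover have "Src C (Comp C \<beta> \<alpha>) = Src C \<alpha>" using Hom_Arr[OF Comp_Hom[OF a1 a2]] by blast
    ultimately show "dact (AD X) (Comp C \<beta> \<alpha>) x = dact (AD X) \<alpha> (dact (AD X) \<beta> x)" by simp
  qed
  fix b assume "b \<in> dbpts (AD X)"
  then have b: "b \<in> bpts X" by simp
  show "dob (AD X) b \<in> Obj C" using fob_Obj[OF X b] by simp
  show "homeomorphic_map (subtopology (dsp (AD X) V) (dfibre (AD X) b V)) (Hom_top C V (dob (AD X) b)) (dchart (AD X) b V)"
    if V: "V \<in> Obj C" for V
  proof -
    let ?F = "{a \<in> Ma V X. snd a = b}"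
    let ?T = "subtopology (mapspace C V X) ?F"
    have "homeomorphic_maps ?T (Hom_top C V (fob X b)) (marr V X) (mpt V X b)"
      unfolding homeomorphic_maps_def
    proof (intro conjI ballI)
      show "continuous_map ?T (Hom_top C V (fob X b)) (marr V X)"
      proof (rule Hom_curry)
        have "continuous_map (prod_topology ?T (Fob C V)) (tot X) (\<lambda>(a, v). fst a v)"
          using continuous_map_from_subtopology[OF mapspace_ev[OF V, of X], of "?F \<times> pts V"]
          by (simp add: prod_topology_subtopology)
        then have "continuous_map (prod_topology ?T (Fob C V)) (subtopology (tot X) (fibre X b)) (\<lambda>(a, v). fst a v)"
          using mapspace_fibre[OF X] by (auto simp: continuous_map_in_subtopology)
        from continuous_map_compose[OF this chart_continuous[OF X b]]
        have "continuous_map (prod_topology ?T (Fob C V)) (Fob C (fob X b)) (\<lambda>(a, v). chart X b (fst a v))"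
          by (simp add: o_def case_prod_unfold)
        then show "continuous_map (prod_topology ?T (Fob C V)) (Fob C (fob X b)) (\<lambda>(a, v). Far C (marr V X a) v)"
          by (rule continuous_map_eq) (auto simp: marr(2)[OF X, symmetric])
        show "marr V X a \<in> Hom C V (fob X b)" if "a \<in> topspace ?T" for a
          using marr(1)[OF X, of a V] that by auto
      qed
      have "continuous_map (prod_topology (Hom_top C V (fob X b)) (Fob C V)) (tot X) (\<lambda>(\<phi>, v). fpt X b (Far C \<phi> v))"
        using continuous_map_compose[OF Hom_ev[OF V] fpt_continuous[OF X b]] by (simp add: o_def case_prod_unfold)
      then have "continuous_map (Hom_top C V (fob X b)) (mapspace C V X) (\<lambda>\<phi>. (restrict (\<lambda>v. fpt X b (Far C \<phi> v)) (pts V), b))"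
      proof (rule mapspace_curry)
        show "(restrict (\<lambda>v. fpt X b (Far C \<phi> v)) (pts V), b) \<in> Ma V X"
          if "\<phi> \<in> topspace (Hom_top C V (fob X b))" for \<phi>
          using mpt_mapspace(1)[OF X b, of \<phi> V] that by (simp add: mpt_def)
      qed (use b in simp)
      then show "continuous_map (Hom_top C V (fob X b)) ?T (mpt V X b)"
        using mpt_mapspace(1,3)[OF X b, of _ V] by (auto simp: continuous_map_in_subtopology mpt_def[abs_def])
      show "mpt V X b (marr V X a) = a" if "a \<in> topspace ?T" for a using mpt_marr[OF X, of a V] that by auto
      show "marr V X (mpt V X b \<phi>) = \<phi>" if "\<phi> \<in> topspace (Hom_top C V (fob X b))" for \<phi>
        using mpt_mapspace(2)[OF X b, of \<phi> V] that by simp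
    qed
    then have "homeomorphic_map ?T (Hom_top C V (fob X b)) (marr V X)" by (rule homeomorphic_maps_imp_map)
    then have "homeomorphic_map ?T (Hom_top C V (fob X b)) (dchart (AD X) b V)"
      by (rule homeomorphic_map_eq) (auto simp: AD_chart)
    then show ?thesis by (simp add: dfibre_AD)
  qed
  show "dchart (AD X) b (Src C \<alpha>) (dact (AD X) \<alpha> x) = Comp C (dchart (AD X) b (Trg C \<alpha>) x) \<alpha>"
    if "\<alpha> \<in> Arr C" "x \<in> dfibre (AD X) b (Trg C \<alpha>)" for \<alpha> x
  proof -
    have x: "x \<in> Ma (Trg C \<alpha>) X" "snd x = b" using that(2) by (auto simp: dfibre_AD)
    note p = mapspace_pre[OF X Arr_Hom[OF that(1)] x(1)]
    show ?thesis using p(2,3) x(2) by (simp add: AD_chart)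
  qed
qed

lemma AD_map:
  assumes X: "family C X" and Y: "family C Y" and f: "fam_map C X Y f fb"
  shows "b \<in> bpts X \<Longrightarrow> fibre_arrow C X Y f fb b \<phi> \<Longrightarrow>
      dfibre_arrow C (AD X) (AD Y) (\<lambda>V. mapspace_map V f fb) fb b \<phi>"
    "diag_map C (AD X) (AD Y) (\<lambda>V. mapspace_map V f fb) fb"
proof -
  show 1: "dfibre_arrow C (AD X) (AD Y) (\<lambda>V. mapspace_map V f fb) fb b \<phi>"
    if b: "b \<in> bpts X" and \<phi>: "fibre_arrow C X Y f fb b \<phi>" for b \<phi>
    unfolding dfibre_arrow_def
  proof (intro conjI ballI)
    show "\<phi> \<in> Hom C (dob (AD X) b) (dob (AD Y) (fb b))" using \<phi> unfolding fibre_arrow_def by simp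
    fix V a assume "V \<in> Obj C" "a \<in> dfibre (AD X) b V"
    then have a: "a \<in> Ma V X" "snd a = b" by (auto simp: dfibre_AD)
    have "marr V Y (mapspace_map V f fb a) = Comp C \<phi> (marr V X a)"
      by (rule mapspace_map_mem(2)[OF X Y f a(1)]) (use \<phi> a(2) in simp)
    moreover have "snd (mapspace_map V f fb a) = fb b" using a(2) by (simp add: mapspace_map_def)
    ultimately show "dchart (AD Y) (fb b) V (mapspace_map V f fb a) = Comp C \<phi> (dchart (AD X) b V a)"
      using a(2) by (simp add: AD_chart)
  qed
  show "diag_map C (AD X) (AD Y) (\<lambda>V. mapspace_map V f fb) fb"
  proof (rule diag_mapI)
    show "continuous_map (dbase (AD X)) (dbase (AD Y)) fb" using fam_mapD(2)[OF f] by simp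
    show "continuous_map (dsp (AD X) V) (dsp (AD Y) V) (mapspace_map V f fb)" if "V \<in> Obj C" for V
      using mapspace_map_continuous[OF X Y f that] by simp
    show "dprj (AD Y) V (mapspace_map V f fb x) = fb (dprj (AD X) V x)" for V x by (simp add: mapspace_map_def)
    show "mapspace_map V f fb (dact (AD X) \<alpha> x) = dact (AD Y) \<alpha> (mapspace_map W f fb x)"
      if a: "\<alpha> \<in> Hom C V W" for V W \<alpha> x
    proof -
      have "Src C \<alpha> = V" using Hom_Arr[OF a] by blast
      then show ?thesis using Far_pts[OF a] by (auto simp: mapspace_map_def mapspace_pre_def restrict_def fun_eq_iff)
    qed
    show "\<exists>\<phi>. dfibre_arrow C (AD X) (AD Y) (\<lambda>V. mapspace_map V f fb) fb b \<phi>" if "b \<in> dbpts (AD X)" for b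
      using 1[of b] fam_mapD(4)[OF f, of b] that by auto
  qed
qed

text \<open>Diagrams are compared as records with a space for every \<open>V\<close> of type
  \<open>'o\<close>, so \<open>AD_restrict\<close> also has to know the function spaces at
  non-objects.\<close>

lemma mapspace_empty:
  assumes Y: "family C Y" and V: "V \<notin> Obj C"
  shows "mapspace C V Y = trivial_topology"
proof -
  have "Ma V Y = {}" using V Hom_Obj unfolding mapspace_mem[OF Y] set_eq_iff by blast
  then show ?thesis by simp
qed

lemma AD_restrict:
  assumes X: "family C X"
  shows "AD (fam_restrict X U) = diag_restrict (AD X) U"
proof -
  have "mapspace C V (fam_restrict X U) = subtopology (mapspace C V X) {a \<in> Ma V X. snd a \<in> U}" for V
  proof (cases "V \<in> Obj C")
    case True
    then show ?thesis by (rule mapspace_restrict[OF X])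
  next
    case False
    then show ?thesis using mapspace_empty[OF X False] mapspace_empty[OF family_restrict[OF X] False] by simp
  qed
  then show ?thesis by (simp add: associated_diagram_def diag_restrict_def fibre_arrow_def)
qed

text \<open>A trivialisation of \<open>Y\<close> over \<open>N\<close> induces one of the associated
  diagram: a map goes to its base point and its morphism \<open>tarr\<close> in the coordinate of
  the trivialisation.\<close>

lemma AD_bundle:
  assumes Y: "fibre_bundle C Y"
  shows "diagram_bundle C (AD Y)"
  unfolding diagram_bundle_def
proof (intro conjI ballI)
  note fY = fibre_bundleD[OF Y]
  show "diagram_family C (AD Y)" by (rule AD_family[OF fY])
  fix b0 assume "b0 \<in> dbpts (AD Y)"
  then have "b0 \<in> bpts Y" by simp
  then obtain N W t s where N: "b0 \<in> N" and l: "loc_triv Y N W t s" by (rule bundle_loc_triv[OF Y])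
  note d = loc_trivD[OF l]
  have NB: "N \<subseteq> bpts Y" by (rule openin_subset[OF d(1)])
  let ?R = "diag_restrict (AD Y) N" and ?P = "product_diagram C (subtopology (base Y) N) W"
  let ?f = "\<lambda>V a. (snd a, tarr V W s a)" and ?g = "\<lambda>V p. tpt V t (fst p) (snd p)"
  have tR: "a \<in> dpts ?R V \<longleftrightarrow> a \<in> Ma V Y \<and> snd a \<in> N" for a V by auto
  have tP: "p \<in> dpts ?P V \<longleftrightarrow> fst p \<in> N \<and> snd p \<in> Hom C V W" for p V
    using NB by (auto simp: product_diagram_simps mem_Times_iff)
  have fR: "dsp ?R V = subtopology (mapspace C V Y) {a \<in> Ma V Y. snd a \<in> N}" for V by simp
  have gf: "?g V (?f V a) = a" if "a \<in> dpts ?R V" for V a using tarr(4)[OF fY l] that unfolding tR by simp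
  have fg: "?f V (?g V p) = p" if "p \<in> dpts ?P V" for V p
    using tpt(2,4)[OF fY l] that unfolding tP by (simp add: prod_eq_iff)
  have fnat: "tarr V W s (mapspace_pre V \<alpha> a) = Comp C (tarr U W s a) \<alpha>"
    if \<alpha>: "\<alpha> \<in> Hom C V U" and a: "a \<in> Ma U Y" "snd a \<in> N" for \<alpha> V U a
  proof -
    note p = mapspace_pre[OF fY \<alpha> a(1)]
    have pN: "snd (mapspace_pre V \<alpha> a) \<in> N" using p(2) a(2) by simp
    note t1 = tarr[OF fY l p(1) pN] and t2 = tarr[OF fY l a]
    show ?thesis
    proof (rule Far_inject[OF t1(1) Comp_Hom[OF \<alpha> t2(1)]])
      fix v assume v: "v \<in> pts V"
      show "Far C (tarr V W s (mapspace_pre V \<alpha> a)) v = Far C (Comp C (tarr U W s a) \<alpha>) v"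
        using t1(2)[OF v] p(4)[OF v] t2(2)[OF Far_pts[OF \<alpha> v]] Far_Comp[OF \<alpha> t2(1) v] by simp
    qed
  qed
  have fmap: "diag_map C ?R ?P ?f id"
  proof (rule diag_mapI)
    show "continuous_map (dbase ?R) (dbase ?P) id" by simp
    show "continuous_map (dsp ?R V) (dsp ?P V) (?f V)" if V: "V \<in> Obj C" for V
    proof -
      have "continuous_map (dsp ?R V) (subtopology (base Y) N) snd"
        using mapspace_snd_continuous[of V Y] by (auto simp: continuous_map_in_subtopology continuous_map_from_subtopology)
      moreover have "continuous_map (dsp ?R V) (Hom_top C V W) (tarr V W s)"
        unfolding fR by (rule tarr_continuous[OF fY l V])
      ultimately show ?thesis by (simp add: continuous_map_pairwise o_def)
    qed
    show "dprj ?P V (?f V x) = id (dprj ?R V x)" for V x by simp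
    show "?f V (dact ?R \<alpha> x) = dact ?P \<alpha> (?f U x)" if a: "\<alpha> \<in> Hom C V U" "x \<in> dpts ?R U" for V U \<alpha> x
    proof -
      have "Src C \<alpha> = V" using Hom_Arr[OF a(1)] by blast
      moreover have "x \<in> Ma U Y" "snd x \<in> N" using a(2) unfolding tR by auto
      ultimately show ?thesis using fnat[OF a(1)] by (simp add: mapspace_pre_def)
    qed
    show "\<exists>\<phi>. dfibre_arrow C ?R ?P ?f id b \<phi>" if "b \<in> dbpts ?R" for b
    proof -
      have b: "b \<in> N" using that by simp
      obtain \<phi> where \<phi>: "\<phi> \<in> Hom C W (fob Y b)" "invertible_arrow C \<phi>"
        "\<And>w. w \<in> pts W \<Longrightarrow> chart Y b (t b w) = Far C \<phi> w" using d(9)[OF b] by blast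
      obtain \<psi> where \<psi>: "\<psi> \<in> Hom C (fob Y b) W" "Comp C \<psi> \<phi> = Idn C W"
        using invertible_arrowE[OF \<phi>(2,1)] by metis
      \<comment> \<open>On a fibre the coordinate and the chart differ by \<open>\<psi>\<close>, the
        inverse of the morphism by which \<open>t b\<close> is seen in the chart.\<close>
      have "tarr V W s a = Comp C \<psi> (marr V Y a)" if a: "a \<in> Ma V Y" "snd a = b" for V a
      proof -
        have aN: "snd a \<in> N" using a(2) b by simp
        note ta = tarr[OF fY l a(1) aN]
        have "marr V Y a = Comp C \<phi> (tarr V W s a)" using tpt(3)[OF fY l b ta(1) \<phi>(1,3)] ta(4) a(2) by simp
        then have "Comp C \<psi> (marr V Y a) = Comp C (Comp C \<psi> \<phi>) (tarr V W s a)"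
          using Comp_assoc[OF ta(1) \<phi>(1) \<psi>(1)] by simp
        then show ?thesis using \<psi>(2) Comp_Idn(2)[OF ta(1)] by simp
      qed
      then show ?thesis using \<psi>(1)
        by (intro exI[of _ \<psi>]) (auto simp: dfibre_arrow_def dfibre_restrict[OF b] dfibre_AD AD_chart)
    qed
  qed
  have gmap: "diag_map C ?P ?R ?g id"
  proof (rule diag_mapI)
    show "continuous_map (dbase ?P) (dbase ?R) id" by simp
    show "continuous_map (dsp ?P V) (dsp ?R V) (?g V)" if V: "V \<in> Obj C" for V
    proof -
      have "continuous_map (dsp ?P V) (mapspace C V Y) (?g V)"
        using tpt_continuous[OF fY l V] by (simp add: case_prod_unfold)
      moreover have "?g V p \<in> Ma V Y" "snd (?g V p) \<in> N" if "p \<in> dpts ?P V" for p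
        using tpt(1,4)[OF fY l] that unfolding tP by auto
      ultimately show ?thesis unfolding fR continuous_map_in_subtopology by blast
    qed
    show "dprj ?R V (?g V x) = id (dprj ?P V x)" for V x by (simp add: tpt_def)
    show "?g V (dact ?P \<alpha> x) = dact ?R \<alpha> (?g U x)" if a: "\<alpha> \<in> Hom C V U" "x \<in> dpts ?P U" for V U \<alpha> x
    proof -
      have S: "Src C \<alpha> = V" using Hom_Arr[OF a(1)] by blast
      have x: "snd x \<in> Hom C U W" using a(2) unfolding tP by blast
      have "Far C (Comp C (snd x) \<alpha>) v = Far C (snd x) (Far C \<alpha> v)" if "v \<in> pts V" for v
        by (rule Far_Comp[OF a(1) x that])
      then show ?thesis using S Far_pts[OF a(1)]
        by (simp add: tpt_def mapspace_pre_def case_prod_unfold restrict_def fun_eq_iff)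
    qed
    show "\<exists>\<phi>. dfibre_arrow C ?P ?R ?g id b \<phi>" if "b \<in> dbpts ?P" for b
    proof -
      have b: "b \<in> N" using that by simp
      obtain \<phi> where \<phi>: "\<phi> \<in> Hom C W (fob Y b)"
        "\<And>w. w \<in> pts W \<Longrightarrow> chart Y b (t b w) = Far C \<phi> w" using d(9)[OF b] by blast
      have "dfibre_arrow C ?P ?R ?g id b \<phi>"
        unfolding dfibre_arrow_def
      proof (intro conjI ballI)
        show "\<phi> \<in> Hom C (dob ?P b) (dob ?R (id b))" using \<phi>(1) by simp
        fix V p assume "p \<in> dfibre ?P b V"
        then have p: "fst p = b" "snd p \<in> Hom C V W" by (auto simp: dfibre_def)
        have "marr V Y (tpt V t b (snd p)) = Comp C \<phi> (snd p)" by (rule tpt(3)[OF fY l b p(2) \<phi>])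
        then show "dchart ?R (id b) V (?g V p) = Comp C \<phi> (dchart ?P b V p)"
          using p(1) by (simp add: AD_chart tpt_def)
      qed
      then show ?thesis by blast
    qed
  qed
  have "diag_iso C ?R ?P ?f id"
    unfolding diag_iso_def by (intro conjI exI[of _ ?g] exI[of _ id] fmap gmap ballI) (use gf fg in simp_all)
  then show "\<exists>U N. U \<subseteq> dbpts (AD Y) \<and> openin (dbase (AD Y)) N \<and> b0 \<in> N \<and> N \<subseteq> U \<and>
        (\<exists>W \<in> Obj C. \<exists>f fb. diag_iso C (diag_restrict (AD Y) U) (product_diagram C (subtopology (dbase (AD Y)) U) W) f fb)"
    using N NB d(1,2) unfolding AD_simps(2) by blast
qed

end

section \<open>The associated diagram of a stratified bundle\<close>

context strat_family
begin

lemma mapspace_incl_continuous: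
  assumes V: "V \<in> Obj C" and "i \<le> j"
  shows "continuous_map (mapspace C V (Xn i)) (mapspace C V (Xn j)) id"
proof -
  have "continuous_map (subtopology (mapspace C V X) {a \<in> Ma V X. snd a \<in> fil i})
     (subtopology (mapspace C V X) {a \<in> Ma V X. snd a \<in> fil j}) id"
    using strat_fil_mono[OF S assms(2)] by (auto simp: continuous_map_in_subtopology continuous_map_from_subtopology)
  then show ?thesis unfolding mapspace_restrict[OF fX V] .
qed

lemma pull_continuous: "V \<in> Obj C \<Longrightarrow> continuous_map (mapspace C V (M n)) (mapspace C V (Xn (Suc n))) (pull V n)"
  by (rule mapspace_map_continuous[OF fM fXn gmap])

text \<open>The topology is the point: a set with open traces on stage \<open>n\<close> and on
  \<open>M n\<close> also has open traces on stage 0 and on all earlier pieces, because these map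
  continuously into stage \<open>n\<close>. So \<open>strat_open\<close> applies.\<close>

lemma mapspace_pushout:
  assumes nkc: "NKC TYPE('b) C" and V: "V \<in> Obj C"
  shows "pushout_Top (subtopology (mapspace C V (M n)) {a \<in> Ma V (M n). snd a \<in> An n})
    (mapspace C V (Xn n)) (mapspace C V (M n)) (mapspace C V (Xn (Suc n)))
    (mapspace_map V (h n) (hb n)) id id (pull V n)"
proof (rule pushout_Top_inclusionI)
  let ?A = "{a \<in> Ma V (M n). snd a \<in> An n}"
  show "?A \<subseteq> Ma V (M n)" by blast
  show "continuous_map (subtopology (mapspace C V (M n)) ?A) (mapspace C V (Xn n)) (mapspace_map V (h n) (hb n))"
    using mapspace_map_continuous[OF family_restrict[OF fM] fXn hmap V] unfolding mapspace_restrict[OF fM V] .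
  show "continuous_map (mapspace C V (Xn n)) (mapspace C V (Xn (Suc n))) id"
    by (rule mapspace_incl_continuous[OF V]) simp
  show "continuous_map (mapspace C V (M n)) (mapspace C V (Xn (Suc n))) (pull V n)" by (rule pull_continuous[OF V])
  show "pull V n a = mapspace_map V (h n) (hb n) a" if "a \<in> ?A" for a
  proof -
    have a: "a \<in> Ma V (M n)" "snd a \<in> An n" using that by auto
    have "g n (fst a v) = h n (fst a v)" if "v \<in> pts V" for v
      using g_on_An mapspace_fibre[OF fM a(1) that] a(2) by (auto simp: fibre_def)
    moreover have "gb n (snd a) = hb n (snd a)" using pushout_Top_inclusionD(4)[OF po_base An_sub a(2)] .
    ultimately show ?thesis by (simp add: mapspace_map_def restrict_def fun_eq_iff)
  qed
  show "Ma V (Xn (Suc n)) \<subseteq> Ma V (Xn n) \<union> pull V n ` Ma V (M n)"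
  proof
    fix a assume a: "a \<in> Ma V (Xn (Suc n))"
    show "a \<in> Ma V (Xn n) \<union> pull V n ` Ma V (M n)"
    proof (cases "snd a \<in> fil n")
      case True
      then have "a \<in> Ma V (Xn n)" using a unfolding mapspace_Xn by blast
      then show ?thesis by (rule UnI1)
    next
      case False
      then show ?thesis using pull_lift[OF a False] by blast
    qed
  qed
  show "openin (mapspace C V (Xn (Suc n))) U"
    if U: "U \<subseteq> Ma V (Xn (Suc n))" "openin (mapspace C V (Xn n)) (Ma V (Xn n) \<inter> U)"
      "openin (mapspace C V (M n)) {y \<in> Ma V (M n). pull V n y \<in> U}" for U
  proof (rule strat_open[OF nkc V U(1)])
    have "openin (mapspace C V (Xn 0)) {a \<in> Ma V (Xn 0). id a \<in> Ma V (Xn n) \<inter> U}"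
      by (rule openin_continuous_map_preimage[OF mapspace_incl_continuous[OF V] U(2)]) simp
    moreover have "{a \<in> Ma V (Xn 0). id a \<in> Ma V (Xn n) \<inter> U} = {a \<in> Ma V (Xn 0). a \<in> U}"
      using strat_fil_mono[OF S, of 0 n] unfolding Int_iff id_apply mapspace_Xn by auto
    ultimately show "lvl0 V U" unfolding lvl0_def by simp
    fix m assume m: "m < Suc n"
    show "lvlH V U m"
    proof (cases "m = n")
      case True
      then show ?thesis using U(3) unfolding lvlH_def by simp
    next
      case False
      then have le: "Suc m \<le> n" using m by simp
      have "continuous_map (mapspace C V (M m)) (mapspace C V (Xn n)) (id \<circ> pull V m)"
        by (rule continuous_map_compose[OF pull_continuous[OF V] mapspace_incl_continuous[OF V le]])
      then have c: "continuous_map (mapspace C V (M m)) (mapspace C V (Xn n)) (pull V m)" by simp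
      have "openin (mapspace C V (M m)) {y \<in> Ma V (M m). pull V m y \<in> Ma V (Xn n) \<inter> U}"
        by (rule openin_continuous_map_preimage[OF c U(2)])
      moreover have "{y \<in> Ma V (M m). pull V m y \<in> Ma V (Xn n) \<inter> U} =
          {y \<in> Ma V (M m). pull V m y \<in> U}" using continuous_map_funspace[OF c] by auto
      ultimately show ?thesis unfolding lvlH_def by simp
    qed
  qed
  show "inj_on (pull V n) (Ma V (M n) - ?A)" by (rule inj_onI) (use pull_inj in blast)
  have "pull V n a \<notin> Ma V (Xn n)" if "a \<in> Ma V (M n) - ?A" for a
  proof -
    have a: "a \<in> Ma V (M n)" "snd a \<notin> An n" using that by auto
    have "snd (pull V n a) \<notin> fil n" using gb_fil[OF mapspace_snd[OF fM a(1)]] a(2) by (simp add: pull_simps(1))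
    then show ?thesis unfolding mapspace_Xn by blast
  qed
  then show "pull V n ` (Ma V (M n) - ?A) \<inter> Ma V (Xn n) = {}" by blast
qed

text \<open>The attached diagram is that of \<open>M n\<close> in normal form. Invertibility of the
  structure morphisms is inherited, because post-composition acts on the diagrams by the same
  morphisms as on the families.\<close>

lemma AD_pushout:
  assumes nkc: "NKC TYPE('b) C"
  shows "\<exists>(M' :: ('o, 'h, 'b \<times> 'h, 'b) diagram) h' g'.
        diagram_bundle C M' \<and> dbase M' = strat_M S (Suc n) \<and>
        diag_pushout C (diag_restrict (AD X) (fil n)) M' (An n)
          (diag_restrict (AD X) (fil (Suc n))) h' (hb n) g' (gb n)"
proof -
  let ?E = "AD (M n)"
  let ?M' = "dflat ?E"
  let ?h = "\<lambda>V x. mapspace_map V (h n) (hb n) (dunflat_pt ?E V x)"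
  let ?g = "\<lambda>V x. pull V n (dunflat_pt ?E V x)"
  note fE = AD_family[OF fM, of n]
  note fE' = dflat_family[OF fE]
  have R: "diag_restrict (AD X) (fil i) = AD (Xn i)" for i using AD_restrict[OF fX] by simp
  have RM: "diag_restrict ?E (An n) = AD (fam_restrict (M n) (An n))" using AD_restrict[OF fM] by simp
  have bun: "diagram_bundle C ?M'" by (rule dflat_bundle[OF AD_bundle[OF Mb]])
  have gm: "diag_map C ?M' (AD (Xn (Suc n))) ?g (gb n)"
    using diag_map_comp[OF fE' dflat_map(2)[OF fE] AD_map(2)[OF fM fXn gmap]] by simp
  have "diag_map C (diag_restrict ?M' (An n)) (AD (fam_restrict (M n) (An n))) (dunflat_pt ?E) id"
    using diag_map_restrict[OF fE' dflat_map(2)[OF fE], of "An n"] unfolding RM .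
  from diag_map_comp[OF diagram_family_restrict[OF fE'] this AD_map(2)[OF family_restrict[OF fM] fXn hmap]]
  have hm: "diag_map C (diag_restrict ?M' (An n)) (AD (Xn n)) ?h (hb n)" by simp
  have ide: "mapspace_map V id id a = a" if "a \<in> Ma V (Xn n)" for V a
    using that by (auto simp: mapspace_map_def mapspace_mem[OF fXn] prod_eq_iff extensional_restrict)
  have "strat_fil S n \<subseteq> strat_fil S (Suc n)" by (rule strat_sub_topspace(4)[OF S])
  note incl = fam_map_restrict_incl[OF fX this]
  have im: "diag_map C (AD (Xn n)) (AD (Xn (Suc n))) (\<lambda>_. id) id"
    by (rule diag_map_cong[OF AD_family[OF fXn] AD_map(2)[OF fXn fXn incl(1)]]) (simp_all add: ide)
  have po': "pushout_Top (dsp (diag_restrict ?M' (An n)) V) (dsp (AD (Xn n)) V) (dsp ?M' V) (dsp (AD (Xn (Suc n))) V)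
        (?h V) id id (?g V)" if V: "V \<in> Obj C" for V
  proof -
    let ?A = "{a \<in> Ma V (M n). snd a \<in> An n}"
    have eq: "{x \<in> topspace (dsp ?M' V). dprj ?M' V x \<in> An n} =
        {y \<in> topspace (dsp ?M' V). dunflat_pt ?E V y \<in> ?A}"
      using dunflat_top[OF fE V] dunflat_chart(1)[OF fE V] by auto
    have "pushout_Top (subtopology (dsp ?M' V) {x \<in> topspace (dsp ?M' V). dprj ?M' V x \<in> An n})
        (mapspace C V (Xn n)) (dsp ?M' V) (mapspace C V (Xn (Suc n))) (?h V) id id (?g V)"
    proof (rule pushout_Top_transport[OF mapspace_pushout[OF nkc V]])
      show "continuous_map (dsp ?M' V) (mapspace C V (M n)) (dunflat_pt ?E V)"
        using dunflat_continuous[OF fE V] by simp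
      show "continuous_map (mapspace C V (M n)) (dsp ?M' V) (dflat_pt ?E V)" using dflat_continuous[OF fE V] by simp
      show "dflat_pt ?E V (dunflat_pt ?E V y) = y" if "y \<in> topspace (dsp ?M' V)" for y
        by (rule dflat_dunflat[OF fE V that])
      show "dunflat_pt ?E V (dflat_pt ?E V y) = y" if "y \<in> Ma V (M n)" for y
        using dunflat_dflat[OF fE V] that by simp
      show "{x \<in> topspace (dsp ?M' V). dprj ?M' V x \<in> An n} =
        {y \<in> topspace (dsp ?M' V). dunflat_pt ?E V y \<in> ?A}" by (rule eq)
    qed blast
    then show ?thesis unfolding AD_simps(1) diag_restrict_simps(1) .
  qed
  have ar1: "\<exists>\<phi>. dfibre_arrow C (AD (Xn n)) (AD (Xn (Suc n))) (\<lambda>_. id) id b \<phi> \<and> invertible_arrow C \<phi>"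
    if b: "b \<in> dbpts (AD (Xn n))" for b
  proof -
    have b': "b \<in> bpts (Xn n)" "b \<in> bpts X" using b by auto
    have "dfibre_arrow C (AD (Xn n)) (AD (Xn (Suc n))) (\<lambda>_. id) id b (Idn C (fob X b))"
      by (rule dfibre_arrow_cong[OF AD_map(1)[OF fXn fXn incl(1) b'(1) incl(2)[OF b'(2)]]])
        (auto simp: dfibre_AD ide)
    then show ?thesis using invertible_Idn[OF fob_Obj[OF fX b'(2)]] by blast
  qed
  have ar2: "\<exists>\<phi>. dfibre_arrow C ?M' (AD (Xn (Suc n))) ?g (gb n) b \<phi> \<and> invertible_arrow C \<phi>"
    if b: "b \<in> topspace (dbase ?M') - An n" for b
  proof -
    have b': "b \<in> bpts (M n)" "b \<in> dbpts ?E" "b \<in> topspace (dbase ?M')" "b \<in> bpts (M n) - An n"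
      using b by auto
    obtain \<phi> where \<phi>: "fibre_arrow C (M n) (Xn (Suc n)) (g n) (gb n) b \<phi>" "invertible_arrow C \<phi>"
      using g_inv[OF b'(4)] by blast
    have pH: "\<phi> \<in> Hom C (fob (M n) b) (fob X (gb n b))" using \<phi>(1) unfolding fibre_arrow_def by simp
    have "dfibre_arrow C ?E (AD (Xn (Suc n))) (\<lambda>V. pull V n) (gb n) (id b) \<phi>"
      using AD_map(1)[OF fM fXn gmap b'(1) \<phi>(1)] by simp
    from dfibre_arrow_comp[OF fE' b'(3) dflat_map(2)[OF fE] dflat_map(4)[OF fE b'(2)] this]
    have "dfibre_arrow C ?M' (AD (Xn (Suc n))) ?g (gb n) b (Comp C \<phi> (Idn C (fob (M n) b)))" by simp
    then show ?thesis using \<phi>(2) Comp_Idn(1)[OF pH] by auto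
  qed
  have "diag_pushout C (AD (Xn n)) ?M' (An n) (AD (Xn (Suc n))) ?h (hb n) ?g (gb n)"
    unfolding diag_pushout_def using hm im gm po' po_base[of n] ar1 ar2 by (intro conjI ballI) simp_all
  then show ?thesis
    using bun baseM[of n] unfolding R by (intro exI[of _ ?M'] exI[of _ ?h] exI[of _ ?g] conjI) simp_all
qed

text \<open>What the single stages leave open is the colimit clause: open traces on all stages pull
  back to open traces on all pieces, which is what \<open>strat_open_lim\<close> asks for.\<close>

theorem associated_diagram_principal:
  assumes nkc: "NKC TYPE('b) C"
  shows "principal_stratified_bundle_diagram C S (AD X)"
  unfolding principal_stratified_bundle_diagram_def
proof (intro conjI allI ballI)
  show "stratified_space S" by (rule S)
  show "diagram_family C (AD X)" by (rule AD_family[OF fX])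
  show "dbase (AD X) = strat_space S" using baseX by simp
  show "diagram_bundle C (diag_restrict (AD X) (strat_fil S 0))"
    using AD_bundle[OF X0] unfolding AD_restrict[OF fX] .
  show "\<exists>(M :: ('o, 'h, 'b \<times> 'h, 'b) diagram) h g.
        diagram_bundle C M \<and> dbase M = strat_M S (Suc n) \<and>
        diag_pushout C (diag_restrict (AD X) (strat_fil S n)) M (strat_A S (Suc n))
          (diag_restrict (AD X) (strat_fil S (Suc n))) h (strat_h S (Suc n)) g (strat_g S (Suc n))" for n
    by (rule AD_pushout[OF nkc])
  fix V assume V: "V \<in> Obj C"
  let ?F = "\<lambda>n. {a \<in> Ma V X. snd a \<in> fil n}"
  have "lim_Top (mapspace C V X) ?F"
    unfolding lim_Top_def
  proof (intro conjI allI impI)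
    show "?F n \<subseteq> ?F (Suc n)" for n using strat_sub_topspace(4)[OF S, of n] by auto
    show "(\<Union>n. ?F n) = Ma V X"
      using mapspace_snd[OF fX, of _ V] strat_sub_topspace(3)[OF S] unfolding baseX by blast
    fix U assume U: "U \<subseteq> Ma V X"
    show "openin (mapspace C V X) U \<longleftrightarrow> (\<forall>n. openin (subtopology (mapspace C V X) (?F n)) (U \<inter> ?F n))"
    proof
      assume "openin (mapspace C V X) U"
      then show "\<forall>n. openin (subtopology (mapspace C V X) (?F n)) (U \<inter> ?F n)"
        by (simp add: openin_subtopology_Int)
    next
      assume "\<forall>n. openin (subtopology (mapspace C V X) (?F n)) (U \<inter> ?F n)"
      then have o: "openin (mapspace C V (Xn n)) (U \<inter> ?F n)" for n unfolding mapspace_restrict[OF fX V] by blast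
      show "openin (mapspace C V X) U"
      proof (rule strat_open_lim[OF nkc V U])
        have "{a \<in> Ma V (Xn 0). a \<in> U} = U \<inter> ?F 0" unfolding mapspace_Xn by auto
        then show "lvl0 V U" unfolding lvl0_def using o[of 0] by simp
        fix m
        have "{y \<in> Ma V (M m). pull V m y \<in> U} =
            {y \<in> Ma V (M m). pull V m y \<in> U \<inter> ?F (Suc m)}"
          using pull_mem[of _ V m] unfolding mapspace_Xn by auto
        then show "lvlH V U m"
          unfolding lvlH_def using openin_continuous_map_preimage[OF pull_continuous[OF V] o[of "Suc m"]] by simp
      qed
    qed
  qed
  then show "lim_Top (dsp (AD X) V) (\<lambda>n. {x \<in> dpts (AD X) V. dprj (AD X) V x \<in> strat_fil S n})" by simp
qed

end

lemma (in str_cat) stratified_bundle_family: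
  fixes X :: "('o, 'v, 'x, 'b) family" and S :: "'b stratification"
  assumes "stratified_bundle C S X"
  shows "\<exists>M h g. strat_family C S X M h g"
proof -
  let ?P = "\<lambda>n (M :: ('o, 'v, 'b \<times> 'v, 'b) family) h g. fibre_bundle C M \<and> base M = strat_M S (Suc n) \<and>
        fam_pushout C (fam_restrict X (strat_fil S n)) M (strat_A S (Suc n))
          (fam_restrict X (strat_fil S (Suc n))) h (strat_h S (Suc n)) g (strat_g S (Suc n))"
  \<comment> \<open>The data of a stage are packed into one triple, so that a single choice over
    \<open>n\<close> suffices.\<close>
  have "\<forall>n. \<exists>z. ?P n (fst z) (fst (snd z)) (snd (snd z))"
  proof
    fix n
    obtain M h g where "?P n M h g" using assms unfolding stratified_bundle_def by (elim conjE allE[of _ n] exE) blast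
    then show "\<exists>z. ?P n (fst z) (fst (snd z)) (snd (snd z))" by (intro exI[of _ "(M, h, g)"]) simp
  qed
  then obtain z where z: "\<And>n. ?P n (fst (z n)) (fst (snd (z n))) (snd (snd (z n)))" by metis
  have "strat_family C S X (\<lambda>n. fst (z n)) (\<lambda>n. fst (snd (z n))) (\<lambda>n. snd (snd (z n)))"
    unfolding strat_family_def strat_family_axioms_def
    using assms z str_cat_axioms unfolding stratified_bundle_def by simp
  then show ?thesis by blast
qed

section \<open>Quotient spaces and generated equivalence relations\<close>

lemma openin_quotient_space:
  "openin (quotient_space X r) U \<longleftrightarrow> U \<subseteq> topspace X // r \<and> openin X {x \<in> topspace X. r `` {x} \<in> U}"
  unfolding quotient_space_def by (simp add: istopology_quotient_space)

lemma topspace_quotient_space: "topspace (quotient_space X r) = topspace X // r"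
proof -
  have "{x \<in> topspace X. r `` {x} \<in> topspace X // r} = topspace X" by (auto intro: quotientI)
  then have "openin (quotient_space X r) (topspace X // r)" by (simp add: openin_quotient_space)
  moreover have "topspace (quotient_space X r) \<subseteq> topspace X // r"
    using openin_topspace[of "quotient_space X r"] unfolding openin_quotient_space by (rule conjunct1)
  ultimately show ?thesis using openin_subset by blast
qed

text \<open>The predicate \<open>Q\<close> travels with the invariant: for coends it says that the
  related triples are points of the sum at all.\<close>

lemma generated_equiv_invariant:
  assumes "(s, t) \<in> generated_equiv r" and r: "\<And>s t. (s, t) \<in> r \<Longrightarrow> Q s \<and> Q t \<and> f s = f t" and s: "Q s"
  shows "Q t \<and> f t = f s"
  using assms(1) unfolding generated_equiv_def
proof (induction rule: rtrancl_induct)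
  case base
  then show ?case using s by simp
next
  case (step t u)
  then have "Q t \<and> Q u \<and> f t = f u" using r by (metis Un_iff converse_iff)
  then show ?case using step.IH by simp
qed

lemma generated_equiv_sym: "(s, t) \<in> generated_equiv r \<Longrightarrow> (t, s) \<in> generated_equiv r"
  unfolding generated_equiv_def using sym_rtrancl[OF sym_Un_converse] by (rule symD)

lemma generated_equiv_trans: "(s, t) \<in> generated_equiv r \<Longrightarrow> (t, u) \<in> generated_equiv r \<Longrightarrow> (s, u) \<in> generated_equiv r"
  unfolding generated_equiv_def by (rule rtrancl_trans)

context str_cat
begin

subsection \<open>Coends\<close>

abbreviation CF :: "('o, 'h, 'p, 'b) diagram \<Rightarrow> ('o, 'v, ('o \<times> 'p \<times> 'v) set, 'b) family" where
  "CF \<equiv> coend_family C"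

abbreviation cls :: "('o, 'h, 'p, 'b) diagram \<Rightarrow> 'o \<Rightarrow> 'p \<Rightarrow> 'v \<Rightarrow> ('o \<times> 'p \<times> 'v) set" where
  "cls \<equiv> coend_class C"

abbreviation PF :: "('o, 'h, 'p, 'b) diagram \<Rightarrow> 'o \<Rightarrow> ('p \<times> 'v) topology" where
  "PF P V \<equiv> prod_topology (dsp P V) (Fob C V)"

abbreviation cpre :: "('o, 'h, 'p, 'b) diagram \<Rightarrow> 'o \<Rightarrow> ('o \<times> 'p \<times> 'v) set set \<Rightarrow> ('p \<times> 'v) set" where
  "cpre P V U \<equiv> {p \<in> topspace (PF P V). cls P V (fst p) (snd p) \<in> U}"

definition triple :: "('o, 'h, 'p, 'b) diagram \<Rightarrow> 'o \<times> 'p \<times> 'v \<Rightarrow> bool" where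
  "triple P t \<longleftrightarrow> fst t \<in> Obj C \<and> fst (snd t) \<in> dpts P (fst t) \<and> snd (snd t) \<in> pts (fst t)"

text \<open>Base point and chart value of the class of a triple; together they determine the class.\<close>

definition cval :: "('o, 'h, 'p, 'b) diagram \<Rightarrow> 'o \<times> 'p \<times> 'v \<Rightarrow> 'b \<times> 'v" where
  "cval P = (\<lambda>(V, x, y). (dprj P V x, Far C (dchart P (dprj P V x) V x) y))"

text \<open>The universal element over \<open>b\<close> in the sense of the Yoneda lemma: its chart
  is the identity of \<open>dob P b\<close>, and every point over \<open>b\<close> arises from it by
  the action of its own chart morphism.\<close>

definition crep :: "('o, 'h, 'p, 'b) diagram \<Rightarrow> 'b \<Rightarrow> 'p" where
  "crep P b = (SOME x. x \<in> dfibre P b (dob P b) \<and> dchart P b (dob P b) x = Idn C (dob P b))"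

text \<open>Has the shape of \<open>prj\<close> and \<open>chart\<close> in
  \<open>coend_family\<close>, so that independence of the chosen representative is shown once, in
  the lemma of the same name.\<close>

definition clift :: "('o \<Rightarrow> 'p \<Rightarrow> 'v \<Rightarrow> 'z) \<Rightarrow> ('o \<times> 'p \<times> 'v) set \<Rightarrow> 'z" where
  "clift F c = (case SOME t. t \<in> c of (V, x, y) \<Rightarrow> F V x y)"

lemma triple_iff: "triple P (V, x, y) \<longleftrightarrow> V \<in> Obj C \<and> x \<in> dpts P V \<and> y \<in> pts V"
  by (simp add: triple_def)

lemma topspace_coend_sum: "t \<in> topspace (coend_sum C P) \<longleftrightarrow> triple P t"
  by (cases t) (auto simp: coend_sum_def triple_def)

lemma CF_simps [simp]: "base (CF P) = dbase P" "fob (CF P) = dob P" by (simp_all add: coend_family_def)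

context
  fixes P :: "('o, 'h, 'p, 'b) diagram"
  assumes P: "diagram_family C P"
begin

lemma crep:
  assumes b: "b \<in> dbpts P"
  shows "crep P b \<in> dfibre P b (dob P b)" "dchart P b (dob P b) (crep P b) = Idn C (dob P b)"
    "crep P b \<in> dpts P (dob P b)" "dprj P (dob P b) (crep P b) = b"
proof -
  have "\<exists>x. x \<in> dfibre P b (dob P b) \<and> dchart P b (dob P b) x = Idn C (dob P b)"
    using dchart_surj[OF P b dob_Obj[OF P b] Idn_Hom[OF dob_Obj[OF P b]]] by blast
  from someI_ex[OF this] show "crep P b \<in> dfibre P b (dob P b)" "dchart P b (dob P b) (crep P b) = Idn C (dob P b)"
    unfolding crep_def by simp_all
  then show "crep P b \<in> dpts P (dob P b)" "dprj P (dob P b) (crep P b) = b" by (simp_all add: dfibre_def)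
qed

lemma dchart_Hom': "V \<in> Obj C \<Longrightarrow> x \<in> dpts P V \<Longrightarrow> dchart P (dprj P V x) V x \<in> Hom C V (dob P (dprj P V x))"
  by (rule dchart_Hom[OF P dprj_base[OF P]]) (auto intro: dfibreI[OF P])

lemma cval_mem:
  assumes "triple P (V, x, y)"
  shows "dprj P V x \<in> dbpts P" "Far C (dchart P (dprj P V x) V x) y \<in> pts (dob P (dprj P V x))"
  using assms dprj_base[OF P] Far_pts[OF dchart_Hom'] unfolding triple_iff by blast+

lemma coend_rel_cval:
  assumes "triple P s" "(s, t) \<in> coend_rel C P"
  shows "triple P t \<and> cval P t = cval P s"
proof (rule generated_equiv_invariant[where Q = "triple P" and f = "cval P", OF assms(2)[unfolded coend_rel_def] _ assms(1)])
  fix s t :: "'o \<times> 'p \<times> 'v"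
  assume "(s, t) \<in> {((Src C \<alpha>, dact P \<alpha> x, y), (Trg C \<alpha>, x, Far C \<alpha> y)) | \<alpha> x y.
          \<alpha> \<in> Arr C \<and> x \<in> dpts P (Trg C \<alpha>) \<and> y \<in> topspace (Fob C (Src C \<alpha>))}"
  then obtain \<alpha> x y where st: "s = (Src C \<alpha>, dact P \<alpha> x, y)" "t = (Trg C \<alpha>, x, Far C \<alpha> y)"
    and a: "\<alpha> \<in> Arr C" and x: "x \<in> dpts P (Trg C \<alpha>)" and y: "y \<in> pts (Src C \<alpha>)"
    by blast
  note a' = Arr_Hom[OF a]
  note o = Hom_Obj[OF a']
  have V: "Src C \<alpha> \<in> Obj C" and W: "Trg C \<alpha> \<in> Obj C" using o by auto
  note b = dprj_base[OF P W x]
  note c = dchart_dact[OF P b a' dfibreI[OF P x]]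
  have "Far C (Comp C (dchart P (dprj P (Trg C \<alpha>) x) (Trg C \<alpha>) x) \<alpha>) y = Far C (dchart P (dprj P (Trg C \<alpha>) x) (Trg C \<alpha>) x) (Far C \<alpha> y)"
    by (rule Far_Comp[OF a' dchart_Hom'[OF W x] y])
  then show "triple P s \<and> triple P t \<and> cval P s = cval P t"
    using V W x y dact_top[OF P a' x] Far_pts[OF a' y] dprj_dact[OF P a' x] c by (simp add: st triple_iff cval_def)
qed

text \<open>By naturality and injectivity of the charts \<open>x\<close> is the universal element
  acted on by the chart morphism of \<open>x\<close>, so a single generating relation moves the
  triple to the universal element.\<close>

lemma coend_rel_crep:
  assumes "triple P (V, x, y)"
  shows "((V, x, y), (dob P (dprj P V x), crep P (dprj P V x), Far C (dchart P (dprj P V x) V x) y)) \<in> coend_rel C P"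
proof -
  have V: "V \<in> Obj C" and x: "x \<in> dpts P V" and y: "y \<in> pts V" using assms unfolding triple_iff by auto
  let ?b = "dprj P V x"
  let ?\<phi> = "dchart P ?b V x"
  note b = dprj_base[OF P V x] and ph = dchart_Hom'[OF V x]
  note r = crep[OF b]
  have "dact P ?\<phi> (crep P ?b) \<in> dfibre P ?b V" by (rule dact_dfibre[OF P ph r(1)])
  moreover have "dchart P ?b V (dact P ?\<phi> (crep P ?b)) = ?\<phi>"
    using dchart_dact[OF P b ph r(1)] by (simp add: r(2) Comp_Idn(2)[OF ph])
  ultimately have e: "dact P ?\<phi> (crep P ?b) = x"
    using dchart_inj[OF P b V] dfibreI[OF P x] by (simp add: inj_on_eq_iff)
  have a: "?\<phi> \<in> Arr C" "Src C ?\<phi> = V" "Trg C ?\<phi> = dob P ?b" using Hom_Arr[OF ph] by auto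
  have "((V, x, y), (dob P ?b, crep P ?b, Far C ?\<phi> y)) \<in> {((Src C \<alpha>, dact P \<alpha> x, y), (Trg C \<alpha>, x, Far C \<alpha> y)) | \<alpha> x y.
          \<alpha> \<in> Arr C \<and> x \<in> dpts P (Trg C \<alpha>) \<and> y \<in> topspace (Fob C (Src C \<alpha>))}"
    using a y r(3) e by (intro CollectI exI[of _ ?\<phi>] exI[of _ "crep P ?b"] exI[of _ y]) simp
  then show ?thesis unfolding coend_rel_def generated_equiv_def by blast
qed

text \<open>Triples with equal \<open>cval\<close> are both related to the same triple at the
  universal element.\<close>

lemma coend_rel_iff:
  assumes s: "triple P s"
  shows "(s, t) \<in> coend_rel C P \<longleftrightarrow> triple P t \<and> cval P t = cval P s"
proof
  assume t: "triple P t \<and> cval P t = cval P s"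
  obtain V x y where s': "s = (V, x, y)" by (cases s)
  obtain V' x' y' where t': "t = (V', x', y')" by (cases t)
  have e: "dprj P V' x' = dprj P V x" "Far C (dchart P (dprj P V' x') V' x') y' = Far C (dchart P (dprj P V x) V x) y"
    using t unfolding s' t' cval_def by auto
  have "(s, (dob P (dprj P V x), crep P (dprj P V x), Far C (dchart P (dprj P V x) V x) y)) \<in> coend_rel C P"
    unfolding s' by (rule coend_rel_crep) (use s s' in simp)
  moreover have "(t, (dob P (dprj P V x), crep P (dprj P V x), Far C (dchart P (dprj P V x) V x) y)) \<in> coend_rel C P"
    using coend_rel_crep[of V' x' y'] t unfolding t' e(1) e(2)[unfolded e(1)] by blast
  ultimately show "(s, t) \<in> coend_rel C P"
    unfolding coend_rel_def by (blast intro: generated_equiv_sym generated_equiv_trans)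
qed (rule coend_rel_cval[OF s])

lemma coend_class_mem: "triple P (V, x, y) \<Longrightarrow> t \<in> cls P V x y \<longleftrightarrow> triple P t \<and> cval P t = cval P (V, x, y)"
  unfolding coend_class_def using coend_rel_iff by simp

lemma coend_class_eq:
  assumes "triple P (V, x, y)" "triple P (V', x', y')"
  shows "cls P V x y = cls P V' x' y' \<longleftrightarrow> cval P (V, x, y) = cval P (V', x', y')"
proof
  assume "cls P V x y = cls P V' x' y'"
  moreover have "(V, x, y) \<in> cls P V x y" using coend_class_mem[OF assms(1)] assms(1) by simp
  ultimately show "cval P (V, x, y) = cval P (V', x', y')" using coend_class_mem[OF assms(2)] by simp
next
  assume "cval P (V, x, y) = cval P (V', x', y')"
  then show "cls P V x y = cls P V' x' y'" using coend_class_mem[OF assms(1)] coend_class_mem[OF assms(2)] by (intro set_eqI) simp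
qed

lemma clift:
  assumes t: "triple P (V, x, y)"
    and r: "\<And>V' x' y'. triple P (V', x', y') \<Longrightarrow> cval P (V', x', y') = cval P (V, x, y) \<Longrightarrow> F V' x' y' = F V x y"
  shows "clift F (cls P V x y) = F V x y"
proof -
  have "(V, x, y) \<in> cls P V x y" using coend_class_mem[OF t] t by simp
  then have "(SOME t. t \<in> cls P V x y) \<in> cls P V x y" by (rule someI)
  moreover obtain V' x' y' where e: "(SOME t. t \<in> cls P V x y) = (V', x', y')" by (metis prod_cases3)
  ultimately have "triple P (V', x', y')" "cval P (V', x', y') = cval P (V, x, y)"
    unfolding coend_class_mem[OF t] by auto
  then have "F V' x' y' = F V x y" by (rule r)
  then show ?thesis by (simp add: clift_def e)
qed

lemma CF_prj:
  assumes t: "triple P (V, x, y)"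
  shows "prj (CF P) (cls P V x y) = dprj P V x"
proof -
  have "clift (\<lambda>V x y. dprj P V x) (cls P V x y) = dprj P V x" by (rule clift[OF t]) (simp add: cval_def)
  then show ?thesis by (simp add: coend_family_def clift_def)
qed

lemma CF_chart:
  assumes t: "triple P (V, x, y)"
  shows "chart (CF P) (dprj P V x) (cls P V x y) = Far C (dchart P (dprj P V x) V x) y"
proof -
  have "clift (\<lambda>V' x' y'. Far C (dchart P (dprj P V x) V' x') y') (cls P V x y) = Far C (dchart P (dprj P V x) V x) y"
    by (rule clift[OF t]) (auto simp: cval_def)
  then show ?thesis by (simp add: coend_family_def clift_def)
qed

lemma CF_top: "c \<in> tpts (CF P) \<longleftrightarrow> (\<exists>V x y. triple P (V, x, y) \<and> c = cls P V x y)"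
proof -
  have "tpts (CF P) = topspace (coend_sum C P) // coend_rel C P"
    by (simp add: coend_family_def topspace_quotient_space)
  then have "c \<in> tpts (CF P) \<longleftrightarrow> (\<exists>t. triple P t \<and> c = coend_rel C P `` {t})"
    by (simp add: quotient_def Bex_def topspace_coend_sum del: split_paired_Ex)
  then show ?thesis unfolding coend_class_def split_paired_Ex .
qed

lemma CF_topI: "triple P (V, x, y) \<Longrightarrow> cls P V x y \<in> tpts (CF P)" unfolding CF_top by blast

lemma CF_topE:
  assumes "c \<in> tpts (CF P)"
  obtains V x y where "triple P (V, x, y)" "c = cls P V x y" using assms unfolding CF_top by blast

lemma CF_openin: "openin (tot (CF P)) U \<longleftrightarrow> U \<subseteq> tpts (CF P) \<and>
     (\<forall>V\<in>Obj C. openin (PF P V) (cpre P V U))"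
proof -
  have t: "tpts (CF P) = topspace (coend_sum C P) // coend_rel C P"
    by (simp add: coend_family_def topspace_quotient_space)
  have e: "{p. (V, p) \<in> {t \<in> topspace (coend_sum C P). coend_rel C P `` {t} \<in> U}} =
      cpre P V U" if "V \<in> Obj C" for V using that by (auto simp: topspace_coend_sum triple_def coend_class_def)
  have "openin (coend_sum C P) {t \<in> topspace (coend_sum C P). coend_rel C P `` {t} \<in> U} \<longleftrightarrow>
     (\<forall>V\<in>Obj C. openin (PF P V) {p. (V, p) \<in> {t \<in> topspace (coend_sum C P). coend_rel C P `` {t} \<in> U}})"
    unfolding coend_sum_def openin_sum_topology by auto
  also have "\<dots> \<longleftrightarrow> (\<forall>V\<in>Obj C. openin (PF P V) (cpre P V U))"
    by (rule ball_cong[OF refl]) (simp only: e)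
  finally show ?thesis unfolding t by (simp add: coend_family_def openin_quotient_space)
qed

lemma cls_continuous:
  assumes V: "V \<in> Obj C"
  shows "continuous_map (PF P V) (tot (CF P)) (\<lambda>p. cls P V (fst p) (snd p))"
  unfolding continuous_map_def
proof (intro conjI allI impI)
  show "(\<lambda>p. cls P V (fst p) (snd p)) \<in> topspace (PF P V) \<rightarrow> tpts (CF P)"
    using V by (auto simp: triple_iff intro: CF_topI)
qed (use V CF_openin in blast)

lemma cls_continuous':
  assumes V: "V \<in> Obj C" and f: "continuous_map T (dsp P V) f" and g: "continuous_map T (Fob C V) g"
  shows "continuous_map T (tot (CF P)) (\<lambda>t. cls P V (f t) (g t))"
proof -
  have "continuous_map T (PF P V) (\<lambda>t. (f t, g t))" using f g by (simp add: continuous_map_pairwise o_def)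
  from continuous_map_compose[OF this cls_continuous[OF V]] show ?thesis by (simp add: o_def)
qed

lemma CF_continuous:
  assumes "\<And>V. V \<in> Obj C \<Longrightarrow> continuous_map (PF P V) Z (\<lambda>p. f (cls P V (fst p) (snd p)))"
  shows "continuous_map (tot (CF P)) Z f"
  unfolding continuous_map_def
proof (intro conjI allI impI)
  show "f \<in> tpts (CF P) \<rightarrow> topspace Z"
  proof
    fix c assume "c \<in> tpts (CF P)"
    then obtain V x y where t: "triple P (V, x, y)" and c: "c = cls P V x y" by (rule CF_topE)
    then show "f c \<in> topspace Z" using continuous_map_funspace[OF assms[of V]] by (auto simp: triple_iff Pi_iff)
  qed
  fix U assume U: "openin Z U"
  show "openin (tot (CF P)) {c \<in> tpts (CF P). f c \<in> U}"
    unfolding CF_openin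
  proof (intro conjI ballI)
    fix V assume V: "V \<in> Obj C"
    have "{p \<in> topspace (PF P V). cls P V (fst p) (snd p) \<in> {c \<in> tpts (CF P). f c \<in> U}} =
       {p \<in> topspace (PF P V). f (cls P V (fst p) (snd p)) \<in> U}"
      using continuous_map_funspace[OF cls_continuous[OF V]] by (auto simp: Pi_iff)
    then show "openin (PF P V) {p \<in> topspace (PF P V). cls P V (fst p) (snd p) \<in> {c \<in> tpts (CF P). f c \<in> U}}"
      using openin_continuous_map_preimage[OF assms[OF V] U] by simp
  qed blast
qed

lemma CF_closedin: "closedin (tot (CF P)) K \<longleftrightarrow> K \<subseteq> tpts (CF P) \<and>
     (\<forall>V\<in>Obj C. closedin (PF P V) (cpre P V K))"
proof -
  have e: "{p \<in> topspace (PF P V). cls P V (fst p) (snd p) \<in> tpts (CF P) - K} =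
      topspace (PF P V) - (cpre P V K)"
    if V: "V \<in> Obj C" for V using continuous_map_funspace[OF cls_continuous[OF V]] by (auto simp: Pi_iff)
  show ?thesis unfolding closedin_def CF_openin using e by auto
qed

lemma CF_prj_continuous: "continuous_map (tot (CF P)) (dbase P) (prj (CF P))"
proof (rule CF_continuous)
  fix V assume V: "V \<in> Obj C"
  have "continuous_map (PF P V) (dbase P) (\<lambda>p. dprj P V (fst p))"
    using continuous_map_compose[OF continuous_map_fst dprj_continuous[OF P V]] by (simp add: o_def)
  then show "continuous_map (PF P V) (dbase P) (\<lambda>p. prj (CF P) (cls P V (fst p) (snd p)))"
    by (rule continuous_map_eq) (use V CF_prj in \<open>auto simp: triple_iff\<close>)
qed

end


lemma triple_restrict: "triple (diag_restrict P A) t \<longleftrightarrow> triple P t \<and> fst (cval P t) \<in> A"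
  by (cases t) (auto simp: triple_def cval_def)

lemma triple_restrict': "triple (diag_restrict P A) (V, x, y) \<longleftrightarrow> triple P (V, x, y) \<and> dprj P V x \<in> A"
  unfolding triple_restrict by (simp add: cval_def)

lemma cval_restrict: "cval (diag_restrict P A) = cval P" by (simp add: cval_def)

lemma cls_restrict:
  assumes P: "diagram_family C P" and t: "triple (diag_restrict P A) (V, x, y)"
  shows "cls (diag_restrict P A) V x y = cls P V x y"
proof (rule set_eqI)
  fix u
  have t': "triple P (V, x, y)" "fst (cval P (V, x, y)) \<in> A" using t unfolding triple_restrict by auto
  show "u \<in> cls (diag_restrict P A) V x y \<longleftrightarrow> u \<in> cls P V x y"
    unfolding coend_class_mem[OF diagram_family_restrict[OF P] t] coend_class_mem[OF P t'(1)] cval_restrict triple_restrict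
    using t'(2) by auto
qed

text \<open>Quotient topologies restrict well only to suitable saturated subsets. For closed or open
  \<open>A\<close> the part over \<open>A\<close> is closed or open in every product
  \<open>PF P V\<close>, so closed or open sets can be tested without leaving it.\<close>

lemma CF_restrict:
  assumes P: "diagram_family C P" and A: "closedin (dbase P) A \<or> openin (dbase P) A"
  shows "CF (diag_restrict P A) = fam_restrict (CF P) A"
proof -
  let ?R = "diag_restrict P A"
  let ?O = "over (CF P) A"
  let ?PP = "\<lambda>V. (PF P V)" and ?PR = "\<lambda>V. (PF ?R V)"
  note R = diagram_family_restrict[OF P, of A]
  have top: "tpts (CF ?R) = ?O"
  proof (intro set_eqI iffI)
    fix c assume "c \<in> tpts (CF ?R)"
    then obtain V x y where t: "triple ?R (V, x, y)" "c = cls ?R V x y" by (rule CF_topE[OF R])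
    note t' = t(1)[unfolded triple_restrict]
    show "c \<in> ?O" using t' CF_topI[OF P, of V x y] CF_prj[OF P, of V x y] unfolding t(2) cls_restrict[OF P t(1)]
      by (simp add: cval_def)
  next
    fix c assume c: "c \<in> ?O"
    then have "c \<in> tpts (CF P)" by blast
    then obtain V x y where t: "triple P (V, x, y)" "c = cls P V x y" by (rule CF_topE[OF P])
    then have t': "triple ?R (V, x, y)" using c CF_prj[OF P t(1)] unfolding triple_restrict by (simp add: cval_def)
    show "c \<in> tpts (CF ?R)" unfolding t(2) cls_restrict[OF P t', symmetric] by (rule CF_topI[OF R t'])
  qed
  have pre: "{p \<in> topspace (?PP V). cls P V (fst p) (snd p) \<in> K} = {p \<in> topspace (?PR V). cls ?R V (fst p) (snd p) \<in> K}"
    if K: "K \<subseteq> ?O" and V: "V \<in> Obj C" for K V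
  proof (intro set_eqI)
    fix p
    have 1: "p \<in> topspace (?PP V) \<longleftrightarrow> triple P (V, fst p, snd p)" unfolding triple_iff using V by (simp add: mem_Times_iff)
    have 2: "p \<in> topspace (?PR V) \<longleftrightarrow> triple ?R (V, fst p, snd p)" unfolding triple_iff using V by (auto simp: mem_Times_iff)
    show "p \<in> {p \<in> topspace (?PP V). cls P V (fst p) (snd p) \<in> K} \<longleftrightarrow> p \<in> {p \<in> topspace (?PR V). cls ?R V (fst p) (snd p) \<in> K}"
    proof
      assume "p \<in> {p \<in> topspace (?PP V). cls P V (fst p) (snd p) \<in> K}"
      then have t: "triple P (V, fst p, snd p)" and k: "cls P V (fst p) (snd p) \<in> K" using 1 by auto
      then have "dprj P V (fst p) \<in> A" using K CF_prj[OF P t] by auto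
      then have t': "triple ?R (V, fst p, snd p)" using t unfolding triple_restrict' by (intro conjI)
      show "p \<in> {p \<in> topspace (?PR V). cls ?R V (fst p) (snd p) \<in> K}"
        using t' k 2 cls_restrict[OF P t'] by simp
    next
      assume "p \<in> {p \<in> topspace (?PR V). cls ?R V (fst p) (snd p) \<in> K}"
      then have t: "triple ?R (V, fst p, snd p)" and k: "cls ?R V (fst p) (snd p) \<in> K" using 2 by auto
      then show "p \<in> {p \<in> topspace (?PP V). cls P V (fst p) (snd p) \<in> K}"
        using 1 cls_restrict[OF P t] unfolding triple_restrict by simp
    qed
  qed
  have PR: "?PR V = subtopology (?PP V) (dover P V A \<times> pts V)" for V by (simp add: prod_topology_subtopology)
  have "tot (CF ?R) = subtopology (tot (CF P)) ?O"
  proof (rule topology_eq_by_id)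
    have "continuous_map (tot (CF ?R)) (tot (CF P)) (\<lambda>c. c)"
    proof (rule CF_continuous[OF R])
      fix V assume V: "V \<in> Obj C"
      have "continuous_map (?PR V) (tot (CF P)) (\<lambda>p. cls P V (fst p) (snd p))"
        unfolding PR by (rule continuous_map_from_subtopology[OF cls_continuous[OF P V]])
      then show "continuous_map (?PR V) (tot (CF P)) (\<lambda>p. cls ?R V (fst p) (snd p))"
      proof (rule continuous_map_eq)
        fix p assume "p \<in> topspace (?PR V)"
        then have "triple ?R (V, fst p, snd p)" using V by (auto simp: triple_iff)
        then show "cls P V (fst p) (snd p) = cls ?R V (fst p) (snd p)" by (rule cls_restrict[OF P, symmetric])
      qed
    qed
    then show "continuous_map (tot (CF ?R)) (subtopology (tot (CF P)) ?O) (\<lambda>c. c)"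
      unfolding continuous_map_in_subtopology top by auto
    have TO: "topspace (subtopology (tot (CF P)) ?O) = ?O" by auto
    \<comment> \<open>Here the hypothesis on \<open>A\<close> enters: a preimage that is closed in
      the closed part is closed in the whole product, and likewise with open sets.\<close>
    show "continuous_map (subtopology (tot (CF P)) ?O) (tot (CF ?R)) (\<lambda>c. c)"
      using A
    proof
      assume cA: "closedin (dbase P) A"
      show ?thesis
        unfolding continuous_map_closedin
      proof (intro conjI allI impI ballI)
        fix K assume K: "closedin (tot (CF ?R)) K"
        then have KO: "K \<subseteq> ?O" using closedin_subset top by blast
        have "closedin (tot (CF P)) K"
          unfolding CF_closedin[OF P]
        proof (intro conjI ballI)
          fix V assume V: "V \<in> Obj C"
          have "closedin (dsp P V) (dover P V A)" by (rule closedin_continuous_map_preimage[OF dprj_continuous[OF P V] cA])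
          then have "closedin (?PP V) (dover P V A \<times> pts V)" by (simp add: closedin_prod_Times_iff)
          moreover have "closedin (?PR V) {p \<in> topspace (?PR V). cls ?R V (fst p) (snd p) \<in> K}"
            using K V unfolding CF_closedin[OF R] by blast
          ultimately have "closedin (?PP V) {p \<in> topspace (?PR V). cls ?R V (fst p) (snd p) \<in> K}"
            unfolding PR[of V] by (rule closedin_trans_full[rotated])
          then show "closedin (?PP V) {p \<in> topspace (?PP V). cls P V (fst p) (snd p) \<in> K}" unfolding pre[OF KO V] .
        qed (use KO in blast)
        then have "closedin (subtopology (tot (CF P)) ?O) K" by (rule closedin_subset_topspace[OF _ KO])
        moreover have "{x \<in> topspace (subtopology (tot (CF P)) ?O). x \<in> K} = K" using KO unfolding TO by blast
        ultimately show "closedin (subtopology (tot (CF P)) ?O) {x \<in> topspace (subtopology (tot (CF P)) ?O). x \<in> K}" by simp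
      qed (use top TO in blast)
    next
      assume oA: "openin (dbase P) A"
      show ?thesis
        unfolding continuous_map_def
      proof (intro conjI allI impI)
        fix K assume K: "openin (tot (CF ?R)) K"
        then have KO: "K \<subseteq> ?O" using openin_subset top by blast
        have "openin (tot (CF P)) K"
          unfolding CF_openin[OF P]
        proof (intro conjI ballI)
          fix V assume V: "V \<in> Obj C"
          have "openin (dsp P V) (dover P V A)" by (rule openin_continuous_map_preimage[OF dprj_continuous[OF P V] oA])
          then have "openin (?PP V) (dover P V A \<times> pts V)" by (simp add: openin_prod_Times_iff)
          moreover have "openin (?PR V) {p \<in> topspace (?PR V). cls ?R V (fst p) (snd p) \<in> K}"
            using K V unfolding CF_openin[OF R] by blast
          ultimately have "openin (?PP V) {p \<in> topspace (?PR V). cls ?R V (fst p) (snd p) \<in> K}"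
            unfolding PR[of V] by (rule openin_trans_full[rotated])
          then show "openin (?PP V) {p \<in> topspace (?PP V). cls P V (fst p) (snd p) \<in> K}" unfolding pre[OF KO V] .
        qed (use KO in blast)
        then have "openin (subtopology (tot (CF P)) ?O) K" using KO unfolding openin_subtopology by blast
        moreover have "{x \<in> topspace (subtopology (tot (CF P)) ?O). x \<in> K} = K" using KO unfolding TO by blast
        ultimately show "openin (subtopology (tot (CF P)) ?O) {x \<in> topspace (subtopology (tot (CF P)) ?O). x \<in> K}" by simp
      qed (use top TO in blast)
    qed
  qed
  then show ?thesis by (simp add: coend_family_def fam_restrict_def)
qed

text \<open>Since \<open>{b}\<close> is closed, the fibre over \<open>b\<close> is the coend of the
  diagram restricted to \<open>{b}\<close>. Its chart evaluates chart morphisms, and the inverse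
  pairs a point with the universal element \<open>crep P b\<close>.\<close>

lemma CF_family:
  assumes P: "diagram_family C P" and T1: "\<And>b. b \<in> dbpts P \<Longrightarrow> closedin (dbase P) {b}"
  shows "family C (CF P)"
  unfolding family_def CF_simps
proof (intro conjI ballI)
  show "continuous_map (tot (CF P)) (dbase P) (prj (CF P))" by (rule CF_prj_continuous[OF P])
  fix b assume b: "b \<in> dbpts P"
  show o: "dob P b \<in> Obj C" by (rule dob_Obj[OF P b])
  let ?R = "diag_restrict P {b}"
  note R = diagram_family_restrict[OF P, of "{b}"]
  have "tot (CF ?R) = tot (fam_restrict (CF P) {b})" using CF_restrict[OF P disjI1[OF T1[OF b]]] by simp
  moreover have fO: "over (CF P) {b} = fibre (CF P) b" by (simp add: fibre_def)
  ultimately have T: "subtopology (tot (CF P)) (fibre (CF P) b) = tot (CF ?R)" by simp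
  have elt: "c \<in> tpts (CF ?R) \<Longrightarrow> \<exists>V x y. triple P (V, x, y) \<and> dprj P V x = b \<and> c = cls P V x y" for c
  proof -
    assume "c \<in> tpts (CF ?R)"
    then obtain V x y where t: "triple ?R (V, x, y)" "c = cls ?R V x y" by (rule CF_topE[OF R])
    then show ?thesis using t(1)[unfolded triple_restrict] cls_restrict[OF P t(1)]
      by (intro exI[of _ V] exI[of _ x] exI[of _ y]) (simp add: cval_def)
  qed
  have ctr: "triple P (dob P b, crep P b, w)" if "w \<in> pts (dob P b)" for w
    using o crep(3)[OF P b] that by (simp add: triple_iff)
  have chr: "chart (CF P) b (cls P (dob P b) (crep P b) w) = w" if "w \<in> pts (dob P b)" for w
    using CF_chart[OF P ctr[OF that]] Far_Idn[OF o that] by (simp add: crep(4)[OF P b] crep(2)[OF P b])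
  have "homeomorphic_maps (tot (CF ?R)) (Fob C (dob P b)) (chart (CF P) b) (\<lambda>w. cls P (dob P b) (crep P b) w)"
    unfolding homeomorphic_maps_def
  proof (intro conjI ballI)
    show "continuous_map (tot (CF ?R)) (Fob C (dob P b)) (chart (CF P) b)"
    proof (rule CF_continuous[OF R])
      fix V assume V: "V \<in> Obj C"
      have "continuous_map (dsp ?R V) (Hom_top C V (dob P b)) (dchart P b V)"
        using dchart_continuous[OF P b V] by (simp add: dfibre_def)
      from continuous_map_compose[OF continuous_map_fst this]
      have "continuous_map (PF ?R V) (Hom_top C V (dob P b)) (\<lambda>p. dchart P b V (fst p))"
        by (simp add: o_def)
      from Far_app_continuous[OF V this continuous_map_snd]
      show "continuous_map (PF ?R V) (Fob C (dob P b)) (\<lambda>p. chart (CF P) b (cls ?R V (fst p) (snd p)))"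
      proof (rule continuous_map_eq)
        fix p assume "p \<in> topspace (PF ?R V)"
        then have t: "triple ?R (V, fst p, snd p)" using V by (auto simp: triple_iff)
        have t': "triple P (V, fst p, snd p)" "dprj P V (fst p) = b" using t unfolding triple_restrict' by blast+
        show "Far C (dchart P b V (fst p)) (snd p) = chart (CF P) b (cls ?R V (fst p) (snd p))"
          unfolding cls_restrict[OF P t] using CF_chart[OF P t'(1)] unfolding t'(2) by (rule sym)
      qed
    qed
    have "continuous_map (Fob C (dob P b)) (tot (CF P)) (\<lambda>w. cls P (dob P b) (crep P b) w)"
      by (rule cls_continuous'[OF P o]) (simp_all add: crep(3)[OF P b])
    then show "continuous_map (Fob C (dob P b)) (tot (CF ?R)) (\<lambda>w. cls P (dob P b) (crep P b) w)"
      unfolding T[symmetric] continuous_map_in_subtopology fO[symmetric]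
      using CF_topI[OF P ctr] CF_prj[OF P ctr] crep(4)[OF P b] by auto
    show "chart (CF P) b (cls P (dob P b) (crep P b) w) = w" if "w \<in> pts (dob P b)" for w by (rule chr[OF that])
    fix c assume "c \<in> tpts (CF ?R)"
    then obtain V x y where t: "triple P (V, x, y)" "dprj P V x = b" "c = cls P V x y" using elt by blast
    note m = cval_mem[OF P t(1), unfolded t(2)]
    have "cls P (dob P b) (crep P b) (Far C (dchart P b V x) y) = cls P V x y"
      unfolding coend_class_eq[OF P ctr[OF m(2)] t(1)]
      using Far_Idn[OF o m(2)] by (simp add: cval_def t(2) crep(4)[OF P b] crep(2)[OF P b])
    then show "cls P (dob P b) (crep P b) (chart (CF P) b c) = c"
      using CF_chart[OF P t(1)] unfolding t(2) t(3) by simp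
  qed
  then show "homeomorphic_map (subtopology (tot (CF P)) (fibre (CF P) b)) (Fob C (dob P b)) (chart (CF P) b)"
    unfolding T homeomorphic_map_maps by blast
qed

section \<open>Functoriality of the coend, and coends of bundles\<close>

definition cmap :: "('o, 'h, 'q, 'c) diagram \<Rightarrow> ('o \<Rightarrow> 'p \<Rightarrow> 'q) \<Rightarrow> ('o \<times> 'p \<times> 'v) set \<Rightarrow> ('o \<times> 'q \<times> 'v) set" where
  "cmap E f = clift (\<lambda>V x y. cls E V (f V x) y)"

context
  fixes D :: "('o, 'h, 'p, 'b) diagram" and E :: "('o, 'h, 'q, 'c) diagram" and f fb
  assumes D: "diagram_family C D" and E: "diagram_family C E" and f: "diag_map C D E f fb"
begin

lemma cval_map:
  assumes t: "triple D (V, x, y)" and a: "dfibre_arrow C D E f fb (dprj D V x) \<phi>"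
  shows "triple E (V, f V x, y)" "cval E (V, f V x, y) = (fb (dprj D V x), Far C \<phi> (snd (cval D (V, x, y))))"
proof -
  have V: "V \<in> Obj C" and x: "x \<in> dpts D V" and y: "y \<in> pts V" using t unfolding triple_iff by auto
  show "triple E (V, f V x, y)" using diag_mapD(6)[OF f V x] V y by (simp add: triple_iff)
  have p: "\<phi> \<in> Hom C (dob D (dprj D V x)) (dob E (fb (dprj D V x)))"
    and c: "dchart E (fb (dprj D V x)) V (f V x) = Comp C \<phi> (dchart D (dprj D V x) V x)"
    using a V dfibreI[OF D x] unfolding dfibre_arrow_def by blast+
  show "cval E (V, f V x, y) = (fb (dprj D V x), Far C \<phi> (snd (cval D (V, x, y))))"
    using diag_mapD(3)[OF f V x] c Far_Comp[OF dchart_Hom'[OF D V x] p y] by (simp add: cval_def)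
qed

lemma cmap_cls:
  assumes t: "triple D (V, x, y)"
  shows "cmap E f (cls D V x y) = cls E V (f V x) y"
  unfolding cmap_def
proof (rule clift[OF D t])
  fix V' x' y' assume t': "triple D (V', x', y')" and e: "cval D (V', x', y') = cval D (V, x, y)"
  obtain \<phi> where a: "dfibre_arrow C D E f fb (dprj D V x) \<phi>"
    using diag_mapD(5)[OF f cval_mem(1)[OF D t]] by blast
  have b: "dprj D V' x' = dprj D V x" using e by (simp add: cval_def)
  note m = cval_map[OF t a] and m' = cval_map[OF t' a[folded b]]
  show "cls E V' (f V' x') y' = cls E V (f V x) y"
    unfolding coend_class_eq[OF E m'(1) m(1)] using m(2) m'(2) e b by simp
qed

lemma cmap_continuous: "continuous_map (tot (CF D)) (tot (CF E)) (cmap E f)"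
proof (rule CF_continuous[OF D])
  fix V assume V: "V \<in> Obj C"
  have "continuous_map (PF D V) (tot (CF E)) (\<lambda>p. cls E V (f V (fst p)) (snd p))"
    by (rule cls_continuous'[OF E V])
      (use continuous_map_compose[OF continuous_map_fst diag_mapD(2)[OF f V]] in \<open>simp_all add: o_def continuous_map_snd\<close>)
  then show "continuous_map (PF D V) (tot (CF E)) (\<lambda>p. cmap E f (cls D V (fst p) (snd p)))"
  proof (rule continuous_map_eq)
    fix p assume "p \<in> topspace (PF D V)"
    then have "triple D (V, fst p, snd p)" using V by (auto simp: triple_iff)
    then show "cls E V (f V (fst p)) (snd p) = cmap E f (cls D V (fst p) (snd p))" by (rule cmap_cls[symmetric])
  qed
qed

lemma cmap_prj: "c \<in> tpts (CF D) \<Longrightarrow> prj (CF E) (cmap E f c) = fb (prj (CF D) c)"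
proof -
  assume "c \<in> tpts (CF D)"
  then obtain V x y where t: "triple D (V, x, y)" "c = cls D V x y" by (rule CF_topE[OF D])
  obtain \<phi> where a: "dfibre_arrow C D E f fb (dprj D V x) \<phi>"
    using diag_mapD(5)[OF f cval_mem(1)[OF D t(1)]] by blast
  note m = cval_map[OF t(1) a]
  show "prj (CF E) (cmap E f c) = fb (prj (CF D) c)"
    unfolding t(2) cmap_cls[OF t(1)] CF_prj[OF E m(1)] CF_prj[OF D t(1)] using m(2) by (simp add: cval_def)
qed

text \<open>A map of diagrams acts on chart morphisms by composition, hence on chart values by
  \<open>Far C \<phi>\<close>; so the same morphism serves for the families.\<close>

lemma cmap_arrow:
  assumes b: "b \<in> dbpts D" and a: "dfibre_arrow C D E f fb b \<phi>"
  shows "fibre_arrow C (CF D) (CF E) (cmap E f) fb b \<phi>"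
  unfolding fibre_arrow_def CF_simps
proof (intro conjI ballI)
  show "\<phi> \<in> Hom C (dob D b) (dob E (fb b))" using a unfolding dfibre_arrow_def by blast
  fix c assume c: "c \<in> fibre (CF D) b"
  then have c': "c \<in> tpts (CF D)" "prj (CF D) c = b" by (simp_all add: fibre_def)
  then obtain V x y where t: "triple D (V, x, y)" "c = cls D V x y" by (elim CF_topE[OF D])
  have b: "dprj D V x = b" using c'(2) CF_prj[OF D t(1)] t(2) by simp
  note m = cval_map[OF t(1) a[folded b]]
  have e: "dprj E V (f V x) = fb b" using m(2) b by (simp add: cval_def)
  show "chart (CF E) (fb b) (cmap E f c) = Far C \<phi> (chart (CF D) b c)"
    using CF_chart[OF E m(1)] CF_chart[OF D t(1)] m(2) unfolding t(2) cmap_cls[OF t(1)] e b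
    by (simp add: cval_def e b)
qed

lemma cmap_map: "fam_map C (CF D) (CF E) (cmap E f) fb"
  unfolding fam_map_def CF_simps
proof (intro conjI ballI)
  show "continuous_map (dbase D) (dbase E) fb" by (rule diag_mapD(1)[OF f])
  show "\<exists>\<phi>. fibre_arrow C (CF D) (CF E) (cmap E f) fb b \<phi>" if "b \<in> dbpts D" for b
    using diag_mapD(5)[OF f that] cmap_arrow[OF that] by blast
qed (fact cmap_continuous cmap_prj)+

end


text \<open>A trivialisation of the diagram carries the identity morphism to a continuous family
  \<open>x0\<close> of points over \<open>N\<close>. Pairing with \<open>x0 b\<close> gives
  \<open>t\<close>, and applying the morphism found in the trivialisation gives the coordinate
  \<open>s\<close>.\<close>

lemma CF_bundle:
  assumes bun: "diagram_bundle C D" and T1: "\<And>b. b \<in> dbpts D \<Longrightarrow> closedin (dbase D) {b}"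
  shows "fibre_bundle C (CF D)"
proof (rule loc_triv_bundle)
  have D: "diagram_family C D" using bun unfolding diagram_bundle_def by (rule conjunct1)
  show "family C (CF D)" by (rule CF_family[OF D T1])
  fix b0 assume "b0 \<in> bpts (CF D)"
  then have "b0 \<in> dbpts D" by simp
  then obtain U N W f fb where U: "U \<subseteq> dbpts D" "openin (dbase D) N" "b0 \<in> N" "N \<subseteq> U" "W \<in> Obj C"
    and iso: "diag_iso C (diag_restrict D U) (product_diagram C (subtopology (dbase D) U) W) f fb"
    using bun unfolding diagram_bundle_def by blast
  let ?DU = "diag_restrict D U" and ?R = "diag_restrict D N"
  let ?P = "product_diagram C (subtopology (dbase D) U) W"
  obtain k kb where f: "diag_map C ?DU ?P f fb" and k: "diag_map C ?P ?DU k kb"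
    and kf: "\<forall>V\<in>Obj C. (\<forall>x\<in>dpts ?DU V. k V (f V x) = x) \<and> (\<forall>y\<in>dpts ?P V. f V (k V y) = y)"
    and kfb: "\<forall>b\<in>dbpts ?DU. kb (fb b) = b" "\<forall>c\<in>dbpts ?P. fb (kb c) = c"
    using iso unfolding diag_iso_def by blast
  have NB: "N \<subseteq> dbpts D" by (rule openin_subset[OF U(2)])
  note iW = Idn_Hom[OF U(5)]
  have bU: "b \<in> dbpts ?DU" "fb b \<in> dbpts ?P" "kb (fb b) = b" "b \<in> dbpts D" if "b \<in> N" for b
  proof -
    show "b \<in> dbpts ?DU" using that NB U(4) by auto
    then show "fb b \<in> dbpts ?P" "kb (fb b) = b" using diag_mapD(7)[OF f] kfb(1) by blast+
    show "b \<in> dbpts D" using that NB by blast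
  qed
  have Ptop: "p \<in> dpts ?P V \<longleftrightarrow> fst p \<in> dbpts ?P \<and> snd p \<in> Hom C V W" for V p
    by (simp add: mem_Times_iff)
  define x0 where "x0 b = k W (fb b, Idn C W)" for b
  have x0P: "(fb b, Idn C W) \<in> dpts ?P W" if "b \<in> N" for b using bU[OF that] iW unfolding Ptop by simp
  have x0: "x0 b \<in> dpts ?DU W" "dprj D W (x0 b) = b" "f W (x0 b) = (fb b, Idn C W)" "x0 b \<in> dpts D W"
    if b: "b \<in> N" for b
  proof -
    show 1: "x0 b \<in> dpts ?DU W" unfolding x0_def by (rule diag_mapD(6)[OF k U(5) x0P[OF b]])
    show "dprj D W (x0 b) = b" using diag_mapD(3)[OF k U(5) x0P[OF b]] bU(3)[OF b] by (simp add: x0_def)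
    show "f W (x0 b) = (fb b, Idn C W)" using kf U(5) x0P[OF b] unfolding x0_def by blast
    show "x0 b \<in> dpts D W" using 1 by simp
  qed
  have x0c: "continuous_map (subtopology (dbase D) N) (dsp D W) x0"
  proof -
    have "continuous_map (subtopology (dbase D) N) (dbase ?P) fb"
      using continuous_map_from_subtopology_mono[OF _ U(4)] diag_mapD(1)[OF f] by simp
    then have "continuous_map (subtopology (dbase D) N) (dsp ?P W) (\<lambda>b. (fb b, Idn C W))"
      using iW by (simp add: continuous_map_pairwise o_def)
    from continuous_map_compose[OF this diag_mapD(2)[OF k U(5)]]
    show ?thesis by (simp add: o_def x0_def[abs_def] continuous_map_in_subtopology)
  qed
  define t where "t b w = cls D W (x0 b) w" for b w
  define s where "s = clift (\<lambda>V x y. Far C (snd (f V x)) y)"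
  have tr: "triple D (W, x0 b, w)" if "b \<in> N" "w \<in> pts W" for b w
    using x0(4)[OF that(1)] U(5) that(2) by (simp add: triple_iff)
  have fx: "x \<in> dpts ?DU V" "fst (f V x) = fb (dprj D V x)" "snd (f V x) \<in> Hom C V W"
    if "V \<in> Obj C" "x \<in> dpts D V" "dprj D V x \<in> N" for V x
  proof -
    show 1: "x \<in> dpts ?DU V" using that U(4) by auto
    show "fst (f V x) = fb (dprj D V x)" using diag_mapD(3)[OF f that(1) 1] by simp
    show "snd (f V x) \<in> Hom C V W" using diag_mapD(6)[OF f that(1) 1] unfolding Ptop by simp
  qed
  have arr: "\<exists>\<theta>\<in>Hom C (dob D b) W. \<forall>V\<in>Obj C. \<forall>x\<in>dfibre D b V. snd (f V x) = Comp C \<theta> (dchart D b V x)"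
    if b: "b \<in> N" for b
  proof -
    have "dfibre ?DU b V = dfibre D b V" for V by (rule dfibre_restrict) (use b U(4) in blast)
    moreover obtain \<theta> where "dfibre_arrow C ?DU ?P f fb b \<theta>" using diag_mapD(5)[OF f bU(1)[OF b]] by blast
    ultimately have "\<theta> \<in> Hom C (dob D b) W" "\<forall>V\<in>Obj C. \<forall>x\<in>dfibre D b V. snd (f V x) = Comp C \<theta> (dchart D b V x)"
      unfolding dfibre_arrow_def by simp_all
    then show ?thesis by blast
  qed
  have scls: "s (cls D V x y) = Far C (snd (f V x)) y" if t: "triple D (V, x, y)" and N: "dprj D V x \<in> N" for V x y
    unfolding s_def
  proof (rule clift[OF D t])
    fix V' x' y' assume t': "triple D (V', x', y')" and e: "cval D (V', x', y') = cval D (V, x, y)"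
    have b: "dprj D V' x' = dprj D V x" using e by (simp add: cval_def)
    \<comment> \<open>In the trivialisation the value is \<open>\<theta>\<close> applied to the
      chart value, so it depends only on \<open>cval\<close> and is well defined on classes.\<close>
    have val: "Far C (snd (f V2 x2)) y2 = Far C \<theta> (snd (cval D (V2, x2, y2)))"
      if t2: "triple D (V2, x2, y2)" and b2: "dprj D V2 x2 = dprj D V x"
        and al: "\<forall>V'\<in>Obj C. \<forall>z\<in>dfibre D (dprj D V x) V'. snd (f V' z) = Comp C \<theta> (dchart D (dprj D V x) V' z)"
        and th: "\<theta> \<in> Hom C (dob D (dprj D V x)) W" for V2 x2 y2 \<theta>
    proof -
      have m: "V2 \<in> Obj C" "x2 \<in> topspace (dsp D V2)" "y2 \<in> pts V2" using t2 unfolding triple_iff by auto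
      have "x2 \<in> dfibre D (dprj D V x) V2" using m(2) b2 by (simp add: dfibre_def)
      then have "snd (f V2 x2) = Comp C \<theta> (dchart D (dprj D V x) V2 x2)" using al m(1) by blast
      moreover have "dchart D (dprj D V x) V2 x2 \<in> Hom C V2 (dob D (dprj D V x))"
        using dchart_Hom'[OF D m(1,2)] unfolding b2 .
      ultimately show ?thesis using Far_Comp[OF _ th m(3)] by (simp add: cval_def b2)
    qed
    obtain \<theta>' where "\<theta>' \<in> Hom C (dob D (dprj D V x)) W"
      "\<forall>V'\<in>Obj C. \<forall>z\<in>dfibre D (dprj D V x) V'. snd (f V' z) = Comp C \<theta>' (dchart D (dprj D V x) V' z)"
      using arr[OF N] by blast
    from val[OF t' b this(2,1)] val[OF t refl this(2,1)]
    show "Far C (snd (f V' x')) y' = Far C (snd (f V x)) y" using e by simp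
  qed
  have st: "s (t b w) = w" if "b \<in> N" "w \<in> pts W" for b w
    unfolding t_def using scls[OF tr[OF that]] x0[OF that(1)] that Far_Idn[OF U(5) that(2)] by simp
  \<comment> \<open>The chart of \<open>x0 b\<close> is the morphism \<open>\<kappa>\<close> of the
    inverse isomorphism, and \<open>\<theta>\<close> is its inverse: one identity is read off at
    \<open>x0 b\<close>, the other at the universal element \<open>crep D b\<close>.\<close>
  have chx0: "\<exists>\<phi>\<in>Hom C W (dob D b). invertible_arrow C \<phi> \<and> \<phi> = dchart D b W (x0 b)" if b: "b \<in> N" for b
  proof -
    obtain \<theta> where th: "\<theta> \<in> Hom C (dob D b) W" "\<forall>V\<in>Obj C. \<forall>x\<in>dfibre D b V. snd (f V x) = Comp C \<theta> (dchart D b V x)"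
      using arr[OF b] by blast
    have x0f: "x0 b \<in> dfibre D b W" using x0[OF b] by (simp add: dfibre_def)
    let ?\<phi> = "dchart D b W (x0 b)"
    have ph: "?\<phi> \<in> Hom C W (dob D b)" by (rule dchart_Hom[OF D bU(4)[OF b] U(5) x0f])
    have 1: "Comp C \<theta> ?\<phi> = Idn C W" using th(2) U(5) x0f x0(3)[OF b] by fastforce
    obtain \<kappa> where ka: "dfibre_arrow C ?P ?DU k kb (fb b) \<kappa>" using diag_mapD(5)[OF k bU(2)[OF b]] by blast
    have kH: "\<kappa> \<in> Hom C W (dob D b)" using ka bU(3)[OF b] unfolding dfibre_arrow_def by simp
    have kk: "dchart D b V (k V (fb b, \<psi>)) = Comp C \<kappa> \<psi>" if V: "V \<in> Obj C" and psi: "\<psi> \<in> Hom C V W" for V \<psi>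
    proof -
      have "(fb b, \<psi>) \<in> dfibre ?P (fb b) V" using bU(2)[OF b] psi by (simp add: dfibre_def)
      then show ?thesis using ka V bU(3)[OF b] unfolding dfibre_arrow_def by auto
    qed
    have "?\<phi> = \<kappa>" using kk[OF U(5) iW] Comp_Idn(1)[OF kH] by (simp add: x0_def)
    moreover have "Comp C \<kappa> \<theta> = Idn C (dob D b)"
    proof -
      note r = crep[OF D bU(4)[OF b]] and o = dob_Obj[OF D bU(4)[OF b]]
      have rN: "dprj D (dob D b) (crep D b) \<in> N" using b r(4) by simp
      have "snd (f (dob D b) (crep D b)) = \<theta>" using th(2) o r(1,2) Comp_Idn(1)[OF th(1)] by simp
      then have "f (dob D b) (crep D b) = (fb b, \<theta>)" using fx(2)[OF o r(3) rN] r(4) by (simp add: prod_eq_iff)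
      then have "k (dob D b) (fb b, \<theta>) = crep D b" using kf o fx(1)[OF o r(3) rN] by (metis)
      then show ?thesis using kk[OF o th(1)] r(2) by simp
    qed
    ultimately have "invertible_arrow C ?\<phi>"
      unfolding invertible_arrow_def using Hom_Arr[OF ph] th(1) 1 by (intro bexI[of _ \<theta>]) simp_all
    then show ?thesis using ph by blast
  qed
  have "loc_triv (CF D) N W t s"
    unfolding loc_triv_def CF_simps
  proof (intro conjI ballI)
    show "continuous_map (prod_topology (subtopology (dbase D) N) (Fob C W)) (tot (CF D)) (\<lambda>(b, w). t b w)"
      unfolding t_def case_prod_unfold by (rule cls_continuous'[OF D U(5)])
        (use continuous_map_compose[OF continuous_map_fst x0c] in \<open>simp_all add: o_def continuous_map_snd\<close>)
    have "tot (CF ?R) = tot (fam_restrict (CF D) N)" using CF_restrict[OF D disjI2[OF U(2)]] by simp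
    then have T: "tot_on (CF D) N = tot (CF ?R)" by simp
    show "continuous_map (tot_on (CF D) N) (Fob C W) s"
      unfolding T
    proof (rule CF_continuous[OF diagram_family_restrict[OF D]])
      fix V assume V: "V \<in> Obj C"
      have sub: "dover D V N \<subseteq> dover D V U" using U(4) by blast
      have "continuous_map (dsp ?R V) (dsp ?P V) (f V)"
        using continuous_map_from_subtopology_mono[OF _ sub] diag_mapD(2)[OF f V] by simp
      from continuous_map_compose[OF continuous_map_compose[OF continuous_map_fst this, unfolded product_diagram_simps(1)] continuous_map_snd]
      have "continuous_map (PF ?R V) (Hom_top C V W) (\<lambda>p. snd (f V (fst p)))"
        by (simp add: o_def)
      from Far_app_continuous[OF V this continuous_map_snd]
      show "continuous_map (PF ?R V) (Fob C W) (\<lambda>p. s (cls ?R V (fst p) (snd p)))"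
      proof (rule continuous_map_eq)
        fix p assume "p \<in> topspace (PF ?R V)"
        then have t: "triple ?R (V, fst p, snd p)" unfolding triple_iff using V by (auto simp: mem_Times_iff)
        note t' = t[unfolded triple_restrict']
        show "Far C (snd (f V (fst p))) (snd p) = s (cls ?R V (fst p) (snd p))"
          unfolding cls_restrict[OF D t] using scls[OF conjunct1[OF t'] conjunct2[OF t']] by (rule sym)
      qed
    qed
    show "t b w \<in> fibre (CF D) b" if "b \<in> N" "w \<in> pts W" for b w
      using CF_topI[OF D tr[OF that]] CF_prj[OF D tr[OF that]] x0(2)[OF that(1)] by (simp add: fibre_def t_def)
    show "s (t b w) = w" if "b \<in> N" "w \<in> pts W" for b w by (rule st[OF that])
    show "t (prj (CF D) c) (s c) = c" if "c \<in> over (CF D) N" for c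
    proof -
      have "c \<in> tpts (CF D)" using that by blast
      then obtain V x y where t: "triple D (V, x, y)" "c = cls D V x y" by (rule CF_topE[OF D])
      have m: "V \<in> Obj C" "x \<in> dpts D V" "y \<in> pts V" using t(1) unfolding triple_iff by auto
      let ?b = "dprj D V x"
      let ?\<psi> = "snd (f V x)"
      have bN: "?b \<in> N" using that CF_prj[OF D t(1)] t(2) by simp
      note fx' = fx[OF m(1,2) bN]
      have x0f: "x0 ?b \<in> dfibre D ?b W" using x0[OF bN] by (simp add: dfibre_def)
      note dx = dact_top[OF D fx'(3) x0(4)[OF bN]]
      have dxb: "dprj D V (dact D ?\<psi> (x0 ?b)) = ?b" using dprj_dact[OF D fx'(3) x0(4)[OF bN]] x0(2)[OF bN] by simp
      \<comment> \<open>By naturality, acting on \<open>x0\<close> with the morphism of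
        \<open>x\<close> gives \<open>x\<close> itself; this recovers a class from its base point
        and its coordinate.\<close>
      have "f V (dact D ?\<psi> (x0 ?b)) = dact ?P ?\<psi> (f W (x0 ?b))"
        using diag_mapD(4)[OF f fx'(3) x0(1)[OF bN]] by simp
      also have "\<dots> = f V x" using x0(3)[OF bN] fx'(2) Comp_Idn(2)[OF fx'(3)] by (cases "f V x") simp
      finally have "k V (f V (dact D ?\<psi> (x0 ?b))) = k V (f V x)" by simp
      moreover have "dact D ?\<psi> (x0 ?b) \<in> dpts ?DU V" by (rule fx(1)[OF m(1) dx]) (simp add: dxb bN)
      ultimately have "dact D ?\<psi> (x0 ?b) = x" using kf m(1) fx'(1) by simp
      then have "dchart D ?b V x = Comp C (dchart D ?b W (x0 ?b)) ?\<psi>"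
        using dchart_dact[OF D bU(4)[OF bN] fx'(3) x0f] by simp
      then have "Far C (dchart D ?b W (x0 ?b)) (Far C ?\<psi> y) = Far C (dchart D ?b V x) y"
        using Far_Comp[OF fx'(3) dchart_Hom[OF D bU(4)[OF bN] U(5) x0f] m(3)] by simp
      then have "cval D (W, x0 ?b, Far C ?\<psi> y) = cval D (V, x, y)" by (simp add: cval_def x0(2)[OF bN])
      then have "cls D W (x0 ?b) (Far C ?\<psi> y) = cls D V x y"
        using coend_class_eq[OF D tr[OF bN Far_pts[OF fx'(3) m(3)]] t(1)] by simp
      then show ?thesis unfolding t(2) CF_prj[OF D t(1)] scls[OF t(1) bN] t_def .
    qed
    show "\<exists>\<phi>\<in>Hom C W (dob D b). invertible_arrow C \<phi> \<and> (\<forall>w\<in>pts W. chart (CF D) b (t b w) = Far C \<phi> w)"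
      if b: "b \<in> N" for b using chx0[OF b] CF_chart[OF D tr[OF b]] x0(2)[OF b] unfolding t_def by auto
  qed (use U in auto)
  then show "\<exists>N W t s. b0 \<in> N \<and> loc_triv (CF D) N W t s" using U(3) by blast
qed

section \<open>Coends of push-outs, of sequential colimits and of stratified bundle diagrams\<close>

lemma fibre_arrow_comp:
  assumes f: "fam_map C X Y f fb" and b: "b \<in> bpts X" and X: "family C X"
    and \<phi>: "fibre_arrow C X Y f fb b \<phi>" and \<psi>: "fibre_arrow C Y Z g gb (fb b) \<psi>"
  shows "fibre_arrow C X Z (\<lambda>x. g (f x)) (\<lambda>b. gb (fb b)) b (Comp C \<psi> \<phi>)"
proof -
  have p: "\<phi> \<in> Hom C (fob X b) (fob Y (fb b))" and q: "\<psi> \<in> Hom C (fob Y (fb b)) (fob Z (gb (fb b)))"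
    using \<phi> \<psi> unfolding fibre_arrow_def by blast+
  have "chart Z (gb (fb b)) (g (f x)) = Far C (Comp C \<psi> \<phi>) (chart X b x)" if x: "x \<in> fibre X b" for x
    using \<phi> \<psi> x fam_mapD(5)[OF f b x] Far_Comp[OF p q chart_pts[OF X x b]] unfolding fibre_arrow_def by simp
  then show ?thesis unfolding fibre_arrow_def using Comp_Hom[OF p q] by blast
qed

lemma fam_map_comp:
  assumes X: "family C X" and f: "fam_map C X Y f fb" and g: "fam_map C Y Z g gb"
  shows "fam_map C X Z (\<lambda>x. g (f x)) (\<lambda>b. gb (fb b))"
  unfolding fam_map_def
proof (intro conjI ballI)
  show "continuous_map (tot X) (tot Z) (\<lambda>x. g (f x))"
    using continuous_map_compose[OF fam_mapD(1)[OF f] fam_mapD(1)[OF g]] by (simp add: o_def)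
  show "continuous_map (base X) (base Z) (\<lambda>b. gb (fb b))"
    using continuous_map_compose[OF fam_mapD(2)[OF f] fam_mapD(2)[OF g]] by (simp add: o_def)
  show "prj Z (g (f x)) = gb (fb (prj X x))" if "x \<in> tpts X" for x
  proof -
    have "f x \<in> tpts Y" using continuous_map_funspace[OF fam_mapD(1)[OF f]] that by blast
    from fam_mapD(3)[OF g this] show ?thesis using fam_mapD(3)[OF f that] by simp
  qed
  show "\<exists>\<phi>. fibre_arrow C X Z (\<lambda>x. g (f x)) (\<lambda>b. gb (fb b)) b \<phi>" if b: "b \<in> bpts X" for b
    using fibre_arrow_comp[OF f b X] fam_mapD(4)[OF f b] fam_mapD(4)[OF g fam_mapD(6)[OF f b]] by blast
qed

lemma fam_map_restrict:
  assumes f: "fam_map C X Y f id"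
  shows "fam_map C (fam_restrict X U) (fam_restrict Y U) f id"
proof -
  have o: "f x \<in> over Y U" if "x \<in> over X U" for x
  proof -
    have x: "x \<in> tpts X" "prj X x \<in> U" using that by auto
    have "f x \<in> tpts Y" using continuous_map_funspace[OF fam_mapD(1)[OF f]] x(1) by blast
    then show ?thesis using fam_mapD(3)[OF f x(1)] x(2) by simp
  qed
  have "continuous_map (tot_on X U) (tot_on Y U) f"
    unfolding continuous_map_in_subtopology using o continuous_map_from_subtopology[OF fam_mapD(1)[OF f]] by auto
  moreover have "continuous_map (subtopology (base X) U) (subtopology (base Y) U) id"
    unfolding continuous_map_in_subtopology using continuous_map_from_subtopology[OF fam_mapD(2)[OF f]] by auto
  moreover have "\<exists>\<phi>. fibre_arrow C (fam_restrict X U) (fam_restrict Y U) f id b \<phi>"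
    if b: "b \<in> bpts X" "b \<in> U" for b
  proof -
    obtain \<phi> where "fibre_arrow C X Y f id b \<phi>" using fam_mapD(4)[OF f b(1)] by blast
    then have "fibre_arrow C (fam_restrict X U) (fam_restrict Y U) f id b \<phi>"
      unfolding fibre_arrow_def fibre_restrict[OF b(2)] by simp
    then show ?thesis by blast
  qed
  ultimately show ?thesis using fam_mapD(3)[OF f] unfolding fam_map_def by simp
qed

lemma fam_pushout_flat:
  assumes Y: "family C Y" and po: "fam_pushout C X Y A Z h hb g gb"
  shows "fam_pushout C X (flat Y) A Z (\<lambda>y. h (unflat_pt Y y)) hb (\<lambda>y. g (unflat_pt Y y)) gb"
proof -
  note p = po[unfolded fam_pushout_def]
  note fY = flat_family[OF Y]
  have ps: "fam_map C (fam_restrict Y A) X h hb" "fam_map C Y Z g gb"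
    "pushout_Top (tot_on Y A) (tot X) (tot Y) (tot Z) h id id g"
    "\<And>b. b \<in> bpts Y - A \<Longrightarrow> \<exists>\<phi>. fibre_arrow C Y Z g gb b \<phi> \<and> invertible_arrow C \<phi>"
    using p by simp_all
  have h: "fam_map C (fam_restrict (flat Y) A) X (\<lambda>y. h (unflat_pt Y y)) hb"
    using fam_map_comp[OF family_restrict[OF fY] fam_map_restrict[OF flat_map(2)[OF Y]] ps(1)] by simp
  have g: "fam_map C (flat Y) Z (\<lambda>y. g (unflat_pt Y y)) gb"
    using fam_map_comp[OF fY flat_map(2)[OF Y] ps(2)] by simp
  have "over (flat Y) A = {y \<in> tpts (flat Y). unflat_pt Y y \<in> over Y A}"
    using unflat_top[OF Y] unflat_chart(1)[OF Y] by auto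
  then have t: "pushout_Top (tot (fam_restrict (flat Y) A)) (tot X) (tot (flat Y)) (tot Z) (\<lambda>y. h (unflat_pt Y y)) id id (\<lambda>y. g (unflat_pt Y y))"
    unfolding fam_restrict_simps
    by (intro pushout_Top_transport[OF ps(3) _ unflat_continuous[OF Y] flat_continuous[OF Y] flat_unflat[OF Y] unflat_flat[OF Y]]) auto
  have ar: "\<exists>\<phi>. fibre_arrow C (flat Y) Z (\<lambda>y. g (unflat_pt Y y)) gb b \<phi> \<and> invertible_arrow C \<phi>"
    if b: "b \<in> bpts (flat Y) - A" for b
  proof -
    have b': "b \<in> bpts Y - A" "b \<in> bpts Y" "b \<in> bpts (flat Y)" using b by auto
    obtain \<phi> where ph: "fibre_arrow C Y Z g gb b \<phi>" "invertible_arrow C \<phi>" using ps(4)[OF b'(1)] by blast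
    have "\<phi> \<in> Hom C (fob Y b) (fob Z (gb b))" using ph(1) unfolding fibre_arrow_def by blast
    then show ?thesis
      using fibre_arrow_comp[OF flat_map(2)[OF Y] b'(3) fY flat_map(4)[OF Y b'(2)], of Z g gb \<phi>] ph
      by (auto simp: Comp_Idn(1))
  qed
  show ?thesis unfolding fam_pushout_def using p h g t ar by (intro conjI ballI) simp_all
qed


text \<open>By the description of open sets in a coend the topological claim concerns
  \<open>PF ?Z V\<close> for each \<open>V\<close>; slices and tubes over compact sets are open on
  both pieces, hence on the push-out. Injectivity off \<open>A'\<close> is checked on
  \<open>cval\<close>: base points agree by the push-out of the bases, chart values by invertibility
  of the morphism.\<close>

lemma coend_pushout:
  fixes E :: "('o, 'h, 'q, 'b) diagram" and P :: "('o, 'h, 'p, 'b) diagram"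
  assumes P: "diagram_family C P" and E: "diagram_family C E"
    and A0: "closedin (dbase P) A0" and A1: "closedin (dbase P) A1" and A01: "A0 \<subseteq> A1" and A': "closedin (dbase E) A'"
    and T1: "\<And>b. b \<in> dbpts P \<Longrightarrow> closedin (dbase P) {b}" "\<And>b. b \<in> dbpts E \<Longrightarrow> closedin (dbase E) {b}"
    and po: "diag_pushout C (diag_restrict P A0) E A' (diag_restrict P A1) h hb g gb"
  shows "fam_pushout C (fam_restrict (CF P) A0) (CF E) A' (fam_restrict (CF P) A1)
    (cmap (diag_restrict P A0) h) hb (cmap (diag_restrict P A1) g) gb"
proof -
  let ?D = "diag_restrict P A0" and ?Z = "diag_restrict P A1" and ?EA = "diag_restrict E A'"
  let ?H = "cmap ?D h" and ?G = "cmap ?Z g"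
  note D = diagram_family_restrict[OF P, of A0] and Z = diagram_family_restrict[OF P, of A1]
    and EA = diagram_family_restrict[OF E, of A']
  have hm: "diag_map C ?EA ?D h hb" and gm: "diag_map C E ?Z g gb"
    and pov: "\<And>V. V \<in> Obj C \<Longrightarrow> pushout_Top (subtopology (dsp E V) (dover E V A')) (dsp ?D V) (dsp E V) (dsp ?Z V) (h V) id id (g V)"
    and pob: "pushout_Top (subtopology (dbase E) A') (dbase ?D) (dbase E) (dbase ?Z) hb id id gb"
    and ginv: "\<And>b. b \<in> dbpts E - A' \<Longrightarrow> \<exists>\<phi>. dfibre_arrow C E ?Z g gb b \<phi> \<and> invertible_arrow C \<phi>"
    using po unfolding diag_pushout_def by simp_all
  have FD: "fam_restrict (CF P) A0 = CF ?D" and FZ: "fam_restrict (CF P) A1 = CF ?Z" and FE: "fam_restrict (CF E) A' = CF ?EA"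
    using CF_restrict[OF P disjI1[OF A0]] CF_restrict[OF P disjI1[OF A1]] CF_restrict[OF E disjI1[OF A']] by simp_all
  have fP: "family C (CF P)" by (rule CF_family[OF P T1(1)])
  have fE: "family C (CF E)" by (rule CF_family[OF E T1(2)])
  note incl = fam_map_restrict_incl[OF fP A01, unfolded FD FZ]
  note Hm = cmap_map[OF EA D hm] and Gm = cmap_map[OF E Z gm]
  have A'E: "A' \<subseteq> dbpts E" by (rule closedin_subset[OF A'])
  have dA: "dover E V A' \<subseteq> dpts E V" for V by blast
  have trD: "triple ?D (V, x, y) \<Longrightarrow> triple ?Z (V, x, y)" for V x y using A01 unfolding triple_restrict' by blast
  have clD: "cls ?D V x y = cls ?Z V x y" if t: "triple ?D (V, x, y)" for V x y
    unfolding cls_restrict[OF P t] cls_restrict[OF P trD[OF t]] ..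
  have OE: "over (CF E) A' = tpts (CF ?EA)"
  proof -
    have "tpts (fam_restrict (CF E) A') = tpts (CF ?EA)" unfolding FE ..
    then show ?thesis by auto
  qed
  have pre: "cls E V x y \<in> over (CF E) A' \<longleftrightarrow> dprj E V x \<in> A'" if t: "triple E (V, x, y)" for V x y
    using CF_topI[OF E t] CF_prj[OF E t] by simp
  have "pushout_Top (tot_on (CF E) A') (tot (CF ?D)) (tot (CF E)) (tot (CF ?Z)) ?H id id ?G"
  proof (rule pushout_Top_inclusionI)
    show "over (CF E) A' \<subseteq> tpts (CF E)" by blast
    have "tot (CF ?EA) = tot_on (CF E) A'" unfolding FE[symmetric] by simp
    then show "continuous_map (tot_on (CF E) A') (tot (CF ?D)) ?H" using fam_mapD(1)[OF Hm] by simp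
    show "continuous_map (tot (CF ?D)) (tot (CF ?Z)) id" by (rule fam_mapD(1)[OF incl(1)])
    show "continuous_map (tot (CF E)) (tot (CF ?Z)) ?G" by (rule fam_mapD(1)[OF Gm])
    show "?G c = ?H c" if c: "c \<in> over (CF E) A'" for c
    proof -
      obtain V x y where t: "triple ?EA (V, x, y)" "c = cls ?EA V x y" using c unfolding OE by (rule CF_topE[OF EA])
      have t': "triple E (V, x, y)" "dprj E V x \<in> A'" using t(1) unfolding triple_restrict' by blast+
      have m: "V \<in> Obj C" "x \<in> dover E V A'" using t' unfolding triple_iff by auto
      have e: "c = cls E V x y" unfolding t(2) by (rule cls_restrict[OF E t(1)])
      obtain \<phi> where "dfibre_arrow C ?EA ?D h hb (dprj ?EA V x) \<phi>" using diag_mapD(5)[OF hm cval_mem(1)[OF EA t(1)]] by blast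
      note tD = cval_map(1)[OF EA D hm t(1) this]
      have "?G c = cls ?Z V (g V x) y" unfolding e by (rule cmap_cls[OF E Z gm t'(1)])
      also have "\<dots> = cls ?Z V (h V x) y" using pushout_Top_inclusionD(4)[OF pov[OF m(1)] dA m(2)] by simp
      also have "\<dots> = cls ?D V (h V x) y" by (rule clD[OF tD, symmetric])
      also have "\<dots> = ?H c" unfolding t(2) by (rule cmap_cls[OF EA D hm t(1), symmetric])
      finally show ?thesis .
    qed
    show "tpts (CF ?Z) \<subseteq> tpts (CF ?D) \<union> ?G ` tpts (CF E)"
    proof
      fix c assume "c \<in> tpts (CF ?Z)"
      then obtain V z y where t: "triple ?Z (V, z, y)" "c = cls ?Z V z y" by (rule CF_topE[OF Z])
      have m: "V \<in> Obj C" "z \<in> dpts ?Z V" "y \<in> pts V" using t(1) unfolding triple_iff by auto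
      have "z \<in> dpts ?D V \<or> (\<exists>x\<in>dpts E V. z = g V x)"
        using m(2) unfolding pushout_Top_inclusionD(6)[OF pov[OF m(1)] dA] by blast
      then show "c \<in> tpts (CF ?D) \<union> ?G ` tpts (CF E)"
      proof
        assume "z \<in> dpts ?D V"
        then have tD: "triple ?D (V, z, y)" using m unfolding triple_iff by blast
        show ?thesis unfolding t(2) clD[OF tD, symmetric] using CF_topI[OF D tD] by (rule UnI1)
      next
        assume "\<exists>x\<in>dpts E V. z = g V x"
        then obtain x where x: "x \<in> dpts E V" "z = g V x" by blast
        then have tE: "triple E (V, x, y)" using m unfolding triple_iff by blast
        have "c = ?G (cls E V x y)" unfolding t(2) x(2) by (rule cmap_cls[OF E Z gm tE, symmetric])
        then show ?thesis using CF_topI[OF E tE] by blast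
      qed
    qed
    show "openin (tot (CF ?Z)) U"
      if U: "U \<subseteq> tpts (CF ?Z)" "openin (tot (CF ?D)) (tpts (CF ?D) \<inter> U)"
        "openin (tot (CF E)) {c \<in> tpts (CF E). ?G c \<in> U}" for U
      unfolding CF_openin[OF Z]
    proof (intro conjI ballI U(1))
      fix V assume V: "V \<in> Obj C"
      note d = pushout_Top_inclusionD[OF pov[OF V] dA]
      \<comment> \<open>\<open>W\<close> is the preimage whose openness is wanted; on points that
        come from one of the two pieces it is described by the open sets \<open>DU\<close> and
        \<open>EU\<close> (\<open>onD\<close> and \<open>onE\<close>).\<close>
      define DU EU W where DU: "DU = tpts (CF ?D) \<inter> U" and EU: "EU = {c \<in> tpts (CF E). ?G c \<in> U}"
        and W: "W = cpre ?Z V U"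
      note oD = U(2)[folded DU] and oE = U(3)[folded EU]
      have onD: "(z, k) \<in> W \<longleftrightarrow> cls ?D V z k \<in> DU" if "z \<in> dpts ?D V" "k \<in> pts V" for z k
      proof -
        have t: "triple ?D (V, z, k)" using V that unfolding triple_iff by blast
        have "z \<in> dpts ?Z V" using trD[OF t] unfolding triple_iff by blast
        then show ?thesis using that CF_topI[OF D t] clD[OF t] by (simp add: W DU)
      qed
      have onE: "(g V x, k) \<in> W \<longleftrightarrow> cls E V x k \<in> EU" if "x \<in> dpts E V" "k \<in> pts V" for x k
      proof -
        have t: "triple E (V, x, k)" using V that unfolding triple_iff by blast
        have "g V x \<in> dpts ?Z V" by (rule diag_mapD(6)[OF gm V that(1)])
        then show ?thesis using that CF_topI[OF E t] cmap_cls[OF E Z gm t] by (simp add: W EU)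
      qed
      have "openin (PF ?Z V) W"
      proof (rule openin_prod_locally_compact[OF Fob_space(1)[OF V] Fob_space(3)[OF V]])
        show "W \<subseteq> dpts ?Z V \<times> pts V" unfolding W by auto
        show "openin (Fob C V) {k \<in> pts V. (z, k) \<in> W}" if z: "z \<in> dpts ?Z V" for z
          using z unfolding d(6)
        proof
          assume z: "z \<in> dpts ?D V"
          have c: "continuous_map (Fob C V) (tot (CF ?D)) (\<lambda>k. cls ?D V z k)"
            by (rule cls_continuous'[OF D V]) (use z in simp_all)
          have "{k \<in> pts V. (z, k) \<in> W} = {k \<in> pts V. cls ?D V z k \<in> DU}" using onD[OF z] by blast
          then show ?thesis using openin_continuous_map_preimage[OF c oD] by simp
        next
          assume "z \<in> g V ` dpts E V"
          then obtain x where x: "x \<in> dpts E V" "z = g V x" by blast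
          have c: "continuous_map (Fob C V) (tot (CF E)) (\<lambda>k. cls E V x k)"
            by (rule cls_continuous'[OF E V]) (use x in simp_all)
          have "{k \<in> pts V. (z, k) \<in> W} = {k \<in> pts V. cls E V x k \<in> EU}" using onE[OF x(1)] unfolding x(2) by blast
          then show ?thesis using openin_continuous_map_preimage[OF c oE] by simp
        qed
        fix K assume K: "compactin (Fob C V) K"
        have KV: "k \<in> pts V" if "k \<in> K" for k using compactin_subset_topspace[OF K] that by blast
        show "openin (dsp ?Z V) {z \<in> dpts ?Z V. \<forall>k\<in>K. (z, k) \<in> W}" (is "openin _ ?O")
        proof (rule d(7))
          show "?O \<subseteq> dpts ?Z V" by blast
          have "dpts ?D V \<inter> ?O = {z \<in> dpts ?D V. \<forall>k\<in>K. cls ?D V (fst (z, k)) (snd (z, k)) \<in> DU}"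
          proof (rule set_eqI)
            fix z
            have "z \<in> dpts ?D V \<Longrightarrow> z \<in> dpts ?Z V" unfolding d(6) by (rule UnI1)
            then show "z \<in> dpts ?D V \<inter> ?O \<longleftrightarrow> z \<in> {z \<in> dpts ?D V. \<forall>k\<in>K. cls ?D V (fst (z, k)) (snd (z, k)) \<in> DU}"
              unfolding fst_conv snd_conv Int_iff mem_Collect_eq using onD[OF _ KV] by blast
          qed
          then show "openin (dsp ?D V) (dpts ?D V \<inter> ?O)"
            using openin_tube[OF cls_continuous[OF D V] K oD] by simp
          have "{x \<in> dpts E V. g V x \<in> ?O} = {x \<in> dpts E V. \<forall>k\<in>K. cls E V (fst (x, k)) (snd (x, k)) \<in> EU}"
          proof (rule set_eqI)
            fix x
            show "x \<in> {x \<in> dpts E V. g V x \<in> ?O} \<longleftrightarrow> x \<in> {x \<in> dpts E V. \<forall>k\<in>K. cls E V (fst (x, k)) (snd (x, k)) \<in> EU}"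
              unfolding fst_conv snd_conv mem_Collect_eq using onE[OF _ KV] diag_mapD(6)[OF gm V, of x] by blast
          qed
          then show "openin (dsp E V) {x \<in> dpts E V. g V x \<in> ?O}"
            using openin_tube[OF cls_continuous[OF E V] K oE] by simp
        qed
      qed
      then show "openin (PF ?Z V) (cpre ?Z V U)"
        unfolding W .
    qed
    show "inj_on ?G (tpts (CF E) - over (CF E) A')"
    proof (rule inj_onI)
      fix c c' assume c: "c \<in> tpts (CF E) - over (CF E) A'" and c': "c' \<in> tpts (CF E) - over (CF E) A'" and e: "?G c = ?G c'"
      have "c \<in> tpts (CF E)" "c' \<in> tpts (CF E)" using c c' by blast+
      then obtain V x y V' x' y' where t: "triple E (V, x, y)" "c = cls E V x y" and t': "triple E (V', x', y')" "c' = cls E V' x' y'"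
        by (elim CF_topE[OF E])
      let ?b = "dprj E V x" and ?b' = "dprj E V' x'"
      have b: "?b \<in> dbpts E - A'" "?b' \<in> dbpts E - A'"
        using c c' pre[OF t(1)] pre[OF t'(1)] cval_mem(1)[OF E t(1)] cval_mem(1)[OF E t'(1)] unfolding t(2) t'(2) by blast+
      obtain \<phi> where ph: "dfibre_arrow C E ?Z g gb ?b \<phi>" "invertible_arrow C \<phi>" using ginv[OF b(1)] by blast
      obtain \<phi>' where ph': "dfibre_arrow C E ?Z g gb ?b' \<phi>'" using ginv[OF b(2)] by blast
      note m = cval_map[OF E Z gm t(1) ph(1)] and m' = cval_map[OF E Z gm t'(1) ph']
      have "cls ?Z V (g V x) y = cls ?Z V' (g V' x') y'"
        using e unfolding t(2) t'(2) cmap_cls[OF E Z gm t(1)] cmap_cls[OF E Z gm t'(1)] .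
      then have cv: "cval ?Z (V, g V x, y) = cval ?Z (V', g V' x', y')" using coend_class_eq[OF Z m(1) m'(1)] by simp
      then have "gb ?b = gb ?b'" using m(2) m'(2) by simp
      then have bb: "?b = ?b'" using pushout_Top_inclusionD(8)[OF pob A'E] b by (simp add: inj_on_eq_iff)
      have "Far C \<phi> (snd (cval E (V, x, y))) = Far C \<phi> (snd (cval E (V', x', y')))"
        using cv m(2) cval_map(2)[OF E Z gm t'(1) ph(1)[unfolded bb]] by simp
      moreover have "snd (cval E (V, x, y)) \<in> pts (dob E ?b)" "snd (cval E (V', x', y')) \<in> pts (dob E ?b)"
        using cval_mem(2)[OF E t(1)] cval_mem(2)[OF E t'(1)] bb by (simp_all add: cval_def)
      moreover have "\<phi> \<in> Hom C (dob E ?b) (dob ?Z (gb ?b))" using ph(1) unfolding dfibre_arrow_def by blast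
      ultimately have "snd (cval E (V, x, y)) = snd (cval E (V', x', y'))" using invertible_arrowE[OF ph(2)] by metis
      then have "cval E (V, x, y) = cval E (V', x', y')" using bb by (simp add: cval_def)
      then show "c = c'" unfolding t(2) t'(2) coend_class_eq[OF E t(1) t'(1)] .
    qed
    have "?G c \<notin> tpts (CF ?D)" if c: "c \<in> tpts (CF E) - over (CF E) A'" for c
    proof
      assume a: "?G c \<in> tpts (CF ?D)"
      have cE: "c \<in> tpts (CF E)" "prj (CF E) c \<in> dbpts E - A'" using c prj_base[OF fE, of c] by auto
      have "?G c \<in> tpts (fam_restrict (CF P) A0)" using a unfolding FD .
      then have "prj (CF P) (?G c) \<in> A0" by simp
      moreover have "prj (CF ?Z) (?G c) = gb (prj (CF E) c)" by (rule fam_mapD(3)[OF Gm cE(1)])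
      moreover have "prj (CF ?Z) = prj (CF P)" unfolding FZ[symmetric] by simp
      ultimately have "gb (prj (CF E) c) \<in> dbpts ?D" using closedin_subset[OF A0] by auto
      then show False using pushout_Top_inclusionD(9)[OF pob A'E] cE(2) by blast
    qed
    then show "?G ` (tpts (CF E) - over (CF E) A') \<inter> tpts (CF ?D) = {}" by blast
  qed
  then have pt: "pushout_Top (tot (fam_restrict (CF E) A')) (tot (CF ?D)) (tot (CF E)) (tot (CF ?Z)) ?H id id ?G" by simp
  have ar1: "\<exists>\<phi>. fibre_arrow C (CF ?D) (CF ?Z) id id b \<phi> \<and> invertible_arrow C \<phi>" if "b \<in> bpts (CF ?D)" for b
  proof -
    have b: "b \<in> bpts (CF P)" using that by auto
    show ?thesis using incl(2)[OF b] invertible_Idn[OF fob_Obj[OF fP b]] by blast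
  qed
  have ar2: "\<exists>\<phi>. fibre_arrow C (CF E) (CF ?Z) ?G gb b \<phi> \<and> invertible_arrow C \<phi>" if "b \<in> bpts (CF E) - A'" for b
  proof -
    have b: "b \<in> dbpts E - A'" "b \<in> dbpts E" using that by auto
    show ?thesis using ginv[OF b(1)] cmap_arrow[OF E Z gm b(2)] by blast
  qed
  show ?thesis
    unfolding fam_pushout_def FD FZ using Hm[folded FE] Gm incl(1) pt pob ar1 ar2 by (intro conjI ballI) simp_all
qed

text \<open>The same test on slices and tubes as for push-outs; closedness of the stages lets the
  restricted coends be used as subspaces of the whole coend.\<close>

lemma coend_lim:
  assumes P: "diagram_family C P" and cl: "\<And>n. closedin (dbase P) (A n)"
    and mono: "\<And>n. A n \<subseteq> A (Suc n)" and un: "(\<Union>n. A n) = dbpts P"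
    and l: "\<And>V. V \<in> Obj C \<Longrightarrow> lim_Top (dsp P V) (\<lambda>n. dover P V (A n))"
  shows "lim_Top (tot (CF P)) (\<lambda>n. over (CF P) (A n))"
  unfolding lim_Top_def
proof (intro conjI allI impI iffI)
  show "over (CF P) (A n) \<subseteq> over (CF P) (A (Suc n))" for n using mono[of n] by blast
  show "(\<Union>n. over (CF P) (A n)) = tpts (CF P)"
    using un continuous_map_funspace[OF CF_prj_continuous[OF P]] by (auto simp: Pi_iff)
  show "openin (tot_on (CF P) (A n)) (U \<inter> over (CF P) (A n))" if "openin (tot (CF P)) U" for U n
    using that by (simp add: openin_subtopology_Int)
  fix U assume U: "U \<subseteq> tpts (CF P)"
    and o: "\<forall>n. openin (tot_on (CF P) (A n)) (U \<inter> over (CF P) (A n))"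
  let ?D = "\<lambda>n. diag_restrict P (A n)"
  define Ur where Ur: "Ur n = U \<inter> over (CF P) (A n)" for n
  note D = diagram_family_restrict[OF P]
  have T: "tot_on (CF P) (A n) = tot (CF (?D n))" for n unfolding CF_restrict[OF P disjI1[OF cl]] by simp
  have oD: "openin (tot (CF (?D n))) (Ur n)" for n using o unfolding T Ur by blast
  show "openin (tot (CF P)) U"
    unfolding CF_openin[OF P]
  proof (intro conjI ballI U)
    fix V assume V: "V \<in> Obj C"
    define W where W: "W = cpre P V U"
    have onD: "(z, k) \<in> W \<longleftrightarrow> cls (?D n) V z k \<in> Ur n" if "z \<in> dover P V (A n)" "k \<in> pts V" for z k n
    proof -
      have t: "triple P (V, z, k)" and t': "triple (?D n) (V, z, k)" using V that by (simp_all add: triple_iff)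
      have "z \<in> dpts P V" "dprj P V z \<in> A n" using that by auto
      then show ?thesis using that CF_topI[OF P t] CF_prj[OF P t] cls_restrict[OF P t'] by (simp add: W Ur)
    qed
    have lV: "\<And>O'. O' \<subseteq> dpts P V \<Longrightarrow> (\<And>n. openin (subtopology (dsp P V) (dover P V (A n))) (O' \<inter> dover P V (A n))) \<Longrightarrow> openin (dsp P V) O'"
      and uV: "(\<Union>n. dover P V (A n)) = dpts P V" using l[OF V, unfolded lim_Top_def] by (elim conjE, blast)+
    have "openin (PF P V) W"
    proof (rule openin_prod_locally_compact[OF Fob_space(1)[OF V] Fob_space(3)[OF V]])
      show "W \<subseteq> dpts P V \<times> pts V" unfolding W by auto
      show "openin (Fob C V) {k \<in> pts V. (z, k) \<in> W}" if "z \<in> dpts P V" for z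
      proof -
        have "z \<in> (\<Union>n. dover P V (A n))" by (simp only: uV that)
        then obtain n where z: "z \<in> dover P V (A n)" by (rule UN_E)
        have c: "continuous_map (Fob C V) (tot (CF (?D n))) (\<lambda>k. cls (?D n) V z k)"
          by (rule cls_continuous'[OF D V]) (use z in simp_all)
        have "{k \<in> pts V. (z, k) \<in> W} = {k \<in> pts V. cls (?D n) V z k \<in> Ur n}"
          by (intro Collect_cong conj_cong refl onD[OF z])
        then show ?thesis using openin_continuous_map_preimage[OF c oD] by simp
      qed
      fix K assume K: "compactin (Fob C V) K"
      have KV: "k \<in> pts V" if "k \<in> K" for k using compactin_subset_topspace[OF K] that by blast
      show "openin (dsp P V) {z \<in> dpts P V. \<forall>k\<in>K. (z, k) \<in> W}" (is "openin _ ?O")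
      proof (rule lV)
        show "?O \<subseteq> dpts P V" by blast
        fix n
        have dt: "dpts (?D n) V = dover P V (A n)" by auto
        have "?O \<inter> dover P V (A n) = {z \<in> dpts (?D n) V. \<forall>k\<in>K. cls (?D n) V (fst (z, k)) (snd (z, k)) \<in> Ur n}"
        proof -
          have "(\<forall>k\<in>K. (z, k) \<in> W) \<longleftrightarrow> (\<forall>k\<in>K. cls (?D n) V z k \<in> Ur n)" if "z \<in> dover P V (A n)" for z
            by (rule ball_cong[OF refl onD[OF that KV]])
          then have "{z \<in> dover P V (A n). \<forall>k\<in>K. (z, k) \<in> W} = {z \<in> dover P V (A n). \<forall>k\<in>K. cls (?D n) V z k \<in> Ur n}"
            by (intro Collect_cong conj_cong refl)
          moreover have "?O \<inter> dover P V (A n) = {z \<in> dover P V (A n). \<forall>k\<in>K. (z, k) \<in> W}" by blast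
          ultimately show ?thesis unfolding dt fst_conv snd_conv by (rule trans[rotated])
        qed
        then show "openin (subtopology (dsp P V) (dover P V (A n))) (?O \<inter> dover P V (A n))"
          using openin_tube[OF cls_continuous[OF D V] K oD, of n] by simp
      qed
    qed
    then show "openin (PF P V) (cpre P V U)"
      unfolding W .
  qed
qed

text \<open>Closed stages and closed points of a stratified space permit the restrictions of coends
  that are needed; the attached families are then brought to the prescribed type with
  \<open>flat\<close>.\<close>

theorem coend_stratified_bundle:
  fixes P :: "('o, 'h, 'p, 'b) diagram"
  assumes p: "principal_stratified_bundle_diagram C S P"
  shows "stratified_bundle C S (CF P)"
proof -
  have S: "stratified_space S" and P: "diagram_family C P" and B: "dbase P = strat_space S"
    and P0: "diagram_bundle C (diag_restrict P (strat_fil S 0))"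
    and M: "\<And>n. \<exists>(M :: ('o, 'h, 'b \<times> 'h, 'b) diagram) h g.
        diagram_bundle C M \<and> dbase M = strat_M S (Suc n) \<and>
        diag_pushout C (diag_restrict P (strat_fil S n)) M (strat_A S (Suc n))
          (diag_restrict P (strat_fil S (Suc n))) h (strat_h S (Suc n)) g (strat_g S (Suc n))"
    and l: "\<And>V. V \<in> Obj C \<Longrightarrow> lim_Top (dsp P V) (\<lambda>n. dover P V (strat_fil S n))"
    using p unfolding principal_stratified_bundle_diagram_def by (elim conjE, blast)+
  have cl: "closedin (dbase P) (strat_fil S n)" for n unfolding B by (rule strat_fil_closed[OF S])
  have T1: "closedin (dbase P) {b}" if "b \<in> dbpts P" for b using strat_T1[OF S] that unfolding B by blast
  have F0: "fibre_bundle C (fam_restrict (CF P) (strat_fil S 0))"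
    unfolding CF_restrict[OF P disjI1[OF cl], symmetric]
  proof (rule CF_bundle[OF P0])
    fix b assume "b \<in> dbpts (diag_restrict P (strat_fil S 0))"
    then have "b \<in> dbpts P" "b \<in> strat_fil S 0" by auto
    then show "closedin (dbase (diag_restrict P (strat_fil S 0))) {b}" using closedin_subset_topspace[OF T1] by simp
  qed
  have step: "\<exists>(M :: ('o, 'v, 'b \<times> 'v, 'b) family) h g.
        fibre_bundle C M \<and> base M = strat_M S (Suc n) \<and>
        fam_pushout C (fam_restrict (CF P) (strat_fil S n)) M (strat_A S (Suc n))
          (fam_restrict (CF P) (strat_fil S (Suc n))) h (strat_h S (Suc n)) g (strat_g S (Suc n))" for n
  proof -
    obtain M :: "('o, 'h, 'b \<times> 'h, 'b) diagram" and h g where M: "diagram_bundle C M" "dbase M = strat_M S (Suc n)"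
      "diag_pushout C (diag_restrict P (strat_fil S n)) M (strat_A S (Suc n))
          (diag_restrict P (strat_fil S (Suc n))) h (strat_h S (Suc n)) g (strat_g S (Suc n))"
      using M[of n] by (elim exE conjE)
    have fM: "diagram_family C M" using M(1) unfolding diagram_bundle_def by (rule conjunct1)
    obtain E where cw: "CW_complex (dbase M) E" using strat_pushout(3)[OF S, of n] unfolding M(2) by blast
    have T1M: "closedin (dbase M) {b}" if "b \<in> dbpts M" for b
      by (rule closedin_Hausdorff_singleton[OF CW_Hausdorff[OF cw] that])
    have cA: "closedin (dbase M) (strat_A S (Suc n))" unfolding M(2) by (rule strat_pushout(2)[OF S])
    note fp = fam_pushout_flat[OF CF_family[OF fM T1M] coend_pushout[OF P fM cl cl strat_sub_topspace(4)[OF S] cA T1 T1M M(3)]]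
    have "fibre_bundle C (flat (CF M))" by (rule flat_bundle[OF CF_bundle[OF M(1) T1M]])
    moreover have "base (flat (CF M)) = strat_M S (Suc n)" using M(2) by simp
    ultimately show ?thesis using fp by blast
  qed
  show ?thesis
    unfolding stratified_bundle_def
  proof (intro conjI allI)
    show "lim_Top (tot (CF P)) (\<lambda>n. over (CF P) (strat_fil S n))"
      by (rule coend_lim[OF P cl strat_sub_topspace(4)[OF S] _ l]) (use strat_sub_topspace(3)[OF S] B in simp_all)
  qed (use S CF_family[OF P T1] F0 step B in simp_all)
qed

end

lemma pushout_Top_continuous:
  assumes p: "pushout_Top (subtopology Y A) X Y Z f id id g" and A: "A \<subseteq> topspace Y"
    and u: "continuous_map X R u" and w: "continuous_map Y R (\<lambda>y. u (g y))"
  shows "continuous_map Z R u"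
  unfolding continuous_map_def
proof (intro conjI allI impI)
  note d = pushout_Top_inclusionD[OF p A]
  show "u \<in> topspace Z \<rightarrow> topspace R"
    unfolding d(6) using continuous_map_funspace[OF u] continuous_map_funspace[OF w] by auto
  fix U assume U: "openin R U"
  show "openin Z {x \<in> topspace Z. u x \<in> U}"
  proof (rule d(7))
    have "topspace X \<inter> {x \<in> topspace Z. u x \<in> U} = {x \<in> topspace X. u x \<in> U}" unfolding d(6) by blast
    then show "openin X (topspace X \<inter> {x \<in> topspace Z. u x \<in> U})" using openin_continuous_map_preimage[OF u U] by simp
    have "{y \<in> topspace Y. g y \<in> {x \<in> topspace Z. u x \<in> U}} = {y \<in> topspace Y. u (g y) \<in> U}" unfolding d(6) by blast
    then show "openin Y {y \<in> topspace Y. g y \<in> {x \<in> topspace Z. u x \<in> U}}" using openin_continuous_map_preimage[OF w U] by simp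
  qed blast
qed

context str_cat
begin

subsection \<open>Evaluation\<close>

definition ceval :: "('o \<times> (('v \<Rightarrow> 'x) \<times> 'b) \<times> 'v) set \<Rightarrow> 'x" where
  "ceval = clift (\<lambda>V a y. fst a y)"

text \<open>Writes \<open>x\<close> as the value, at its own chart coordinate, of the inverse chart,
  which is the member of the function space at \<open>fob X b\<close> with the identity as its
  morphism. The formula uses charts that need not vary continuously, so its continuity has to be
  proved by other representatives.\<close>

definition csec :: "('o, 'v, 'x, 'b) family \<Rightarrow> 'x \<Rightarrow> ('o \<times> (('v \<Rightarrow> 'x) \<times> 'b) \<times> 'v) set" where
  "csec X x = (let b = prj X x in cls (AD X) (fob X b) (mpt (fob X b) X b (Idn C (fob X b))) (chart X b x))"

context
  fixes X :: "('o, 'v, 'x, 'b) family"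
  assumes X: "family C X"
begin

lemma triple_AD: "triple (AD X) (V, a, y) \<longleftrightarrow> V \<in> Obj C \<and> a \<in> Ma V X \<and> y \<in> pts V"
  by (simp add: triple_iff)

lemma cval_AD:
  assumes t: "triple (AD X) (V, a, y)"
  shows "cval (AD X) (V, a, y) = (prj X (fst a y), chart X (prj X (fst a y)) (fst a y))" "fst a y \<in> tpts X"
    "snd a = prj X (fst a y)"
proof -
  have m: "a \<in> Ma V X" "y \<in> pts V" using t unfolding triple_AD by auto
  have f: "fst a y \<in> fibre X (snd a)" by (rule mapspace_fibre[OF X m])
  then show 1: "snd a = prj X (fst a y)" and "fst a y \<in> tpts X" by (simp_all add: fibre_def)
  show "cval (AD X) (V, a, y) = (prj X (fst a y), chart X (prj X (fst a y)) (fst a y))"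
    using marr(2)[OF X m] by (simp add: cval_def AD_chart 1)
qed

lemma chart_determines:
  assumes "x \<in> tpts X" "x' \<in> tpts X" "prj X x = prj X x'" "chart X (prj X x) x = chart X (prj X x') x'"
  shows "x = x'"
proof -
  have "x \<in> fibre X (prj X x)" "x' \<in> fibre X (prj X x)" using assms by (simp_all add: fibre_def)
  then show ?thesis using chart_inj[OF X prj_base[OF X assms(1)]] assms(3,4) by (simp add: inj_on_eq_iff)
qed

lemma ceval_cls:
  assumes t: "triple (AD X) (V, a, y)"
  shows "ceval (cls (AD X) V a y) = fst a y"
  unfolding ceval_def
proof (rule clift[OF AD_family[OF X] t])
  fix V' a' y' assume t': "triple (AD X) (V', a', y')" and e: "cval (AD X) (V', a', y') = cval (AD X) (V, a, y)"
  note e' = e[unfolded cval_AD(1)[OF t] cval_AD(1)[OF t'] prod.inject]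
  show "fst a' y' = fst a y"
    by (rule chart_determines[OF cval_AD(2)[OF t'] cval_AD(2)[OF t] conjunct1[OF e'] conjunct2[OF e']])
qed

lemma ceval_map: "fam_map C (CF (AD X)) X ceval id"
  unfolding fam_map_def
proof (intro conjI ballI)
  note A = AD_family[OF X]
  show "continuous_map (tot (CF (AD X))) (tot X) ceval"
  proof (rule CF_continuous[OF A])
    fix V assume V: "V \<in> Obj C"
    have "continuous_map (PF (AD X) V) (tot X) (\<lambda>p. fst (fst p) (snd p))"
      using mapspace_ev[OF V, of X] by (simp add: case_prod_unfold)
    then show "continuous_map (PF (AD X) V) (tot X) (\<lambda>p. ceval (cls (AD X) V (fst p) (snd p)))"
    proof (rule continuous_map_eq)
      fix p assume "p \<in> topspace (PF (AD X) V)"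
      then have "triple (AD X) (V, fst p, snd p)" unfolding triple_AD using V by (auto simp: mem_Times_iff)
      then show "fst (fst p) (snd p) = ceval (cls (AD X) V (fst p) (snd p))" by (rule ceval_cls[symmetric])
    qed
  qed
  show "continuous_map (base (CF (AD X))) (base X) id" by simp
  have c: "prj X (ceval c) = prj (CF (AD X)) c \<and> chart X (prj X (ceval c)) (ceval c) = chart (CF (AD X)) (prj X (ceval c)) c
      \<and> ceval c \<in> tpts X" if c': "c \<in> tpts (CF (AD X))" for c
  proof -
    obtain V a y where t: "triple (AD X) (V, a, y)" "c = cls (AD X) V a y" using c' by (rule CF_topE[OF A])
    note cv = cval_AD[OF t(1)]
    have "chart (CF (AD X)) (snd a) c = Far C (dchart (AD X) (snd a) V a) y"
      unfolding t(2) using CF_chart[OF A t(1)] by simp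
    moreover have "Far C (dchart (AD X) (snd a) V a) y = chart X (prj X (fst a y)) (fst a y)"
      using cv(1) unfolding cval_def AD_simps case_prod_conv prod.inject by (rule conjunct2)
    ultimately show ?thesis unfolding t(2) ceval_cls[OF t(1)] using cv(2,3) CF_prj[OF A t(1)] by simp
  qed
  show "prj X (ceval c) = id (prj (CF (AD X)) c)" if "c \<in> tpts (CF (AD X))" for c using c[OF that] by simp
  fix b assume "b \<in> bpts (CF (AD X))"
  then have b: "b \<in> bpts X" by simp
  have "chart X b (ceval c) = Far C (Idn C (fob X b)) (chart (CF (AD X)) b c)" if c': "c \<in> fibre (CF (AD X)) b" for c
  proof -
    have ct: "c \<in> tpts (CF (AD X))" "prj (CF (AD X)) c = b" using c' by (simp_all add: fibre_def)
    note cc = c[OF ct(1), unfolded ct(2)]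
    have "ceval c \<in> fibre X b" using cc by (simp add: fibre_def)
    from Far_Idn[OF fob_Obj[OF X b] chart_pts[OF X this b]] show ?thesis
      using cc[THEN conjunct2, THEN conjunct1, unfolded cc[THEN conjunct1]] by simp
  qed
  then have "fibre_arrow C (CF (AD X)) X ceval id b (Idn C (fob X b))"
    unfolding fibre_arrow_def using Idn_Hom[OF fob_Obj[OF X b]] by simp
  then show "\<exists>\<phi>. fibre_arrow C (CF (AD X)) X ceval id b \<phi>" by blast
qed

lemma csec:
  assumes x: "x \<in> tpts X"
  shows "csec X x \<in> tpts (CF (AD X))" "ceval (csec X x) = x"
    "prj (CF (AD X)) (csec X x) = prj X x" "chart (CF (AD X)) (prj X x) (csec X x) = chart X (prj X x) x"
proof -
  let ?b = "prj X x"
  let ?a = "mpt (fob X ?b) X ?b (Idn C (fob X ?b))"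
  have b: "?b \<in> bpts X" by (rule prj_base[OF X x])
  note o = fob_Obj[OF X b]
  note iH = Idn_Hom[OF o]
  have xf: "x \<in> fibre X ?b" using x by (simp add: fibre_def)
  note m = mpt_mapspace[OF X b iH]
  have t: "triple (AD X) (fob X ?b, ?a, chart X ?b x)" unfolding triple_AD using o m(1) chart_pts[OF X xf b] by simp
  have k: "csec X x = cls (AD X) (fob X ?b) ?a (chart X ?b x)" by (simp add: csec_def Let_def)
  show "csec X x \<in> tpts (CF (AD X))" unfolding k by (rule CF_topI[OF AD_family[OF X] t])
  show "ceval (csec X x) = x"
    unfolding k ceval_cls[OF t] using m(4)[OF chart_pts[OF X xf b]] Far_Idn[OF o chart_pts[OF X xf b]] fpt_chart[OF X b xf] by simp
  show "prj (CF (AD X)) (csec X x) = ?b" unfolding k CF_prj[OF AD_family[OF X] t] using m(3) by simp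
  show "chart (CF (AD X)) ?b (csec X x) = chart X ?b x"
    using CF_chart[OF AD_family[OF X] t] unfolding k AD_simps m(3) AD_chart[OF m(3)] m(2)
    using Far_Idn[OF o chart_pts[OF X xf b]] by simp
qed

text \<open>Both classes evaluate to the same point of \<open>X\<close>, and that point determines
  \<open>cval\<close> and therefore the class. This allows any convenient representative in
  continuity arguments.\<close>

lemma csec_ceval:
  assumes t: "triple (AD X) (V, a, y)"
  shows "csec X (fst a y) = cls (AD X) V a y"
proof -
  note A = AD_family[OF X] and cv = cval_AD[OF t]
  obtain V' a' y' where t': "triple (AD X) (V', a', y')" "csec X (fst a y) = cls (AD X) V' a' y'"
    using csec(1)[OF cv(2)] by (rule CF_topE[OF A])
  have "fst a' y' = fst a y" using csec(2)[OF cv(2)] unfolding t'(2) ceval_cls[OF t'(1)] .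
  then have "cval (AD X) (V', a', y') = cval (AD X) (V, a, y)" unfolding cv(1) cval_AD(1)[OF t'(1)] by simp
  then show ?thesis unfolding t'(2) coend_class_eq[OF A t'(1) t] .
qed

text \<open>Over a trivialising set the points of a bundle are values of a continuously varying element of
  a function space; this gives local formulas for the inverse of the evaluation map.\<close>

lemma csec_bundle_continuous:
  assumes Y: "fibre_bundle C Y" and u: "fam_map C Y X u ub"
  shows "continuous_map (tot Y) (tot (CF (AD X))) (\<lambda>y. csec X (u y))"
proof (rule continuous_map_local)
  note fY = fibre_bundleD[OF Y]
  fix y assume "y \<in> tpts Y"
  then have y: "y \<in> tpts Y" "prj Y y \<in> bpts Y" using prj_base[OF fY] by auto
  obtain N W t s where N: "prj Y y \<in> N" and l: "loc_triv Y N W t s" by (rule bundle_loc_triv[OF Y y(2)])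
  note d = loc_trivD[OF l]
  let ?T = "tot_on Y N"
  let ?a = "\<lambda>b. mapspace_map W u ub (tpt W t b (Idn C W))"
  have iW: "Idn C W \<in> Hom C W W" by (rule Idn_Hom[OF d(2)])
  have "continuous_map (subtopology (base Y) N) (prod_topology (subtopology (base Y) N) (Hom_top C W W)) (\<lambda>b. (b, Idn C W))"
    using iW by (simp add: continuous_map_pairwise o_def)
  from continuous_map_compose[OF continuous_map_compose[OF this tpt_continuous[OF fY l d(2)]] mapspace_map_continuous[OF fY X u d(2)]]
  have ac: "continuous_map (subtopology (base Y) N) (mapspace C W X) ?a" by (simp add: o_def)
  have pc: "continuous_map ?T (subtopology (base Y) N) (prj Y)"
    using continuous_map_from_subtopology[OF prj_continuous[OF fY]] by (auto simp: continuous_map_in_subtopology)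
  have "continuous_map ?T (dsp (AD X) W) (\<lambda>y. ?a (prj Y y))"
    using continuous_map_compose[OF pc ac] by (simp add: o_def)
  from cls_continuous'[OF AD_family[OF X] d(2) this d(4)]
  have "continuous_map ?T (tot (CF (AD X))) (\<lambda>y. csec X (u y))"
  proof (rule continuous_map_eq)
    fix y assume "y \<in> topspace ?T"
    then have y: "y \<in> tpts Y" "prj Y y \<in> N" by auto
    note sy = d(8)[OF y]
    have t: "triple (AD X) (W, ?a (prj Y y), s y)"
      unfolding triple_AD using d(2) sy mapspace_map_mem'[OF fY X u tpt(1)[OF fY l y(2) iW]] by simp
    have "fst (?a (prj Y y)) (s y) = u y"
      using sy Far_Idn[OF d(2) sy] d(7)[OF y] by (simp add: mapspace_map_def tpt_def)
    then show "cls (AD X) W (?a (prj Y y)) (s y) = csec X (u y)" using csec_ceval[OF t] by simp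
  qed
  then show "\<exists>U. openin (tot Y) U \<and> y \<in> U \<and> continuous_map (subtopology (tot Y) U) (tot (CF (AD X))) (\<lambda>y. csec X (u y))"
    using over_open[OF fY d(1)] y(1) N by (intro exI[of _ "over Y N"]) simp
qed

lemma ceval_iso:
  assumes c: "continuous_map (tot X) (tot (CF (AD X))) (csec X)"
  shows "fam_iso C (CF (AD X)) X ceval id"
  unfolding fam_iso_def
proof (intro conjI exI)
  show "fam_map C (CF (AD X)) X ceval id" by (rule ceval_map)
  show "fam_map C X (CF (AD X)) (csec X) id"
    unfolding fam_map_def
  proof (intro conjI ballI c)
    show "continuous_map (base X) (base (CF (AD X))) id" by simp
    show "prj (CF (AD X)) (csec X x) = id (prj X x)" if "x \<in> tpts X" for x using csec(3)[OF that] by simp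
    fix b assume b: "b \<in> bpts X"
    have "chart (CF (AD X)) b (csec X x) = Far C (Idn C (fob X b)) (chart X b x)" if "x \<in> fibre X b" for x
    proof -
      have "x \<in> tpts X" "prj X x = b" using that by (simp_all add: fibre_def)
      then show ?thesis using csec(4)[of x] Far_Idn[OF fob_Obj[OF X b] chart_pts[OF X that b]] by simp
    qed
    then have "fibre_arrow C X (CF (AD X)) (csec X) id b (Idn C (fob X b))"
      unfolding fibre_arrow_def using Idn_Hom[OF fob_Obj[OF X b]] by simp
    then show "\<exists>\<phi>. fibre_arrow C X (CF (AD X)) (csec X) id b \<phi>" by blast
  qed
  show "\<forall>x\<in>tpts (CF (AD X)). csec X (ceval x) = x"
  proof
    fix c assume "c \<in> tpts (CF (AD X))"
    then obtain V a y where t: "triple (AD X) (V, a, y)" "c = cls (AD X) V a y" by (rule CF_topE[OF AD_family[OF X]])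
    show "csec X (ceval c) = c" unfolding t(2) ceval_cls[OF t(1)] by (rule csec_ceval[OF t(1)])
  qed
qed (use csec(2) in simp_all)

end

end

context strat_family
begin

lemma csec_continuous: "continuous_map (tot X) (tot (CF (AD X))) (csec X)"
proof (rule lim_Top_continuous[OF limX])
  fix n
  have "continuous_map (tot (Xn n)) (tot (CF (AD X))) (csec X)"
  proof (induction n)
    case 0
    show ?case using csec_bundle_continuous[OF fX X0 fam_map_restrict_UNIV(1)[OF fX]] by simp
  next
    case (Suc n)
    show ?case
    proof (rule pushout_Top_continuous[OF po_tot over_sub Suc.IH])
      have "fam_map C (M n) X (g n) (gb n)" using fam_map_comp[OF fM gmap fam_map_restrict_UNIV(1)[OF fX]] by simp
      then show "continuous_map (tot (M n)) (tot (CF (AD X))) (\<lambda>y. csec X (g n y))"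
        by (rule csec_bundle_continuous[OF fX Mb])
    qed
  qed
  then show "continuous_map (subtopology (tot X) {x \<in> tpts X. prj X x \<in> strat_fil S n}) (tot (CF (AD X))) (csec X)"
    by simp
qed

end

text \<open>The equality of the last claim is rendered as an isomorphism over the identity of the
  base, and its values on classes identify it as evaluation. \<open>S\<close> and \<open>S'\<close>
  are separate because the two directions start from unrelated data.\<close>

theorem theorem6p17:
  fixes C :: "('o, 'h, 'v) structure_category"
    and S S' :: "'b stratification"
    and X :: "('o, 'v, 'x, 'b) family"
    and P :: "('o, 'h, 'p, 'b) diagram"
  assumes "structure_category C" and "faithful C"
  shows "(NKC TYPE('b) C \<and> stratified_bundle C S X \<longrightarrow>
            principal_stratified_bundle_diagram C S (associated_diagram C X)) \<and>
         (principal_stratified_bundle_diagram C S' P \<longrightarrow>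
            stratified_bundle C S' (coend_family C P)) \<and>
         (NKC TYPE('b) C \<and> stratified_bundle C S X \<longrightarrow>
            (\<exists>e. fam_iso C (coend_family C (associated_diagram C X)) X e id \<and>
                 (\<forall>V \<in> Obj C. \<forall>a \<in> topspace (mapspace C V X). \<forall>y \<in> topspace (Fob C V).
                    e (coend_class C (associated_diagram C X) V a y) = fst a y)))"
proof (intro conjI impI)
  interpret str_cat C using assms by (rule str_cat.intro)
  show "principal_stratified_bundle_diagram C S (associated_diagram C X)"
    if a: "NKC TYPE('b) C \<and> stratified_bundle C S X"
  proof -
    obtain M h g where "strat_family C S X M h g" using stratified_bundle_family a by blast
    then show ?thesis using strat_family.associated_diagram_principal a by blast
  qed
  show "stratified_bundle C S' (coend_family C P)" if "principal_stratified_bundle_diagram C S' P"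
    by (rule coend_stratified_bundle[OF that])
  show "\<exists>e. fam_iso C (coend_family C (associated_diagram C X)) X e id \<and>
                 (\<forall>V \<in> Obj C. \<forall>a \<in> topspace (mapspace C V X). \<forall>y \<in> topspace (Fob C V).
                    e (coend_class C (associated_diagram C X) V a y) = fst a y)"
    if a: "NKC TYPE('b) C \<and> stratified_bundle C S X"
  proof -
    obtain M h g where "strat_family C S X M h g" using stratified_bundle_family a by blast
    then have c: "continuous_map (tot X) (tot (CF (AD X))) (csec X)" by (rule strat_family.csec_continuous)
    have fX: "family C X" using a unfolding stratified_bundle_def by blast
    show ?thesis using ceval_iso[OF fX c] ceval_cls[OF fX] triple_AD[OF fX] by (intro exI[of _ ceval]) simp
  qed
qed

end
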